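(* Let $k$ be a field of characteristic zero and let $A=k+A_1+A_2+\cdots$ be a left noetherian graded $k$-algebra. Put $R=\widehat{A}$. Let $M$ be a finitely generated left $R$-module such that $\operatorname{Ext}^1_R(M,M)=0$. Then $M$ is the completion of a finitely generated graded $A$-module $N$.
   Context: $A$ is not assumed commutative. $\widehat{A}$ denotes the completion of $A$ at the ideal $A_{\ge1}$, and likewise for modules: for a finitely generated graded left $A$-module $N$, $\widehat{N}$ is its completion, which is a finitely generated $\widehat{A}$-module. $\operatorname{Ext}^1_R$ is ungraded. *)

theory Defs
  imports "HOL-Algebra.Algebra"
begin

section \<open>Left modules over a not necessarily commutative ring\<close>

text \<open>
  The library locale \<^locale>\<open>module\<close> requires a commutative base ring. The axioms below are the same
  over an arbitrary ring. As in the library, the fields \<open>mult\<close> and \<open>one\<close> of the module record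
  carry no meaning for a module.
\<close>

locale left_module = R?: ring R + M?: abelian_group M
  for R :: "('r, 'x) ring_scheme" (structure) and M :: "('r, 'm, 'y) module_scheme" (structure) +
  assumes smult_closed [simp, intro]:
      "\<lbrakk>a \<in> carrier R; x \<in> carrier M\<rbrakk> \<Longrightarrow> a \<odot>\<^bsub>M\<^esub> x \<in> carrier M"
    and smult_l_distr:
      "\<lbrakk>a \<in> carrier R; b \<in> carrier R; x \<in> carrier M\<rbrakk> \<Longrightarrow>
        (a \<oplus>\<^bsub>R\<^esub> b) \<odot>\<^bsub>M\<^esub> x = (a \<odot>\<^bsub>M\<^esub> x) \<oplus>\<^bsub>M\<^esub> (b \<odot>\<^bsub>M\<^esub> x)"
    and smult_r_distr:
      "\<lbrakk>a \<in> carrier R; x \<in> carrier M; y \<in> carrier M\<rbrakk> \<Longrightarrow>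
        a \<odot>\<^bsub>M\<^esub> (x \<oplus>\<^bsub>M\<^esub> y) = (a \<odot>\<^bsub>M\<^esub> x) \<oplus>\<^bsub>M\<^esub> (a \<odot>\<^bsub>M\<^esub> y)"
    and smult_assoc1:
      "\<lbrakk>a \<in> carrier R; b \<in> carrier R; x \<in> carrier M\<rbrakk> \<Longrightarrow>
        (a \<otimes>\<^bsub>R\<^esub> b) \<odot>\<^bsub>M\<^esub> x = a \<odot>\<^bsub>M\<^esub> (b \<odot>\<^bsub>M\<^esub> x)"
    and smult_one [simp]: "x \<in> carrier M \<Longrightarrow> \<one>\<^bsub>R\<^esub> \<odot>\<^bsub>M\<^esub> x = x"

definition left_hom ::
    "('r, 'x) ring_scheme \<Rightarrow> ('r, 'm, 'y) module_scheme \<Rightarrow> ('r, 'n, 'z) module_scheme \<Rightarrow> ('m \<Rightarrow> 'n) set"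
  where "left_hom R M N =
    {f \<in> carrier M \<rightarrow> carrier N.
      (\<forall>x\<in>carrier M. \<forall>y\<in>carrier M. f (x \<oplus>\<^bsub>M\<^esub> y) = f x \<oplus>\<^bsub>N\<^esub> f y) \<and>
      (\<forall>a\<in>carrier R. \<forall>x\<in>carrier M. f (a \<odot>\<^bsub>M\<^esub> x) = a \<odot>\<^bsub>N\<^esub> f x)}"

definition left_module_iso ::
    "('r, 'x) ring_scheme \<Rightarrow> ('r, 'm, 'y) module_scheme \<Rightarrow> ('r, 'n, 'z) module_scheme \<Rightarrow> bool"
  where "left_module_iso R M N \<longleftrightarrow> (\<exists>f\<in>left_hom R M N. bij_betw f (carrier M) (carrier N))"

definition submodule_generated ::
    "('r, 'x) ring_scheme \<Rightarrow> ('r, 'm, 'y) module_scheme \<Rightarrow> 'm set \<Rightarrow> 'm set"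
  where "submodule_generated R M S = \<Inter>{H. submodule H R M \<and> S \<subseteq> H}"

definition finitely_generated :: "('r, 'x) ring_scheme \<Rightarrow> ('r, 'm, 'y) module_scheme \<Rightarrow> bool"
  where "finitely_generated R M \<longleftrightarrow>
    (\<exists>S. finite S \<and> S \<subseteq> carrier M \<and> submodule_generated R M S = carrier M)"

definition regular_module :: "('r, 'x) ring_scheme \<Rightarrow> ('r, 'r) module"
  where "regular_module R =
    \<lparr>carrier = carrier R, monoid.mult = (\<otimes>\<^bsub>R\<^esub>), one = \<one>\<^bsub>R\<^esub>, ring.zero = \<zero>\<^bsub>R\<^esub>, ring.add = (\<oplus>\<^bsub>R\<^esub>),
     smult = (\<otimes>\<^bsub>R\<^esub>)\<rparr>"

text \<open>
  The left ideals are the submodules of the regular module. The library locale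
  \<^locale>\<open>noetherian_ring\<close> only concerns two-sided ideals.
\<close>

definition left_noetherian :: "('r, 'x) ring_scheme \<Rightarrow> bool"
  where "left_noetherian R \<longleftrightarrow> ring R \<and>
    (\<forall>L. submodule L R (regular_module R) \<longrightarrow>
      (\<exists>S. finite S \<and> S \<subseteq> carrier R \<and> L = submodule_generated R (regular_module R) S))"


section \<open>Graded algebras and graded modules\<close>

definition char_zero :: "('r, 'x) ring_scheme \<Rightarrow> bool"
  where "char_zero R \<longleftrightarrow> (\<forall>n::nat. n > 0 \<longrightarrow> add_pow R n \<one>\<^bsub>R\<^esub> \<noteq> \<zero>\<^bsub>R\<^esub>)"

text \<open>
  The library locale \<^locale>\<open>algebra\<close> without commutativity of the algebra; therefore
  compatibility of the scalars with both factors of a product has to be required.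
\<close>

locale assoc_algebra = module k A + A?: ring A
  for k :: "('k, 'x) ring_scheme" and A :: "('k, 'a, 'y) module_scheme" +
  assumes smult_assoc_l:
      "\<lbrakk>c \<in> carrier k; x \<in> carrier A; y \<in> carrier A\<rbrakk> \<Longrightarrow>
        (c \<odot>\<^bsub>A\<^esub> x) \<otimes>\<^bsub>A\<^esub> y = c \<odot>\<^bsub>A\<^esub> (x \<otimes>\<^bsub>A\<^esub> y)"
    and smult_assoc_r:
      "\<lbrakk>c \<in> carrier k; x \<in> carrier A; y \<in> carrier A\<rbrakk> \<Longrightarrow>
        x \<otimes>\<^bsub>A\<^esub> (c \<odot>\<^bsub>A\<^esub> y) = c \<odot>\<^bsub>A\<^esub> (x \<otimes>\<^bsub>A\<^esub> y)"

definition homogeneous_family :: "('m, 'x) ring_scheme \<Rightarrow> ('i \<Rightarrow> 'm set) \<Rightarrow> ('i \<Rightarrow> 'm) \<Rightarrow> bool"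
  where "homogeneous_family M gr c \<longleftrightarrow> (\<forall>i. c i \<in> gr i) \<and> finite {i. c i \<noteq> \<zero>\<^bsub>M\<^esub>}"

definition family_sum :: "('m, 'x) ring_scheme \<Rightarrow> ('i \<Rightarrow> 'm) \<Rightarrow> 'm"
  where "family_sum M c = (\<Oplus>\<^bsub>M\<^esub>i\<in>{i. c i \<noteq> \<zero>\<^bsub>M\<^esub>}. c i)"

definition internal_direct_sum :: "('m, 'x) ring_scheme \<Rightarrow> ('i \<Rightarrow> 'm set) \<Rightarrow> bool"
  where "internal_direct_sum M gr \<longleftrightarrow>
    (\<forall>i. subgroup (gr i) (add_monoid M)) \<and>
    (\<forall>x\<in>carrier M. \<exists>!c. homogeneous_family M gr c \<and> x = family_sum M c)"

text \<open>Graded algebras of the form \<open>A = k + A\<^sub>1 + A\<^sub>2 + \<dots>\<close>, with \<open>k\<close> embedded as \<open>k\<cdot>1\<close>.\<close>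

locale connected_graded_algebra = assoc_algebra k A
  for k :: "('k, 'x) ring_scheme" and A :: "('k, 'a, 'y) module_scheme" and gr :: "nat \<Rightarrow> 'a set" +
  assumes gr_subspace: "submodule (gr i) k A"
    and gr_direct_sum: "internal_direct_sum A gr"
    and gr_mult: "\<lbrakk>x \<in> gr i; y \<in> gr j\<rbrakk> \<Longrightarrow> x \<otimes>\<^bsub>A\<^esub> y \<in> gr (i + j)"
    and gr_zero: "gr 0 = {c \<odot>\<^bsub>A\<^esub> \<one>\<^bsub>A\<^esub> | c. c \<in> carrier k}"
    and one_not_zero: "\<one>\<^bsub>A\<^esub> \<noteq> \<zero>\<^bsub>A\<^esub>"

text \<open>The ideal \<open>A\<^bsub>\<ge>1\<^esub>\<close>.\<close>

definition positive_part :: "('a, 'x) ring_scheme \<Rightarrow> (nat \<Rightarrow> 'a set) \<Rightarrow> 'a set"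
  where "positive_part A gr = {family_sum A c | c. homogeneous_family A gr c \<and> c 0 = \<zero>\<^bsub>A\<^esub>}"

locale graded_left_module = left_module A N
  for A :: "('a, 'x) ring_scheme" and gr :: "nat \<Rightarrow> 'a set"
    and N :: "('a, 'n, 'y) module_scheme" and grN :: "int \<Rightarrow> 'n set" +
  assumes grN_direct_sum: "internal_direct_sum N grN"
    and grN_smult: "\<lbrakk>a \<in> gr i; x \<in> grN j\<rbrakk> \<Longrightarrow> a \<odot>\<^bsub>N\<^esub> x \<in> grN (int i + j)"


section \<open>Adic completion\<close>

abbreviation ideal_power :: "('a, 'x) ring_scheme \<Rightarrow> 'a set \<Rightarrow> nat \<Rightarrow> 'a set"
  where "ideal_power A I n \<equiv> I [^]\<^bsub>ideals_set A\<^esub> n"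

text \<open>
  The completion is the inverse limit of the quotients \<open>A / I\<^sup>n\<close>. The transition map
  \<open>A / I\<^sup>n \<rightarrow> A / I\<^sup>m\<close>, for \<open>m \<le> n\<close>, sends a coset of \<open>I\<^sup>n\<close> to the unique coset of \<open>I\<^sup>m\<close>
  containing it, so that compatibility of a sequence of cosets is inclusion.
\<close>

definition ring_completion :: "('a, 'x) ring_scheme \<Rightarrow> 'a set \<Rightarrow> (nat \<Rightarrow> 'a set) ring"
  where "ring_completion A I =
    \<lparr>carrier = {x. (\<forall>n. x n \<in> carrier (A Quot ideal_power A I n)) \<and> (\<forall>m n. m \<le> n \<longrightarrow> x n \<subseteq> x m)},
     monoid.mult = (\<lambda>x y n. x n \<otimes>\<^bsub>A Quot ideal_power A I n\<^esub> y n),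
     one = (\<lambda>n. \<one>\<^bsub>A Quot ideal_power A I n\<^esub>),
     ring.zero = (\<lambda>n. \<zero>\<^bsub>A Quot ideal_power A I n\<^esub>),
     ring.add = (\<lambda>x y n. x n \<oplus>\<^bsub>A Quot ideal_power A I n\<^esub> y n)\<rparr>"

text \<open>The submodule \<open>J N\<close>.\<close>

definition ideal_smult ::
    "('a, 'x) ring_scheme \<Rightarrow> 'a set \<Rightarrow> ('a, 'n, 'y) module_scheme \<Rightarrow> 'n set"
  where "ideal_smult A J N = submodule_generated A N {a \<odot>\<^bsub>N\<^esub> x | a x. a \<in> J \<and> x \<in> carrier N}"

text \<open>
  The quotient \<open>N / H\<close>, with scalars in \<open>A / J\<close> for any ideal \<open>J\<close> such that \<open>J N \<subseteq> H\<close>. The action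
  is formed on cosets in the same way as \<^const>\<open>rcoset_mult\<close>.
\<close>

definition FactModule :: "('a, 'n, 'y) module_scheme \<Rightarrow> 'n set \<Rightarrow> ('a set, 'n set) module"
  where "FactModule N H =
    \<lparr>carrier = a_rcosets\<^bsub>N\<^esub> H, monoid.mult = undefined, one = undefined, ring.zero = H, ring.add = set_add N,
     smult = (\<lambda>C D. \<Union>a\<in>C. \<Union>x\<in>D. H +>\<^bsub>N\<^esub> (a \<odot>\<^bsub>N\<^esub> x))\<rparr>"

definition module_completion ::
    "('a, 'x) ring_scheme \<Rightarrow> 'a set \<Rightarrow> ('a, 'n, 'y) module_scheme \<Rightarrow> (nat \<Rightarrow> 'a set, nat \<Rightarrow> 'n set) module"
  where "module_completion A I N =
    (let Q = (\<lambda>n. FactModule N (ideal_smult A (ideal_power A I n) N)) in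
    \<lparr>carrier = {x. (\<forall>n. x n \<in> carrier (Q n)) \<and> (\<forall>m n. m \<le> n \<longrightarrow> x n \<subseteq> x m)},
     monoid.mult = undefined, one = undefined,
     ring.zero = (\<lambda>n. \<zero>\<^bsub>Q n\<^esub>),
     ring.add = (\<lambda>x y n. x n \<oplus>\<^bsub>Q n\<^esub> y n),
     smult = (\<lambda>r x n. r n \<odot>\<^bsub>Q n\<^esub> x n)\<rparr>)"


section \<open>The group \<open>Ext\<^sup>1\<close>\<close>

definition free_module :: "('r, 'x) ring_scheme \<Rightarrow> 'b set \<Rightarrow> ('r, 'b \<Rightarrow> 'r) module"
  where "free_module R B =
    \<lparr>carrier = {f. (\<forall>x. f x \<in> carrier R) \<and> (\<forall>x. x \<notin> B \<longrightarrow> f x = \<zero>\<^bsub>R\<^esub>) \<and> finite {x. f x \<noteq> \<zero>\<^bsub>R\<^esub>}},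
     monoid.mult = undefined, one = undefined,
     ring.zero = (\<lambda>x. \<zero>\<^bsub>R\<^esub>),
     ring.add = (\<lambda>f g x. f x \<oplus>\<^bsub>R\<^esub> g x),
     smult = (\<lambda>a f x. a \<otimes>\<^bsub>R\<^esub> f x)\<rparr>"

text \<open>
  For \<open>B \<subseteq> carrier M\<close>, the linear map from the free module on \<open>B\<close> to \<open>M\<close> that extends the inclusion.
\<close>

definition free_eval ::
    "('r, 'x) ring_scheme \<Rightarrow> ('r, 'm, 'y) module_scheme \<Rightarrow> ('m \<Rightarrow> 'r) \<Rightarrow> 'm"
  where "free_eval R M f = (\<Oplus>\<^bsub>M\<^esub>x\<in>{x. f x \<noteq> \<zero>\<^bsub>R\<^esub>}. f x \<odot>\<^bsub>M\<^esub> x)"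

text \<open>
  The beginning \<open>F\<^sub>2 \<rightarrow> F\<^sub>1 \<rightarrow> F\<^sub>0 \<rightarrow> M \<rightarrow> 0\<close> of the standard free resolution of \<open>M\<close>: \<open>F\<^sub>0\<close> is free on
  the elements of \<open>M\<close>, and each further term is free on the elements of the kernel of the
  preceding map. All the maps are instances of \<^const>\<open>free_eval\<close>.
\<close>

definition resolution0 :: "('r, 'x) ring_scheme \<Rightarrow> ('r, 'm, 'y) module_scheme \<Rightarrow> ('r, 'm \<Rightarrow> 'r) module"
  where "resolution0 R M = free_module R (carrier M)"

definition resolution1 ::
    "('r, 'x) ring_scheme \<Rightarrow> ('r, 'm, 'y) module_scheme \<Rightarrow> ('r, ('m \<Rightarrow> 'r) \<Rightarrow> 'r) module"
  where "resolution1 R M =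
    free_module R {f \<in> carrier (resolution0 R M). free_eval R M f = \<zero>\<^bsub>M\<^esub>}"

definition resolution2 ::
    "('r, 'x) ring_scheme \<Rightarrow> ('r, 'm, 'y) module_scheme \<Rightarrow> ('r, (('m \<Rightarrow> 'r) \<Rightarrow> 'r) \<Rightarrow> 'r) module"
  where "resolution2 R M =
    free_module R {f \<in> carrier (resolution1 R M).
      free_eval R (resolution0 R M) f = \<zero>\<^bsub>resolution0 R M\<^esub>}"

text \<open>
  The abelian group \<open>Hom\<^sub>R(P, N)\<close>, written multiplicatively as all groups in the library.
  Homomorphisms are restricted to the carrier so that equality of homomorphisms is equality of
  functions.
\<close>

definition hom_group ::
    "('r, 'x) ring_scheme \<Rightarrow> ('r, 'p, 'y) module_scheme \<Rightarrow> ('r, 'n, 'z) module_scheme \<Rightarrow> ('p \<Rightarrow> 'n) monoid"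
  where "hom_group R P N =
    \<lparr>carrier = left_hom R P N \<inter> extensional (carrier P),
     monoid.mult = (\<lambda>f g. \<lambda>x\<in>carrier P. f x \<oplus>\<^bsub>N\<^esub> g x),
     one = (\<lambda>x\<in>carrier P. \<zero>\<^bsub>N\<^esub>)\<rparr>"

definition Ext1_cocycles ::
    "('r, 'x) ring_scheme \<Rightarrow> ('r, 'm, 'y) module_scheme \<Rightarrow> ('r, 'n, 'z) module_scheme \<Rightarrow>
      ((('m \<Rightarrow> 'r) \<Rightarrow> 'r) \<Rightarrow> 'n) set"
  where "Ext1_cocycles R M N =
    {\<phi> \<in> carrier (hom_group R (resolution1 R M) N).
      \<forall>h\<in>carrier (resolution2 R M). \<phi> (free_eval R (resolution1 R M) h) = \<zero>\<^bsub>N\<^esub>}"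

definition Ext1_coboundaries ::
    "('r, 'x) ring_scheme \<Rightarrow> ('r, 'm, 'y) module_scheme \<Rightarrow> ('r, 'n, 'z) module_scheme \<Rightarrow>
      ((('m \<Rightarrow> 'r) \<Rightarrow> 'r) \<Rightarrow> 'n) set"
  where "Ext1_coboundaries R M N =
    {\<lambda>g\<in>carrier (resolution1 R M). \<psi> (free_eval R (resolution0 R M) g) | \<psi>.
      \<psi> \<in> carrier (hom_group R (resolution0 R M) N)}"

definition Ext1 ::
    "('r, 'x) ring_scheme \<Rightarrow> ('r, 'm, 'y) module_scheme \<Rightarrow> ('r, 'n, 'z) module_scheme \<Rightarrow>
      ((('m \<Rightarrow> 'r) \<Rightarrow> 'r) \<Rightarrow> 'n) set monoid"
  where "Ext1 R M N =
    (hom_group R (resolution1 R M) N)\<lparr>carrier := Ext1_cocycles R M N\<rparr> Mod Ext1_coboundaries R M N"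

end

theory Submission
  imports Defs
begin

text \<open>
  Let \<open>\<delta>\<close> be the Euler derivation of \<open>R\<close>, which multiplies \<open>A\<^sub>i\<close> by \<open>i\<close>. The vanishing of
  \<open>Ext\<^sup>1(M, M)\<close> splits the extension of \<open>M\<close> by itself twisted by \<open>\<delta>\<close>, which amounts to an additive
  map \<open>D\<close> on \<open>M\<close> with \<open>D (r m) = r (D m) + \<delta>(r) m\<close>. It acts on the quotients of \<open>M\<close> by the
  filtration \<open>R\<^sub>\<ge>\<^sub>n M\<close>, where it is annihilated by a product of integer shifts of a polynomial over
  \<open>k\<close>, because this holds for the finite-dimensional quotient \<open>n = 1\<close> and because
  \<open>p(D) a = a p(D + i)\<close> for \<open>a \<in> A\<^sub>i\<close>. In characteristic zero, an irreducible polynomial is coprime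
  to all its nontrivial integer shifts. Choosing one representative in each orbit of irreducible
  factors under shifts, one gets a polynomial \<open>h\<close> which is coprime to its nontrivial shifts and whose
  shifts annihilate. The generalized kernels of \<open>h(D - l)\<close> are then the components of degree \<open>l\<close>
  of a graded \<open>A\<close>-submodule \<open>N\<close>, which is dense in \<open>M\<close>. Since \<open>A\<close> is left noetherian, a
  leading-term argument of Artin--Rees type shows that \<open>M\<close> is separated and complete; hence
  homogeneous generators of \<open>M\<close> generate \<open>N\<close>, and \<open>M\<close> is the completion of \<open>N\<close>.
\<close>

section \<open>Sums and congruences in abelian groups\<close>

text \<open>\<open>M\<close> may have infinite dimension over \<open>k\<close>, so no nonzero
  polynomial in \<open>D\<close> need vanish on it; only the quotients by \<open>Fil n\<close> are
  sure to have annihilators, and these vary with \<open>n\<close>. Kernels are therefore formed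
  modulo \<open>Fil n\<close> and glued by limits, which is why separatedness and completeness are
  settled before the grading. The eigenvalues of \<open>D\<close> need be neither integers nor in
  \<open>k\<close>, so they cannot serve as degrees. Only the shift is canonical: an element of
  \<open>A_i\<close> carries the generalized kernel of \<open>h(D - l)\<close> into that of
  \<open>h(D - l - i)\<close>. The representative chosen in each orbit decides what is placed in
  degree zero; another choice regrades \<open>N\<close>. Coprimality of \<open>h\<close> with its
  shifts makes the degrees independent. Two filtrations have to be reconciled. Components,
  \<open>D\<close> and leading terms see the filtration by degree, whereas the completion is formed
  with the powers of the ideal \<open>A_{>=1}\<close>. As \<open>A\<close> need not be generated in
  degree one, the two are only cofinal, and the constant \<open>power_bound\<close> measures the
  discrepancy.\<close>

context abelian_group
begin

lemma minus_add_minus_cancel: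
  "\<lbrakk>x \<in> carrier G; y \<in> carrier G; z \<in> carrier G\<rbrakk> \<Longrightarrow> (x \<ominus> y) \<oplus> (y \<ominus> z) = x \<ominus> z"
  by (simp add: a_minus_def a_assoc r_neg1)

lemma add_minus_add:
  "\<lbrakk>a \<in> carrier G; b \<in> carrier G; c \<in> carrier G; d \<in> carrier G\<rbrakk> \<Longrightarrow>
    (a \<oplus> b) \<ominus> (c \<oplus> d) = (a \<ominus> c) \<oplus> (b \<ominus> d)"
  by (simp add: a_minus_def minus_add a_ac)

lemma minus_swap: "\<lbrakk>x \<in> carrier G; y \<in> carrier G\<rbrakk> \<Longrightarrow> \<ominus> (x \<ominus> y) = y \<ominus> x"
  by (simp add: a_minus_def minus_add a_comm)

lemma add_minus_cancel_left: "\<lbrakk>x \<in> carrier G; y \<in> carrier G\<rbrakk> \<Longrightarrow> x \<oplus> (y \<ominus> x) = y"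
  using a_lcomm[of x y "\<ominus> x"] by (simp add: a_minus_def r_neg)

lemma add_minus_cancel_right:
  "\<lbrakk>y \<in> carrier G; z \<in> carrier G\<rbrakk> \<Longrightarrow> (y \<oplus> z) \<ominus> z = y"
  by (simp add: a_minus_def a_assoc r_neg)

lemma minus_add_cancel:
  "\<lbrakk>y \<in> carrier G; z \<in> carrier G\<rbrakk> \<Longrightarrow> (y \<ominus> z) \<oplus> z = y"
  by (simp add: a_minus_def a_assoc l_neg)

lemma minus_eq_zero_iff: "\<lbrakk>x \<in> carrier G; y \<in> carrier G\<rbrakk> \<Longrightarrow> x \<ominus> y = \<zero> \<longleftrightarrow> x = y"
  by (metis a_minus_def minus_equality minus_minus r_neg a_inv_closed)

lemma minus_zero_right [simp]: "x \<in> carrier G \<Longrightarrow> x \<ominus> \<zero> = x"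
  by (simp add: a_minus_def)

lemma a_inv_zero: "\<ominus> \<zero> = \<zero>"
  by (metis zero_closed l_zero minus_equality)

lemma finsum_a_inv:
  assumes "f \<in> I \<rightarrow> carrier G"
  shows "(\<Oplus>i\<in>I. \<ominus> f i) = \<ominus> (\<Oplus>i\<in>I. f i)"
  using assms
proof (induction I rule: infinite_finite_induct)
  case (insert x F)
  then show ?case by (simp add: Pi_def minus_add)
qed (simp_all add: a_inv_zero)

lemma finsum_minus:
  assumes "f \<in> I \<rightarrow> carrier G" "g \<in> I \<rightarrow> carrier G"
  shows "(\<Oplus>i\<in>I. f i \<ominus> g i) = (\<Oplus>i\<in>I. f i) \<ominus> (\<Oplus>i\<in>I. g i)"
proof -
  have "(\<Oplus>i\<in>I. f i \<ominus> g i) = (\<Oplus>i\<in>I. f i \<oplus> (\<ominus> g i))" by (simp add: a_minus_def)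
  also have "\<dots> = (\<Oplus>i\<in>I. f i) \<oplus> (\<Oplus>i\<in>I. \<ominus> g i)"
    using assms by (intro finsum_addf) (auto simp: Pi_def)
  finally show ?thesis using finsum_a_inv[OF assms(2)] by (simp add: a_minus_def)
qed

lemma finsum_single:
  assumes "finite I" "i \<in> I" "f \<in> I \<rightarrow> carrier G" "\<And>j. j \<in> I \<Longrightarrow> j \<noteq> i \<Longrightarrow> f j = \<zero>"
  shows "(\<Oplus>j\<in>I. f j) = f i"
proof -
  have I: "I = insert i (I - {i})" using assms by auto
  have "(\<Oplus>j\<in>I. f j) = (\<Oplus>j\<in>insert i (I - {i}). f j)" using I by simp
  also have "\<dots> = f i \<oplus> (\<Oplus>j\<in>I - {i}. f j)"
    using assms by (intro finsum_insert) (auto simp: Pi_def)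
  also have "(\<Oplus>j\<in>I - {i}. f j) = \<zero>"
    using assms by (intro add.finprod_one_eqI) auto
  finally show ?thesis using assms by (auto simp: Pi_def)
qed

lemma additive_subgroup_by_minus:
  assumes "H \<subseteq> carrier G" "\<zero> \<in> H" "\<And>x y. x \<in> H \<Longrightarrow> y \<in> H \<Longrightarrow> x \<ominus> y \<in> H"
  shows "additive_subgroup H G"
proof -
  have inv: "\<ominus> y \<in> H" if "y \<in> H" for y
    using assms(3)[OF assms(2) that] that assms(1) by (auto simp: a_minus_def)
  have "x \<oplus> y \<in> H" if "x \<in> H" "y \<in> H" for x y
  proof -
    have "x \<ominus> (\<ominus> y) \<in> H" using assms(3)[OF that(1) inv[OF that(2)]] .
    then show ?thesis using that assms(1) by (auto simp: a_minus_def)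
  qed
  then show ?thesis
    using inv assms(1,2)
    by (intro additive_subgroupI subgroup.intro) (auto simp: a_inv_def[symmetric])
qed

lemma additive_subgroup_carrier: "additive_subgroup (carrier G) G"
  by (rule additive_subgroup_by_minus) auto

lemma subgroup_minus_closed:
  assumes "additive_subgroup H G" "x \<in> H" "y \<in> H"
  shows "x \<ominus> y \<in> H"
  using assms additive_subgroup.a_closed additive_subgroup.a_inv_closed by (metis a_minus_def)

lemma subgroup_finsum_closed:
  assumes "additive_subgroup H G" "\<And>i. i \<in> I \<Longrightarrow> f i \<in> H"
  shows "(\<Oplus>i\<in>I. f i) \<in> H"
  using assms(2)
proof (induction I rule: infinite_finite_induct)
  case (infinite A)
  then show ?case using assms(1) by (simp add: additive_subgroup.zero_closed)
next
  case empty
  then show ?case using assms(1) by (simp add: additive_subgroup.zero_closed)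
next
  case (insert x F)
  have sub: "H \<subseteq> carrier G" using assms(1) by (rule additive_subgroup.a_subset)
  then have "(\<Oplus>i\<in>insert x F. f i) = f x \<oplus> (\<Oplus>i\<in>F. f i)"
    using insert by (intro finsum_insert) auto
  then show ?case using insert assms(1) by (simp add: additive_subgroup.a_closed)
qed

text \<open>Membership of both sides in the carrier is part of the relation, so that chains of
  congruences carry their own typing.\<close>

definition congr :: "'a set \<Rightarrow> 'a \<Rightarrow> 'a \<Rightarrow> bool"
  where "congr H x y \<longleftrightarrow> x \<in> carrier G \<and> y \<in> carrier G \<and> x \<ominus> y \<in> H"

lemma congr_refl: "\<lbrakk>additive_subgroup H G; x \<in> carrier G\<rbrakk> \<Longrightarrow> congr H x x"
  by (simp add: congr_def minus_eq_zero_iff[THEN iffD2] additive_subgroup.zero_closed)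

lemma congr_sym: "\<lbrakk>additive_subgroup H G; congr H x y\<rbrakk> \<Longrightarrow> congr H y x"
  unfolding congr_def by (metis additive_subgroup.a_inv_closed minus_swap)

lemma congr_trans: "\<lbrakk>additive_subgroup H G; congr H x y; congr H y z\<rbrakk> \<Longrightarrow> congr H x z"
  unfolding congr_def by (metis additive_subgroup.a_closed minus_add_minus_cancel)

lemma congr_add:
  "\<lbrakk>additive_subgroup H G; congr H x y; congr H u v\<rbrakk> \<Longrightarrow> congr H (x \<oplus> u) (y \<oplus> v)"
  unfolding congr_def by (metis a_closed additive_subgroup.a_closed add_minus_add)

lemma congr_minus:
  "\<lbrakk>additive_subgroup H G; congr H x y; congr H u v\<rbrakk> \<Longrightarrow> congr H (x \<ominus> u) (y \<ominus> v)"
proof -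
  assume H: "additive_subgroup H G" "congr H x y" "congr H u v"
  then have c: "x \<in> carrier G" "y \<in> carrier G" "u \<in> carrier G" "v \<in> carrier G"
    by (auto simp: congr_def)
  have "(x \<ominus> u) \<ominus> (y \<ominus> v) = (x \<ominus> y) \<ominus> (u \<ominus> v)"
    using c by (simp add: a_minus_def minus_add a_ac)
  then show ?thesis using H c subgroup_minus_closed[OF H(1)] by (simp add: congr_def)
qed

lemma congr_finsum:
  assumes "additive_subgroup H G" "\<And>i. i \<in> I \<Longrightarrow> congr H (f i) (g i)"
  shows "congr H (\<Oplus>i\<in>I. f i) (\<Oplus>i\<in>I. g i)"
proof -
  have "f \<in> I \<rightarrow> carrier G" "g \<in> I \<rightarrow> carrier G" using assms(2) by (auto simp: congr_def)
  then show ?thesis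
    using assms finsum_minus[of f I g] subgroup_finsum_closed[OF assms(1), of I "\<lambda>i. f i \<ominus> g i"]
    by (auto simp: congr_def)
qed

lemma congr_mono: "congr H x y \<Longrightarrow> H \<subseteq> K \<Longrightarrow> congr K x y"
  by (auto simp: congr_def)

lemma congr_mem_iff: "\<lbrakk>additive_subgroup H G; congr H x y\<rbrakk> \<Longrightarrow> x \<in> H \<longleftrightarrow> y \<in> H"
proof -
  have *: "y \<in> H" if "additive_subgroup H G" "congr H x y" "x \<in> H" for x y
  proof -
    have "x \<ominus> (x \<ominus> y) \<in> H"
      using that subgroup_minus_closed[OF that(1,3)] by (simp add: congr_def)
    moreover have "x \<ominus> (x \<ominus> y) = y"
      using that add_minus_cancel_left[of x y] minus_swap[of x y] by (simp add: congr_def a_minus_def)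
    ultimately show ?thesis by simp
  qed
  assume "additive_subgroup H G" "congr H x y"
  then show ?thesis using *[of x y] *[of y x] congr_sym by blast
qed

lemma congr_zero_iff: "x \<in> carrier G \<Longrightarrow> congr H x \<zero> \<longleftrightarrow> x \<in> H"
  by (simp add: congr_def)

text \<open>The completions are made of cosets, the estimates of differences; this is the bridge
  between the two.\<close>

lemma mem_coset_iff:
  assumes "additive_subgroup H G" "x \<in> carrier G"
  shows "w \<in> H +> x \<longleftrightarrow> w \<in> carrier G \<and> w \<ominus> x \<in> H"
proof
  assume "w \<in> H +> x"
  then obtain h where h: "h \<in> H" "w = h \<oplus> x" by (auto simp: a_r_coset_def')
  then have "h \<in> carrier G" using additive_subgroup.a_subset[OF assms(1)] by blast
  then show "w \<in> carrier G \<and> w \<ominus> x \<in> H" using h assms(2) by (simp add: add_minus_cancel_right)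
next
  assume w: "w \<in> carrier G \<and> w \<ominus> x \<in> H"
  then have "w = (w \<ominus> x) \<oplus> x" using assms(2) by (simp add: minus_add_cancel)
  then show "w \<in> H +> x" using w unfolding a_r_coset_def' by blast
qed

lemma mem_coset_iff_congr:
  "\<lbrakk>additive_subgroup H G; x \<in> carrier G\<rbrakk> \<Longrightarrow> w \<in> H +> x \<longleftrightarrow> congr H w x"
  by (simp add: mem_coset_iff congr_def)

lemma coset_eqI:
  assumes "additive_subgroup H G" "congr H x y"
  shows "H +> x = H +> y"
proof -
  have c: "x \<in> carrier G" "y \<in> carrier G" using assms(2) by (auto simp: congr_def)
  show ?thesis
    using congr_trans[OF assms(1) _ assms(2)] congr_trans[OF assms(1) _ congr_sym[OF assms]]
    by (auto simp: mem_coset_iff_congr[OF assms(1)] c)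
qed

lemma coset_self: "\<lbrakk>additive_subgroup H G; x \<in> carrier G\<rbrakk> \<Longrightarrow> x \<in> H +> x"
  by (simp add: mem_coset_iff_congr congr_refl)

lemma additive_subgroup_add_pow:
  "\<lbrakk>additive_subgroup H G; x \<in> H\<rbrakk> \<Longrightarrow> [(n::nat)] \<cdot>\<^bsub>G\<^esub> x \<in> H"
proof (induction n)
  case 0
  then show ?case by (simp add: additive_subgroup.zero_closed)
next
  case (Suc n)
  then show ?case using additive_subgroup.a_closed[OF Suc.prems(1)]
    by (simp add: add.nat_pow_Suc)
qed

lemma add_pow_finsum:
  "f \<in> I \<rightarrow> carrier G \<Longrightarrow> [(n::nat)] \<cdot>\<^bsub>G\<^esub> (\<Oplus>i\<in>I. f i) = (\<Oplus>i\<in>I. [n] \<cdot>\<^bsub>G\<^esub> f i)"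
proof (induction I rule: infinite_finite_induct)
  case (insert x F)
  then show ?case by (simp add: Pi_def add.nat_pow_distrib)
qed auto

end

section \<open>Linear combinations in left modules\<close>

context left_module
begin

lemma smult_l_null [simp]:
  assumes "x \<in> carrier M" shows "\<zero>\<^bsub>R\<^esub> \<odot>\<^bsub>M\<^esub> x = \<zero>\<^bsub>M\<^esub>"
proof -
  have "\<zero>\<^bsub>R\<^esub> \<odot>\<^bsub>M\<^esub> x \<oplus>\<^bsub>M\<^esub> \<zero>\<^bsub>R\<^esub> \<odot>\<^bsub>M\<^esub> x = \<zero>\<^bsub>R\<^esub> \<odot>\<^bsub>M\<^esub> x"
    using smult_l_distr[of "\<zero>\<^bsub>R\<^esub>" "\<zero>\<^bsub>R\<^esub>" x] assms by simp
  then show ?thesis using assms by (metis M.add.r_cancel_one' R.zero_closed smult_closed)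
qed

lemma smult_r_null [simp]:
  assumes "a \<in> carrier R" shows "a \<odot>\<^bsub>M\<^esub> \<zero>\<^bsub>M\<^esub> = \<zero>\<^bsub>M\<^esub>"
proof -
  have "a \<odot>\<^bsub>M\<^esub> \<zero>\<^bsub>M\<^esub> \<oplus>\<^bsub>M\<^esub> a \<odot>\<^bsub>M\<^esub> \<zero>\<^bsub>M\<^esub> = a \<odot>\<^bsub>M\<^esub> \<zero>\<^bsub>M\<^esub>"
    using smult_r_distr[of a "\<zero>\<^bsub>M\<^esub>" "\<zero>\<^bsub>M\<^esub>"] assms by simp
  then show ?thesis using assms by (metis M.add.r_cancel_one' M.zero_closed smult_closed)
qed

lemma smult_l_minus:
  assumes "a \<in> carrier R" "x \<in> carrier M" shows "(\<ominus>\<^bsub>R\<^esub> a) \<odot>\<^bsub>M\<^esub> x = \<ominus>\<^bsub>M\<^esub> (a \<odot>\<^bsub>M\<^esub> x)"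
  using assms smult_l_distr[of "\<ominus>\<^bsub>R\<^esub> a" a x]
  by (metis M.minus_equality R.a_inv_closed R.l_neg smult_closed smult_l_null)

lemma smult_r_minus:
  assumes "a \<in> carrier R" "x \<in> carrier M" shows "a \<odot>\<^bsub>M\<^esub> (\<ominus>\<^bsub>M\<^esub> x) = \<ominus>\<^bsub>M\<^esub> (a \<odot>\<^bsub>M\<^esub> x)"
  using assms smult_r_distr[of a "\<ominus>\<^bsub>M\<^esub> x" x]
  by (metis M.minus_equality M.a_inv_closed M.l_neg smult_closed smult_r_null)

lemma smult_l_diff:
  assumes "a \<in> carrier R" "b \<in> carrier R" "x \<in> carrier M"
  shows "(a \<ominus>\<^bsub>R\<^esub> b) \<odot>\<^bsub>M\<^esub> x = (a \<odot>\<^bsub>M\<^esub> x) \<ominus>\<^bsub>M\<^esub> (b \<odot>\<^bsub>M\<^esub> x)"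
  using assms by (simp add: a_minus_def smult_l_distr smult_l_minus)

lemma smult_r_diff:
  assumes "a \<in> carrier R" "x \<in> carrier M" "y \<in> carrier M"
  shows "a \<odot>\<^bsub>M\<^esub> (x \<ominus>\<^bsub>M\<^esub> y) = (a \<odot>\<^bsub>M\<^esub> x) \<ominus>\<^bsub>M\<^esub> (a \<odot>\<^bsub>M\<^esub> y)"
  using assms by (simp add: a_minus_def smult_r_distr smult_r_minus)

lemma smult_finsum:
  assumes "a \<in> carrier R" "f \<in> I \<rightarrow> carrier M"
  shows "a \<odot>\<^bsub>M\<^esub> (\<Oplus>\<^bsub>M\<^esub>i\<in>I. f i) = (\<Oplus>\<^bsub>M\<^esub>i\<in>I. a \<odot>\<^bsub>M\<^esub> f i)"
  using assms
proof (induction I rule: infinite_finite_induct)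
  case (insert x F)
  then show ?case by (simp add: Pi_def smult_r_distr)
qed auto

lemma finsum_smult:
  assumes "f \<in> I \<rightarrow> carrier R" "x \<in> carrier M"
  shows "(\<Oplus>\<^bsub>R\<^esub>i\<in>I. f i) \<odot>\<^bsub>M\<^esub> x = (\<Oplus>\<^bsub>M\<^esub>i\<in>I. f i \<odot>\<^bsub>M\<^esub> x)"
  using assms
proof (induction I rule: infinite_finite_induct)
  case (insert x F)
  then show ?case by (simp add: Pi_def smult_l_distr)
qed auto

text \<open>The generators form a family indexed by \<open>I\<close> rather than a set: a generating
  set \<open>S\<close> is used as \<open>id\<close> on \<open>S\<close>, while the generators in the
  Artin-Rees lemma are indexed by leading components and may repeat.\<close>

definition lincomb :: "('i \<Rightarrow> 'r) \<Rightarrow> ('i \<Rightarrow> 'm) \<Rightarrow> 'i set \<Rightarrow> 'm"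
  where "lincomb r g I = (\<Oplus>\<^bsub>M\<^esub>i\<in>I. r i \<odot>\<^bsub>M\<^esub> g i)"

lemma lincomb_closed [intro, simp]:
  "\<lbrakk>r \<in> I \<rightarrow> carrier R; g \<in> I \<rightarrow> carrier M\<rbrakk> \<Longrightarrow> lincomb r g I \<in> carrier M"
  by (auto simp: lincomb_def Pi_def)

lemma lincomb_add:
  "\<lbrakk>r \<in> I \<rightarrow> carrier R; s \<in> I \<rightarrow> carrier R; g \<in> I \<rightarrow> carrier M\<rbrakk> \<Longrightarrow>
    lincomb (\<lambda>i. r i \<oplus>\<^bsub>R\<^esub> s i) g I = lincomb r g I \<oplus>\<^bsub>M\<^esub> lincomb s g I"
proof -
  assume *: "r \<in> I \<rightarrow> carrier R" "s \<in> I \<rightarrow> carrier R" "g \<in> I \<rightarrow> carrier M"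
  have "lincomb (\<lambda>i. r i \<oplus>\<^bsub>R\<^esub> s i) g I = (\<Oplus>\<^bsub>M\<^esub>i\<in>I. r i \<odot>\<^bsub>M\<^esub> g i \<oplus>\<^bsub>M\<^esub> s i \<odot>\<^bsub>M\<^esub> g i)"
    unfolding lincomb_def using * by (intro M.finsum_cong') (auto simp: Pi_def smult_l_distr)
  then show ?thesis using * by (simp add: lincomb_def Pi_def)
qed

lemma lincomb_minus:
  "\<lbrakk>r \<in> I \<rightarrow> carrier R; s \<in> I \<rightarrow> carrier R; g \<in> I \<rightarrow> carrier M\<rbrakk> \<Longrightarrow>
    lincomb (\<lambda>i. r i \<ominus>\<^bsub>R\<^esub> s i) g I = lincomb r g I \<ominus>\<^bsub>M\<^esub> lincomb s g I"
  unfolding lincomb_def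
  by (subst M.finsum_minus[symmetric]) (auto intro!: M.finsum_cong' simp: Pi_def smult_l_diff)

lemma smult_lincomb:
  "\<lbrakk>a \<in> carrier R; r \<in> I \<rightarrow> carrier R; g \<in> I \<rightarrow> carrier M\<rbrakk> \<Longrightarrow>
    a \<odot>\<^bsub>M\<^esub> lincomb r g I = lincomb (\<lambda>i. a \<otimes>\<^bsub>R\<^esub> r i) g I"
  unfolding lincomb_def
  by (subst smult_finsum) (auto intro!: M.finsum_cong' simp: Pi_def smult_assoc1)

lemma lincomb_insert:
  "\<lbrakk>finite I; j \<notin> I; r \<in> insert j I \<rightarrow> carrier R; g \<in> insert j I \<rightarrow> carrier M\<rbrakk> \<Longrightarrow>
    lincomb r g (insert j I) = r j \<odot>\<^bsub>M\<^esub> g j \<oplus>\<^bsub>M\<^esub> lincomb r g I"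
  unfolding lincomb_def by (rule M.finsum_insert) (auto simp: Pi_def)

lemma lincomb_cong:
  "\<lbrakk>\<And>i. i \<in> I \<Longrightarrow> r i = s i; s \<in> I \<rightarrow> carrier R; g \<in> I \<rightarrow> carrier M\<rbrakk> \<Longrightarrow>
    lincomb r g I = lincomb s g I"
  unfolding lincomb_def by (rule M.finsum_cong') (auto simp: Pi_def)

lemma lincomb_single:
  assumes "finite I" "j \<in> I" "a \<in> carrier R" "g \<in> I \<rightarrow> carrier M"
  shows "lincomb (\<lambda>i. if i = j then a else \<zero>\<^bsub>R\<^esub>) g I = a \<odot>\<^bsub>M\<^esub> g j"
  unfolding lincomb_def
  by (subst M.finsum_single[where i = j]) (use assms in \<open>auto simp: Pi_def\<close>)

lemma lincomb_zero: "g \<in> I \<rightarrow> carrier M \<Longrightarrow> lincomb (\<lambda>i. \<zero>\<^bsub>R\<^esub>) g I = \<zero>\<^bsub>M\<^esub>"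
  unfolding lincomb_def by (intro M.add.finprod_one_eqI) (auto simp: Pi_def)

lemma submodule_by_minus:
  assumes "additive_subgroup H M" "\<And>a x. \<lbrakk>a \<in> carrier R; x \<in> H\<rbrakk> \<Longrightarrow> a \<odot>\<^bsub>M\<^esub> x \<in> H"
  shows "submodule H R M"
  using assms by (simp add: submodule_def submodule_axioms_def additive_subgroup_def)

lemma submodule_imp_additive: "submodule H R M \<Longrightarrow> additive_subgroup H M"
  by (simp add: submodule_def additive_subgroup_def)

lemma submodule_lincomb:
  assumes "submodule H R M" "r \<in> I \<rightarrow> carrier R" "g \<in> I \<rightarrow> H"
  shows "lincomb r g I \<in> H"
  unfolding lincomb_def
  using assms by (intro M.subgroup_finsum_closed submodule_imp_additive) (auto simp: Pi_def submodule.smult_closed)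

lemma submodule_generated_is_submodule:
  assumes "S \<subseteq> carrier M"
  shows "submodule (submodule_generated R M S) R M"
proof (rule submodule_by_minus)
  have c: "submodule (carrier M) R M"
    by (rule submodule_by_minus) (auto intro: M.additive_subgroup_carrier)
  show "additive_subgroup (submodule_generated R M S) M"
  proof (rule M.additive_subgroup_by_minus)
    show "submodule_generated R M S \<subseteq> carrier M"
      using c assms by (auto simp: submodule_generated_def)
    show "\<zero>\<^bsub>M\<^esub> \<in> submodule_generated R M S"
      by (auto simp: submodule_generated_def dest!: submodule_imp_additive additive_subgroup.zero_closed)
    show "x \<ominus>\<^bsub>M\<^esub> y \<in> submodule_generated R M S"
      if "x \<in> submodule_generated R M S" "y \<in> submodule_generated R M S" for x y
      using that by (auto simp: submodule_generated_def intro: M.subgroup_minus_closed submodule_imp_additive)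
  qed
  show "a \<odot>\<^bsub>M\<^esub> x \<in> submodule_generated R M S"
    if "a \<in> carrier R" "x \<in> submodule_generated R M S" for a x
    using that by (auto simp: submodule_generated_def intro: submodule.smult_closed)
qed

lemma submodule_generated_least:
  "\<lbrakk>submodule H R M; S \<subseteq> H\<rbrakk> \<Longrightarrow> submodule_generated R M S \<subseteq> H"
  by (auto simp: submodule_generated_def)

lemma submodule_generated_superset: "S \<subseteq> submodule_generated R M S"
  by (auto simp: submodule_generated_def)

lemma lincombs_submodule:
  assumes "finite I" "g \<in> I \<rightarrow> carrier M"
  shows "submodule {lincomb r g I | r. r \<in> I \<rightarrow> carrier R} R M"
proof (rule submodule_by_minus)
  show "additive_subgroup {lincomb r g I | r. r \<in> I \<rightarrow> carrier R} M"
  proof (rule M.additive_subgroup_by_minus)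
    show "{lincomb r g I | r. r \<in> I \<rightarrow> carrier R} \<subseteq> carrier M" using assms by auto
    show "\<zero>\<^bsub>M\<^esub> \<in> {lincomb r g I | r. r \<in> I \<rightarrow> carrier R}"
      using lincomb_zero[OF assms(2)] by force
    fix x y
    assume "x \<in> {lincomb r g I | r. r \<in> I \<rightarrow> carrier R}" "y \<in> {lincomb r g I | r. r \<in> I \<rightarrow> carrier R}"
    then obtain r s where rs: "x = lincomb r g I" "y = lincomb s g I"
      "r \<in> I \<rightarrow> carrier R" "s \<in> I \<rightarrow> carrier R" by auto
    then have "x \<ominus>\<^bsub>M\<^esub> y = lincomb (\<lambda>i. r i \<ominus>\<^bsub>R\<^esub> s i) g I" using assms by (simp add: lincomb_minus)
    moreover have "(\<lambda>i. r i \<ominus>\<^bsub>R\<^esub> s i) \<in> I \<rightarrow> carrier R" using rs by auto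
    ultimately show "x \<ominus>\<^bsub>M\<^esub> y \<in> {lincomb r g I | r. r \<in> I \<rightarrow> carrier R}" by blast
  qed
next
  fix a x
  assume a: "a \<in> carrier R" and "x \<in> {lincomb r g I | r. r \<in> I \<rightarrow> carrier R}"
  then obtain r where r: "x = lincomb r g I" "r \<in> I \<rightarrow> carrier R" by auto
  then have "a \<odot>\<^bsub>M\<^esub> x = lincomb (\<lambda>i. a \<otimes>\<^bsub>R\<^esub> r i) g I" using a assms by (simp add: smult_lincomb)
  moreover have "(\<lambda>i. a \<otimes>\<^bsub>R\<^esub> r i) \<in> I \<rightarrow> carrier R" using r a by auto
  ultimately show "a \<odot>\<^bsub>M\<^esub> x \<in> {lincomb r g I | r. r \<in> I \<rightarrow> carrier R}" by blast
qed

text \<open>The linear combinations already form a submodule, and it contains each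
  \<open>g j\<close> through the indicator of \<open>j\<close> as coefficients. An intersection of
  submodules is thereby turned into explicit coefficients.\<close>

lemma submodule_generated_finite:
  assumes "finite I" "g \<in> I \<rightarrow> carrier M"
  shows "submodule_generated R M (g ` I) = {lincomb r g I | r. r \<in> I \<rightarrow> carrier R}"
proof
  have "g ` I \<subseteq> {lincomb r g I | r. r \<in> I \<rightarrow> carrier R}"
  proof
    fix x assume "x \<in> g ` I"
    then obtain j where j: "j \<in> I" "x = g j" by auto
    have "x = lincomb (\<lambda>i. if i = j then \<one>\<^bsub>R\<^esub> else \<zero>\<^bsub>R\<^esub>) g I"
      using lincomb_single[of I j "\<one>\<^bsub>R\<^esub>" g] smult_one[of "g j"] assms j by (simp add: Pi_def)
    then show "x \<in> {lincomb r g I | r. r \<in> I \<rightarrow> carrier R}" by fastforce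
  qed
  then show "submodule_generated R M (g ` I) \<subseteq> {lincomb r g I | r. r \<in> I \<rightarrow> carrier R}"
    using lincombs_submodule[OF assms] by (rule submodule_generated_least[rotated])
  have "submodule (submodule_generated R M (g ` I)) R M"
    using assms by (intro submodule_generated_is_submodule) auto
  moreover have "g \<in> I \<rightarrow> submodule_generated R M (g ` I)"
    using submodule_generated_superset[of "g ` I"] by auto
  ultimately show "{lincomb r g I | r. r \<in> I \<rightarrow> carrier R} \<subseteq> submodule_generated R M (g ` I)"
    by (auto intro: submodule_lincomb)
qed

text \<open>The union of the submodules generated by finite subsets of \<open>S\<close> is a
  submodule, since two finite subsets have a finite union. It allows a finite generating set
  supplied by noetherianity, which may lie anywhere in the submodule, to be exchanged for one inside
  a prescribed generating set.\<close>

lemma submodule_generated_finite_subset: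
  assumes "S \<subseteq> carrier M" "x \<in> submodule_generated R M S"
  shows "\<exists>T. finite T \<and> T \<subseteq> S \<and> x \<in> submodule_generated R M T"
proof -
  let ?H = "{x. \<exists>T. finite T \<and> T \<subseteq> S \<and> x \<in> submodule_generated R M T}"
  have mono: "submodule_generated R M T \<subseteq> submodule_generated R M T'" if "T \<subseteq> T'" for T T'
    using that by (auto simp: submodule_generated_def)
  have sub: "submodule (submodule_generated R M T) R M" if "T \<subseteq> S" for T
    using that assms by (intro submodule_generated_is_submodule) auto
  have "submodule ?H R M"
  proof (rule submodule_by_minus[OF M.additive_subgroup_by_minus])
    show "?H \<subseteq> carrier M"
      using sub additive_subgroup.a_subset[OF submodule_imp_additive] by blast
    show "\<zero>\<^bsub>M\<^esub> \<in> ?H"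
      using additive_subgroup.zero_closed[OF submodule_imp_additive[OF sub]] by blast
    fix x y assume "x \<in> ?H" "y \<in> ?H"
    then obtain T U where TU: "finite T" "T \<subseteq> S" "x \<in> submodule_generated R M T"
      "finite U" "U \<subseteq> S" "y \<in> submodule_generated R M U" by auto
    have "x \<in> submodule_generated R M (T \<union> U)" "y \<in> submodule_generated R M (T \<union> U)"
      using TU mono[of T "T \<union> U"] mono[of U "T \<union> U"] by auto
    moreover have "T \<union> U \<subseteq> S" using TU by blast
    ultimately have "x \<ominus>\<^bsub>M\<^esub> y \<in> submodule_generated R M (T \<union> U)"
      by (intro M.subgroup_minus_closed[OF submodule_imp_additive[OF sub]])
    then show "x \<ominus>\<^bsub>M\<^esub> y \<in> ?H" using TU by (metis (mono_tags, lifting) CollectI finite_UnI le_sup_iff)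
  next
    fix a x assume a: "a \<in> carrier R" and "x \<in> ?H"
    then obtain T where T: "finite T" "T \<subseteq> S" "x \<in> submodule_generated R M T" by auto
    then have "a \<odot>\<^bsub>M\<^esub> x \<in> submodule_generated R M T" by (intro submodule.smult_closed[OF sub] a)
    then show "a \<odot>\<^bsub>M\<^esub> x \<in> ?H" using T by blast
  qed
  moreover have "S \<subseteq> ?H"
  proof
    fix s assume "s \<in> S"
    then show "s \<in> ?H"
      using submodule_generated_superset[of "{s}"] by (intro CollectI exI[of _ "{s}"]) auto
  qed
  ultimately show ?thesis using submodule_generated_least assms(2) by blast
qed

end

lemma additive_subgroup_regular_module_iff:
  "additive_subgroup H (regular_module R) \<longleftrightarrow> additive_subgroup H R"
  by (simp add: additive_subgroup_def subgroup_def regular_module_def m_inv_def)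

lemma (in ring) regular_left_module: "left_module R (regular_module R)"
proof -
  have "abelian_group (regular_module R)"
    by (rule abelian_groupI) (auto simp: regular_module_def a_ac intro: add.l_inv_ex)
  then show ?thesis
    by (intro left_module.intro left_module_axioms.intro ring_axioms)
      (auto simp: regular_module_def l_distr r_distr m_assoc)
qed

section \<open>Homogeneous components\<close>

context connected_graded_algebra
begin

lemma gr_subgroup: "additive_subgroup (gr i) A"
  using gr_subspace[of i] by (simp add: submodule_def additive_subgroup_def)

lemma gr_carrier: "x \<in> gr i \<Longrightarrow> x \<in> carrier A"
  using additive_subgroup.a_subset[OF gr_subgroup] by auto

lemma zero_in_gr [simp]: "\<zero>\<^bsub>A\<^esub> \<in> gr i"
  by (rule additive_subgroup.zero_closed[OF gr_subgroup])

lemma one_in_gr [simp]: "\<one>\<^bsub>A\<^esub> \<in> gr 0"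
  using gr_zero smult_one[of "\<one>\<^bsub>A\<^esub>"] by force

definition comp :: "'a \<Rightarrow> nat \<Rightarrow> 'a"
  where "comp a = (THE c. homogeneous_family A gr c \<and> a = family_sum A c)"

lemma comp_props:
  assumes "a \<in> carrier A"
  shows "homogeneous_family A gr (comp a)" "a = family_sum A (comp a)"
proof -
  have "\<exists>!c. homogeneous_family A gr c \<and> a = family_sum A c"
    using gr_direct_sum assms by (auto simp: internal_direct_sum_def)
  then have "homogeneous_family A gr (comp a) \<and> a = family_sum A (comp a)"
    unfolding comp_def by (rule theI')
  then show "homogeneous_family A gr (comp a)" "a = family_sum A (comp a)" by auto
qed

lemma comp_in_gr [simp, intro]: "a \<in> carrier A \<Longrightarrow> comp a i \<in> gr i"
  using comp_props(1) by (auto simp: homogeneous_family_def)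

lemma comp_closed [simp, intro]: "a \<in> carrier A \<Longrightarrow> comp a i \<in> carrier A"
  using comp_in_gr gr_carrier by blast

lemma family_sum_eq:
  assumes "finite I" "\<And>i. c i \<in> carrier A" "\<And>i. i \<notin> I \<Longrightarrow> c i = \<zero>\<^bsub>A\<^esub>"
  shows "family_sum A c = (\<Oplus>\<^bsub>A\<^esub>i\<in>I. c i)"
  unfolding family_sum_def
  using assms by (intro M.add.finprod_mono_neutral_cong_left) auto

text \<open>Any finite set outside of which the family vanishes may serve as \<open>I\<close>, in
  place of the exact support that \<open>family_sum\<close> uses; this spares recomputing supports
  after sums and products.\<close>

lemma comp_unique:
  assumes "finite I" "\<And>i. c i \<in> gr i" "\<And>i. i \<notin> I \<Longrightarrow> c i = \<zero>\<^bsub>A\<^esub>"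
  shows "comp (\<Oplus>\<^bsub>A\<^esub>i\<in>I. c i) = c"
proof -
  have cc: "\<And>i. c i \<in> carrier A" using assms(2) gr_carrier by blast
  then have a: "(\<Oplus>\<^bsub>A\<^esub>i\<in>I. c i) \<in> carrier A" by (intro M.finsum_closed) auto
  have "finite {i. c i \<noteq> \<zero>\<^bsub>A\<^esub>}" using assms by (auto intro: finite_subset[of _ I])
  then have "homogeneous_family A gr c" using assms by (auto simp: homogeneous_family_def)
  moreover have "(\<Oplus>\<^bsub>A\<^esub>i\<in>I. c i) = family_sum A c"
    using assms cc by (intro family_sum_eq[symmetric]) auto
  ultimately show ?thesis
    using gr_direct_sum a comp_props[OF a] unfolding internal_direct_sum_def by metis
qed

lemma comp_bound: "a \<in> carrier A \<Longrightarrow> \<exists>n. \<forall>i\<ge>n. comp a i = \<zero>\<^bsub>A\<^esub>"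
  using comp_props(1)[of a] finite_nat_set_iff_bounded[of "{i. comp a i \<noteq> \<zero>\<^bsub>A\<^esub>}"]
  by (auto simp: homogeneous_family_def) (meson linorder_not_less)

lemma comp_sum:
  assumes "a \<in> carrier A" "\<And>i. i \<ge> n \<Longrightarrow> comp a i = \<zero>\<^bsub>A\<^esub>"
  shows "a = (\<Oplus>\<^bsub>A\<^esub>i\<in>{..<n}. comp a i)"
  using comp_props(2)[OF assms(1)] family_sum_eq[of "{..<n}" "comp a"] assms by auto

lemma comp_sum_ex: "a \<in> carrier A \<Longrightarrow> \<exists>n. a = (\<Oplus>\<^bsub>A\<^esub>i\<in>{..<n}. comp a i)"
  using comp_bound comp_sum by metis

lemma comp_add [simp]:
  assumes "a \<in> carrier A" "b \<in> carrier A"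
  shows "comp (a \<oplus>\<^bsub>A\<^esub> b) i = comp a i \<oplus>\<^bsub>A\<^esub> comp b i"
proof -
  obtain n m where nm: "\<forall>i\<ge>n. comp a i = \<zero>\<^bsub>A\<^esub>" "\<forall>i\<ge>m. comp b i = \<zero>\<^bsub>A\<^esub>"
    using comp_bound assms by meson
  let ?N = "max n m"
  have "a \<oplus>\<^bsub>A\<^esub> b = (\<Oplus>\<^bsub>A\<^esub>i\<in>{..<?N}. comp a i) \<oplus>\<^bsub>A\<^esub> (\<Oplus>\<^bsub>A\<^esub>i\<in>{..<?N}. comp b i)"
    using comp_sum[of a ?N] comp_sum[of b ?N] assms nm by simp
  also have "\<dots> = (\<Oplus>\<^bsub>A\<^esub>i\<in>{..<?N}. comp a i \<oplus>\<^bsub>A\<^esub> comp b i)"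
    using assms by (intro M.finsum_addf[symmetric]) auto
  finally have *: "a \<oplus>\<^bsub>A\<^esub> b = (\<Oplus>\<^bsub>A\<^esub>i\<in>{..<?N}. comp a i \<oplus>\<^bsub>A\<^esub> comp b i)" .
  have "comp (\<Oplus>\<^bsub>A\<^esub>i\<in>{..<?N}. comp a i \<oplus>\<^bsub>A\<^esub> comp b i) = (\<lambda>i. comp a i \<oplus>\<^bsub>A\<^esub> comp b i)"
    using assms nm additive_subgroup.a_closed[OF gr_subgroup]
    by (intro comp_unique) auto
  then show ?thesis using * by simp
qed

lemma comp_homogeneous: "a \<in> gr i \<Longrightarrow> comp a j = (if j = i then a else \<zero>\<^bsub>A\<^esub>)"
  using comp_unique[of "{i}" "\<lambda>j. if j = i then a else \<zero>\<^bsub>A\<^esub>"] M.finsum_insert[of "{}" i "\<lambda>_. a"]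
    gr_carrier[of a i]
  by auto

lemma comp_zero [simp]: "comp \<zero>\<^bsub>A\<^esub> i = \<zero>\<^bsub>A\<^esub>"
  using comp_homogeneous[of "\<zero>\<^bsub>A\<^esub>" 0 i] by (simp split: if_splits)

lemma comp_a_inv [simp]: "a \<in> carrier A \<Longrightarrow> comp (\<ominus>\<^bsub>A\<^esub> a) i = \<ominus>\<^bsub>A\<^esub> comp a i"
  by (metis M.a_inv_closed M.l_neg M.minus_equality comp_add comp_closed comp_zero)

lemma comp_minus [simp]:
  "\<lbrakk>a \<in> carrier A; b \<in> carrier A\<rbrakk> \<Longrightarrow> comp (a \<ominus>\<^bsub>A\<^esub> b) i = comp a i \<ominus>\<^bsub>A\<^esub> comp b i"
  by (simp add: a_minus_def)

lemma comp_finsum: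
  "f \<in> I \<rightarrow> carrier A \<Longrightarrow> comp (\<Oplus>\<^bsub>A\<^esub>j\<in>I. f j) i = (\<Oplus>\<^bsub>A\<^esub>j\<in>I. comp (f j) i)"
proof (induction I rule: infinite_finite_induct)
  case (insert x F)
  then show ?case by (simp add: Pi_def)
qed auto

lemma comp_one: "comp \<one>\<^bsub>A\<^esub> i = (if i = 0 then \<one>\<^bsub>A\<^esub> else \<zero>\<^bsub>A\<^esub>)"
  by (simp add: comp_homogeneous[of _ 0])

lemma comp_mult_homogeneous_right:
  assumes "a \<in> carrier A" "b \<in> gr j"
  shows "comp (a \<otimes>\<^bsub>A\<^esub> b) n = (if j \<le> n then comp a (n - j) \<otimes>\<^bsub>A\<^esub> b else \<zero>\<^bsub>A\<^esub>)"
proof -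
  note [simp] = gr_carrier[OF assms(2)]
  obtain m where m: "\<forall>i\<ge>m. comp a i = \<zero>\<^bsub>A\<^esub>" using comp_bound assms by meson
  have "a \<otimes>\<^bsub>A\<^esub> b = (\<Oplus>\<^bsub>A\<^esub>i\<in>{..<m}. comp a i) \<otimes>\<^bsub>A\<^esub> b"
    using comp_sum[of a m] m assms by simp
  also have "\<dots> = (\<Oplus>\<^bsub>A\<^esub>i\<in>{..<m}. comp a i \<otimes>\<^bsub>A\<^esub> b)"
    using assms by (intro A.finsum_ldistr) auto
  finally have "comp (a \<otimes>\<^bsub>A\<^esub> b) n = (\<Oplus>\<^bsub>A\<^esub>i\<in>{..<m}. comp (comp a i \<otimes>\<^bsub>A\<^esub> b) n)"
    using assms by (simp add: comp_finsum)
  also have "\<dots> = (\<Oplus>\<^bsub>A\<^esub>i\<in>{..<m}. if n = i + j then comp a i \<otimes>\<^bsub>A\<^esub> b else \<zero>\<^bsub>A\<^esub>)"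
    using assms gr_mult comp_homogeneous by (intro M.finsum_cong') auto
  also have "\<dots> = (if j \<le> n then comp a (n - j) \<otimes>\<^bsub>A\<^esub> b else \<zero>\<^bsub>A\<^esub>)"
  proof (cases "j \<le> n \<and> n - j < m")
    case True
    then show ?thesis using assms by (subst M.finsum_single[where i = "n - j"]) auto
  next
    case False
    have "(\<Oplus>\<^bsub>A\<^esub>i\<in>{..<m}. if n = i + j then comp a i \<otimes>\<^bsub>A\<^esub> b else \<zero>\<^bsub>A\<^esub>) = \<zero>\<^bsub>A\<^esub>"
      using False by (intro M.add.finprod_one_eqI) auto
    then show ?thesis using False m assms by auto
  qed
  finally show ?thesis .
qed

lemma comp_mult:
  assumes "a \<in> carrier A" "b \<in> carrier A"
  shows "comp (a \<otimes>\<^bsub>A\<^esub> b) n = (\<Oplus>\<^bsub>A\<^esub>i\<in>{..n}. comp a i \<otimes>\<^bsub>A\<^esub> comp b (n - i))"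
proof -
  obtain m where m: "\<forall>i\<ge>m. comp b i = \<zero>\<^bsub>A\<^esub>" using comp_bound assms by meson
  \<comment> \<open>The range must exhaust the components of \<open>b\<close> and also contain every
    index up to \<open>n\<close>, so that it can be cut down to \<open>{..n}\<close>
    afterwards.\<close>
  let ?m = "max m (Suc n)"
  have "a \<otimes>\<^bsub>A\<^esub> b = a \<otimes>\<^bsub>A\<^esub> (\<Oplus>\<^bsub>A\<^esub>j\<in>{..<?m}. comp b j)"
    using comp_sum[of b ?m] m assms by simp
  also have "\<dots> = (\<Oplus>\<^bsub>A\<^esub>j\<in>{..<?m}. a \<otimes>\<^bsub>A\<^esub> comp b j)"
    using assms by (intro A.finsum_rdistr) auto
  finally have "comp (a \<otimes>\<^bsub>A\<^esub> b) n = (\<Oplus>\<^bsub>A\<^esub>j\<in>{..<?m}. comp (a \<otimes>\<^bsub>A\<^esub> comp b j) n)"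
    using assms by (simp add: comp_finsum)
  also have "\<dots> = (\<Oplus>\<^bsub>A\<^esub>j\<in>{..n}. comp a (n - j) \<otimes>\<^bsub>A\<^esub> comp b j)"
    using assms comp_mult_homogeneous_right[OF assms(1) comp_in_gr[OF assms(2)]]
    by (intro M.add.finprod_mono_neutral_cong_right) auto
  also have "\<dots> = (\<Oplus>\<^bsub>A\<^esub>i\<in>{..n}. comp a i \<otimes>\<^bsub>A\<^esub> comp b (n - i))"
  proof -
    have "(\<Oplus>\<^bsub>A\<^esub>i\<in>{..n}. comp a i \<otimes>\<^bsub>A\<^esub> comp b (n - i))
        = (\<Oplus>\<^bsub>A\<^esub>i\<in>(\<lambda>j. n - j) ` {..n}. comp a i \<otimes>\<^bsub>A\<^esub> comp b (n - i))"
    proof -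
      have "x \<in> (\<lambda>j. n - j) ` {..n}" if "x \<le> n" for x
        using that by (intro image_eqI[of _ _ "n - x"]) auto
      then have "(\<lambda>j. n - j) ` {..n} = {..n}" by auto
      then show ?thesis by simp
    qed
    also have "\<dots> = (\<Oplus>\<^bsub>A\<^esub>j\<in>{..n}. comp a (n - j) \<otimes>\<^bsub>A\<^esub> comp b (n - (n - j)))"
      using assms by (intro M.finsum_reindex) (auto simp: inj_on_def)
    also have "\<dots> = (\<Oplus>\<^bsub>A\<^esub>j\<in>{..n}. comp a (n - j) \<otimes>\<^bsub>A\<^esub> comp b j)"
      using assms by (intro M.finsum_cong') auto
    finally show ?thesis by simp
  qed
  finally show ?thesis .
qed

lemma positive_part_iff: "a \<in> positive_part A gr \<longleftrightarrow> a \<in> carrier A \<and> comp a 0 = \<zero>\<^bsub>A\<^esub>"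
proof
  assume "a \<in> positive_part A gr"
  then obtain c where c: "homogeneous_family A gr c" "c 0 = \<zero>\<^bsub>A\<^esub>" "a = family_sum A c"
    by (auto simp: positive_part_def)
  then have a: "a = (\<Oplus>\<^bsub>A\<^esub>i\<in>{i. c i \<noteq> \<zero>\<^bsub>A\<^esub>}. c i)" by (simp add: family_sum_def)
  have "comp a = c"
    unfolding a using c by (intro comp_unique) (auto simp: homogeneous_family_def)
  moreover have "a \<in> carrier A"
    unfolding a using c gr_carrier by (intro M.finsum_closed) (auto simp: homogeneous_family_def)
  ultimately show "a \<in> carrier A \<and> comp a 0 = \<zero>\<^bsub>A\<^esub>" using c by simp
next
  assume "a \<in> carrier A \<and> comp a 0 = \<zero>\<^bsub>A\<^esub>"
  then show "a \<in> positive_part A gr" using comp_props[of a] by (auto simp: positive_part_def)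
qed

end

section \<open>The completed ring in terms of components\<close>

text \<open>The completion is used only as a ring of formal series \<open>\<Sum> a\<^sub>i\<close> with \<open>a\<^sub>i \<in> A\<^sub>i\<close>; the map \<open>co\<close>
  reads off the components.\<close>

locale graded_completion = connected_graded_algebra k A gr + S: ring R
  for k :: "('k, 'x) ring_scheme" and A :: "('k, 'a, 'y) module_scheme" and gr :: "nat \<Rightarrow> 'a set"
    and R :: "('r, 'w) ring_scheme" +
  fixes co :: "'r \<Rightarrow> nat \<Rightarrow> 'a"
  assumes co_bij: "bij_betw co (carrier R) {f. \<forall>i. f i \<in> gr i}"
    and co_add: "\<lbrakk>x \<in> carrier R; y \<in> carrier R\<rbrakk> \<Longrightarrow> co (x \<oplus>\<^bsub>R\<^esub> y) i = co x i \<oplus>\<^bsub>A\<^esub> co y i"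
    and co_mult: "\<lbrakk>x \<in> carrier R; y \<in> carrier R\<rbrakk> \<Longrightarrow>
      co (x \<otimes>\<^bsub>R\<^esub> y) n = (\<Oplus>\<^bsub>A\<^esub>i\<in>{..n}. co x i \<otimes>\<^bsub>A\<^esub> co y (n - i))"
    and co_one: "co \<one>\<^bsub>R\<^esub> i = (if i = 0 then \<one>\<^bsub>A\<^esub> else \<zero>\<^bsub>A\<^esub>)"
begin

declare co_add [simp]

lemma co_in_gr [simp, intro]: "x \<in> carrier R \<Longrightarrow> co x i \<in> gr i"
  using co_bij by (auto simp: bij_betw_def)

lemma co_closed [simp, intro]: "x \<in> carrier R \<Longrightarrow> co x i \<in> carrier A"
  using co_in_gr gr_carrier by blast

lemma co_eqI: "\<lbrakk>x \<in> carrier R; y \<in> carrier R; \<And>i. co x i = co y i\<rbrakk> \<Longrightarrow> x = y"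
  using co_bij inj_onD[of co "carrier R" x y] by (auto simp: bij_betw_def)

definition series :: "(nat \<Rightarrow> 'a) \<Rightarrow> 'r" where "series = inv_into (carrier R) co"

lemma series_closed: "(\<And>i. f i \<in> gr i) \<Longrightarrow> series f \<in> carrier R"
  and co_series: "(\<And>i. f i \<in> gr i) \<Longrightarrow> co (series f) = f"
  using co_bij unfolding series_def bij_betw_def
  by (auto intro: inv_into_into f_inv_into_f)

lemma co_zero [simp]: "co \<zero>\<^bsub>R\<^esub> i = \<zero>\<^bsub>A\<^esub>"
proof -
  have "co \<zero>\<^bsub>R\<^esub> i \<oplus>\<^bsub>A\<^esub> co \<zero>\<^bsub>R\<^esub> i = co \<zero>\<^bsub>R\<^esub> i" using co_add[of "\<zero>\<^bsub>R\<^esub>" "\<zero>\<^bsub>R\<^esub>" i] by simp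
  then show ?thesis by (metis M.add.r_cancel_one' S.zero_closed co_closed)
qed

lemma co_a_inv [simp]: "x \<in> carrier R \<Longrightarrow> co (\<ominus>\<^bsub>R\<^esub> x) i = \<ominus>\<^bsub>A\<^esub> co x i"
  by (metis M.minus_equality S.a_inv_closed S.l_neg co_add co_closed co_zero)

lemma co_minus [simp]:
  "\<lbrakk>x \<in> carrier R; y \<in> carrier R\<rbrakk> \<Longrightarrow> co (x \<ominus>\<^bsub>R\<^esub> y) i = co x i \<ominus>\<^bsub>A\<^esub> co y i"
  by (simp add: a_minus_def)

lemma co_finsum:
  "f \<in> I \<rightarrow> carrier R \<Longrightarrow> co (\<Oplus>\<^bsub>R\<^esub>j\<in>I. f j) i = (\<Oplus>\<^bsub>A\<^esub>j\<in>I. co (f j) i)"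
proof (induction I rule: infinite_finite_induct)
  case (insert x F)
  then show ?case by (simp add: Pi_def)
qed auto

text \<open>This is the ideal \<open>R_{>=n}\<close>. It plays the part of the powers of a maximal
  ideal: orders add under multiplication, only zero lies in all of them, and
  \<open>series_limit\<close> provides limits.\<close>

definition fl :: "nat \<Rightarrow> 'r set"
  where "fl n = {x \<in> carrier R. \<forall>i<n. co x i = \<zero>\<^bsub>A\<^esub>}"

lemma fl_carrier: "x \<in> fl n \<Longrightarrow> x \<in> carrier R"
  by (simp add: fl_def)

lemma fl_subgroup: "additive_subgroup (fl n) R"
  by (rule S.additive_subgroup_by_minus) (auto simp: fl_def)

lemma fl_0: "fl 0 = carrier R"
  by (auto simp: fl_def)

lemma fl_antimono: "m \<le> n \<Longrightarrow> fl n \<subseteq> fl m"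
  by (auto simp: fl_def)

lemma fl_mult:
  assumes "x \<in> fl m" "y \<in> fl n"
  shows "x \<otimes>\<^bsub>R\<^esub> y \<in> fl (m + n)"
proof -
  have "co (x \<otimes>\<^bsub>R\<^esub> y) i = \<zero>\<^bsub>A\<^esub>" if "i < m + n" for i
  proof -
    have "co x j \<otimes>\<^bsub>A\<^esub> co y (i - j) = \<zero>\<^bsub>A\<^esub>" if "j \<le> i" for j
      using that \<open>i < m + n\<close> assms by (cases "j < m") (auto simp: fl_def)
    then show ?thesis
      using assms by (subst co_mult) (auto simp: fl_def intro!: M.add.finprod_one_eqI)
  qed
  then show ?thesis using assms by (auto simp: fl_def)
qed

lemma fl_mult_right: "\<lbrakk>x \<in> fl m; y \<in> carrier R\<rbrakk> \<Longrightarrow> x \<otimes>\<^bsub>R\<^esub> y \<in> fl m"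
  using fl_mult[of x m y 0] by (simp add: fl_0)

lemma fl_Inter: "(\<And>n. x \<in> fl n) \<Longrightarrow> x = \<zero>\<^bsub>R\<^esub>"
  by (rule co_eqI) (auto simp: fl_def)

definition emb :: "'a \<Rightarrow> 'r" where "emb a = series (comp a)"

lemma emb_closed [simp, intro]: "a \<in> carrier A \<Longrightarrow> emb a \<in> carrier R"
  unfolding emb_def by (rule series_closed) simp

lemma co_emb [simp]: "a \<in> carrier A \<Longrightarrow> co (emb a) = comp a"
  unfolding emb_def by (rule co_series) simp

lemma emb_add [simp]:
  "\<lbrakk>a \<in> carrier A; b \<in> carrier A\<rbrakk> \<Longrightarrow> emb (a \<oplus>\<^bsub>A\<^esub> b) = emb a \<oplus>\<^bsub>R\<^esub> emb b"
  by (rule co_eqI) auto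

lemma emb_zero [simp]: "emb \<zero>\<^bsub>A\<^esub> = \<zero>\<^bsub>R\<^esub>"
  by (rule co_eqI) auto

lemma emb_minus [simp]:
  "\<lbrakk>a \<in> carrier A; b \<in> carrier A\<rbrakk> \<Longrightarrow> emb (a \<ominus>\<^bsub>A\<^esub> b) = emb a \<ominus>\<^bsub>R\<^esub> emb b"
  by (rule co_eqI) auto

lemma emb_mult [simp]:
  "\<lbrakk>a \<in> carrier A; b \<in> carrier A\<rbrakk> \<Longrightarrow> emb (a \<otimes>\<^bsub>A\<^esub> b) = emb a \<otimes>\<^bsub>R\<^esub> emb b"
  by (rule co_eqI) (auto simp: co_mult comp_mult)

lemma emb_one [simp]: "emb \<one>\<^bsub>A\<^esub> = \<one>\<^bsub>R\<^esub>"
  by (rule co_eqI) (auto simp: co_one comp_one)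

lemma emb_finsum:
  "f \<in> I \<rightarrow> carrier A \<Longrightarrow> emb (\<Oplus>\<^bsub>A\<^esub>i\<in>I. f i) = (\<Oplus>\<^bsub>R\<^esub>i\<in>I. emb (f i))"
proof (induction I rule: infinite_finite_induct)
  case (insert x F)
  then show ?case by (simp add: Pi_def)
qed auto

lemma emb_in_fl: "\<lbrakk>a \<in> carrier A; \<And>i. i < n \<Longrightarrow> comp a i = \<zero>\<^bsub>A\<^esub>\<rbrakk> \<Longrightarrow> emb a \<in> fl n"
  by (simp add: fl_def)

lemma emb_gr_in_fl: "a \<in> gr n \<Longrightarrow> emb a \<in> fl n"
  by (rule emb_in_fl) (auto simp: comp_homogeneous gr_carrier)

definition trunc :: "nat \<Rightarrow> 'r \<Rightarrow> 'a" where "trunc n x = (\<Oplus>\<^bsub>A\<^esub>i\<in>{..<n}. co x i)"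

lemma trunc_closed [simp, intro]: "x \<in> carrier R \<Longrightarrow> trunc n x \<in> carrier A"
  by (auto simp: trunc_def)

lemma comp_trunc: "x \<in> carrier R \<Longrightarrow> comp (trunc n x) i = (if i < n then co x i else \<zero>\<^bsub>A\<^esub>)"
proof -
  assume x: "x \<in> carrier R"
  have "trunc n x = (\<Oplus>\<^bsub>A\<^esub>i\<in>{..<n}. if i < n then co x i else \<zero>\<^bsub>A\<^esub>)"
    unfolding trunc_def using x by (intro M.finsum_cong') auto
  then show ?thesis
    using comp_unique[of "{..<n}" "\<lambda>i. if i < n then co x i else \<zero>\<^bsub>A\<^esub>"] x by simp
qed

lemma trunc_diff: "x \<in> carrier R \<Longrightarrow> x \<ominus>\<^bsub>R\<^esub> emb (trunc n x) \<in> fl n"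
  by (auto simp: fl_def comp_trunc M.minus_eq_zero_iff)

lemma leading_diff: "x \<in> fl n \<Longrightarrow> x \<ominus>\<^bsub>R\<^esub> emb (co x n) \<in> fl (Suc n)"
  by (auto simp: fl_def comp_homogeneous[of "co x n" n] M.minus_eq_zero_iff less_Suc_eq)

text \<open>In a fixed degree \<open>i\<close> only the terms with \<open>m + l <= i\<close>
  contribute, so the infinite sum is finite degree by degree.\<close>

lemma series_limit:
  assumes "\<And>l. r l \<in> fl (m + l)"
  shows "\<exists>s\<in>fl m. \<forall>n. s \<ominus>\<^bsub>R\<^esub> (\<Oplus>\<^bsub>R\<^esub>l\<in>{..<n}. r l) \<in> fl (m + n)"
proof -
  have rc: "r l \<in> carrier R" for l using assms fl_carrier by blast
  define s where "s = series (\<lambda>i. \<Oplus>\<^bsub>A\<^esub>l\<in>{..i}. co (r l) i)"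
  have g: "(\<Oplus>\<^bsub>A\<^esub>l\<in>{..i}. co (r l) i) \<in> gr i" for i
    using rc by (intro M.subgroup_finsum_closed[OF gr_subgroup]) auto
  have s: "s \<in> carrier R" "\<And>i. co s i = (\<Oplus>\<^bsub>A\<^esub>l\<in>{..i}. co (r l) i)"
    unfolding s_def using g by (auto intro: series_closed simp: co_series)
  have z: "co (r l) i = \<zero>\<^bsub>A\<^esub>" if "i < m + l" for i l
    using assms[of l] that by (auto simp: fl_def)
  have "s \<ominus>\<^bsub>R\<^esub> (\<Oplus>\<^bsub>R\<^esub>l\<in>{..<n}. r l) \<in> fl (m + n)" for n
  proof -
    have "co s i = co (\<Oplus>\<^bsub>R\<^esub>l\<in>{..<n}. r l) i" if i: "i < m + n" for i
    proof -
      \<comment> \<open>Terms with \<open>l > i\<close> vanish in degree \<open>i\<close>, and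
        \<open>i < m + n\<close> puts all surviving \<open>l\<close> below \<open>n\<close>; both
        ranges reduce to the same finite set.\<close>
      have "(\<Oplus>\<^bsub>A\<^esub>l\<in>{..i}. co (r l) i) = (\<Oplus>\<^bsub>A\<^esub>l\<in>{l. m + l \<le> i}. co (r l) i)"
        using z rc by (intro M.add.finprod_mono_neutral_cong_right) auto
      also have "\<dots> = (\<Oplus>\<^bsub>A\<^esub>l\<in>{..<n}. co (r l) i)"
        using z rc i by (intro M.add.finprod_mono_neutral_cong_left) auto
      also have "\<dots> = co (\<Oplus>\<^bsub>R\<^esub>l\<in>{..<n}. r l) i" using rc by (simp add: co_finsum)
      finally show ?thesis using s by simp
    qed
    then show ?thesis using s rc by (auto simp: fl_def M.minus_eq_zero_iff)
  qed
  moreover from this[of 0] s have "s \<in> fl m" by (simp add: fl_def)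
  ultimately show ?thesis by blast
qed

subsection \<open>The Euler derivation\<close>

definition der :: "'r \<Rightarrow> 'r" where "der x = series (\<lambda>i. [i] \<cdot>\<^bsub>A\<^esub> co x i)"

lemma der_closed [simp, intro]: "x \<in> carrier R \<Longrightarrow> der x \<in> carrier R"
  and co_der: "x \<in> carrier R \<Longrightarrow> co (der x) i = [i] \<cdot>\<^bsub>A\<^esub> co x i"
  unfolding der_def
  using M.additive_subgroup_add_pow[OF gr_subgroup] co_in_gr
  by (auto intro!: series_closed simp: co_series)

lemma der_add:
  "\<lbrakk>x \<in> carrier R; y \<in> carrier R\<rbrakk> \<Longrightarrow> der (x \<oplus>\<^bsub>R\<^esub> y) = der x \<oplus>\<^bsub>R\<^esub> der y"
  by (rule co_eqI) (auto simp: co_der M.add.nat_pow_distrib)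

text \<open>The Leibniz rule is \<open>n = (n - i) + i\<close> applied to the summand of the Cauchy
  product in bidegree \<open>(i, n - i)\<close>.\<close>

lemma der_mult:
  assumes "x \<in> carrier R" "y \<in> carrier R"
  shows "der (x \<otimes>\<^bsub>R\<^esub> y) = x \<otimes>\<^bsub>R\<^esub> der y \<oplus>\<^bsub>R\<^esub> der x \<otimes>\<^bsub>R\<^esub> y"
proof (rule co_eqI)
  fix n
  have "co (der (x \<otimes>\<^bsub>R\<^esub> y)) n = [n] \<cdot>\<^bsub>A\<^esub> (\<Oplus>\<^bsub>A\<^esub>i\<in>{..n}. co x i \<otimes>\<^bsub>A\<^esub> co y (n - i))"
    using assms by (simp add: co_der co_mult)
  also have "\<dots> = (\<Oplus>\<^bsub>A\<^esub>i\<in>{..n}. [n] \<cdot>\<^bsub>A\<^esub> (co x i \<otimes>\<^bsub>A\<^esub> co y (n - i)))"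
    using assms by (intro M.add_pow_finsum) auto
  also have "\<dots> = (\<Oplus>\<^bsub>A\<^esub>i\<in>{..n}. co x i \<otimes>\<^bsub>A\<^esub> co (der y) (n - i) \<oplus>\<^bsub>A\<^esub> co (der x) i \<otimes>\<^bsub>A\<^esub> co y (n - i))"
  proof (rule M.finsum_cong')
    fix i assume i: "i \<in> {..n}"
    let ?t = "co x i \<otimes>\<^bsub>A\<^esub> co y (n - i)"
    have t: "?t \<in> carrier A" using assms by auto
    have "co x i \<otimes>\<^bsub>A\<^esub> co (der y) (n - i) = [(n - i)] \<cdot>\<^bsub>A\<^esub> ?t"
      using assms by (simp add: co_der A.add_pow_rdistr)
    moreover have "co (der x) i \<otimes>\<^bsub>A\<^esub> co y (n - i) = [i] \<cdot>\<^bsub>A\<^esub> ?t"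
      using assms by (simp add: co_der A.add_pow_ldistr)
    moreover have "[(n - i)] \<cdot>\<^bsub>A\<^esub> ?t \<oplus>\<^bsub>A\<^esub> [i] \<cdot>\<^bsub>A\<^esub> ?t = [n] \<cdot>\<^bsub>A\<^esub> ?t"
      using M.add.nat_pow_mult[OF t, of "n - i" i] i by simp
    ultimately show "[n] \<cdot>\<^bsub>A\<^esub> ?t = co x i \<otimes>\<^bsub>A\<^esub> co (der y) (n - i) \<oplus>\<^bsub>A\<^esub> co (der x) i \<otimes>\<^bsub>A\<^esub> co y (n - i)"
      by simp
  qed (use assms in auto)
  also have "\<dots> = co (x \<otimes>\<^bsub>R\<^esub> der y \<oplus>\<^bsub>R\<^esub> der x \<otimes>\<^bsub>R\<^esub> y) n"
    using assms by (simp add: co_mult Pi_def)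
  finally show "co (der (x \<otimes>\<^bsub>R\<^esub> y)) n = co (x \<otimes>\<^bsub>R\<^esub> der y \<oplus>\<^bsub>R\<^esub> der x \<otimes>\<^bsub>R\<^esub> y) n" .
qed (use assms in auto)

lemma der_fl: "x \<in> fl n \<Longrightarrow> der x \<in> fl n"
  by (auto simp: fl_def co_der)

lemma co_add_pow: "x \<in> carrier R \<Longrightarrow> co ([(n::nat)] \<cdot>\<^bsub>R\<^esub> x) i = [n] \<cdot>\<^bsub>A\<^esub> co x i"
  by (induction n) auto

lemma der_emb: "a \<in> gr i \<Longrightarrow> der (emb a) = [i] \<cdot>\<^bsub>R\<^esub> emb a"
  by (rule co_eqI) (auto simp: co_der co_add_pow comp_homogeneous gr_carrier)

text \<open>The structure map of \<open>k\<close> into \<open>R\<close>. It is central and killed by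
  \<open>der\<close>, which makes \<open>D\<close> linear over \<open>k\<close>.\<close>

definition kap :: "'k \<Rightarrow> 'r" where "kap c = emb (c \<odot>\<^bsub>A\<^esub> \<one>\<^bsub>A\<^esub>)"

lemma kap_gr: "c \<in> carrier k \<Longrightarrow> c \<odot>\<^bsub>A\<^esub> \<one>\<^bsub>A\<^esub> \<in> gr 0"
  using gr_zero by auto

lemma kap_closed [simp, intro]: "c \<in> carrier k \<Longrightarrow> kap c \<in> carrier R"
  by (simp add: kap_def)

lemma der_kap: "c \<in> carrier k \<Longrightarrow> der (kap c) = \<zero>\<^bsub>R\<^esub>"
  unfolding kap_def by (subst der_emb[OF kap_gr]) auto

lemma kap_add: "\<lbrakk>c \<in> carrier k; d \<in> carrier k\<rbrakk> \<Longrightarrow> kap (c \<oplus>\<^bsub>k\<^esub> d) = kap c \<oplus>\<^bsub>R\<^esub> kap d"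
  by (simp add: kap_def smult_l_distr)

lemma kap_mult: "\<lbrakk>c \<in> carrier k; d \<in> carrier k\<rbrakk> \<Longrightarrow> kap (c \<otimes>\<^bsub>k\<^esub> d) = kap c \<otimes>\<^bsub>R\<^esub> kap d"
  by (simp add: kap_def emb_mult[symmetric] smult_assoc_l smult_assoc1 del: emb_mult)

lemma kap_minus:
  assumes "c \<in> carrier k" "d \<in> carrier k"
  shows "kap (c \<ominus>\<^bsub>k\<^esub> d) = kap c \<ominus>\<^bsub>R\<^esub> kap d"
proof -
  have "kap c = kap (c \<ominus>\<^bsub>k\<^esub> d) \<oplus>\<^bsub>R\<^esub> kap d"
    using assms kap_add[of "c \<ominus>\<^bsub>k\<^esub> d" d] R.minus_add_cancel[of c d] by simp
  then show ?thesis using assms S.add_minus_cancel_right[of "kap (c \<ominus>\<^bsub>k\<^esub> d)" "kap d"] by simp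
qed

lemma kap_one: "kap \<one>\<^bsub>k\<^esub> = \<one>\<^bsub>R\<^esub>"
  by (simp add: kap_def)

lemma kap_central:
  assumes "c \<in> carrier k" "x \<in> carrier R"
  shows "kap c \<otimes>\<^bsub>R\<^esub> x = x \<otimes>\<^bsub>R\<^esub> kap c"
proof (rule co_eqI)
  fix n
  have c: "c \<odot>\<^bsub>A\<^esub> \<one>\<^bsub>A\<^esub> \<in> gr 0" "c \<odot>\<^bsub>A\<^esub> \<one>\<^bsub>A\<^esub> \<in> carrier A" using assms kap_gr by auto
  have "co (kap c \<otimes>\<^bsub>R\<^esub> x) n = (c \<odot>\<^bsub>A\<^esub> \<one>\<^bsub>A\<^esub>) \<otimes>\<^bsub>A\<^esub> co x n"
    using assms c
    by (simp add: kap_def co_mult comp_homogeneous[OF c(1)])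
      (subst M.finsum_single[where i = 0], auto)
  also have "\<dots> = co x n \<otimes>\<^bsub>A\<^esub> (c \<odot>\<^bsub>A\<^esub> \<one>\<^bsub>A\<^esub>)"
    using assms by (simp add: smult_assoc_l smult_assoc_r)
  also have "\<dots> = co (x \<otimes>\<^bsub>R\<^esub> kap c) n"
    using assms c
    by (simp add: kap_def co_mult comp_homogeneous[OF c(1)])
      (subst M.finsum_single[where i = n], auto)
  finally show "co (kap c \<otimes>\<^bsub>R\<^esub> x) n = co (x \<otimes>\<^bsub>R\<^esub> kap c) n" .
qed (use assms in auto)

text \<open>Connectedness, \<open>A_0 = k\<close>, enters here: modulo \<open>fl 1\<close> every
  coefficient is a scalar, and this is what makes \<open>M / Fil 1\<close> finite-dimensional over
  \<open>k\<close>.\<close>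

lemma kap_approx: "x \<in> carrier R \<Longrightarrow> \<exists>c\<in>carrier k. x \<ominus>\<^bsub>R\<^esub> kap c \<in> fl 1"
proof -
  assume x: "x \<in> carrier R"
  then obtain c where c: "c \<in> carrier k" "co x 0 = c \<odot>\<^bsub>A\<^esub> \<one>\<^bsub>A\<^esub>" using co_in_gr[OF x, of 0] gr_zero by auto
  have "x \<ominus>\<^bsub>R\<^esub> kap c \<in> fl (Suc 0)"
    using leading_diff[of x 0] x c by (simp add: fl_0 kap_def)
  then show ?thesis using c by auto
qed

lemma kap_nat: "kap ([(n::nat)] \<cdot>\<^bsub>k\<^esub> \<one>\<^bsub>k\<^esub>) = [n] \<cdot>\<^bsub>R\<^esub> \<one>\<^bsub>R\<^esub>"
proof (induction n)
  case 0
  then show ?case by (simp add: kap_def)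
next
  case (Suc n)
  then show ?case using kap_add[of "[n] \<cdot>\<^bsub>k\<^esub> \<one>\<^bsub>k\<^esub>" "\<one>\<^bsub>k\<^esub>"] by (simp add: kap_one)
qed

end

section \<open>Finitely generated modules over the completion\<close>

locale completion_module = graded_completion k A gr R co + L: left_module R M
  for k :: "('k, 'x) ring_scheme" and A :: "('k, 'a, 'y) module_scheme" and gr :: "nat \<Rightarrow> 'a set"
    and R :: "('r, 'w) ring_scheme" and co :: "'r \<Rightarrow> nat \<Rightarrow> 'a" and M :: "('r, 'm, 'v) module_scheme"
begin

text \<open>The correction found at stage \<open>n\<close> has coefficients in \<open>fl n\<close>,
  so the coefficients of all stages add up to convergent series, and their combination differs from
  \<open>x\<close> by an element of every \<open>G n\<close>. The constant \<open>c\<close> allows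
  for a loss between the depth of \<open>x\<close> and that of its coefficients, and
  \<open>Z\<close> is whatever property the remainders keep. It is used with \<open>Z\<close> the
  closure of a left ideal, and with \<open>Z\<close> the whole module for a Nakayama
  argument.\<close>

lemma successive_approximation:
  assumes I: "finite I" "g \<in> I \<rightarrow> carrier M"
    and G: "\<And>n. additive_subgroup (G n) M" "\<And>m n. m \<le> n \<Longrightarrow> G n \<subseteq> G m" "\<And>x. (\<And>n. x \<in> G n) \<Longrightarrow> x = \<zero>\<^bsub>M\<^esub>"
    and gG: "\<And>i r n. \<lbrakk>i \<in> I; r \<in> fl n\<rbrakk> \<Longrightarrow> r \<odot>\<^bsub>M\<^esub> g i \<in> G n"
    and step: "\<And>n x. \<lbrakk>x \<in> Z; x \<in> G (c + n)\<rbrakk> \<Longrightarrow>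
      \<exists>r. (\<forall>i\<in>I. r i \<in> fl n) \<and> x \<ominus>\<^bsub>M\<^esub> L.lincomb r g I \<in> Z \<inter> G (c + Suc n)"
    and x: "x \<in> Z" "x \<in> G (c + m)"
  shows "\<exists>r. (\<forall>i\<in>I. r i \<in> fl m) \<and> x = L.lincomb r g I"
proof -
  \<comment> \<open>One choice for all \<open>n\<close> and all remainders, so that the remainders
    can be defined by recursion.\<close>
  define \<rho> where "\<rho> n x =
    (SOME r. (\<forall>i\<in>I. r i \<in> fl n) \<and> x \<ominus>\<^bsub>M\<^esub> L.lincomb r g I \<in> Z \<inter> G (c + Suc n))" for n x
  have \<rho>: "(\<forall>i\<in>I. \<rho> n x i \<in> fl n) \<and> x \<ominus>\<^bsub>M\<^esub> L.lincomb (\<rho> n x) g I \<in> Z \<inter> G (c + Suc n)"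
    if "x \<in> Z" "x \<in> G (c + n)" for n x
    unfolding \<rho>_def by (rule someI_ex[OF step[OF that]])
  define xs where "xs = rec_nat x (\<lambda>n y. y \<ominus>\<^bsub>M\<^esub> L.lincomb (\<rho> (m + n) y) g I)"
  have xs0: "xs 0 = x" and xsS: "xs (Suc n) = xs n \<ominus>\<^bsub>M\<^esub> L.lincomb (\<rho> (m + n) (xs n)) g I" for n
    by (auto simp: xs_def)
  have xs: "xs n \<in> Z \<inter> G (c + (m + n))" for n
  proof (induction n)
    case 0
    then show ?case using x by (simp add: xs0)
  next
    case (Suc n)
    then show ?case using \<rho>[of "xs n" "m + n"] by (simp add: xsS)
  qed
  define r where "r n = \<rho> (m + n) (xs n)" for n
  have r: "i \<in> I \<Longrightarrow> r n i \<in> fl (m + n)" for n i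
    using \<rho>[of "xs n" "m + n"] xs[of n] by (auto simp: r_def)
  then have rc: "i \<in> I \<Longrightarrow> r n i \<in> carrier R" for n i using fl_carrier by blast
  have Gc: "G n \<subseteq> carrier M" for n by (rule additive_subgroup.a_subset[OF G(1)])
  have xc: "x \<in> carrier M" using x Gc by blast
  have partial: "xs n = x \<ominus>\<^bsub>M\<^esub> L.lincomb (\<lambda>i. \<Oplus>\<^bsub>R\<^esub>l\<in>{..<n}. r l i) g I" for n
  proof (induction n)
    case 0
    have "x \<ominus>\<^bsub>M\<^esub> L.lincomb (\<lambda>i. \<Oplus>\<^bsub>R\<^esub>l\<in>{..<0}. r l i) g I = x" using I xc by (simp add: L.lincomb_zero)
    then show ?case by (simp add: xs0)
  next
    case (Suc n)
    let ?s = "\<lambda>i. \<Oplus>\<^bsub>R\<^esub>l\<in>{..<n}. r l i"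
    have s: "?s \<in> I \<rightarrow> carrier R" using rc by (auto intro!: S.finsum_closed)
    have rn: "r n \<in> I \<rightarrow> carrier R" using rc by auto
    have "L.lincomb (\<lambda>i. \<Oplus>\<^bsub>R\<^esub>l\<in>{..<Suc n}. r l i) g I = L.lincomb (\<lambda>i. r n i \<oplus>\<^bsub>R\<^esub> ?s i) g I"
      using rc I s by (intro L.lincomb_cong) (auto simp: lessThan_Suc S.finsum_insert Pi_def)
    also have "\<dots> = L.lincomb (r n) g I \<oplus>\<^bsub>M\<^esub> L.lincomb ?s g I"
      by (rule L.lincomb_add[OF rn s I(2)])
    finally have "x \<ominus>\<^bsub>M\<^esub> L.lincomb (\<lambda>i. \<Oplus>\<^bsub>R\<^esub>l\<in>{..<Suc n}. r l i) g I
        = (x \<ominus>\<^bsub>M\<^esub> L.lincomb ?s g I) \<ominus>\<^bsub>M\<^esub> L.lincomb (r n) g I"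
      using xc L.lincomb_closed[OF rn I(2)] L.lincomb_closed[OF s I(2)]
      by (simp add: a_minus_def L.M.minus_add L.M.a_ac)
    then show ?case using Suc by (simp add: xsS r_def)
  qed
  have "\<forall>i\<in>I. \<exists>s\<in>fl m. \<forall>n. s \<ominus>\<^bsub>R\<^esub> (\<Oplus>\<^bsub>R\<^esub>l\<in>{..<n}. r l i) \<in> fl (m + n)"
    using series_limit[of "\<lambda>l. r l i" m for i] r by blast
  then obtain s where s: "\<And>i. i \<in> I \<Longrightarrow> s i \<in> fl m"
    "\<And>i n. i \<in> I \<Longrightarrow> s i \<ominus>\<^bsub>R\<^esub> (\<Oplus>\<^bsub>R\<^esub>l\<in>{..<n}. r l i) \<in> fl (m + n)" by metis
  have sc: "s \<in> I \<rightarrow> carrier R" using s(1) fl_carrier by blast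
  \<comment> \<open>The offset \<open>c\<close> is dropped here: the remainder \<open>xs n\<close>
    lies deeper, but the tails of the coefficients are only known to be in
    \<open>fl (m + n)\<close>.\<close>
  have "x \<ominus>\<^bsub>M\<^esub> L.lincomb s g I \<in> G (m + n)" for n
  proof -
    let ?s = "\<lambda>i. \<Oplus>\<^bsub>R\<^esub>l\<in>{..<n}. r l i"
    have s': "?s \<in> I \<rightarrow> carrier R" using rc by (auto intro!: S.finsum_closed)
    have "L.lincomb s g I \<ominus>\<^bsub>M\<^esub> L.lincomb ?s g I = L.lincomb (\<lambda>i. s i \<ominus>\<^bsub>R\<^esub> ?s i) g I"
      using sc s' I by (simp add: L.lincomb_minus)
    also have "\<dots> \<in> G (m + n)"
      unfolding L.lincomb_def using gG s by (intro L.M.subgroup_finsum_closed[OF G(1)]) auto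
    finally have A: "L.M.congr (G (m + n)) (L.lincomb s g I) (L.lincomb ?s g I)"
      using sc s' I by (simp add: L.M.congr_def)
    have "x \<ominus>\<^bsub>M\<^esub> L.lincomb ?s g I \<in> G (m + n)"
      using xs[of n] G(2)[of "m + n" "c + (m + n)"] by (auto simp: partial)
    then have B: "L.M.congr (G (m + n)) x (L.lincomb ?s g I)"
      using xc s' I by (simp add: L.M.congr_def)
    show ?thesis using L.M.congr_trans[OF G(1) B L.M.congr_sym[OF G(1) A]] by (simp add: L.M.congr_def)
  qed
  then have "x \<ominus>\<^bsub>M\<^esub> L.lincomb s g I \<in> G n" for n
    using G(2)[of n "m + n"] by auto
  then have "x = L.lincomb s g I"
    using G(3) L.M.minus_eq_zero_iff[OF xc L.lincomb_closed[OF sc I(2)]] by blast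
  then show ?thesis using s by blast
qed

text \<open>For generators of \<open>M\<close> this is \<open>R_{>=n} M\<close>. It is formed for
  arbitrary families because the proof of separatedness removes the generators one at a
  time.\<close>

definition fil :: "('i \<Rightarrow> 'm) \<Rightarrow> 'i set \<Rightarrow> nat \<Rightarrow> 'm set"
  where "fil g I n = {L.lincomb r g I | r. \<forall>i\<in>I. r i \<in> fl n}"

lemma filI: "(\<And>i. i \<in> I \<Longrightarrow> r i \<in> fl n) \<Longrightarrow> L.lincomb r g I \<in> fil g I n"
  unfolding fil_def by (rule CollectI, rule exI[of _ r], rule conjI[OF refl], rule ballI)

lemma fil_subgroup:
  assumes "g \<in> I \<rightarrow> carrier M"
  shows "additive_subgroup (fil g I n) M"
proof (rule L.M.additive_subgroup_by_minus)
  show "fil g I n \<subseteq> carrier M"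
  proof
    fix x assume "x \<in> fil g I n"
    then obtain r where r: "x = L.lincomb r g I" "\<forall>i\<in>I. r i \<in> fl n" by (auto simp: fil_def)
    then have "r \<in> I \<rightarrow> carrier R" using fl_carrier by auto
    then show "x \<in> carrier M" unfolding r(1) using assms by (rule L.lincomb_closed)
  qed
  have "L.lincomb (\<lambda>i. \<zero>\<^bsub>R\<^esub>) g I \<in> fil g I n" by (rule filI) (auto simp: fl_def)
  then show "\<zero>\<^bsub>M\<^esub> \<in> fil g I n" using assms by (simp add: L.lincomb_zero)
  fix x y assume "x \<in> fil g I n" "y \<in> fil g I n"
  then obtain r s where rs: "x = L.lincomb r g I" "y = L.lincomb s g I"
    "\<forall>i\<in>I. r i \<in> fl n" "\<forall>i\<in>I. s i \<in> fl n" by (auto simp: fil_def)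
  then have "r \<in> I \<rightarrow> carrier R" "s \<in> I \<rightarrow> carrier R" using fl_carrier by auto
  then have "x \<ominus>\<^bsub>M\<^esub> y = L.lincomb (\<lambda>i. r i \<ominus>\<^bsub>R\<^esub> s i) g I" using rs assms by (simp add: L.lincomb_minus)
  also have "\<dots> \<in> fil g I n" using rs S.subgroup_minus_closed[OF fl_subgroup] by (intro filI) auto
  finally show "x \<ominus>\<^bsub>M\<^esub> y \<in> fil g I n" .
qed

lemma fil_antimono: "m \<le> n \<Longrightarrow> fil g I n \<subseteq> fil g I m"
  using fl_antimono unfolding fil_def by blast

lemma fil_smult:
  assumes "g \<in> I \<rightarrow> carrier M" "a \<in> fl p" "x \<in> fil g I n"
  shows "a \<odot>\<^bsub>M\<^esub> x \<in> fil g I (p + n)"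
proof -
  obtain r where r: "x = L.lincomb r g I" "\<forall>i\<in>I. r i \<in> fl n" using assms by (auto simp: fil_def)
  have "a \<odot>\<^bsub>M\<^esub> x = L.lincomb (\<lambda>i. a \<otimes>\<^bsub>R\<^esub> r i) g I"
    unfolding r(1) using assms r(2) fl_carrier by (intro L.smult_lincomb) auto
  also have "\<dots> \<in> fil g I (p + n)" using r(2) fl_mult[OF assms(2)] by (intro filI) auto
  finally show ?thesis .
qed

end

section \<open>Leading components and the Artin-Rees lemma for left ideals\<close>

context graded_completion
begin

lemma co_emb_mult:
  assumes "b \<in> gr p" "y \<in> carrier R"
  shows "co (emb b \<otimes>\<^bsub>R\<^esub> y) n = (if p \<le> n then b \<otimes>\<^bsub>A\<^esub> co y (n - p) else \<zero>\<^bsub>A\<^esub>)"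
proof -
  have b: "b \<in> carrier A" using assms gr_carrier by blast
  have *: "co (emb b \<otimes>\<^bsub>R\<^esub> y) n = (\<Oplus>\<^bsub>A\<^esub>i\<in>{..n}. (if i = p then b else \<zero>\<^bsub>A\<^esub>) \<otimes>\<^bsub>A\<^esub> co y (n - i))"
    using assms b by (simp add: co_mult comp_homogeneous[OF assms(1)])
  show ?thesis
  proof (cases "p \<le> n")
    case True
    then show ?thesis unfolding * using assms b by (subst M.finsum_single[where i = p]) auto
  next
    case False
    then show ?thesis unfolding * using assms b by (auto intro!: M.add.finprod_one_eqI)
  qed
qed

text \<open>An Artin--Rees lemma for left ideals, and at the same time their closedness: the leading
  components of the elements of \<open>L\<close> generate a left ideal of \<open>A\<close>, which is finitely generated.\<close>

lemma left_ideal_artin_rees: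
  assumes noeth: "left_noetherian A" and L: "submodule L R (regular_module R)"
  obtains I :: "'a set" and g c where "finite I" "g \<in> I \<rightarrow> L"
    "\<forall>n x. x \<in> fl (c + n) \<longrightarrow> (\<forall>m. \<exists>y\<in>L. x \<ominus>\<^bsub>R\<^esub> y \<in> fl m) \<longrightarrow>
      (\<exists>r. (\<forall>i\<in>I. r i \<in> fl n) \<and> x = (\<Oplus>\<^bsub>R\<^esub>i\<in>I. r i \<otimes>\<^bsub>R\<^esub> g i))"
proof -
  interpret RM: left_module R "regular_module R" by (rule S.regular_left_module)
  interpret AM: left_module A "regular_module A" by (rule A.regular_left_module)
  interpret completion_module k A gr R co "regular_module R" by unfold_locales
  have reg [simp]: "carrier (regular_module R) = carrier R" "smult (regular_module R) = monoid.mult R"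
    "ring.add (regular_module R) = ring.add R" "ring.zero (regular_module R) = ring.zero R"
    "carrier (regular_module A) = carrier A" "smult (regular_module A) = monoid.mult A"
    "ring.add (regular_module A) = ring.add A" "ring.zero (regular_module A) = ring.zero A"
    by (auto simp: regular_module_def)
  have inv: "a_inv (regular_module R) = a_inv R" "a_minus (regular_module R) = a_minus R"
    "finsum (regular_module R) = finsum R" "finsum (regular_module A) = finsum A"
    by (auto simp: regular_module_def a_inv_def a_minus_def finsum_def fun_eq_iff
        m_inv_def finprod_def)
  have Lsub: "additive_subgroup L R"
    using RM.submodule_imp_additive[OF L] by (simp add: additive_subgroup_regular_module_iff)
  have Lc: "L \<subseteq> carrier R" by (rule additive_subgroup.a_subset[OF Lsub])
  \<comment> \<open>Here \<open>d\<close> is only a lower bound for the order of \<open>y\<close>,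
    so zero counts as a leading component and vanishing needs no separate case.\<close>
  define \<Lambda> where "\<Lambda> = {co y d | y d. y \<in> L \<and> y \<in> fl d}"
  have \<Lambda>c: "\<Lambda> \<subseteq> carrier A" using Lc by (auto simp: \<Lambda>_def)
  let ?gen = "submodule_generated A (regular_module A)"
  have "submodule (?gen \<Lambda>) A (regular_module A)"
    using \<Lambda>c by (intro AM.submodule_generated_is_submodule) simp
  then obtain S where S: "finite S" "S \<subseteq> carrier A" "?gen \<Lambda> = ?gen S"
    using noeth by (auto simp: left_noetherian_def)
  \<comment> \<open>The generators given by noetherianity need not be leading components themselves;
    each is expressed through finitely many that are.\<close>
  have "\<forall>s\<in>S. \<exists>T. finite T \<and> T \<subseteq> \<Lambda> \<and> s \<in> ?gen T"
    using AM.submodule_generated_finite_subset[of \<Lambda>] AM.submodule_generated_superset[of S] S(3) \<Lambda>c by auto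
  then obtain \<tau> where \<tau>: "\<And>s. s \<in> S \<Longrightarrow> finite (\<tau> s) \<and> \<tau> s \<subseteq> \<Lambda> \<and> s \<in> ?gen (\<tau> s)" by metis
  define I where "I = (\<Union>s\<in>S. \<tau> s)"
  have I: "finite I" "I \<subseteq> \<Lambda>" using \<tau> S(1) by (auto simp: I_def)
  have Ic: "I \<subseteq> carrier A" using I \<Lambda>c by blast
  have genI: "submodule (?gen I) A (regular_module A)"
    using Ic by (intro AM.submodule_generated_is_submodule) simp
  have "S \<subseteq> ?gen I"
  proof
    fix s assume s: "s \<in> S"
    then have "?gen (\<tau> s) \<subseteq> ?gen I"
      using AM.submodule_generated_superset[of I]
      by (intro AM.submodule_generated_least[OF genI]) (auto simp: I_def)
    then show "s \<in> ?gen I" using \<tau> s by blast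
  qed
  then have \<Lambda>_gen: "\<Lambda> \<subseteq> ?gen I"
    using AM.submodule_generated_least[OF genI] S(3) AM.submodule_generated_superset[of \<Lambda>] by blast
  have "\<forall>t\<in>I. \<exists>y d. t = co y d \<and> y \<in> L \<and> y \<in> fl d" using I by (auto simp: \<Lambda>_def)
  then obtain g d where gd: "\<And>t. t \<in> I \<Longrightarrow> t = co (g t) (d t) \<and> g t \<in> L \<and> g t \<in> fl (d t)" by metis
  \<comment> \<open>A bound for the degrees of the chosen leading components; a sum in place of a
    maximum also covers the empty set.\<close>
  define c where "c = sum d I"
  have dc: "t \<in> I \<Longrightarrow> d t \<le> c" for t unfolding c_def using I(1) by (intro member_le_sum) auto
  have gI: "g \<in> I \<rightarrow> L" "g \<in> I \<rightarrow> carrier (regular_module R)" using gd Lc by auto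
  \<comment> \<open>The closure of \<open>L\<close> for the filtration \<open>fl\<close>.\<close>
  define Z where "Z = {x \<in> carrier R. \<forall>m. \<exists>y\<in>L. x \<ominus>\<^bsub>R\<^esub> y \<in> fl m}"
  have step: "\<exists>r. (\<forall>i\<in>I. r i \<in> fl n) \<and> x \<ominus>\<^bsub>R\<^esub> RM.lincomb r g I \<in> Z \<inter> fl (c + Suc n)"
    if x: "x \<in> Z" "x \<in> fl (c + n)" for n x
  proof -
    let ?N = "c + n"
    have xc: "x \<in> carrier R" using x by (simp add: Z_def)
    \<comment> \<open>This \<open>y\<close> agrees with \<open>x\<close> through degree
      \<open>?N\<close>. The component of \<open>x\<close> in that degree is therefore a leading
      component of \<open>L\<close>, although \<open>x\<close> is only in the closure.\<close>
    obtain y where y: "y \<in> L" "x \<ominus>\<^bsub>R\<^esub> y \<in> fl (Suc ?N)" using x by (auto simp: Z_def)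
    have yc: "y \<in> carrier R" using y Lc by blast
    have coy: "co y i = co x i" if "i \<le> ?N" for i
      using y(2) that xc yc by (auto simp: fl_def M.minus_eq_zero_iff less_Suc_eq_le)
    then have "y \<in> fl ?N" using x(2) yc by (auto simp: fl_def)
    then have "co x ?N \<in> \<Lambda>" using coy[of ?N] y(1) by (auto simp: \<Lambda>_def) metis
    then have "co x ?N \<in> ?gen (id ` I)" using \<Lambda>_gen by auto
    moreover have "id \<in> I \<rightarrow> carrier (regular_module A)" using Ic by auto
    ultimately obtain \<alpha> where \<alpha>: "\<alpha> \<in> I \<rightarrow> carrier A" "co x ?N = AM.lincomb \<alpha> id I"
      using AM.submodule_generated_finite[of I id] I(1) by auto
    \<comment> \<open>Since \<open>g t\<close> begins with \<open>t\<close> in degree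
      \<open>d t\<close>, the part of \<open>\<alpha> t\<close> that matters in degree
      \<open>?N\<close> is the one of degree \<open>?N - d t\<close>. Keeping only that part puts
      the product in \<open>fl ?N\<close>, and \<open>d t <= c\<close> puts the coefficient in
      \<open>fl n\<close>.\<close>
    define r where "r t = emb (comp (\<alpha> t) (?N - d t))" for t
    have \<alpha>c: "t \<in> I \<Longrightarrow> \<alpha> t \<in> carrier A" for t using \<alpha> by auto
    have gr_t: "t \<in> I \<Longrightarrow> t \<in> gr (d t)" for t using gd Lc co_in_gr by (metis subsetD)
    have r_fl: "t \<in> I \<Longrightarrow> r t \<in> fl (?N - d t)" for t
      unfolding r_def using \<alpha>c by (intro emb_gr_in_fl) auto
    then have r: "\<forall>t\<in>I. r t \<in> fl n" using dc fl_antimono by (metis Nat.le_diff_conv2 add.commute add_le_mono1 in_mono le_add1 order_trans)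
    have rc: "t \<in> I \<Longrightarrow> r t \<in> carrier R" for t using r_fl fl_carrier by blast
    have gc: "t \<in> I \<Longrightarrow> g t \<in> carrier R" for t using gI by auto
    let ?l = "RM.lincomb r g I"
    have l: "?l = (\<Oplus>\<^bsub>R\<^esub>t\<in>I. r t \<otimes>\<^bsub>R\<^esub> g t)" by (simp add: RM.lincomb_def inv)
    have lL: "?l \<in> L" using rc gI by (intro RM.submodule_lincomb[OF L]) auto
    have "r t \<otimes>\<^bsub>R\<^esub> g t \<in> fl ?N" if "t \<in> I" for t
      using fl_mult[OF r_fl[OF that], of "g t" "d t"] gd[OF that] dc[OF that] by simp
    then have lfl: "?l \<in> fl ?N" unfolding l by (intro S.subgroup_finsum_closed[OF fl_subgroup])
    have "co ?l ?N = (\<Oplus>\<^bsub>A\<^esub>t\<in>I. co (r t \<otimes>\<^bsub>R\<^esub> g t) ?N)"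
      unfolding l using rc gc by (intro co_finsum) auto
    also have "\<dots> = (\<Oplus>\<^bsub>A\<^esub>t\<in>I. comp (\<alpha> t) (?N - d t) \<otimes>\<^bsub>A\<^esub> t)"
    proof (rule M.finsum_cong')
      fix t assume t: "t \<in> I"
      have "?N - (?N - d t) = d t" using dc[OF t] by simp
      then show "co (r t \<otimes>\<^bsub>R\<^esub> g t) ?N = comp (\<alpha> t) (?N - d t) \<otimes>\<^bsub>A\<^esub> t"
        unfolding r_def using co_emb_mult[OF comp_in_gr[OF \<alpha>c[OF t]] gc[OF t], of "?N - d t" ?N] gd[OF t]
        by simp
    qed (use \<alpha>c Ic in auto)
    also have "\<dots> = (\<Oplus>\<^bsub>A\<^esub>t\<in>I. comp (\<alpha> t \<otimes>\<^bsub>A\<^esub> t) ?N)"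
    proof (rule M.finsum_cong')
      fix t assume t: "t \<in> I"
      show "comp (\<alpha> t) (?N - d t) \<otimes>\<^bsub>A\<^esub> t = comp (\<alpha> t \<otimes>\<^bsub>A\<^esub> t) ?N"
        using dc[OF t] comp_mult_homogeneous_right[OF \<alpha>c[OF t] gr_t[OF t], of ?N] by simp
    qed (use \<alpha>c Ic in auto)
    also have "\<dots> = comp (\<Oplus>\<^bsub>A\<^esub>t\<in>I. \<alpha> t \<otimes>\<^bsub>A\<^esub> t) ?N"
      using \<alpha>c Ic by (intro comp_finsum[symmetric]) auto
    also have "(\<Oplus>\<^bsub>A\<^esub>t\<in>I. \<alpha> t \<otimes>\<^bsub>A\<^esub> t) = co x ?N" unfolding \<alpha>(2) by (simp add: AM.lincomb_def inv)
    also have "comp (co x ?N) ?N = co x ?N" using comp_homogeneous[OF co_in_gr[OF xc]] by simp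
    finally have "co (x \<ominus>\<^bsub>R\<^esub> ?l) ?N = \<zero>\<^bsub>A\<^esub>"
      using xc lL Lc by (auto simp: M.minus_eq_zero_iff)
    moreover have "x \<ominus>\<^bsub>R\<^esub> ?l \<in> fl ?N" using S.subgroup_minus_closed[OF fl_subgroup x(2) lfl] .
    ultimately have "x \<ominus>\<^bsub>R\<^esub> ?l \<in> fl (c + Suc n)" by (auto simp: fl_def less_Suc_eq)
    moreover have "x \<ominus>\<^bsub>R\<^esub> ?l \<in> Z"
    proof -
      have "\<exists>y\<in>L. (x \<ominus>\<^bsub>R\<^esub> ?l) \<ominus>\<^bsub>R\<^esub> y \<in> fl m" for m
      proof -
        obtain y where y: "y \<in> L" "x \<ominus>\<^bsub>R\<^esub> y \<in> fl m" using x by (auto simp: Z_def)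
        have c: "y \<in> carrier R" "?l \<in> carrier R" using y lL Lc by auto
        then have "(x \<ominus>\<^bsub>R\<^esub> ?l) \<ominus>\<^bsub>R\<^esub> (y \<ominus>\<^bsub>R\<^esub> ?l) = x \<ominus>\<^bsub>R\<^esub> y"
          using xc by (simp add: a_minus_def S.minus_add S.a_ac S.r_neg S.r_neg2 S.r_neg1)
        then show ?thesis using y lL S.subgroup_minus_closed[OF Lsub] by metis
      qed
      then show ?thesis using xc lL Lc by (auto simp: Z_def)
    qed
    ultimately show ?thesis using r by blast
  qed
  have main: "\<exists>r. (\<forall>i\<in>I. r i \<in> fl n) \<and> x = RM.lincomb r g I"
    if "x \<in> Z" "x \<in> fl (c + n)" for n x
  proof (rule successive_approximation[where G = fl and Z = Z and c = c])
    show "additive_subgroup (fl n) (regular_module R)" for n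
      using fl_subgroup[of n] by (simp add: additive_subgroup_regular_module_iff)
    show "x = \<zero>\<^bsub>regular_module R\<^esub>" if "\<And>n. x \<in> fl n" for x using fl_Inter that by simp
    show "r \<odot>\<^bsub>regular_module R\<^esub> g i \<in> fl n" if "i \<in> I" "r \<in> fl n" for i r n
      using that gI(2) fl_mult_right[of r n "g i"] by (auto simp: Pi_def)
    show "\<exists>r. (\<forall>i\<in>I. r i \<in> fl n) \<and> x \<ominus>\<^bsub>regular_module R\<^esub> RM.lincomb r g I \<in> Z \<inter> fl (c + Suc n)"
      if "x \<in> Z" "x \<in> fl (c + n)" for n x
      using step[OF that] by (simp add: inv)
  qed (use that I gI fl_antimono in auto)
  show thesis
  proof (rule that[OF I(1) gI(1)])
    show "\<forall>n x. x \<in> fl (c + n) \<longrightarrow> (\<forall>m. \<exists>y\<in>L. x \<ominus>\<^bsub>R\<^esub> y \<in> fl m) \<longrightarrow>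
        (\<exists>r. (\<forall>i\<in>I. r i \<in> fl n) \<and> x = (\<Oplus>\<^bsub>R\<^esub>i\<in>I. r i \<otimes>\<^bsub>R\<^esub> g i))"
    proof (intro allI impI)
      fix n x assume "x \<in> fl (c + n)" "\<forall>m. \<exists>y\<in>L. x \<ominus>\<^bsub>R\<^esub> y \<in> fl m"
      then show "\<exists>r. (\<forall>i\<in>I. r i \<in> fl n) \<and> x = (\<Oplus>\<^bsub>R\<^esub>i\<in>I. r i \<otimes>\<^bsub>R\<^esub> g i)"
        using main[of x n] fl_carrier by (auto simp: Z_def RM.lincomb_def inv)
    qed
  qed
qed

end

section \<open>Separatedness and completeness of the filtration\<close>

context completion_module
begin

text \<open>Krull's intersection argument by induction on the generators. Writing
  \<open>x = r_n g_j + u_n\<close> to every order \<open>n\<close>, the differences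
  \<open>r_n - r_m\<close> lie in the left ideal \<open>J\<close> of elements that carry
  \<open>g j\<close> into the span of the other generators. As \<open>r_m\<close> tends to zero,
  each \<open>r_n\<close> is in the closure of \<open>J\<close>, and Artin-Rees converts the
  smallness of \<open>r_n\<close> into smallness of its coefficients over \<open>J\<close>. Hence
  \<open>x\<close> lies arbitrarily deep in the span of the remaining generators.\<close>

lemma fil_separated:
  assumes noeth: "left_noetherian A" and "finite I" "g \<in> I \<rightarrow> carrier M" "\<And>n. x \<in> fil g I n"
  shows "x = \<zero>\<^bsub>M\<^esub>"
  using assms(2-4)
proof (induction I arbitrary: x rule: finite_induct)
  case empty
  then show ?case by (auto simp: fil_def L.lincomb_def)
next
  case (insert j I)
  have g: "g \<in> I \<rightarrow> carrier M" "g j \<in> carrier M" using insert.prems by auto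
  note fs = fil_subgroup[OF g(1)]
  define J where "J = {r \<in> carrier R. r \<odot>\<^bsub>M\<^esub> g j \<in> fil g I 0}"
  have J: "submodule J R (regular_module R)"
  proof -
    interpret RM: left_module R "regular_module R" by (rule S.regular_left_module)
    show ?thesis
    proof (rule RM.submodule_by_minus)
      have "additive_subgroup J R"
      proof (rule S.additive_subgroup_by_minus)
        show "J \<subseteq> carrier R" by (auto simp: J_def)
        show "\<zero>\<^bsub>R\<^esub> \<in> J" using g additive_subgroup.zero_closed[OF fs] by (simp add: J_def)
        show "r \<ominus>\<^bsub>R\<^esub> s \<in> J" if "r \<in> J" "s \<in> J" for r s
          using that g L.M.subgroup_minus_closed[OF fs] by (simp add: J_def L.smult_l_diff)
      qed
      then show "additive_subgroup J (regular_module R)" by (simp add: additive_subgroup_regular_module_iff)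
      show "a \<odot>\<^bsub>regular_module R\<^esub> r \<in> J" if "a \<in> carrier R" "r \<in> J" for a r
        using that g fil_smult[OF g(1), of a 0 "r \<odot>\<^bsub>M\<^esub> g j" 0]
        by (simp add: J_def regular_module_def L.smult_assoc1 fl_0)
    qed
  qed
  have "\<exists>r u. r \<in> fl n \<and> u \<in> fil g I n \<and> x = r \<odot>\<^bsub>M\<^esub> g j \<oplus>\<^bsub>M\<^esub> u" for n
  proof -
    obtain r where r: "x = L.lincomb r g (insert j I)" "\<forall>i\<in>insert j I. r i \<in> fl n"
      using insert.prems(2)[of n] by (auto simp: fil_def)
    then have "x = r j \<odot>\<^bsub>M\<^esub> g j \<oplus>\<^bsub>M\<^esub> L.lincomb r g I"
      using L.lincomb_insert[OF insert.hyps(1,2) _ insert.prems(1), of r] fl_carrier by auto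
    moreover have "L.lincomb r g I \<in> fil g I n" using r by (intro filI) auto
    ultimately show ?thesis using r by blast
  qed
  then obtain r u where ru: "\<And>n. r n \<in> fl n" "\<And>n. u n \<in> fil g I n" "\<And>n. x = r n \<odot>\<^bsub>M\<^esub> g j \<oplus>\<^bsub>M\<^esub> u n"
    by metis
  have rc: "r n \<in> carrier R" for n using ru fl_carrier by blast
  have uc: "u n \<in> carrier M" for n using ru(2) additive_subgroup.a_subset[OF fs] by blast
  have diff: "r n \<ominus>\<^bsub>R\<^esub> r m \<in> J" for n m
  proof -
    let ?a = "r n \<odot>\<^bsub>M\<^esub> g j" and ?b = "r m \<odot>\<^bsub>M\<^esub> g j"
    have "?a \<oplus>\<^bsub>M\<^esub> u n = ?b \<oplus>\<^bsub>M\<^esub> u m" using ru(3)[of n] ru(3)[of m] by simp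
    then have "?a \<ominus>\<^bsub>M\<^esub> ?b = u m \<ominus>\<^bsub>M\<^esub> u n"
      using rc uc g L.M.add_minus_add[of ?a "u n" ?b "u m"] L.M.minus_eq_zero_iff
      by (smt (verit) L.M.add.inv_solve_right' L.M.add.m_comm L.M.a_assoc L.M.minus_closed
          L.smult_closed a_minus_def L.M.a_inv_closed L.M.add.m_closed)
    moreover have "u m \<ominus>\<^bsub>M\<^esub> u n \<in> fil g I 0"
      using ru(2) fil_antimono[of 0 _ g I] L.M.subgroup_minus_closed[OF fs] by blast
    ultimately show ?thesis using rc g by (simp add: J_def L.smult_l_diff)
  qed
  obtain T :: "'a set" and h c where T: "finite T" "h \<in> T \<rightarrow> J"
    "\<forall>n x. x \<in> fl (c + n) \<longrightarrow> (\<forall>m. \<exists>y\<in>J. x \<ominus>\<^bsub>R\<^esub> y \<in> fl m) \<longrightarrow>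
      (\<exists>r. (\<forall>i\<in>T. r i \<in> fl n) \<and> x = (\<Oplus>\<^bsub>R\<^esub>i\<in>T. r i \<otimes>\<^bsub>R\<^esub> h i))"
    by (rule left_ideal_artin_rees[OF noeth J])
  have hJ: "i \<in> T \<Longrightarrow> h i \<in> carrier R" "i \<in> T \<Longrightarrow> h i \<odot>\<^bsub>M\<^esub> g j \<in> fil g I 0" for i
    using T(2) by (auto simp: J_def)
  have "x \<in> fil g I n" for n
  proof -
    let ?r = "r (c + n)"
    \<comment> \<open>The element of \<open>J\<close> that approximates \<open>?r\<close> to order
      \<open>m\<close> is \<open>?r - r m\<close>; the error is \<open>r m\<close> itself.\<close>
    have "\<exists>y\<in>J. ?r \<ominus>\<^bsub>R\<^esub> y \<in> fl m" for m
    proof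
      have "?r \<ominus>\<^bsub>R\<^esub> (?r \<ominus>\<^bsub>R\<^esub> r m) = r m"
        using rc S.add_minus_cancel_left[of ?r "r m"] S.minus_swap[of ?r "r m"] by (simp add: a_minus_def)
      then show "?r \<ominus>\<^bsub>R\<^esub> (?r \<ominus>\<^bsub>R\<^esub> r m) \<in> fl m" using ru(1) by simp
    qed (rule diff)
    then obtain a where a: "\<forall>i\<in>T. a i \<in> fl n" "?r = (\<Oplus>\<^bsub>R\<^esub>i\<in>T. a i \<otimes>\<^bsub>R\<^esub> h i)"
      using T(3) ru(1) by blast
    have ac: "i \<in> T \<Longrightarrow> a i \<in> carrier R" for i using a fl_carrier by blast
    have "?r \<odot>\<^bsub>M\<^esub> g j = (\<Oplus>\<^bsub>M\<^esub>i\<in>T. (a i \<otimes>\<^bsub>R\<^esub> h i) \<odot>\<^bsub>M\<^esub> g j)"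
      unfolding a(2) using ac hJ g by (intro L.finsum_smult) auto
    also have "\<dots> = (\<Oplus>\<^bsub>M\<^esub>i\<in>T. a i \<odot>\<^bsub>M\<^esub> (h i \<odot>\<^bsub>M\<^esub> g j))"
      using ac hJ g by (intro L.M.finsum_cong') (auto simp: L.smult_assoc1)
    also have "\<dots> \<in> fil g I n"
    proof (rule L.M.subgroup_finsum_closed[OF fs])
      fix i assume "i \<in> T"
      then show "a i \<odot>\<^bsub>M\<^esub> (h i \<odot>\<^bsub>M\<^esub> g j) \<in> fil g I n"
        using a(1) hJ fil_smult[OF g(1), of "a i" n "h i \<odot>\<^bsub>M\<^esub> g j" 0] by simp
    qed
    finally show ?thesis
      using ru(2,3)[of "c + n"] fil_antimono[of n "c + n" g I] additive_subgroup.a_closed[OF fs] by auto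
  qed
  then show ?case using insert.IH[OF g(1)] by blast
qed

text \<open>The differences of the Cauchy sequence have coefficients in \<open>fl n\<close>, and
  these can be summed in \<open>R\<close>: completeness is inherited coefficientwise.\<close>

lemma fil_complete:
  assumes I: "finite I" "g \<in> I \<rightarrow> carrier M" and x: "\<And>n. x n \<in> carrier M"
    and cauchy: "\<And>n. x (Suc n) \<ominus>\<^bsub>M\<^esub> x n \<in> fil g I n"
  shows "\<exists>y\<in>carrier M. \<forall>n. y \<ominus>\<^bsub>M\<^esub> x n \<in> fil g I n"
proof -
  have "\<exists>r. x (Suc n) \<ominus>\<^bsub>M\<^esub> x n = L.lincomb r g I \<and> (\<forall>i\<in>I. r i \<in> fl n)" for n
    using cauchy[of n] by (auto simp: fil_def)
  then obtain r where r: "\<And>n. x (Suc n) \<ominus>\<^bsub>M\<^esub> x n = L.lincomb (r n) g I" "\<And>n i. i \<in> I \<Longrightarrow> r n i \<in> fl n"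
    by metis
  have rc: "i \<in> I \<Longrightarrow> r n i \<in> carrier R" for i n using r(2) fl_carrier by blast
  have sc: "(\<lambda>i. \<Oplus>\<^bsub>R\<^esub>l\<in>{..<n}. r l i) \<in> I \<rightarrow> carrier R" for n using rc by (auto intro!: S.finsum_closed)
  have xn: "x n = x 0 \<oplus>\<^bsub>M\<^esub> L.lincomb (\<lambda>i. \<Oplus>\<^bsub>R\<^esub>l\<in>{..<n}. r l i) g I" for n
  proof (induction n)
    case 0
    then show ?case using I x[of 0] by (simp add: L.lincomb_zero)
  next
    case (Suc n)
    let ?s = "\<lambda>i. \<Oplus>\<^bsub>R\<^esub>l\<in>{..<n}. r l i"
    have rn: "r n \<in> I \<rightarrow> carrier R" using rc by auto
    have "L.lincomb (\<lambda>i. \<Oplus>\<^bsub>R\<^esub>l\<in>{..<Suc n}. r l i) g I = L.lincomb (\<lambda>i. ?s i \<oplus>\<^bsub>R\<^esub> r n i) g I"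
      using rc I sc[of n] by (intro L.lincomb_cong) (auto simp: lessThan_Suc S.finsum_insert Pi_def S.a_comm)
    also have "\<dots> = L.lincomb ?s g I \<oplus>\<^bsub>M\<^esub> L.lincomb (r n) g I"
      by (rule L.lincomb_add[OF sc rn I(2)])
    also have "x 0 \<oplus>\<^bsub>M\<^esub> \<dots> = x n \<oplus>\<^bsub>M\<^esub> L.lincomb (r n) g I"
      using Suc x L.lincomb_closed[OF sc I(2)] L.lincomb_closed[OF rn I(2)] by (simp add: L.M.a_assoc)
    also have "\<dots> = x (Suc n)"
      using r(1)[of n] L.M.add_minus_cancel_left[OF x x, of n "Suc n"] by simp
    finally show ?case by simp
  qed
  have "\<forall>i\<in>I. \<exists>s\<in>fl 0. \<forall>n. s \<ominus>\<^bsub>R\<^esub> (\<Oplus>\<^bsub>R\<^esub>l\<in>{..<n}. r l i) \<in> fl (0 + n)"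
    using series_limit[of "\<lambda>l. r l i" 0 for i] r(2) by simp
  then obtain s where s: "\<And>i. i \<in> I \<Longrightarrow> s i \<in> fl 0"
    "\<And>i n. i \<in> I \<Longrightarrow> s i \<ominus>\<^bsub>R\<^esub> (\<Oplus>\<^bsub>R\<^esub>l\<in>{..<n}. r l i) \<in> fl n" by (metis add_0)
  have ss: "s \<in> I \<rightarrow> carrier R" using s(1) fl_carrier by blast
  show ?thesis
  proof (intro bexI[of _ "x 0 \<oplus>\<^bsub>M\<^esub> L.lincomb s g I"] allI)
    fix n
    let ?s = "\<lambda>i. \<Oplus>\<^bsub>R\<^esub>l\<in>{..<n}. r l i"
    have "(x 0 \<oplus>\<^bsub>M\<^esub> L.lincomb s g I) \<ominus>\<^bsub>M\<^esub> (x 0 \<oplus>\<^bsub>M\<^esub> L.lincomb ?s g I)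
        = L.lincomb s g I \<ominus>\<^bsub>M\<^esub> L.lincomb ?s g I"
      using x[of 0] L.lincomb_closed[OF sc[of n] I(2)] L.lincomb_closed[OF ss I(2)]
      by (subst L.M.add_minus_add) (auto simp: L.M.minus_eq_zero_iff[THEN iffD2])
    also have "\<dots> = L.lincomb (\<lambda>i. s i \<ominus>\<^bsub>R\<^esub> ?s i) g I" using ss sc I by (simp add: L.lincomb_minus)
    also have "\<dots> \<in> fil g I n" using s(2) by (intro filI) auto
    finally show "(x 0 \<oplus>\<^bsub>M\<^esub> L.lincomb s g I) \<ominus>\<^bsub>M\<^esub> x n \<in> fil g I n" using xn[of n] by simp
  next
    show "x 0 \<oplus>\<^bsub>M\<^esub> L.lincomb s g I \<in> carrier M" using x L.lincomb_closed[OF ss I(2)] by simp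
  qed
qed

end

section \<open>The filtration of a finitely generated module by \<open>R_{>=n} M\<close>\<close>

locale fg_completion_module = completion_module k A gr R co M
  for k :: "('k, 'x) ring_scheme" and A :: "('k, 'a, 'y) module_scheme" and gr :: "nat \<Rightarrow> 'a set"
    and R :: "('r, 'w) ring_scheme" and co :: "'r \<Rightarrow> nat \<Rightarrow> 'a" and M :: "('r, 'm, 'v) module_scheme" +
  fixes Y :: "'m set"
  assumes noeth: "left_noetherian A"
    and Y: "finite Y" "Y \<subseteq> carrier M" "carrier M = {L.lincomb r id Y | r. r \<in> Y \<rightarrow> carrier R}"
begin

definition Fil :: "nat \<Rightarrow> 'm set" where "Fil = fil id Y"

lemma idY: "id \<in> Y \<rightarrow> carrier M" using Y(2) by auto

lemma Fil_subgroup: "additive_subgroup (Fil n) M"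
  unfolding Fil_def by (rule fil_subgroup[OF idY])

lemma Fil_carrier: "x \<in> Fil n \<Longrightarrow> x \<in> carrier M"
  using additive_subgroup.a_subset[OF Fil_subgroup] by blast

lemma Fil_0: "Fil 0 = carrier M"
  by (auto simp: Fil_def fil_def fl_0 Pi_def Y(3))

lemma Fil_antimono: "m \<le> n \<Longrightarrow> Fil n \<subseteq> Fil m"
  unfolding Fil_def by (rule fil_antimono)

lemma Fil_smult: "\<lbrakk>a \<in> fl p; x \<in> Fil n\<rbrakk> \<Longrightarrow> a \<odot>\<^bsub>M\<^esub> x \<in> Fil (p + n)"
  unfolding Fil_def by (rule fil_smult[OF idY])

lemma Fil_smult_left: "\<lbrakk>a \<in> carrier R; x \<in> Fil n\<rbrakk> \<Longrightarrow> a \<odot>\<^bsub>M\<^esub> x \<in> Fil n"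
  using Fil_smult[of a 0 x n] by (simp add: fl_0)

lemma Fil_smult_right: "\<lbrakk>a \<in> fl n; x \<in> carrier M\<rbrakk> \<Longrightarrow> a \<odot>\<^bsub>M\<^esub> x \<in> Fil n"
  using Fil_smult[of a n x 0] by (simp add: Fil_0)

lemma Fil_separated: "(\<And>n. x \<in> Fil n) \<Longrightarrow> x = \<zero>\<^bsub>M\<^esub>"
  unfolding Fil_def using fil_separated[OF noeth Y(1) idY] by blast

lemma Fil_complete:
  "\<lbrakk>\<And>n. x n \<in> carrier M; \<And>n. x (Suc n) \<ominus>\<^bsub>M\<^esub> x n \<in> Fil n\<rbrakk> \<Longrightarrow> \<exists>y\<in>carrier M. \<forall>n. y \<ominus>\<^bsub>M\<^esub> x n \<in> Fil n"
  unfolding Fil_def by (rule fil_complete[OF Y(1) idY])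

text \<open>An element of \<open>Fil n\<close> is a combination of \<open>Y\<close> with
  coefficients in \<open>fl n\<close>, and replacing each member of \<open>Y\<close> by its
  approximation modulo \<open>Fil 1\<close> costs only an element of \<open>Fil (n + 1)\<close>.
  Iterating this gives Nakayama's lemma with control of depth: deep elements have deep
  coefficients.\<close>

lemma Fil_generators:
  assumes I: "finite I" "g \<in> I \<rightarrow> carrier M"
    and gen: "\<And>x. x \<in> carrier M \<Longrightarrow> \<exists>r\<in>I \<rightarrow> carrier R. x \<ominus>\<^bsub>M\<^esub> L.lincomb r g I \<in> Fil 1"
    and x: "x \<in> Fil n"
  shows "\<exists>r. (\<forall>i\<in>I. r i \<in> fl n) \<and> x = L.lincomb r g I"
proof (rule successive_approximation[where G = Fil and Z = "carrier M" and c = 0, OF I Fil_subgroup])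
  show "r \<odot>\<^bsub>M\<^esub> g i \<in> Fil n" if "i \<in> I" "r \<in> fl n" for i r n
    using that I by (intro Fil_smult_right) auto
  fix n x assume x: "x \<in> carrier M" "x \<in> Fil (0 + n)"
  \<comment> \<open>The elements for which one step of the approximation succeeds. They form a
    subgroup, so it suffices to treat a single product of an element of \<open>fl n\<close> with a
    member of \<open>Y\<close>.\<close>
  define H where "H = {x \<in> carrier M. \<exists>r. (\<forall>i\<in>I. r i \<in> fl n) \<and> x \<ominus>\<^bsub>M\<^esub> L.lincomb r g I \<in> Fil (Suc n)}"
  have H: "additive_subgroup H M"
  proof (rule L.M.additive_subgroup_by_minus)
    show "H \<subseteq> carrier M" by (auto simp: H_def)
    have "\<zero>\<^bsub>M\<^esub> \<ominus>\<^bsub>M\<^esub> L.lincomb (\<lambda>_. \<zero>\<^bsub>R\<^esub>) g I \<in> Fil (Suc n)"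
      using I additive_subgroup.zero_closed[OF Fil_subgroup] by (simp add: L.lincomb_zero)
    then show "\<zero>\<^bsub>M\<^esub> \<in> H" by (auto simp: H_def intro!: exI[of _ "\<lambda>_. \<zero>\<^bsub>R\<^esub>"] simp: fl_def)
    fix x y assume "x \<in> H" "y \<in> H"
    then obtain r s where rs: "x \<in> carrier M" "y \<in> carrier M" "\<forall>i\<in>I. r i \<in> fl n" "\<forall>i\<in>I. s i \<in> fl n"
      "x \<ominus>\<^bsub>M\<^esub> L.lincomb r g I \<in> Fil (Suc n)" "y \<ominus>\<^bsub>M\<^esub> L.lincomb s g I \<in> Fil (Suc n)"
      by (auto simp: H_def)
    then have c: "r \<in> I \<rightarrow> carrier R" "s \<in> I \<rightarrow> carrier R" using fl_carrier by auto
    then have lc: "L.lincomb r g I \<in> carrier M" "L.lincomb s g I \<in> carrier M" using I by auto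
    have "L.M.congr (Fil (Suc n)) (x \<ominus>\<^bsub>M\<^esub> y) (L.lincomb r g I \<ominus>\<^bsub>M\<^esub> L.lincomb s g I)"
      using rs lc by (intro L.M.congr_minus[OF Fil_subgroup]) (auto simp: L.M.congr_def)
    then have "(x \<ominus>\<^bsub>M\<^esub> y) \<ominus>\<^bsub>M\<^esub> L.lincomb (\<lambda>i. r i \<ominus>\<^bsub>R\<^esub> s i) g I \<in> Fil (Suc n)"
      using c I by (simp add: L.lincomb_minus L.M.congr_def)
    moreover have "\<forall>i\<in>I. r i \<ominus>\<^bsub>R\<^esub> s i \<in> fl n" using rs S.subgroup_minus_closed[OF fl_subgroup] by blast
    ultimately show "x \<ominus>\<^bsub>M\<^esub> y \<in> H" using rs by (auto simp: H_def intro!: exI[of _ "\<lambda>i. r i \<ominus>\<^bsub>R\<^esub> s i"])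
  qed
  obtain a where a: "x = L.lincomb a id Y" "\<forall>y\<in>Y. a y \<in> fl n" using x by (auto simp: Fil_def fil_def)
  have "a y \<odot>\<^bsub>M\<^esub> id y \<in> H" if y: "y \<in> Y" for y
  proof -
    have yc: "y \<in> carrier M" using y Y(2) by blast
    then obtain r where r: "r \<in> I \<rightarrow> carrier R" "y \<ominus>\<^bsub>M\<^esub> L.lincomb r g I \<in> Fil 1" using gen by blast
    have ac: "a y \<in> carrier R" "a y \<in> fl n" using a y fl_carrier by auto
    have "a y \<odot>\<^bsub>M\<^esub> (y \<ominus>\<^bsub>M\<^esub> L.lincomb r g I) \<in> Fil (n + 1)" by (rule Fil_smult[OF ac(2) r(2)])
    moreover have "a y \<odot>\<^bsub>M\<^esub> (y \<ominus>\<^bsub>M\<^esub> L.lincomb r g I)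
        = a y \<odot>\<^bsub>M\<^esub> y \<ominus>\<^bsub>M\<^esub> L.lincomb (\<lambda>i. a y \<otimes>\<^bsub>R\<^esub> r i) g I"
      using ac yc r I by (simp add: L.smult_r_diff L.smult_lincomb)
    ultimately show ?thesis
      using ac r yc fl_mult_right[OF ac(2)] by (auto simp: H_def intro!: exI[of _ "\<lambda>i. a y \<otimes>\<^bsub>R\<^esub> r i"])
  qed
  then have "x \<in> H" unfolding a(1) L.lincomb_def by (intro L.M.subgroup_finsum_closed[OF H])
  then obtain r where r: "\<forall>i\<in>I. r i \<in> fl n" "x \<ominus>\<^bsub>M\<^esub> L.lincomb r g I \<in> Fil (Suc n)" by (auto simp: H_def)
  then show "\<exists>r. (\<forall>i\<in>I. r i \<in> fl n) \<and> x \<ominus>\<^bsub>M\<^esub> L.lincomb r g I \<in> carrier M \<inter> Fil (0 + Suc n)"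
    using Fil_carrier by auto
qed (use x Fil_carrier Fil_antimono Fil_separated in auto)

end

section \<open>Rigidity gives a connection along a derivation\<close>

context left_module
begin

lemma free_module_left_module: "left_module R (free_module R B)"
proof -
  have fin: "finite {x. f x \<oplus>\<^bsub>R\<^esub> g x \<noteq> \<zero>\<^bsub>R\<^esub>}" if "finite {x. f x \<noteq> \<zero>\<^bsub>R\<^esub>}" "finite {x. g x \<noteq> \<zero>\<^bsub>R\<^esub>}"
    for f g :: "'c \<Rightarrow> 'r"
    by (rule finite_subset[of _ "{x. f x \<noteq> \<zero>\<^bsub>R\<^esub>} \<union> {x. g x \<noteq> \<zero>\<^bsub>R\<^esub>}"]) (use that in auto)
  have fin': "finite {x. a \<otimes>\<^bsub>R\<^esub> f x \<noteq> \<zero>\<^bsub>R\<^esub>}" if "finite {x. f x \<noteq> \<zero>\<^bsub>R\<^esub>}" "a \<in> carrier R"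
    for f :: "'c \<Rightarrow> 'r" and a
    by (rule finite_subset[of _ "{x. f x \<noteq> \<zero>\<^bsub>R\<^esub>}"]) (use that in auto)
  have "abelian_group (free_module R B)"
  proof (rule abelian_groupI)
    fix f assume f: "f \<in> carrier (free_module R B)"
    have "finite {x. \<ominus>\<^bsub>R\<^esub> f x \<noteq> \<zero>\<^bsub>R\<^esub>}"
      by (rule finite_subset[of _ "{x. f x \<noteq> \<zero>\<^bsub>R\<^esub>}"]) (use f in \<open>auto simp: free_module_def R.a_inv_zero\<close>)
    then show "\<exists>g\<in>carrier (free_module R B). g \<oplus>\<^bsub>free_module R B\<^esub> f = \<zero>\<^bsub>free_module R B\<^esub>"
      using f by (intro bexI[of _ "\<lambda>x. \<ominus>\<^bsub>R\<^esub> f x"]) (auto simp: free_module_def R.l_neg R.a_inv_zero)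
  qed (auto simp: free_module_def fin R.a_ac fun_eq_iff)
  then show ?thesis
    by (intro left_module.intro left_module_axioms.intro R.ring_axioms)
      (auto simp: free_module_def fin' R.l_distr R.r_distr R.m_assoc fun_eq_iff)
qed

text \<open>The support varies with \<open>f\<close>; a common finite \<open>I\<close> makes
  elements of the free module comparable term by term.\<close>

lemma free_eval_eq_lincomb:
  assumes "f \<in> carrier (free_module R B)" "B \<subseteq> carrier M"
    and "finite I" "{x. f x \<noteq> \<zero>\<^bsub>R\<^esub>} \<subseteq> I" "I \<subseteq> B"
  shows "free_eval R M f = lincomb f id I"
  unfolding free_eval_def lincomb_def
  using assms by (intro M.add.finprod_mono_neutral_cong_left) (auto simp: free_module_def subset_iff)

lemma free_eval_hom:
  assumes B: "B \<subseteq> carrier M"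
  shows "free_eval R M \<in> left_hom R (free_module R B) M"
proof -
  let ?F = "free_module R B"
  have supp: "finite {x. f x \<noteq> \<zero>\<^bsub>R\<^esub>}" "{x. f x \<noteq> \<zero>\<^bsub>R\<^esub>} \<subseteq> B" "f \<in> I \<rightarrow> carrier R"
    if "f \<in> carrier ?F" for f I
    using that by (auto simp: free_module_def)
  have idB: "id \<in> I \<rightarrow> carrier M" if "I \<subseteq> B" for I using that B by auto
  interpret F: left_module R ?F by (rule free_module_left_module)
  have ev: "free_eval R M f \<in> carrier M" if "f \<in> carrier ?F" for f
    using free_eval_eq_lincomb[OF that B supp(1)[OF that] order_refl supp(2)[OF that]]
      lincomb_closed[OF supp(3)[OF that] idB[OF supp(2)[OF that]]] by simp
  have "free_eval R M (f \<oplus>\<^bsub>?F\<^esub> g) = free_eval R M f \<oplus>\<^bsub>M\<^esub> free_eval R M g"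
    if fg: "f \<in> carrier ?F" "g \<in> carrier ?F" for f g
  proof -
    let ?I = "{x. f x \<noteq> \<zero>\<^bsub>R\<^esub>} \<union> {x. g x \<noteq> \<zero>\<^bsub>R\<^esub>}"
    have I: "finite ?I" "?I \<subseteq> B" using supp fg by auto
    have "free_eval R M (f \<oplus>\<^bsub>?F\<^esub> g) = lincomb (f \<oplus>\<^bsub>?F\<^esub> g) id ?I"
      using F.M.a_closed[OF fg]
      by (rule free_eval_eq_lincomb[OF _ B I(1) _ I(2)]) (auto simp: free_module_def)
    also have "\<dots> = lincomb (\<lambda>x. f x \<oplus>\<^bsub>R\<^esub> g x) id ?I" by (simp add: free_module_def)
    also have "\<dots> = lincomb f id ?I \<oplus>\<^bsub>M\<^esub> lincomb g id ?I"
      by (rule lincomb_add[OF supp(3)[OF fg(1)] supp(3)[OF fg(2)] idB[OF I(2)]])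
    also have "lincomb f id ?I = free_eval R M f"
      using fg by (intro free_eval_eq_lincomb[OF _ B I(1) _ I(2), symmetric]) auto
    also have "lincomb g id ?I = free_eval R M g"
      using fg by (intro free_eval_eq_lincomb[OF _ B I(1) _ I(2), symmetric]) auto
    finally show ?thesis .
  qed
  moreover have "free_eval R M (a \<odot>\<^bsub>?F\<^esub> f) = a \<odot>\<^bsub>M\<^esub> free_eval R M f"
    if f: "f \<in> carrier ?F" and a: "a \<in> carrier R" for a f
  proof -
    let ?I = "{x. f x \<noteq> \<zero>\<^bsub>R\<^esub>}"
    have I: "finite ?I" "?I \<subseteq> B" using supp f by auto
    have "free_eval R M (a \<odot>\<^bsub>?F\<^esub> f) = lincomb (a \<odot>\<^bsub>?F\<^esub> f) id ?I"
      using F.smult_closed[OF a f]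
      by (rule free_eval_eq_lincomb[OF _ B I(1) _ I(2)]) (use a in \<open>auto simp: free_module_def\<close>)
    also have "\<dots> = lincomb (\<lambda>x. a \<otimes>\<^bsub>R\<^esub> f x) id ?I" by (simp add: free_module_def)
    also have "\<dots> = a \<odot>\<^bsub>M\<^esub> lincomb f id ?I"
      by (rule smult_lincomb[OF a supp(3)[OF f] idB[OF I(2)], symmetric])
    also have "lincomb f id ?I = free_eval R M f"
      using f by (intro free_eval_eq_lincomb[OF _ B I(1) _ I(2), symmetric]) auto
    finally show ?thesis .
  qed
  ultimately show ?thesis using ev by (auto simp: left_hom_def)
qed

definition basis_vector :: "'c \<Rightarrow> 'c \<Rightarrow> 'r"
  where "basis_vector x = (\<lambda>y. if y = x then \<one>\<^bsub>R\<^esub> else \<zero>\<^bsub>R\<^esub>)"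

lemma basis_vector_in: "x \<in> B \<Longrightarrow> basis_vector x \<in> carrier (free_module R B)"
  unfolding free_module_def basis_vector_def by (auto intro: finite_subset[of _ "{x}"])

lemma free_eval_basis_vector:
  assumes "x \<in> carrier M"
  shows "free_eval R M (basis_vector x) = x"
proof -
  have "free_eval R M (basis_vector x) = lincomb (basis_vector x) id {x}"
    using assms by (intro free_eval_eq_lincomb[of _ "carrier M"] basis_vector_in) (auto simp: basis_vector_def)
  also have "\<dots> = x" using assms by (simp add: lincomb_def basis_vector_def M.finsum_singleton[of _ "{x}"])
  finally show ?thesis .
qed

end

lemma left_hom_simps:
  assumes "left_module R M" "left_module R N" "f \<in> left_hom R M N"
  shows "x \<in> carrier M \<Longrightarrow> f x \<in> carrier N"
    and "\<lbrakk>x \<in> carrier M; y \<in> carrier M\<rbrakk> \<Longrightarrow> f (x \<oplus>\<^bsub>M\<^esub> y) = f x \<oplus>\<^bsub>N\<^esub> f y"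
    and "\<lbrakk>a \<in> carrier R; x \<in> carrier M\<rbrakk> \<Longrightarrow> f (a \<odot>\<^bsub>M\<^esub> x) = a \<odot>\<^bsub>N\<^esub> f x"
    and "f \<zero>\<^bsub>M\<^esub> = \<zero>\<^bsub>N\<^esub>"
    and "\<lbrakk>x \<in> carrier M; y \<in> carrier M\<rbrakk> \<Longrightarrow> f (x \<ominus>\<^bsub>M\<^esub> y) = f x \<ominus>\<^bsub>N\<^esub> f y"
proof -
  interpret M: left_module R M by fact
  interpret N: left_module R N by fact
  show c: "x \<in> carrier M \<Longrightarrow> f x \<in> carrier N" for x using assms(3) by (auto simp: left_hom_def)
  show a: "\<lbrakk>x \<in> carrier M; y \<in> carrier M\<rbrakk> \<Longrightarrow> f (x \<oplus>\<^bsub>M\<^esub> y) = f x \<oplus>\<^bsub>N\<^esub> f y" for x y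
    using assms(3) by (auto simp: left_hom_def)
  show s: "\<lbrakk>a \<in> carrier R; x \<in> carrier M\<rbrakk> \<Longrightarrow> f (a \<odot>\<^bsub>M\<^esub> x) = a \<odot>\<^bsub>N\<^esub> f x" for a x
    using assms(3) by (auto simp: left_hom_def)
  show z: "f \<zero>\<^bsub>M\<^esub> = \<zero>\<^bsub>N\<^esub>"
    using s[of "\<zero>\<^bsub>R\<^esub>" "\<zero>\<^bsub>M\<^esub>"] c[of "\<zero>\<^bsub>M\<^esub>"] by simp
  assume xy: "x \<in> carrier M" "y \<in> carrier M"
  then have "f (\<ominus>\<^bsub>M\<^esub> y) = \<ominus>\<^bsub>N\<^esub> f y"
    using s[of "\<ominus>\<^bsub>R\<^esub> \<one>\<^bsub>R\<^esub>" y] c[of y] by (simp add: M.smult_l_minus N.smult_l_minus)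
  then show "f (x \<ominus>\<^bsub>M\<^esub> y) = f x \<ominus>\<^bsub>N\<^esub> f y" using xy by (simp add: a_minus_def a)
qed

lemma left_hom_kernel:
  assumes "left_module R M" "left_module R N" "f \<in> left_hom R M N"
  shows "submodule {x \<in> carrier M. f x = \<zero>\<^bsub>N\<^esub>} R M"
proof -
  interpret M: left_module R M by fact
  interpret N: left_module R N by fact
  note f = left_hom_simps[OF assms]
  show ?thesis
  proof (rule M.submodule_by_minus[OF M.M.additive_subgroup_by_minus])
    show "x \<ominus>\<^bsub>M\<^esub> y \<in> {x \<in> carrier M. f x = \<zero>\<^bsub>N\<^esub>}"
      if "x \<in> {x \<in> carrier M. f x = \<zero>\<^bsub>N\<^esub>}" "y \<in> {x \<in> carrier M. f x = \<zero>\<^bsub>N\<^esub>}" for x y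
      using that by (simp add: f)
  qed (auto simp: f)
qed

text \<open>Applied with \<open>H\<close> the kernel of the preceding map, it says that consecutive
  maps of the resolution compose to zero.\<close>

lemma free_eval_in_submodule:
  assumes "left_module R M" "submodule H R M" "B \<subseteq> H" "f \<in> carrier (free_module R B)"
  shows "free_eval R M f \<in> H"
proof -
  interpret M: left_module R M by fact
  show ?thesis
    unfolding free_eval_def
  proof (rule M.M.subgroup_finsum_closed[OF M.submodule_imp_additive[OF assms(2)]])
    fix x assume "x \<in> {x. f x \<noteq> \<zero>\<^bsub>R\<^esub>}"
    then have "f x \<in> carrier R" "x \<in> B" using assms(4) by (auto simp: free_module_def)
    then show "f x \<odot>\<^bsub>M\<^esub> x \<in> H" using submodule.smult_closed[OF assms(2)] assms(3) by blast
  qed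
qed

text \<open>In a trivial quotient the coset of \<open>\<phi>\<close> is the group of coboundaries
  itself, and it contains \<open>\<phi>\<close> because the zero map is a coboundary.\<close>

lemma Ext1_trivial_cocycle:
  assumes M: "left_module R M" "left_module R N" and triv: "trivial_group (Ext1 R M N)"
    and \<phi>: "\<phi> \<in> Ext1_cocycles R M N"
  shows "\<phi> \<in> Ext1_coboundaries R M N"
proof -
  interpret N: left_module R N by fact
  let ?H = "(hom_group R (resolution1 R M) N)\<lparr>carrier := Ext1_cocycles R M N\<rparr>"
  let ?B = "Ext1_coboundaries R M N"
  have "?B #>\<^bsub>?H\<^esub> \<phi> \<in> carrier (Ext1 R M N)"
    using \<phi> by (auto simp: Ext1_def FactGroup_def RCOSETS_def)
  then have B: "?B #>\<^bsub>?H\<^esub> \<phi> = ?B"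
    using triv by (auto simp: trivial_group_def Ext1_def FactGroup_def)
  have z: "(\<lambda>x\<in>carrier (resolution0 R M). \<zero>\<^bsub>N\<^esub>) \<in> carrier (hom_group R (resolution0 R M) N)"
  proof -
    interpret M: left_module R M by fact
    interpret F: left_module R "resolution0 R M"
      unfolding resolution0_def by (rule M.free_module_left_module)
    show ?thesis by (auto simp: hom_group_def left_hom_def)
  qed
  have ev: "free_eval R (resolution0 R M) g \<in> carrier (resolution0 R M)" if "g \<in> carrier (resolution1 R M)" for g
  proof -
    interpret M: left_module R M by fact
    interpret F: left_module R "resolution0 R M"
      unfolding resolution0_def by (rule M.free_module_left_module)
    have sub: "submodule (carrier (resolution0 R M)) R (resolution0 R M)"
      by (intro F.submodule_by_minus F.M.additive_subgroup_carrier) auto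
    show ?thesis
      using that unfolding resolution1_def
      by (rule free_eval_in_submodule[OF F.left_module_axioms sub, rotated]) auto
  qed
  have "(\<lambda>g\<in>carrier (resolution1 R M). \<zero>\<^bsub>N\<^esub>) \<in> ?B"
    unfolding Ext1_coboundaries_def
    by (intro CollectI exI[of _ "\<lambda>x\<in>carrier (resolution0 R M). \<zero>\<^bsub>N\<^esub>"] conjI z)
      (auto simp: fun_eq_iff ev)
  moreover have "(\<lambda>g\<in>carrier (resolution1 R M). \<zero>\<^bsub>N\<^esub>) \<otimes>\<^bsub>?H\<^esub> \<phi> = \<phi>"
    using \<phi> by (auto simp: Ext1_cocycles_def hom_group_def left_hom_def extensional_def fun_eq_iff
        dest: funcset_mem)
  ultimately have "\<phi> \<in> ?B #>\<^bsub>?H\<^esub> \<phi>" by (force simp: r_coset_def)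
  then show ?thesis using B by simp
qed

text \<open>A derivation \<open>\<delta>\<close> of \<open>R\<close> acts on the coefficients of a free presentation of \<open>M\<close>; on the
  relations, the result is \<open>R\<close>-linear and a cocycle, and a connection on \<open>M\<close> is the correction
  which makes it a coboundary.\<close>

lemma connection_exists:
  assumes M: "left_module R M" and triv: "trivial_group (Ext1 R M M)"
    and \<delta>: "\<And>x. x \<in> carrier R \<Longrightarrow> \<delta> x \<in> carrier R"
      "\<And>x y. \<lbrakk>x \<in> carrier R; y \<in> carrier R\<rbrakk> \<Longrightarrow> \<delta> (x \<oplus>\<^bsub>R\<^esub> y) = \<delta> x \<oplus>\<^bsub>R\<^esub> \<delta> y"
      "\<And>x y. \<lbrakk>x \<in> carrier R; y \<in> carrier R\<rbrakk> \<Longrightarrow> \<delta> (x \<otimes>\<^bsub>R\<^esub> y) = x \<otimes>\<^bsub>R\<^esub> \<delta> y \<oplus>\<^bsub>R\<^esub> \<delta> x \<otimes>\<^bsub>R\<^esub> y"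
  obtains D where "\<And>x. x \<in> carrier M \<Longrightarrow> D x \<in> carrier M"
    "\<And>x y. \<lbrakk>x \<in> carrier M; y \<in> carrier M\<rbrakk> \<Longrightarrow> D (x \<oplus>\<^bsub>M\<^esub> y) = D x \<oplus>\<^bsub>M\<^esub> D y"
    "\<And>a x. \<lbrakk>a \<in> carrier R; x \<in> carrier M\<rbrakk> \<Longrightarrow> D (a \<odot>\<^bsub>M\<^esub> x) = a \<odot>\<^bsub>M\<^esub> D x \<oplus>\<^bsub>M\<^esub> \<delta> a \<odot>\<^bsub>M\<^esub> x"
proof -
  interpret M: left_module R M by fact
  define F0 where "F0 = resolution0 R M"
  define F1 where "F1 = resolution1 R M"
  define K where "K = {f \<in> carrier F0. free_eval R M f = \<zero>\<^bsub>M\<^esub>}"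
  interpret F0: left_module R F0 unfolding F0_def resolution0_def by (rule M.free_module_left_module)
  interpret F1: left_module R F1 unfolding F1_def resolution1_def by (rule M.free_module_left_module)
  have F1: "F1 = free_module R K" by (simp add: F1_def resolution1_def K_def F0_def)
  have F0: "F0 = free_module R (carrier M)" by (simp add: F0_def resolution0_def)
  have \<pi>: "free_eval R M \<in> left_hom R F0 M" unfolding F0 by (rule M.free_eval_hom) simp
  note \<pi>' = left_hom_simps[OF F0.left_module_axioms M \<pi>]
  have K: "submodule K R F0" unfolding K_def by (rule left_hom_kernel[OF F0.left_module_axioms M \<pi>])
  have KF: "K \<subseteq> carrier F0" by (auto simp: K_def)
  have ev: "free_eval R F0 \<in> left_hom R F1 F0" unfolding F1 by (rule F0.free_eval_hom[OF KF])
  note ev' = left_hom_simps[OF F1.left_module_axioms F0.left_module_axioms ev]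
  have ev_K: "free_eval R F0 g \<in> K" if "g \<in> carrier F1" for g
    using that unfolding F1 by (rule free_eval_in_submodule[OF F0.left_module_axioms K order_refl])
  have \<delta>0: "\<delta> \<zero>\<^bsub>R\<^esub> = \<zero>\<^bsub>R\<^esub>"
  proof -
    have "\<delta> \<zero>\<^bsub>R\<^esub> \<oplus>\<^bsub>R\<^esub> \<delta> \<zero>\<^bsub>R\<^esub> = \<delta> \<zero>\<^bsub>R\<^esub>" using \<delta>(2)[of "\<zero>\<^bsub>R\<^esub>" "\<zero>\<^bsub>R\<^esub>"] by simp
    then show ?thesis using \<delta>(1) by (metis M.R.add.r_cancel_one' M.R.zero_closed)
  qed
  have \<delta>1: "\<delta> \<one>\<^bsub>R\<^esub> = \<zero>\<^bsub>R\<^esub>"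
  proof -
    have "\<delta> \<one>\<^bsub>R\<^esub> \<oplus>\<^bsub>R\<^esub> \<delta> \<one>\<^bsub>R\<^esub> = \<delta> \<one>\<^bsub>R\<^esub>" using \<delta>(3)[of "\<one>\<^bsub>R\<^esub>" "\<one>\<^bsub>R\<^esub>"] \<delta>(1) by simp
    then show ?thesis using \<delta>(1) by (metis M.R.add.r_cancel_one' M.R.one_closed)
  qed
  \<comment> \<open>The connection on the free module for which the basis vectors are flat.\<close>
  define E where "E f = (\<lambda>x. \<delta> (f x))" for f :: "'c \<Rightarrow> 'a"
  have E_closed: "E f \<in> carrier F0" if "f \<in> carrier F0" for f
  proof -
    have "finite {x. \<delta> (f x) \<noteq> \<zero>\<^bsub>R\<^esub>}"
      by (rule finite_subset[of _ "{x. f x \<noteq> \<zero>\<^bsub>R\<^esub>}"]) (use that in \<open>auto simp: F0 free_module_def \<delta>0\<close>)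
    then show ?thesis using that by (auto simp: F0 free_module_def E_def \<delta> \<delta>0)
  qed
  have E_add: "E (f \<oplus>\<^bsub>F0\<^esub> g) = E f \<oplus>\<^bsub>F0\<^esub> E g" if "f \<in> carrier F0" "g \<in> carrier F0" for f g
    using that by (auto simp: F0 free_module_def E_def \<delta>)
  have E_smult: "E (a \<odot>\<^bsub>F0\<^esub> f) = a \<odot>\<^bsub>F0\<^esub> E f \<oplus>\<^bsub>F0\<^esub> \<delta> a \<odot>\<^bsub>F0\<^esub> f"
    if "a \<in> carrier R" "f \<in> carrier F0" for a f
    using that by (auto simp: F0 free_module_def E_def \<delta>)
  have E_zero: "E \<zero>\<^bsub>F0\<^esub> = \<zero>\<^bsub>F0\<^esub>" by (auto simp: F0 free_module_def E_def \<delta>0)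
  have E_minus: "E (f \<ominus>\<^bsub>F0\<^esub> g) = E f \<ominus>\<^bsub>F0\<^esub> E g" if fg: "f \<in> carrier F0" "g \<in> carrier F0" for f g
  proof -
    have "E (f \<ominus>\<^bsub>F0\<^esub> g) \<oplus>\<^bsub>F0\<^esub> E g = E ((f \<ominus>\<^bsub>F0\<^esub> g) \<oplus>\<^bsub>F0\<^esub> g)" using fg by (simp add: E_add)
    also have "(f \<ominus>\<^bsub>F0\<^esub> g) \<oplus>\<^bsub>F0\<^esub> g = f" using fg by (metis F0.M.a_comm F0.M.add_minus_cancel_left F0.M.minus_closed)
    finally show ?thesis
      using fg E_closed
      by (metis F0.M.a_assoc F0.M.a_inv_closed F0.M.minus_closed F0.M.r_neg F0.M.r_zero a_minus_def)
  qed
  let ?e = "M.basis_vector"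
  have e: "?e x \<in> carrier F0" if "x \<in> carrier M" for x unfolding F0 by (rule M.basis_vector_in[OF that])
  have E_e: "E (?e x) = \<zero>\<^bsub>F0\<^esub>" for x
    by (auto simp: E_def M.basis_vector_def F0 free_module_def \<delta>0 \<delta>1)
  define \<phi> where "\<phi> = (\<lambda>g\<in>carrier F1. free_eval R M (E (free_eval R F0 g)))"
  have "\<phi> \<in> left_hom R F1 M"
  proof -
    \<comment> \<open>The defect of linearity of \<open>E\<close> is \<open>\<delta> a\<close> times
      the relation, and the relation is zero in \<open>M\<close>.\<close>
    have "\<phi> (a \<odot>\<^bsub>F1\<^esub> g) = a \<odot>\<^bsub>M\<^esub> \<phi> g" if "a \<in> carrier R" "g \<in> carrier F1" for a g
    proof -
      have "free_eval R M (free_eval R F0 g) = \<zero>\<^bsub>M\<^esub>" using ev_K[OF that(2)] by (simp add: K_def)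
      then show ?thesis using that \<delta>(1)[of a] by (simp add: \<phi>_def ev' E_smult \<pi>' E_closed)
    qed
    then show ?thesis by (auto simp: left_hom_def \<phi>_def ev' E_add \<pi>' E_closed)
  qed
  moreover have "\<phi> (free_eval R F1 h) = \<zero>\<^bsub>M\<^esub>" if h: "h \<in> carrier (resolution2 R M)" for h
  proof -
    let ?K1 = "{f \<in> carrier F1. free_eval R F0 f = \<zero>\<^bsub>F0\<^esub>}"
    have "free_eval R F1 h \<in> ?K1"
    proof (rule free_eval_in_submodule[OF F1.left_module_axioms _ order_refl])
      show "submodule ?K1 R F1" by (rule left_hom_kernel[OF F1.left_module_axioms F0.left_module_axioms ev])
      show "h \<in> carrier (free_module R ?K1)" using h by (simp add: resolution2_def F0_def F1_def)
    qed
    then show ?thesis by (simp add: \<phi>_def E_zero \<pi>')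
  qed
  ultimately have "\<phi> \<in> Ext1_cocycles R M M"
    by (auto simp: Ext1_cocycles_def hom_group_def F1_def \<phi>_def)
  then have "\<phi> \<in> Ext1_coboundaries R M M" by (rule Ext1_trivial_cocycle[OF M M triv])
  then obtain \<psi> where \<psi>: "\<psi> \<in> left_hom R F0 M" "\<phi> = (\<lambda>g\<in>carrier F1. \<psi> (free_eval R F0 g))"
    by (auto simp: Ext1_coboundaries_def hom_group_def F0_def F1_def)
  note \<psi>' = left_hom_simps[OF F0.left_module_axioms M \<psi>(1)]
  \<comment> \<open>Each element of the kernel is the image of its own basis vector of
    \<open>F1\<close>, so an identity of maps on \<open>F1\<close> becomes one on the
    kernel.\<close>
  have key: "\<psi> f = free_eval R M (E f)" if f: "f \<in> carrier F0" "free_eval R M f = \<zero>\<^bsub>M\<^esub>" for f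
  proof -
    have "f \<in> K" using f by (simp add: K_def)
    then have "F0.basis_vector f \<in> carrier F1" unfolding F1 by (rule F0.basis_vector_in)
    then have "\<phi> (F0.basis_vector f) = free_eval R M (E f)" "\<phi> (F0.basis_vector f) = \<psi> f"
      using F0.free_eval_basis_vector[OF f(1)] by (simp add: \<phi>_def, simp add: \<psi>(2))
    then show ?thesis by simp
  qed
  have \<pi>e: "free_eval R M (?e x) = x" if "x \<in> carrier M" for x by (rule M.free_eval_basis_vector[OF that])
  \<comment> \<open>By \<open>key\<close>, the difference of \<open>free_eval R M (E f)\<close> and
    \<open>\<psi> f\<close> depends only on the image of \<open>f\<close> in \<open>M\<close>, and
    this is the connection. For the lift \<open>?e x\<close> of \<open>x\<close> the first term
    vanishes, which leaves the negative of \<open>\<psi> (?e x)\<close>.\<close>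
  show thesis
  proof
    show "\<ominus>\<^bsub>M\<^esub> \<psi> (?e x) \<in> carrier M" if "x \<in> carrier M" for x using e[OF that] \<psi>' by simp
    show "\<ominus>\<^bsub>M\<^esub> \<psi> (?e (x \<oplus>\<^bsub>M\<^esub> y)) = \<ominus>\<^bsub>M\<^esub> \<psi> (?e x) \<oplus>\<^bsub>M\<^esub> \<ominus>\<^bsub>M\<^esub> \<psi> (?e y)"
      if xy: "x \<in> carrier M" "y \<in> carrier M" for x y
    proof -
      \<comment> \<open>The relation that measures the failure of \<open>?e\<close> to be additive.
        It is an integral combination of basis vectors, so \<open>E\<close> kills it.\<close>
      let ?f = "(?e x \<oplus>\<^bsub>F0\<^esub> ?e y) \<ominus>\<^bsub>F0\<^esub> ?e (x \<oplus>\<^bsub>M\<^esub> y)"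
      have f: "?f \<in> carrier F0" using xy e by simp
      have "free_eval R M ?f = \<zero>\<^bsub>M\<^esub>" using xy e by (simp add: \<pi>' \<pi>e M.M.minus_eq_zero_iff)
      moreover have "E ?f = \<zero>\<^bsub>F0\<^esub>" using xy e by (simp add: E_minus E_add E_e)
      ultimately have "\<psi> ?f = \<zero>\<^bsub>M\<^esub>" using key[OF f] by (simp add: \<pi>')
      then have "\<psi> (?e x) \<oplus>\<^bsub>M\<^esub> \<psi> (?e y) = \<psi> (?e (x \<oplus>\<^bsub>M\<^esub> y))"
        using xy e by (simp add: \<psi>' M.M.minus_eq_zero_iff)
      then show ?thesis using xy e \<psi>' by (metis M.M.minus_add)
    qed
    show "\<ominus>\<^bsub>M\<^esub> \<psi> (?e (a \<odot>\<^bsub>M\<^esub> x)) = a \<odot>\<^bsub>M\<^esub> (\<ominus>\<^bsub>M\<^esub> \<psi> (?e x)) \<oplus>\<^bsub>M\<^esub> \<delta> a \<odot>\<^bsub>M\<^esub> x"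
      if ax: "a \<in> carrier R" "x \<in> carrier M" for a x
    proof -
      \<comment> \<open>This relation is not flat: differentiating the coefficient \<open>a\<close>
        produces the Leibniz term.\<close>
      let ?f = "a \<odot>\<^bsub>F0\<^esub> ?e x \<ominus>\<^bsub>F0\<^esub> ?e (a \<odot>\<^bsub>M\<^esub> x)"
      have f: "?f \<in> carrier F0" using ax e by simp
      have c: "\<psi> (?e x) \<in> carrier M" "\<psi> (?e (a \<odot>\<^bsub>M\<^esub> x)) \<in> carrier M" "\<delta> a \<in> carrier R"
        using ax e \<psi>' \<delta> by auto
      have "free_eval R M ?f = \<zero>\<^bsub>M\<^esub>" using ax e by (simp add: \<pi>' \<pi>e M.M.minus_eq_zero_iff)
      moreover have "E ?f = \<delta> a \<odot>\<^bsub>F0\<^esub> ?e x" using ax e \<delta> by (simp add: E_minus E_smult E_e)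
      ultimately have "\<psi> ?f = \<delta> a \<odot>\<^bsub>M\<^esub> x" using key[OF f] ax e \<delta> by (simp add: \<pi>' \<pi>e)
      then have "a \<odot>\<^bsub>M\<^esub> \<psi> (?e x) \<ominus>\<^bsub>M\<^esub> \<psi> (?e (a \<odot>\<^bsub>M\<^esub> x)) = \<delta> a \<odot>\<^bsub>M\<^esub> x" using ax e by (simp add: \<psi>')
      then have "a \<odot>\<^bsub>M\<^esub> (\<ominus>\<^bsub>M\<^esub> \<psi> (?e x)) \<oplus>\<^bsub>M\<^esub> \<delta> a \<odot>\<^bsub>M\<^esub> x =
          \<ominus>\<^bsub>M\<^esub> (a \<odot>\<^bsub>M\<^esub> \<psi> (?e x)) \<oplus>\<^bsub>M\<^esub> (a \<odot>\<^bsub>M\<^esub> \<psi> (?e x) \<ominus>\<^bsub>M\<^esub> \<psi> (?e (a \<odot>\<^bsub>M\<^esub> x)))"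
        using ax c by (simp add: M.smult_r_minus)
      also have "\<dots> = \<ominus>\<^bsub>M\<^esub> \<psi> (?e (a \<odot>\<^bsub>M\<^esub> x))" using ax c by (simp add: a_minus_def M.M.r_neg1)
      finally show ?thesis by simp
    qed
  qed
qed

section \<open>Polynomials and their integer shifts\<close>

context cring
begin

lemma Units_cringI: "\<lbrakk>a \<in> carrier R; b \<in> carrier R; a \<otimes> b = \<one>\<rbrakk> \<Longrightarrow> a \<in> Units R"
  unfolding Units_def using m_comm[of a b] by auto

text \<open>Coprimality in Bezout form: it is carried along by ring homomorphisms such as the
  shifts, and the identity can be evaluated at \<open>D\<close>.\<close>

definition comaximal :: "'a \<Rightarrow> 'a \<Rightarrow> bool"
  where "comaximal a b \<longleftrightarrow> (\<exists>u\<in>carrier R. \<exists>v\<in>carrier R. u \<otimes> a \<oplus> v \<otimes> b = \<one>)"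

lemma comaximal_sym:
  assumes "a \<in> carrier R" "b \<in> carrier R" "comaximal a b"
  shows "comaximal b a"
  using assms a_comm m_closed unfolding comaximal_def by metis

lemma comaximal_mult_right:
  assumes c: "a \<in> carrier R" "b \<in> carrier R" "c \<in> carrier R" and "comaximal a b" "comaximal a c"
  shows "comaximal a (b \<otimes> c)"
proof -
  obtain u v where uv: "u \<in> carrier R" "v \<in> carrier R" "u \<otimes> a \<oplus> v \<otimes> b = \<one>"
    using assms(4) by (auto simp: comaximal_def)
  obtain u' v' where uv': "u' \<in> carrier R" "v' \<in> carrier R" "u' \<otimes> a \<oplus> v' \<otimes> c = \<one>"
    using assms(5) by (auto simp: comaximal_def)
  \<comment> \<open>Expanding the product of the two Bezout identities, every term except
    \<open>v v' b c\<close> has a factor \<open>a\<close>; the cofactors are collected in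
    \<open>?w\<close>.\<close>
  let ?w = "u \<otimes> (u' \<otimes> a \<oplus> v' \<otimes> c) \<oplus> v \<otimes> b \<otimes> u'"
  have "(u \<otimes> a \<oplus> v \<otimes> b) \<otimes> (u' \<otimes> a \<oplus> v' \<otimes> c) = \<one>" using uv uv' by simp
  moreover have "(u \<otimes> a \<oplus> v \<otimes> b) \<otimes> (u' \<otimes> a \<oplus> v' \<otimes> c) = ?w \<otimes> a \<oplus> (v \<otimes> v') \<otimes> (b \<otimes> c)"
    using c uv(1,2) uv'(1,2) by algebra
  moreover have "?w \<in> carrier R" "v \<otimes> v' \<in> carrier R" using c uv uv' by auto
  ultimately show ?thesis unfolding comaximal_def by metis
qed

lemma comaximal_mult_left:
  assumes "a \<in> carrier R" "b \<in> carrier R" "c \<in> carrier R" "comaximal a c" "comaximal b c"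
  shows "comaximal (a \<otimes> b) c"
  by (meson assms comaximal_mult_right comaximal_sym m_closed)

lemma comaximal_one_right: "a \<in> carrier R \<Longrightarrow> comaximal a \<one>"
  unfolding comaximal_def by (intro bexI[of _ \<zero>] bexI[of _ \<one>]) auto

lemma comaximal_pow_left:
  assumes "a \<in> carrier R" "b \<in> carrier R" "comaximal a b"
  shows "comaximal (a [^] (n::nat)) b"
proof (induction n)
  case 0
  show ?case using assms comaximal_one_right comaximal_sym by auto
next
  case (Suc n)
  then show ?case using assms by (simp add: comaximal_mult_left)
qed

end

text \<open>An irreducible element generates a maximal ideal, so adjoining \<open>a\<close> yields
  either the whole ring or nothing new.\<close>

lemma (in principal_domain) irreducible_divides_or_comaximal:
  assumes p: "p \<in> carrier R" "ring_irreducible p" and a: "a \<in> carrier R"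
  shows "p divides a \<or> comaximal p a"
proof -
  interpret maximalideal "PIdl p" R by (rule irreducible_imp_maximalideal[OF p])
  let ?J = "PIdl p <+>\<^bsub>R\<^esub> PIdl a"
  have J: "ideal ?J R" using p a by (intro add_ideals cgenideal_ideal)
  have sub: "PIdl x \<subseteq> PIdl x <+>\<^bsub>R\<^esub> PIdl y" "PIdl y \<subseteq> PIdl x <+>\<^bsub>R\<^esub> PIdl y"
    if xy: "x \<in> carrier R" "y \<in> carrier R" for x y
  proof -
    have I: "ideal (PIdl x) R" "ideal (PIdl y) R" using xy cgenideal_ideal by auto
    have z: "\<zero> \<in> PIdl x" "\<zero> \<in> PIdl y" using I additive_subgroup.zero_closed ideal.axioms(1) by blast+
    have c: "PIdl x \<subseteq> carrier R" "PIdl y \<subseteq> carrier R"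
      using I additive_subgroup.a_subset ideal.axioms(1) by blast+
    show "PIdl x \<subseteq> PIdl x <+>\<^bsub>R\<^esub> PIdl y"
    proof
      fix w assume w: "w \<in> PIdl x"
      then have "w = w \<oplus> \<zero>" using c by auto
      then show "w \<in> PIdl x <+>\<^bsub>R\<^esub> PIdl y" unfolding set_add_def' using w z by blast
    qed
    show "PIdl y \<subseteq> PIdl x <+>\<^bsub>R\<^esub> PIdl y"
    proof
      fix w assume w: "w \<in> PIdl y"
      then have "w = \<zero> \<oplus> w" using c by auto
      then show "w \<in> PIdl x <+>\<^bsub>R\<^esub> PIdl y" unfolding set_add_def' using w z by blast
    qed
  qed
  have "?J = carrier R \<or> ?J = PIdl p"
    using I_maximal[OF J sub(1)[OF p(1) a]] additive_subgroup.a_subset[OF ideal.axioms(1)[OF J]] by blast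
  then show ?thesis
  proof
    assume "?J = carrier R"
    then have "\<one> \<in> ?J" by simp
    then obtain x y where xy: "x \<in> PIdl p" "y \<in> PIdl a" "\<one> = x \<oplus> y" unfolding set_add_def' by blast
    then obtain u v where "u \<in> carrier R" "x = u \<otimes> p" "v \<in> carrier R" "y = v \<otimes> a"
      unfolding cgenideal_def by blast
    then have "comaximal p a" unfolding comaximal_def using xy(3) by metis
    then show ?thesis ..
  next
    assume "?J = PIdl p"
    then have "PIdl a \<subseteq> PIdl p" using sub(2)[OF p(1) a] by simp
    then show ?thesis using to_contain_is_to_divide[OF p(1) a] by simp
  qed
qed

section \<open>Integer shifts of polynomials and their coefficients\<close>

context UP_cring
begin

text \<open>A Horner-type induction: evaluation homomorphisms are known on constants and on the
  variable, so it remains to pass through sums and multiplication by the variable.\<close>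

lemma UP_induct [consumes 1, case_names const add mult_X]:
  assumes p: "p \<in> carrier P"
    and const: "\<And>a. a \<in> carrier R \<Longrightarrow> Q (up_ring.monom P a 0)"
    and add: "\<And>p q. \<lbrakk>p \<in> carrier P; q \<in> carrier P; Q p; Q q\<rbrakk> \<Longrightarrow> Q (p \<oplus>\<^bsub>P\<^esub> q)"
    and X: "\<And>p. \<lbrakk>p \<in> carrier P; Q p\<rbrakk> \<Longrightarrow> Q (p \<otimes>\<^bsub>P\<^esub> up_ring.monom P \<one> 1)"
  shows "Q p"
proof -
  have mon: "Q (up_ring.monom P a n)" if "a \<in> carrier R" for a n
  proof (induction n)
    case 0
    then show ?case using const that by simp
  next
    case (Suc n)
    have "up_ring.monom P a (Suc n) = up_ring.monom P a n \<otimes>\<^bsub>P\<^esub> up_ring.monom P \<one> 1"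
      using that monom_mult[of a \<one> n 1] by simp
    then show ?case using X Suc that by simp
  qed
  have "Q (\<Oplus>\<^bsub>P\<^esub>i\<in>{..n}. up_ring.monom P (up_ring.coeff P p i) i)" for n
  proof (induction n)
    case 0
    then show ?case using mon p by simp
  next
    case (Suc n)
    then show ?case using mon p by (simp add: add)
  qed
  then show ?thesis using up_repr[OF p] by metis
qed

definition int_const :: "int \<Rightarrow> 'a" where "int_const i = [i] \<cdot>\<^bsub>R\<^esub> \<one>"

lemma int_const_closed [simp]: "int_const i \<in> carrier R"
  by (simp add: int_const_def)

lemma int_const_nat: "int_const (int n) = [n] \<cdot>\<^bsub>R\<^esub> \<one>"
  by (simp add: int_const_def add_pow_int_ge)

lemma int_const_add: "int_const (i + j) = int_const i \<oplus> int_const j"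
  by (simp add: int_const_def R.add.int_pow_mult)

lemma int_const_zero [simp]: "int_const 0 = \<zero>"
  using add_pow_int_ge[of 0 R \<one>] by (simp add: int_const_def)

text \<open>The substitution of \<open>T + i\<close> for \<open>T\<close>, taken as an evaluation of
  the polynomial ring in itself, so that it is a ring homomorphism by the universal
  property.\<close>

definition shift :: "int \<Rightarrow> (nat \<Rightarrow> 'a) \<Rightarrow> nat \<Rightarrow> 'a"
  where "shift i = UnivPoly.eval R P (\<lambda>a. up_ring.monom P a 0) (up_ring.monom P \<one> 1 \<oplus>\<^bsub>P\<^esub> up_ring.monom P (int_const i) 0)"

lemma UP_pre_univ_prop_const: "UP_pre_univ_prop R P (\<lambda>a. up_ring.monom P a 0)"
  by unfold_locales (rule const_ring_hom)

lemma shift_hom: "shift i \<in> ring_hom P P"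
  unfolding shift_def P_def
  by (rule UP_pre_univ_prop.eval_ring_hom[OF UP_pre_univ_prop_const[unfolded P_def]]) (simp add: P_def[symmetric])

lemma shift_closed [simp, intro]: "p \<in> carrier P \<Longrightarrow> shift i p \<in> carrier P"
  and shift_add [simp]: "\<lbrakk>p \<in> carrier P; q \<in> carrier P\<rbrakk> \<Longrightarrow> shift i (p \<oplus>\<^bsub>P\<^esub> q) = shift i p \<oplus>\<^bsub>P\<^esub> shift i q"
  and shift_mult [simp]: "\<lbrakk>p \<in> carrier P; q \<in> carrier P\<rbrakk> \<Longrightarrow> shift i (p \<otimes>\<^bsub>P\<^esub> q) = shift i p \<otimes>\<^bsub>P\<^esub> shift i q"
  and shift_one [simp]: "shift i \<one>\<^bsub>P\<^esub> = \<one>\<^bsub>P\<^esub>"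
  using shift_hom[of i] by (auto simp: ring_hom_def)

lemma shift_const [simp]: "a \<in> carrier R \<Longrightarrow> shift i (up_ring.monom P a 0) = up_ring.monom P a 0"
  unfolding shift_def P_def
  by (rule UP_pre_univ_prop.eval_const[OF UP_pre_univ_prop_const[unfolded P_def]]) (simp_all add: P_def[symmetric])

lemma shift_X: "shift i (up_ring.monom P \<one> 1) = up_ring.monom P \<one> 1 \<oplus>\<^bsub>P\<^esub> up_ring.monom P (int_const i) 0"
  unfolding shift_def P_def
  by (rule UP_pre_univ_prop.eval_monom1[OF UP_pre_univ_prop_const[unfolded P_def]]) (simp_all add: P_def[symmetric])

lemma shift_shift: "p \<in> carrier P \<Longrightarrow> shift i (shift j p) = shift (i + j) p"
proof (induction p rule: UP_induct)
  case (mult_X p)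
  have "shift i (shift j (up_ring.monom P \<one> 1)) = shift (i + j) (up_ring.monom P \<one> 1)"
    by (simp add: shift_X int_const_add P.a_assoc del: One_nat_def)
  then show ?case using mult_X by simp
qed simp_all

lemma shift_0: "p \<in> carrier P \<Longrightarrow> shift 0 p = p"
proof (induction p rule: UP_induct)
  case (mult_X p)
  then show ?case using shift_X[of 0] by simp
qed simp_all

lemma shift_pow: "p \<in> carrier P \<Longrightarrow> shift i (p [^]\<^bsub>P\<^esub> (e::nat)) = shift i p [^]\<^bsub>P\<^esub> e"
  by (induction e) simp_all

lemma shift_comaximal:
  assumes "p \<in> carrier P" "q \<in> carrier P" "P.comaximal p q"
  shows "P.comaximal (shift i p) (shift i q)"
proof -
  obtain u v where uv: "u \<in> carrier P" "v \<in> carrier P" "u \<otimes>\<^bsub>P\<^esub> p \<oplus>\<^bsub>P\<^esub> v \<otimes>\<^bsub>P\<^esub> q = \<one>\<^bsub>P\<^esub>"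
    using assms(3) by (auto simp: P.comaximal_def)
  then have "shift i u \<otimes>\<^bsub>P\<^esub> shift i p \<oplus>\<^bsub>P\<^esub> shift i v \<otimes>\<^bsub>P\<^esub> shift i q = \<one>\<^bsub>P\<^esub>"
    using assms by (metis shift_add shift_mult shift_one P.m_closed)
  then show ?thesis using uv unfolding P.comaximal_def by blast
qed

lemma coeff_mult_X:
  assumes "p \<in> carrier P"
  shows "up_ring.coeff P (p \<otimes>\<^bsub>P\<^esub> up_ring.monom P \<one> 1) 0 = \<zero>"
    and "up_ring.coeff P (p \<otimes>\<^bsub>P\<^esub> up_ring.monom P \<one> 1) (Suc n) = up_ring.coeff P p n"
  using assms coeff_monom_mult[of \<one> p 1 n] by (simp_all add: P.m_comm)

lemma coeff_mult_const:
  "\<lbrakk>p \<in> carrier P; a \<in> carrier R\<rbrakk> \<Longrightarrow> up_ring.coeff P (p \<otimes>\<^bsub>P\<^esub> up_ring.monom P a 0) n = a \<otimes> up_ring.coeff P p n"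
  using coeff_monom_mult[of a p 0 n] by (simp add: P.m_comm)

text \<open>Splitting off the constant term is compatible with shifting; the coefficients of
  \<open>p(T + i)\<close> can then be found by induction, without binomial sums.\<close>

lemma UP_split:
  assumes p: "p \<in> carrier P"
  obtains q where "q \<in> carrier P" "p = q \<otimes>\<^bsub>P\<^esub> up_ring.monom P \<one> 1 \<oplus>\<^bsub>P\<^esub> up_ring.monom P (up_ring.coeff P p 0) 0"
    "\<And>n. up_ring.coeff P q n = up_ring.coeff P p (Suc n)"
proof -
  define q where "q = (\<Oplus>\<^bsub>P\<^esub>i\<in>{..deg R p}. up_ring.monom P (up_ring.coeff P p (Suc i)) i)"
  have q: "q \<in> carrier P" unfolding q_def using p by (intro P.finsum_closed) auto
  have c: "up_ring.coeff P q n = up_ring.coeff P p (Suc n)" for n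
  proof -
    have "up_ring.coeff P q n = (\<Oplus>i\<in>{..deg R p}. up_ring.coeff P (up_ring.monom P (up_ring.coeff P p (Suc i)) i) n)"
      unfolding q_def using p by (intro coeff_finsum) auto
    also have "\<dots> = (\<Oplus>i\<in>{..deg R p}. if i = n then up_ring.coeff P p (Suc i) else \<zero>)"
      using p by (intro R.finsum_cong') auto
    also have "\<dots> = up_ring.coeff P p (Suc n)"
    proof (cases "n \<le> deg R p")
      case True
      then show ?thesis using p by (subst R.finsum_single[where i = n]) auto
    next
      case False
      then have "up_ring.coeff P p (Suc n) = \<zero>" using p by (intro deg_aboveD) auto
      then show ?thesis using False by (auto intro!: R.add.finprod_one_eqI)
    qed
    finally show ?thesis .
  qed
  have "p = q \<otimes>\<^bsub>P\<^esub> up_ring.monom P \<one> 1 \<oplus>\<^bsub>P\<^esub> up_ring.monom P (up_ring.coeff P p 0) 0"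
  proof (rule up_eqI)
    fix n
    show "up_ring.coeff P p n = up_ring.coeff P (q \<otimes>\<^bsub>P\<^esub> up_ring.monom P \<one> 1 \<oplus>\<^bsub>P\<^esub> up_ring.monom P (up_ring.coeff P p 0) 0) n"
      using p q c coeff_mult_X[OF q] by (cases n) (auto simp del: coeff_mult One_nat_def)
  qed (use p q in auto)
  then show thesis using that q c by blast
qed

lemma coeff_shift_step:
  assumes q: "q \<in> carrier P" and a: "a \<in> carrier R"
    and p: "p = q \<otimes>\<^bsub>P\<^esub> up_ring.monom P \<one> 1 \<oplus>\<^bsub>P\<^esub> up_ring.monom P a 0"
  shows "up_ring.coeff P (shift i p) 0 = int_const i \<otimes> up_ring.coeff P (shift i q) 0 \<oplus> a"
    and "up_ring.coeff P (shift i p) (Suc n) = up_ring.coeff P (shift i q) n \<oplus> int_const i \<otimes> up_ring.coeff P (shift i q) (Suc n)"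
proof -
  have "shift i p = (shift i q \<otimes>\<^bsub>P\<^esub> up_ring.monom P \<one> 1 \<oplus>\<^bsub>P\<^esub> shift i q \<otimes>\<^bsub>P\<^esub> up_ring.monom P (int_const i) 0) \<oplus>\<^bsub>P\<^esub> up_ring.monom P a 0"
    unfolding p using q a by (simp add: shift_X P.r_distr del: One_nat_def)
  then show "up_ring.coeff P (shift i p) 0 = int_const i \<otimes> up_ring.coeff P (shift i q) 0 \<oplus> a"
    and "up_ring.coeff P (shift i p) (Suc n) = up_ring.coeff P (shift i q) n \<oplus> int_const i \<otimes> up_ring.coeff P (shift i q) (Suc n)"
    using q a coeff_mult_X[OF shift_closed[OF q]] coeff_mult_const[OF shift_closed[OF q]]
    by (simp_all del: coeff_mult One_nat_def)
qed

lemma coeff_shift_top: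
  assumes "p \<in> carrier P" "\<And>m. m > n \<Longrightarrow> up_ring.coeff P p m = \<zero>" "m \<ge> n"
  shows "up_ring.coeff P (shift i p) m = up_ring.coeff P p m"
  using assms
proof (induction n arbitrary: p m)
  case 0
  have "p = up_ring.monom P (up_ring.coeff P p 0) 0"
    using 0 by (intro up_eqI) auto
  then show ?case using 0 by (metis shift_const coeff_closed)
next
  case (Suc n)
  obtain q where q: "q \<in> carrier P" "p = q \<otimes>\<^bsub>P\<^esub> up_ring.monom P \<one> 1 \<oplus>\<^bsub>P\<^esub> up_ring.monom P (up_ring.coeff P p 0) 0"
    "\<And>n. up_ring.coeff P q n = up_ring.coeff P p (Suc n)" using UP_split[OF Suc.prems(1)] by blast
  obtain m' where m: "m = Suc m'" "m' \<ge> n" using Suc.prems(3) by (cases m) auto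
  have IH: "up_ring.coeff P (shift i q) l = up_ring.coeff P q l" if "l \<ge> n" for l
    using Suc.IH[OF q(1) _ that] q(3) Suc.prems(2) by auto
  have "up_ring.coeff P q (Suc m') = \<zero>" using q(3) Suc.prems(2) m by simp
  then show ?case
    using coeff_shift_step(2)[OF q(1) _ q(2), of i m'] IH[of m'] IH[of "Suc m'"] m q(1,3) Suc.prems(1)
    by simp
qed

text \<open>The linear term \<open>i p'\<close> of Taylor's expansion contributes
  \<open>(n + 1) i\<close> times the coefficient of index \<open>n + 1\<close>. Just below the
  leading coefficient is the first place where a shift becomes visible.\<close>

lemma coeff_shift_second:
  assumes "p \<in> carrier P" "\<And>m. m > Suc n \<Longrightarrow> up_ring.coeff P p m = \<zero>"
  shows "up_ring.coeff P (shift i p) n = up_ring.coeff P p n \<oplus> [Suc n] \<cdot>\<^bsub>R\<^esub> (int_const i \<otimes> up_ring.coeff P p (Suc n))"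
  using assms
proof (induction n arbitrary: p)
  case 0
  obtain q where q: "q \<in> carrier P" "p = q \<otimes>\<^bsub>P\<^esub> up_ring.monom P \<one> 1 \<oplus>\<^bsub>P\<^esub> up_ring.monom P (up_ring.coeff P p 0) 0"
    "\<And>n. up_ring.coeff P q n = up_ring.coeff P p (Suc n)" using UP_split[OF 0(1)] by blast
  have "up_ring.coeff P (shift i q) 0 = up_ring.coeff P q 0"
    by (rule coeff_shift_top[of q 0]) (use q 0 in auto)
  then show ?case
    using coeff_shift_step(1)[OF q(1) _ q(2), of i] q(1,3) 0(1) by (simp add: R.a_comm)
next
  case (Suc n)
  obtain q where q: "q \<in> carrier P" "p = q \<otimes>\<^bsub>P\<^esub> up_ring.monom P \<one> 1 \<oplus>\<^bsub>P\<^esub> up_ring.monom P (up_ring.coeff P p 0) 0"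
    "\<And>n. up_ring.coeff P q n = up_ring.coeff P p (Suc n)" using UP_split[OF Suc.prems(1)] by blast
  have top: "up_ring.coeff P (shift i q) (Suc n) = up_ring.coeff P q (Suc n)"
    by (rule coeff_shift_top[of q "Suc n"]) (use q Suc.prems in auto)
  have IH: "up_ring.coeff P (shift i q) n = up_ring.coeff P q n \<oplus> [Suc n] \<cdot>\<^bsub>R\<^esub> (int_const i \<otimes> up_ring.coeff P q (Suc n))"
    by (rule Suc.IH) (use q Suc.prems in auto)
  have c: "up_ring.coeff P p m \<in> carrier R" for m using Suc.prems by simp
  show ?case
    using coeff_shift_step(2)[OF q(1) c q(2), of i n] top IH c
    by (simp add: q(3) R.a_assoc)
qed

text \<open>Repetitions are allowed and multiplicities are not recorded, since only the existence of
  an annihilator of this form is used.\<close>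

inductive_set shift_products :: "(nat \<Rightarrow> 'a) \<Rightarrow> (nat \<Rightarrow> 'a) set" for h where
  one: "\<one>\<^bsub>P\<^esub> \<in> shift_products h"
| mult: "s \<in> shift_products h \<Longrightarrow> s \<otimes>\<^bsub>P\<^esub> shift l h \<in> shift_products h"

lemma shift_products_closed: "\<lbrakk>s \<in> shift_products h; h \<in> carrier P\<rbrakk> \<Longrightarrow> s \<in> carrier P"
  by (induction rule: shift_products.induct) auto

lemma shift_products_mult:
  assumes "s \<in> shift_products h" "t \<in> shift_products h" "h \<in> carrier P"
  shows "s \<otimes>\<^bsub>P\<^esub> t \<in> shift_products h"
  using assms(2)
proof (induction rule: shift_products.induct)
  case one
  then show ?case using assms shift_products_closed by simp
next
  case (mult t l)
  then have "s \<otimes>\<^bsub>P\<^esub> (t \<otimes>\<^bsub>P\<^esub> shift l h) = s \<otimes>\<^bsub>P\<^esub> t \<otimes>\<^bsub>P\<^esub> shift l h"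
    using assms shift_products_closed by (simp add: P.m_assoc)
  then show ?case using mult shift_products.mult by simp
qed

lemma shift_products_shift:
  assumes "s \<in> shift_products h" "h \<in> carrier P"
  shows "shift i s \<in> shift_products h"
  using assms(1)
proof (induction rule: shift_products.induct)
  case one
  then show ?case by (simp add: shift_products.one)
next
  case (mult s l)
  then show ?case
    using assms shift_products_closed shift_products.mult[of "shift i s" h "i + l"] by (simp add: shift_shift)
qed

text \<open>Each factor \<open>shift l h\<close> is multiplied by \<open>shift l h'\<close>: the
  base can be enlarged without losing the factors found before.\<close>

lemma shift_products_divides:
  assumes "s \<in> shift_products h" "h \<in> carrier P" "h' \<in> carrier P"
  shows "\<exists>s'\<in>shift_products (h \<otimes>\<^bsub>P\<^esub> h'). s divides\<^bsub>P\<^esub> s'"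
  using assms(1)
proof (induction rule: shift_products.induct)
  case one
  show ?case by (intro bexI[of _ "\<one>\<^bsub>P\<^esub>"] shift_products.one) auto
next
  case (mult s l)
  then obtain s' where s': "s' \<in> shift_products (h \<otimes>\<^bsub>P\<^esub> h')" "s divides\<^bsub>P\<^esub> s'" by blast
  then obtain u where u: "u \<in> carrier P" "s' = s \<otimes>\<^bsub>P\<^esub> u" by (auto simp: factor_def)
  have sc: "s \<in> carrier P" using mult assms shift_products_closed by blast
  have "s' \<otimes>\<^bsub>P\<^esub> shift l (h \<otimes>\<^bsub>P\<^esub> h') = (s \<otimes>\<^bsub>P\<^esub> shift l h) \<otimes>\<^bsub>P\<^esub> (u \<otimes>\<^bsub>P\<^esub> shift l h')"
    unfolding u(2) using u sc assms by (simp add: P.m_ac)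
  then show ?case
    using shift_products.mult[OF s'(1), of l] u assms
    by (intro bexI[of _ "s' \<otimes>\<^bsub>P\<^esub> shift l (h \<otimes>\<^bsub>P\<^esub> h')"]) (auto simp: factor_def)
qed

end

section \<open>Polynomials over a field of characteristic zero\<close>

locale UP_char0_field = UP R P + R?: field R for R (structure) and P (structure) +
  assumes char0: "char_zero R"

sublocale UP_char0_field < UP_domain
  by intro_locales [1] (rule P_def)

context UP_char0_field
begin

lemma int_const_nonzero: "i \<noteq> 0 \<Longrightarrow> int_const i \<noteq> \<zero>"
proof -
  have *: "int_const (int n) \<noteq> \<zero>" if "n > 0" for n
    using char0 that by (simp add: char_zero_def int_const_def add_pow_int_ge)
  assume "i \<noteq> 0"
  show "int_const i \<noteq> \<zero>"
  proof (cases "i > 0")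
    case True
    then show ?thesis using *[of "nat i"] by simp
  next
    case False
    then have "int_const (- i) \<noteq> \<zero>" using *[of "nat (- i)"] \<open>i \<noteq> 0\<close> by simp
    moreover have "int_const (- i) = \<zero>" if "int_const i = \<zero>"
      using int_const_add[of i "- i"] that by simp
    ultimately show ?thesis by blast
  qed
qed

lemma principal_domain_UP: "principal_domain P"
proof -
  have "euclidean_domain P (deg R)"
  proof (rule euclidean_domainI)
    fix a b assume a: "a \<in> carrier P - {\<zero>\<^bsub>P\<^esub>}" and b: "b \<in> carrier P - {\<zero>\<^bsub>P\<^esub>}"
    let ?l = "up_ring.coeff P b (deg R b)"
    obtain q r and n :: nat where qr: "q \<in> carrier P" "r \<in> carrier P"
      "?l [^] n \<odot>\<^bsub>P\<^esub> a = b \<otimes>\<^bsub>P\<^esub> q \<oplus>\<^bsub>P\<^esub> r" "r = \<zero>\<^bsub>P\<^esub> \<or> deg R r < deg R b"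
      using long_div_theorem[of b a] a b by auto
    \<comment> \<open>The division above holds up to a power of the leading coefficient, which is a
      unit over a field and is removed by \<open>c\<close>.\<close>
    have l: "?l \<in> carrier R" "?l \<noteq> \<zero>" using b lcoeff_nonzero2 by auto
    then have "?l \<in> Units R" by (simp add: field_Units)
    then have "?l [^] n \<in> Units R" by (rule R.Units_pow_closed)
    then obtain c where c: "c \<in> carrier R" "c \<otimes> (?l [^] n) = \<one>"
      by (metis R.Units_l_inv R.Units_inv_closed)
    have ab: "a \<in> carrier P" "b \<in> carrier P" using a b by auto
    have "a = c \<odot>\<^bsub>P\<^esub> (?l [^] n \<odot>\<^bsub>P\<^esub> a)" using c ab l UP_smult_assoc1[of c "?l [^] n" a] by simp
    also have "\<dots> = b \<otimes>\<^bsub>P\<^esub> (c \<odot>\<^bsub>P\<^esub> q) \<oplus>\<^bsub>P\<^esub> c \<odot>\<^bsub>P\<^esub> r"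
      unfolding qr(3) using c qr(1,2) ab UP_smult_assoc2[of c q b] by (simp add: UP_smult_r_distr P.m_comm[of b])
    finally have "a = b \<otimes>\<^bsub>P\<^esub> (c \<odot>\<^bsub>P\<^esub> q) \<oplus>\<^bsub>P\<^esub> c \<odot>\<^bsub>P\<^esub> r" .
    moreover have "c \<odot>\<^bsub>P\<^esub> r = \<zero>\<^bsub>P\<^esub> \<or> deg R (c \<odot>\<^bsub>P\<^esub> r) < deg R b"
      using qr(4) deg_smult_decr[OF c(1) qr(2)] smult_r_null[OF c(1)] by auto
    moreover have "c \<odot>\<^bsub>P\<^esub> q \<in> carrier P" "c \<odot>\<^bsub>P\<^esub> r \<in> carrier P" using c qr by auto
    ultimately show "\<exists>q r. q \<in> carrier P \<and> r \<in> carrier P \<and> a = b \<otimes>\<^bsub>P\<^esub> q \<oplus>\<^bsub>P\<^esub> r \<and>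
        (r = \<zero>\<^bsub>P\<^esub> \<or> deg R r < deg R b)" by blast
  qed
  then interpret E: euclidean_domain P "deg R" .
  show ?thesis by unfold_locales
qed

text \<open>This is where characteristic zero enters: if \<open>p(T + i)\<close> were a multiple of \<open>p(T)\<close>, comparing
  the two leading coefficients would give \<open>n i = 0\<close> with \<open>n = deg p\<close>.\<close>

lemma irreducible_shift_comaximal:
  assumes p: "p \<in> carrier P" "ring_irreducible\<^bsub>P\<^esub> p" and i: "i \<noteq> 0"
  shows "P.comaximal p (shift i p)"
proof -
  interpret PD: principal_domain P by (rule principal_domain_UP)
  have p0: "p \<noteq> \<zero>\<^bsub>P\<^esub>" "p \<notin> Units P" using domain.ring_irreducibleE(1,4)[OF UP_domain p(1,2)] by auto
  let ?n = "deg R p"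
  have top: "up_ring.coeff P (shift i p) m = up_ring.coeff P p m" if "m \<ge> ?n" for m
    by (rule coeff_shift_top[of p ?n]) (use p that in \<open>auto intro: deg_aboveD\<close>)
  have lc: "up_ring.coeff P p ?n \<noteq> \<zero>" using p p0 lcoeff_nonzero2 by blast
  have "\<not> p divides\<^bsub>P\<^esub> shift i p"
  proof
    assume "p divides\<^bsub>P\<^esub> shift i p"
    then obtain u where u: "u \<in> carrier P" "shift i p = p \<otimes>\<^bsub>P\<^esub> u" by (auto simp: factor_def)
    have sp: "shift i p \<noteq> \<zero>\<^bsub>P\<^esub>" using top[of ?n] lc by auto
    then have u0: "u \<noteq> \<zero>\<^bsub>P\<^esub>" using u p by auto
    have "deg R (shift i p) \<le> ?n"
      using top p by (intro deg_aboveI) (auto intro: deg_aboveD)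
    \<comment> \<open>The quotient is a constant, and agreement of the leading coefficients makes it
      one; so \<open>p\<close> would be invariant under the shift.\<close>
    then have "deg R u = 0" using deg_mult[OF p0(1) u0 p(1) u(1)] u(2) by simp
    then have u': "u = up_ring.monom P (up_ring.coeff P u 0) 0" by (rule deg_zero_impl_monom[OF u(1)])
    define c where "c = up_ring.coeff P u 0"
    have c: "c \<in> carrier R" using u by (simp add: c_def)
    have sc: "up_ring.coeff P (shift i p) m = c \<otimes> up_ring.coeff P p m" for m
      unfolding u(2) using u' p c coeff_mult_const[OF p(1) c, of m] by (simp add: c_def)
    have "c \<otimes> up_ring.coeff P p ?n = \<one> \<otimes> up_ring.coeff P p ?n" using sc[of ?n] top[of ?n] p by simp
    then have c1: "c = \<one>" using R.m_rcancel[OF lc, of c \<one>] c p by auto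
    show False
    proof (cases ?n)
      case 0
      then have "p = up_ring.monom P (up_ring.coeff P p 0) 0" by (rule deg_zero_impl_monom[OF p(1)])
      moreover have "up_ring.coeff P p 0 \<in> Units R" using lc 0 p by (simp add: field_Units)
      then obtain d where "d \<in> carrier R" "up_ring.coeff P p 0 \<otimes> d = \<one>"
        by (metis R.Units_r_inv R.Units_inv_closed)
      then have "up_ring.monom P (up_ring.coeff P p 0) 0 \<otimes>\<^bsub>P\<^esub> up_ring.monom P d 0 = \<one>\<^bsub>P\<^esub>" "up_ring.monom P d 0 \<in> carrier P"
        using p by (simp_all add: monom_mult[symmetric] del: monom_mult)
      ultimately have "p \<in> Units P" using P.Units_cringI[OF p(1)] by metis
      then show ?thesis using p0 by simp
    next
      case (Suc n)
      let ?t = "int_const i \<otimes> up_ring.coeff P p (Suc n)"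
      have "up_ring.coeff P (shift i p) n = up_ring.coeff P p n \<oplus> [Suc n] \<cdot>\<^bsub>R\<^esub> ?t"
        by (rule coeff_shift_second[OF p(1)]) (use p Suc in \<open>auto intro: deg_aboveD\<close>)
      moreover have "up_ring.coeff P (shift i p) n = up_ring.coeff P p n" using sc c1 p by simp
      ultimately have eq: "up_ring.coeff P p n = up_ring.coeff P p n \<oplus> [Suc n] \<cdot>\<^bsub>R\<^esub> ?t" by metis
      have t: "?t \<in> carrier R" "up_ring.coeff P p n \<in> carrier R" using p by auto
      have "[Suc n] \<cdot>\<^bsub>R\<^esub> ?t = \<zero>"
        using R.add.l_cancel[of "up_ring.coeff P p n" "[Suc n] \<cdot>\<^bsub>R\<^esub> ?t" \<zero>] eq t
        by (simp del: R.add.nat_pow_Suc)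
      moreover have "[Suc n] \<cdot>\<^bsub>R\<^esub> ?t = int_const (int (Suc n)) \<otimes> ?t"
        using t R.add_pow_ldistr[of \<one> ?t "Suc n"] unfolding int_const_nat by (simp del: R.add.nat_pow_Suc)
      ultimately have "int_const (int (Suc n)) \<otimes> ?t = \<zero>" by metis
      then have "int_const (int (Suc n)) = \<zero> \<or> ?t = \<zero>" using t by (intro R.integral) auto
      moreover have "?t \<noteq> \<zero>" using R.integral[of "int_const i" "up_ring.coeff P p (Suc n)"]
          int_const_nonzero[OF i] lc Suc p by auto
      moreover have "int_const (int (Suc n)) \<noteq> \<zero>" by (rule int_const_nonzero) simp
      ultimately show ?thesis by blast
    qed
  qed
  then show ?thesis
    using PD.irreducible_divides_or_comaximal[OF p shift_closed[OF p(1), of i]] by blast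
qed

text \<open>Split off an irreducible factor \<open>p\<close> of \<open>f\<close>. If
  \<open>p\<close> divides some shift of the base found for the cofactor, one more factor of that
  shift accounts for \<open>p\<close>. Otherwise \<open>p\<close> is comaximal to all shifts of the
  base and is multiplied into it.\<close>

theorem shift_coprime_base:
  assumes "f \<in> carrier P" "f \<noteq> \<zero>\<^bsub>P\<^esub>"
  shows "\<exists>h\<in>carrier P. (\<forall>i. i \<noteq> 0 \<longrightarrow> P.comaximal h (shift i h)) \<and>
    (\<exists>s\<in>shift_products h. f divides\<^bsub>P\<^esub> s)"
  using assms
proof (induction "deg R f" arbitrary: f rule: less_induct)
  case less
  interpret PD: principal_domain P by (rule principal_domain_UP)
  show ?case
  proof (cases "f \<in> Units P")
    case True
    then have "f divides\<^bsub>P\<^esub> \<one>\<^bsub>P\<^esub>" using P.Units_r_inv P.Units_inv_closed unfolding factor_def by metis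
    then show ?thesis
      using shift_products.one P.comaximal_one_right by (intro bexI[of _ "\<one>\<^bsub>P\<^esub>"]) auto
  next
    case False
    moreover have "f \<in> carrier P - {\<zero>\<^bsub>P\<^esub>}" using less.prems by simp
    ultimately obtain p where p: "p \<in> carrier P" "ring_irreducible\<^bsub>P\<^esub> p" "p divides\<^bsub>P\<^esub> f"
      using PD.exists_irreducible_divisor by metis
    then obtain g where g: "g \<in> carrier P" "f = p \<otimes>\<^bsub>P\<^esub> g" by (auto simp: factor_def)
    have p0: "p \<noteq> \<zero>\<^bsub>P\<^esub>" "p \<notin> Units P" using domain.ring_irreducibleE(1,4)[OF UP_domain p(1,2)] by auto
    have g0: "g \<noteq> \<zero>\<^bsub>P\<^esub>" using g(2) less.prems(2) P.r_null[OF p(1)] by metis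
    \<comment> \<open>A constant equals its own shift, so it would be comaximal to itself, that is,
      a unit.\<close>
    have "deg R p \<noteq> 0"
    proof
      assume 0: "deg R p = 0"
      then have "p = up_ring.monom P (up_ring.coeff P p 0) 0" by (rule deg_zero_impl_monom[OF p(1)])
      then have "shift 1 p = p" using p by (metis shift_const coeff_closed)
      then have "P.comaximal p p" using irreducible_shift_comaximal[OF p(1,2), of 1] by simp
      then obtain u v where uv: "u \<in> carrier P" "v \<in> carrier P" "u \<otimes>\<^bsub>P\<^esub> p \<oplus>\<^bsub>P\<^esub> v \<otimes>\<^bsub>P\<^esub> p = \<one>\<^bsub>P\<^esub>"
        by (auto simp: P.comaximal_def)
      then have "(u \<oplus>\<^bsub>P\<^esub> v) \<otimes>\<^bsub>P\<^esub> p = \<one>\<^bsub>P\<^esub>" using p by (simp add: P.l_distr)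
      then have "p \<in> Units P" using uv p P.m_comm[of p "u \<oplus>\<^bsub>P\<^esub> v"]
        by (intro P.Units_cringI[of p "u \<oplus>\<^bsub>P\<^esub> v"]) auto
      then show False using p0 by simp
    qed
    then have "deg R g < deg R f" using deg_mult[OF p0(1) g0 p(1) g(1)] g(2) by simp
    then obtain h s where h: "h \<in> carrier P" "\<And>i. i \<noteq> 0 \<Longrightarrow> P.comaximal h (shift i h)"
      "s \<in> shift_products h" "g divides\<^bsub>P\<^esub> s"
      using less.hyps[OF _ g(1) g0] by blast
    then obtain u where u: "u \<in> carrier P" "s = g \<otimes>\<^bsub>P\<^esub> u" by (auto simp: factor_def)
    show ?thesis
    proof (cases "\<exists>i. p divides\<^bsub>P\<^esub> shift i h")
      case True
      then obtain i v where v: "v \<in> carrier P" "shift i h = p \<otimes>\<^bsub>P\<^esub> v" by (auto simp: factor_def)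
      have "s \<otimes>\<^bsub>P\<^esub> shift i h = f \<otimes>\<^bsub>P\<^esub> (u \<otimes>\<^bsub>P\<^esub> v)"
        unfolding u(2) v(2) g(2) using u v g p by (simp add: P.m_ac)
      then have "f divides\<^bsub>P\<^esub> s \<otimes>\<^bsub>P\<^esub> shift i h" using u v by (auto simp: factor_def)
      then show ?thesis using h shift_products.mult[OF h(3), of i] by blast
    next
      case False
      then have ph: "P.comaximal p (shift i h)" for i
        using PD.irreducible_divides_or_comaximal[OF p(1,2) shift_closed[OF h(1), of i]] by blast
      \<comment> \<open>Start from \<open>p\<close> and the shift of \<open>h\<close> by
        \<open>- i\<close>, and shift both by \<open>i\<close>.\<close>
      have hp: "P.comaximal h (shift i p)" for i
      proof -
        have "P.comaximal (shift i p) (shift i (shift (- i) h))"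
          by (rule shift_comaximal[OF p(1) shift_closed[OF h(1)] ph])
        then show ?thesis using h p by (simp add: shift_shift shift_0 P.comaximal_sym)
      qed
      have "P.comaximal (h \<otimes>\<^bsub>P\<^esub> p) (shift i (h \<otimes>\<^bsub>P\<^esub> p))" if "i \<noteq> 0" for i
        using h(1,2) p ph hp irreducible_shift_comaximal[OF p(1,2) that] that
        by (simp add: P.comaximal_mult_left P.comaximal_mult_right)
      moreover obtain s' where s': "s' \<in> shift_products (h \<otimes>\<^bsub>P\<^esub> p)" "s divides\<^bsub>P\<^esub> s'"
        using shift_products_divides[OF h(3,1) p(1)] by blast
      then obtain w where w: "w \<in> carrier P" "s' = s \<otimes>\<^bsub>P\<^esub> w" by (auto simp: factor_def)
      \<comment> \<open>The unshifted factor is adjoined to supply \<open>p\<close>; the cofactor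
        \<open>g\<close> already divides \<open>s'\<close>.\<close>
      have "s' \<otimes>\<^bsub>P\<^esub> shift 0 (h \<otimes>\<^bsub>P\<^esub> p) = f \<otimes>\<^bsub>P\<^esub> (u \<otimes>\<^bsub>P\<^esub> w \<otimes>\<^bsub>P\<^esub> h)"
        unfolding w(2) u(2) g(2) using u w g p h by (simp add: shift_0 P.m_ac)
      then have "f divides\<^bsub>P\<^esub> s' \<otimes>\<^bsub>P\<^esub> shift 0 (h \<otimes>\<^bsub>P\<^esub> p)" using u w h by (auto simp: factor_def)
      ultimately show ?thesis using h(1) p(1) shift_products.mult[OF s'(1), of 0] by blast
    qed
  qed
qed

end

section \<open>Bicommutants of commuting endomorphisms\<close>

context abelian_group
begin

text \<open>A bicommutant of commuting endomorphisms is a commutative ring. This makes the universal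
  property of the polynomial ring available for substituting \<open>D\<close> into a polynomial.\<close>

definition endos :: "('a \<Rightarrow> 'a) set"
  where "endos = {f \<in> extensional (carrier G). f \<in> carrier G \<rightarrow> carrier G \<and>
    (\<forall>x\<in>carrier G. \<forall>y\<in>carrier G. f (x \<oplus> y) = f x \<oplus> f y)}"

definition commutant :: "('a \<Rightarrow> 'a) set \<Rightarrow> ('a \<Rightarrow> 'a) set"
  where "commutant S = {f \<in> endos. \<forall>s\<in>S. \<forall>x\<in>carrier G. f (s x) = s (f x)}"

definition endo_ring :: "('a \<Rightarrow> 'a) set \<Rightarrow> ('a \<Rightarrow> 'a) ring"
  where "endo_ring C = \<lparr>carrier = C, monoid.mult = (\<lambda>f g. \<lambda>x\<in>carrier G. f (g x)), one = (\<lambda>x\<in>carrier G. x),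
    ring.zero = (\<lambda>x\<in>carrier G. \<zero>), ring.add = (\<lambda>f g. \<lambda>x\<in>carrier G. f x \<oplus> g x)\<rparr>"

lemma endosD:
  assumes "f \<in> endos"
  shows "x \<in> carrier G \<Longrightarrow> f x \<in> carrier G"
    and "\<lbrakk>x \<in> carrier G; y \<in> carrier G\<rbrakk> \<Longrightarrow> f (x \<oplus> y) = f x \<oplus> f y"
    and "f \<zero> = \<zero>"
    and "x \<in> carrier G \<Longrightarrow> f (\<ominus> x) = \<ominus> f x"
    and "f \<in> extensional (carrier G)"
proof -
  show c: "x \<in> carrier G \<Longrightarrow> f x \<in> carrier G" for x using assms by (auto simp: endos_def)
  show a: "\<lbrakk>x \<in> carrier G; y \<in> carrier G\<rbrakk> \<Longrightarrow> f (x \<oplus> y) = f x \<oplus> f y" for x y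
    using assms by (auto simp: endos_def)
  show z: "f \<zero> = \<zero>"
    using a[of \<zero> \<zero>] c[of \<zero>] by (metis add.r_cancel_one' l_zero zero_closed)
  show "x \<in> carrier G \<Longrightarrow> f (\<ominus> x) = \<ominus> f x"
    using a[of "\<ominus> x" x] c z by (metis a_inv_closed l_neg minus_equality)
  show "f \<in> extensional (carrier G)" using assms by (auto simp: endos_def)
qed

text \<open>If the members of \<open>S\<close> commute with each other, then \<open>S\<close> lies
  in its commutant. Commutants reverse inclusions, so the bicommutant lies in the commutant of
  \<open>S\<close> and therefore commutes with itself.\<close>

lemma bicommutant_cring:
  assumes S: "S \<subseteq> commutant S"
  shows "cring (endo_ring (commutant (commutant S)))" "S \<subseteq> commutant (commutant S)"
proof -
  let ?C = "commutant (commutant S)"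
  have CS: "commutant S \<subseteq> endos" and C: "?C \<subseteq> endos" by (auto simp: commutant_def)
  show S2: "S \<subseteq> ?C" using S by (auto simp: commutant_def subset_iff)
  have CC: "?C \<subseteq> commutant S"
  proof
    fix f assume "f \<in> ?C"
    then have f: "f \<in> endos" "\<forall>s\<in>commutant S. \<forall>x\<in>carrier G. f (s x) = s (f x)"
      by (simp_all add: commutant_def[of "commutant S"])
    have "\<forall>s\<in>S. \<forall>x\<in>carrier G. f (s x) = s (f x)" using f(2) S by blast
    then show "f \<in> commutant S" using f(1) by (simp add: commutant_def[of S])
  qed
  have comm: "f (g x) = g (f x)" if "f \<in> ?C" "g \<in> ?C" "x \<in> carrier G" for f g x
  proof -
    have "g \<in> commutant S" using CC that by blast
    then show ?thesis using that(1,3) by (simp add: commutant_def[of "commutant S"])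
  qed
  have e: "f x \<in> carrier G" if "f \<in> ?C" "x \<in> carrier G" for f x using C that endosD(1) by blast
  have ea: "f (x \<oplus> y) = f x \<oplus> f y" if "f \<in> ?C" "x \<in> carrier G" "y \<in> carrier G" for f x y
    using C that endosD(2) by blast
  have mem: "f \<in> ?C" if "f \<in> endos" "\<And>g x. \<lbrakk>g \<in> commutant S; x \<in> carrier G\<rbrakk> \<Longrightarrow> f (g x) = g (f x)" for f
    using that by (simp add: commutant_def[of "commutant S"])
  have memD: "f (g x) = g (f x)" if "f \<in> ?C" "g \<in> commutant S" "x \<in> carrier G" for f g x
    using that by (simp add: commutant_def[of "commutant S"])
  have ext: "f \<in> extensional (carrier G)" if "f \<in> ?C" for f using C that endosD(5) by blast
  have g: "g x \<in> carrier G" "g (x \<oplus> y) = g x \<oplus> g y" "g \<zero> = \<zero>" "g (\<ominus> x) = \<ominus> g x"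
    if "g \<in> commutant S" "x \<in> carrier G" "y \<in> carrier G" for g x y
    using CS that endosD by blast+
  have g0: "g \<zero> = \<zero>" if "g \<in> commutant S" for g using CS that endosD(3) by blast
  have add: "(\<lambda>x\<in>carrier G. f x \<oplus> f' x) \<in> ?C" if f: "f \<in> ?C" "f' \<in> ?C" for f f'
  proof (rule mem)
    show "(\<lambda>x\<in>carrier G. f x \<oplus> f' x) \<in> endos"
      using e[OF f(1)] e[OF f(2)] ea[OF f(1)] ea[OF f(2)] by (auto simp: endos_def a_ac)
    fix t x assume t: "t \<in> commutant S" "x \<in> carrier G"
    then show "(\<lambda>x\<in>carrier G. f x \<oplus> f' x) (t x) = t ((\<lambda>x\<in>carrier G. f x \<oplus> f' x) x)"
      using g[OF t(1) e[OF f(1) t(2)] e[OF f(2) t(2)]] g(1)[OF t(1) t(2) t(2)] memD[OF f(1) t] memD[OF f(2) t]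
      by simp
  qed
  have mul: "(\<lambda>x\<in>carrier G. f (f' x)) \<in> ?C" if f: "f \<in> ?C" "f' \<in> ?C" for f f'
  proof (rule mem)
    show "(\<lambda>x\<in>carrier G. f (f' x)) \<in> endos"
      using e[OF f(1)] e[OF f(2)] ea[OF f(1)] ea[OF f(2)] by (auto simp: endos_def)
    fix t x assume t: "t \<in> commutant S" "x \<in> carrier G"
    then show "(\<lambda>x\<in>carrier G. f (f' x)) (t x) = t ((\<lambda>x\<in>carrier G. f (f' x)) x)"
      using g(1)[OF t(1) t(2) t(2)] memD[OF f(1) t(1) e[OF f(2) t(2)]] memD[OF f(2) t] by simp
  qed
  have one: "(\<lambda>x\<in>carrier G. x) \<in> ?C"
    by (rule mem) (use g(1) in \<open>auto simp: endos_def\<close>)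
  have zero: "(\<lambda>x\<in>carrier G. \<zero>) \<in> ?C"
    by (rule mem) (auto simp: endos_def g0 g(1)[OF _ _ zero_closed])
  have neg: "(\<lambda>x\<in>carrier G. \<ominus> f x) \<in> ?C" if f: "f \<in> ?C" for f
  proof (rule mem)
    show "(\<lambda>x\<in>carrier G. \<ominus> f x) \<in> endos"
      using e[OF f] ea[OF f] by (auto simp: endos_def minus_add)
    fix t x assume t: "t \<in> commutant S" "x \<in> carrier G"
    then show "(\<lambda>x\<in>carrier G. \<ominus> f x) (t x) = t ((\<lambda>x\<in>carrier G. \<ominus> f x) x)"
      using g[OF t(1) e[OF f t(2)] t(2)] g(1)[OF t(1) t(2) t(2)] memD[OF f t] by simp
  qed
  have eqI: "f = f'" if "f \<in> ?C" "f' \<in> ?C" "\<And>x. x \<in> carrier G \<Longrightarrow> f x = f' x" for f f'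
    using extensionalityI[OF ext[OF that(1)] ext[OF that(2)] that(3)] .
  show "cring (endo_ring ?C)"
  proof (rule cringI)
    show "abelian_group (endo_ring ?C)"
    proof (rule abelian_groupI)
      fix f assume f: "f \<in> carrier (endo_ring ?C)"
      then have f': "f \<in> ?C" by (simp add: endo_ring_def)
      have "(\<lambda>x\<in>carrier G. (\<lambda>x\<in>carrier G. \<ominus> f x) x \<oplus> f x) = (\<lambda>x\<in>carrier G. \<zero>)"
        by (intro restrict_ext) (simp add: e[OF f'] l_neg)
      then show "\<exists>y\<in>carrier (endo_ring ?C). y \<oplus>\<^bsub>endo_ring ?C\<^esub> f = \<zero>\<^bsub>endo_ring ?C\<^esub>"
        using neg[OF f'] by (intro bexI[of _ "\<lambda>x\<in>carrier G. \<ominus> f x"]) (auto simp: endo_ring_def)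
      show "\<zero>\<^bsub>endo_ring ?C\<^esub> \<oplus>\<^bsub>endo_ring ?C\<^esub> f = f"
      proof -
        have "(\<lambda>x\<in>carrier G. (\<lambda>x\<in>carrier G. \<zero>) x \<oplus> f x) = f"
          by (rule eqI[OF add[OF zero f'] f']) (simp add: e[OF f'])
        then show ?thesis unfolding endo_ring_def by simp
      qed
    next
      fix f f' f'' assume "f \<in> carrier (endo_ring ?C)" "f' \<in> carrier (endo_ring ?C)" "f'' \<in> carrier (endo_ring ?C)"
      then have f: "f \<in> ?C" "f' \<in> ?C" "f'' \<in> ?C" by (simp_all add: endo_ring_def)
      show "f \<oplus>\<^bsub>endo_ring ?C\<^esub> f' \<oplus>\<^bsub>endo_ring ?C\<^esub> f'' = f \<oplus>\<^bsub>endo_ring ?C\<^esub> (f' \<oplus>\<^bsub>endo_ring ?C\<^esub> f'')"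
        using e[OF f(1)] e[OF f(2)] e[OF f(3)] by (simp add: endo_ring_def restrict_def fun_eq_iff a_assoc)
    next
      fix f f' assume "f \<in> carrier (endo_ring ?C)" "f' \<in> carrier (endo_ring ?C)"
      then have f: "f \<in> ?C" "f' \<in> ?C" by (simp_all add: endo_ring_def)
      show "f \<oplus>\<^bsub>endo_ring ?C\<^esub> f' = f' \<oplus>\<^bsub>endo_ring ?C\<^esub> f"
        using e[OF f(1)] e[OF f(2)] by (simp add: endo_ring_def restrict_def fun_eq_iff a_comm)
      show "f \<oplus>\<^bsub>endo_ring ?C\<^esub> f' \<in> carrier (endo_ring ?C)"
        using add[OF f] by (simp add: endo_ring_def)
    qed (use zero in \<open>simp_all add: endo_ring_def\<close>)
    show "comm_monoid (endo_ring ?C)"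
    proof (rule comm_monoidI)
      fix f f' assume "f \<in> carrier (endo_ring ?C)" "f' \<in> carrier (endo_ring ?C)"
      then have f: "f \<in> ?C" "f' \<in> ?C" by (simp_all add: endo_ring_def)
      show "f \<otimes>\<^bsub>endo_ring ?C\<^esub> f' \<in> carrier (endo_ring ?C)" using mul[OF f] by (simp add: endo_ring_def)
      show "f \<otimes>\<^bsub>endo_ring ?C\<^esub> f' = f' \<otimes>\<^bsub>endo_ring ?C\<^esub> f"
        using comm[OF f] by (simp add: endo_ring_def restrict_def fun_eq_iff)
      show "\<one>\<^bsub>endo_ring ?C\<^esub> \<otimes>\<^bsub>endo_ring ?C\<^esub> f = f"
      proof -
        have "(\<lambda>x\<in>carrier G. (\<lambda>x\<in>carrier G. x) (f x)) = f"
          by (rule eqI[OF mul[OF one f(1)] f(1)]) (simp add: e[OF f(1)])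
        then show ?thesis unfolding endo_ring_def by simp
      qed
    next
      fix f f' f'' assume "f \<in> carrier (endo_ring ?C)" "f' \<in> carrier (endo_ring ?C)" "f'' \<in> carrier (endo_ring ?C)"
      then have f: "f \<in> ?C" "f' \<in> ?C" "f'' \<in> ?C" by (simp_all add: endo_ring_def)
      show "f \<otimes>\<^bsub>endo_ring ?C\<^esub> f' \<otimes>\<^bsub>endo_ring ?C\<^esub> f'' = f \<otimes>\<^bsub>endo_ring ?C\<^esub> (f' \<otimes>\<^bsub>endo_ring ?C\<^esub> f'')"
        using e[OF f(2)] e[OF f(3)] by (simp add: endo_ring_def restrict_def fun_eq_iff)
    qed (use one in \<open>simp_all add: endo_ring_def\<close>)
    fix f f' f'' assume "f \<in> carrier (endo_ring ?C)" "f' \<in> carrier (endo_ring ?C)" "f'' \<in> carrier (endo_ring ?C)"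
    then have f: "f \<in> ?C" "f' \<in> ?C" "f'' \<in> ?C" by (simp_all add: endo_ring_def)
    show "(f \<oplus>\<^bsub>endo_ring ?C\<^esub> f') \<otimes>\<^bsub>endo_ring ?C\<^esub> f'' =
        f \<otimes>\<^bsub>endo_ring ?C\<^esub> f'' \<oplus>\<^bsub>endo_ring ?C\<^esub> f' \<otimes>\<^bsub>endo_ring ?C\<^esub> f''"
      using e[OF f(3)] by (simp add: endo_ring_def restrict_def fun_eq_iff)
  qed
qed

end

section \<open>The action of polynomials in a connection\<close>

locale connection_module = fg_completion_module k A gr R co M Y
  for k :: "('k, 'x) ring_scheme" and A :: "('k, 'a, 'y) module_scheme" and gr :: "nat \<Rightarrow> 'a set"
    and R :: "('r, 'w) ring_scheme" and co :: "'r \<Rightarrow> nat \<Rightarrow> 'a" and M :: "('r, 'm, 'v) module_scheme"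
    and Y :: "'m set" +
  fixes D :: "'m \<Rightarrow> 'm"
  assumes k_field: "field k" and k_char0: "char_zero k"
    and D_closed [simp, intro]: "x \<in> carrier M \<Longrightarrow> D x \<in> carrier M"
    and D_add: "\<lbrakk>x \<in> carrier M; y \<in> carrier M\<rbrakk> \<Longrightarrow> D (x \<oplus>\<^bsub>M\<^esub> y) = D x \<oplus>\<^bsub>M\<^esub> D y"
    and D_smult: "\<lbrakk>a \<in> carrier R; x \<in> carrier M\<rbrakk> \<Longrightarrow> D (a \<odot>\<^bsub>M\<^esub> x) = a \<odot>\<^bsub>M\<^esub> D x \<oplus>\<^bsub>M\<^esub> der a \<odot>\<^bsub>M\<^esub> x"

sublocale connection_module < Pk: UP_char0_field k "UP k"
  by (intro UP_char0_field.intro UP_char0_field_axioms.intro k_field k_char0)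

context connection_module
begin

lemma D_kap: "\<lbrakk>c \<in> carrier k; x \<in> carrier M\<rbrakk> \<Longrightarrow> D (kap c \<odot>\<^bsub>M\<^esub> x) = kap c \<odot>\<^bsub>M\<^esub> D x"
  by (simp add: D_smult der_kap)

text \<open>Restricted to the carrier, like \<open>Dr\<close>, because endomorphisms are compared as
  functions.\<close>

definition scal :: "'k \<Rightarrow> 'm \<Rightarrow> 'm" where "scal c = (\<lambda>x\<in>carrier M. kap c \<odot>\<^bsub>M\<^esub> x)"

definition Dr :: "'m \<Rightarrow> 'm" where "Dr = (\<lambda>x\<in>carrier M. D x)"

definition ops :: "('m \<Rightarrow> 'm) ring"
  where "ops = L.M.endo_ring (L.M.commutant (L.M.commutant (insert Dr (scal ` carrier k))))"

lemma ops_cring: "cring ops" and Dr_ops: "Dr \<in> carrier ops" and scal_ops: "c \<in> carrier k \<Longrightarrow> scal c \<in> carrier ops"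
proof -
  let ?S = "insert Dr (scal ` carrier k)"
  have D: "Dr \<in> L.M.endos" by (auto simp: L.M.endos_def Dr_def D_add)
  have s: "scal c \<in> L.M.endos" if "c \<in> carrier k" for c
    using that by (auto simp: L.M.endos_def scal_def L.smult_r_distr)
  have ss: "scal c (scal d x) = scal d (scal c x)" if "c \<in> carrier k" "d \<in> carrier k" "x \<in> carrier M" for c d x
    using that kap_central[of c "kap d"] by (simp add: scal_def L.smult_assoc1[symmetric])
  have sD: "scal c (Dr x) = Dr (scal c x)" if "c \<in> carrier k" "x \<in> carrier M" for c x
    using that by (simp add: scal_def Dr_def D_kap)
  have S: "?S \<subseteq> L.M.commutant ?S"
    using D s ss sD by (auto simp: L.M.commutant_def)
  show "cring ops" unfolding ops_def by (rule L.M.bicommutant_cring[OF S])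
  have "?S \<subseteq> carrier ops" using L.M.bicommutant_cring(2)[OF S] by (simp add: ops_def L.M.endo_ring_def)
  then show "Dr \<in> carrier ops" "c \<in> carrier k \<Longrightarrow> scal c \<in> carrier ops" by auto
qed

lemma scal_hom: "scal \<in> ring_hom k ops"
proof (rule ring_hom_memI)
  show "scal c \<in> carrier ops" if "c \<in> carrier k" for c by (rule scal_ops[OF that])
  show "scal (c \<otimes>\<^bsub>k\<^esub> d) = scal c \<otimes>\<^bsub>ops\<^esub> scal d" if "c \<in> carrier k" "d \<in> carrier k" for c d
    using that by (auto simp: ops_def L.M.endo_ring_def scal_def kap_mult L.smult_assoc1 intro!: restrict_ext)
  show "scal (c \<oplus>\<^bsub>k\<^esub> d) = scal c \<oplus>\<^bsub>ops\<^esub> scal d" if "c \<in> carrier k" "d \<in> carrier k" for c d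
    using that by (auto simp: ops_def L.M.endo_ring_def scal_def kap_add L.smult_l_distr intro!: restrict_ext)
  show "scal \<one>\<^bsub>k\<^esub> = \<one>\<^bsub>ops\<^esub>"
    by (auto simp: ops_def L.M.endo_ring_def scal_def kap_one intro!: restrict_ext)
qed

text \<open>This is \<open>p(D)\<close>; the universal property makes it additive and multiplicative
  in \<open>p\<close>.\<close>

definition act :: "(nat \<Rightarrow> 'k) \<Rightarrow> 'm \<Rightarrow> 'm"
  where "act = UnivPoly.eval k ops scal Dr"

lemma UP_pre_univ_prop_scal: "UP_pre_univ_prop k ops scal"
proof -
  interpret ops: cring ops by (rule ops_cring)
  show ?thesis by unfold_locales (rule scal_hom)
qed

abbreviation (input) PK where "PK \<equiv> UP k"

lemma act_hom: "act \<in> ring_hom PK ops"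
  unfolding act_def by (rule UP_pre_univ_prop.eval_ring_hom[OF UP_pre_univ_prop_scal Dr_ops])

lemma ops_endos: "carrier ops \<subseteq> L.M.endos"
  by (auto simp: ops_def L.M.endo_ring_def L.M.commutant_def)

lemma act_closed [simp, intro]: "\<lbrakk>p \<in> carrier PK; x \<in> carrier M\<rbrakk> \<Longrightarrow> act p x \<in> carrier M"
  and act_add_right: "\<lbrakk>p \<in> carrier PK; x \<in> carrier M; y \<in> carrier M\<rbrakk> \<Longrightarrow> act p (x \<oplus>\<^bsub>M\<^esub> y) = act p x \<oplus>\<^bsub>M\<^esub> act p y"
  and act_zero_right [simp]: "p \<in> carrier PK \<Longrightarrow> act p \<zero>\<^bsub>M\<^esub> = \<zero>\<^bsub>M\<^esub>"
  and act_a_inv: "\<lbrakk>p \<in> carrier PK; x \<in> carrier M\<rbrakk> \<Longrightarrow> act p (\<ominus>\<^bsub>M\<^esub> x) = \<ominus>\<^bsub>M\<^esub> act p x"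
  using L.M.endosD(1-4)[of "act p"] ops_endos ring_hom_closed[OF act_hom, of p] by blast+

lemma act_minus_right:
  "\<lbrakk>p \<in> carrier PK; x \<in> carrier M; y \<in> carrier M\<rbrakk> \<Longrightarrow> act p (x \<ominus>\<^bsub>M\<^esub> y) = act p x \<ominus>\<^bsub>M\<^esub> act p y"
  by (simp add: a_minus_def act_add_right act_a_inv)

lemma act_finsum:
  assumes "p \<in> carrier PK" "f \<in> I \<rightarrow> carrier M"
  shows "act p (\<Oplus>\<^bsub>M\<^esub>i\<in>I. f i) = (\<Oplus>\<^bsub>M\<^esub>i\<in>I. act p (f i))"
  using assms(2)
proof (induction I rule: infinite_finite_induct)
  case (insert i I)
  then show ?case using assms(1) by (simp add: Pi_def act_add_right)
qed (use assms in auto)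

lemma act_add: "\<lbrakk>p \<in> carrier PK; q \<in> carrier PK; x \<in> carrier M\<rbrakk> \<Longrightarrow> act (p \<oplus>\<^bsub>PK\<^esub> q) x = act p x \<oplus>\<^bsub>M\<^esub> act q x"
  using ring_hom_add[OF act_hom, of p q] by (simp add: ops_def L.M.endo_ring_def)

lemma act_mult: "\<lbrakk>p \<in> carrier PK; q \<in> carrier PK; x \<in> carrier M\<rbrakk> \<Longrightarrow> act (p \<otimes>\<^bsub>PK\<^esub> q) x = act p (act q x)"
  using ring_hom_mult[OF act_hom, of p q] by (simp add: ops_def L.M.endo_ring_def)

lemma act_comm: "\<lbrakk>p \<in> carrier PK; q \<in> carrier PK; x \<in> carrier M\<rbrakk> \<Longrightarrow> act p (act q x) = act q (act p x)"
  by (simp add: act_mult[symmetric] Pk.P.m_comm)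

lemma act_one [simp]: "x \<in> carrier M \<Longrightarrow> act \<one>\<^bsub>PK\<^esub> x = x"
  using ring_hom_one[OF act_hom] by (simp add: ops_def L.M.endo_ring_def)

lemma act_const: "\<lbrakk>c \<in> carrier k; x \<in> carrier M\<rbrakk> \<Longrightarrow> act (up_ring.monom PK c 0) x = kap c \<odot>\<^bsub>M\<^esub> x"
  unfolding act_def using UP_pre_univ_prop.eval_const[OF UP_pre_univ_prop_scal Dr_ops, of c] by (simp add: scal_def)

lemma act_X: "x \<in> carrier M \<Longrightarrow> act (up_ring.monom PK \<one>\<^bsub>k\<^esub> 1) x = D x"
  unfolding act_def using UP_pre_univ_prop.eval_monom1[OF UP_pre_univ_prop_scal Dr_ops] by (simp add: Dr_def)

text \<open>These are the \<open>k\<close>-subspaces of \<open>M\<close>. Invariance under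
  \<open>D\<close> is kept apart, as the subspaces in the elimination argument need not have
  it.\<close>

definition stable :: "'m set \<Rightarrow> bool"
  where "stable H \<longleftrightarrow> additive_subgroup H M \<and> (\<forall>c\<in>carrier k. \<forall>x\<in>H. kap c \<odot>\<^bsub>M\<^esub> x \<in> H)"

lemma act_stable:
  assumes H: "stable H" "\<And>x. x \<in> H \<Longrightarrow> D x \<in> H" and "p \<in> carrier PK" "x \<in> H"
  shows "act p x \<in> H"
  using assms(3,4)
proof (induction p arbitrary: x rule: Pk.UP_induct)
  case (const a)
  have "H \<subseteq> carrier M" using H(1) additive_subgroup.a_subset by (auto simp: stable_def)
  with const show ?case using H(1) by (simp add: stable_def act_const subset_iff)
next
  case (add p q)
  have sub: "additive_subgroup H M" using H(1) by (simp add: stable_def)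
  have "x \<in> carrier M" using additive_subgroup.a_subset[OF sub] add.prems by blast
  then show ?case using add additive_subgroup.a_closed[OF sub] by (simp add: act_add)
next
  case (mult_X p)
  then have "x \<in> carrier M" using H(1) additive_subgroup.a_subset by (auto simp: stable_def)
  then show ?case using mult_X H(2) by (simp add: act_mult act_X del: One_nat_def)
qed

lemma D_zero: "D \<zero>\<^bsub>M\<^esub> = \<zero>\<^bsub>M\<^esub>"
  using act_X[of "\<zero>\<^bsub>M\<^esub>"] by simp

lemma D_minus: "\<lbrakk>x \<in> carrier M; y \<in> carrier M\<rbrakk> \<Longrightarrow> D (x \<ominus>\<^bsub>M\<^esub> y) = D x \<ominus>\<^bsub>M\<^esub> D y"
  using act_X act_minus_right[of "up_ring.monom PK \<one>\<^bsub>k\<^esub> 1" x y] by simp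

text \<open>The derivation does not lower orders, so both terms of the Leibniz rule stay in
  \<open>Fil n\<close>.\<close>

lemma D_Fil:
  assumes "x \<in> Fil n" shows "D x \<in> Fil n"
proof -
  have "additive_subgroup {x \<in> Fil n. D x \<in> Fil n} M"
  proof (rule L.M.additive_subgroup_by_minus)
    show "x \<ominus>\<^bsub>M\<^esub> y \<in> {x \<in> Fil n. D x \<in> Fil n}"
      if "x \<in> {x \<in> Fil n. D x \<in> Fil n}" "y \<in> {x \<in> Fil n. D x \<in> Fil n}" for x y
      using that Fil_carrier[of x n] Fil_carrier[of y n] L.M.subgroup_minus_closed[OF Fil_subgroup]
      by (simp add: D_minus)
  qed (use Fil_carrier additive_subgroup.zero_closed[OF Fil_subgroup] in \<open>auto simp: D_zero\<close>)
  moreover obtain r where r: "x = L.lincomb r id Y" "\<forall>y\<in>Y. r y \<in> fl n"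
    using assms by (auto simp: Fil_def fil_def)
  moreover have "r y \<odot>\<^bsub>M\<^esub> id y \<in> {x \<in> Fil n. D x \<in> Fil n}" if y: "y \<in> Y" for y
  proof -
    have y': "y \<in> carrier M" "r y \<in> carrier R" "r y \<in> fl n" using y Y(2) r(2) fl_carrier by auto
    have "r y \<odot>\<^bsub>M\<^esub> D y \<in> Fil n" "der (r y) \<odot>\<^bsub>M\<^esub> y \<in> Fil n" "r y \<odot>\<^bsub>M\<^esub> y \<in> Fil n"
      using y' der_fl by (auto intro: Fil_smult_right)
    then show ?thesis using y' additive_subgroup.a_closed[OF Fil_subgroup] by (simp add: D_smult)
  qed
  ultimately have "x \<in> {x \<in> Fil n. D x \<in> Fil n}"
    unfolding r(1) L.lincomb_def by (intro L.M.subgroup_finsum_closed) auto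
  then show ?thesis by simp
qed

lemma Fil_stable: "stable (Fil n)"
  using Fil_subgroup Fil_smult_left by (auto simp: stable_def)

lemma act_Fil: "\<lbrakk>p \<in> carrier PK; x \<in> Fil n\<rbrakk> \<Longrightarrow> act p x \<in> Fil n"
  by (rule act_stable[OF Fil_stable D_Fil])

text \<open>The commutation relation \<open>p(D) a = a p(D + i)\<close> for \<open>a \<in> A\<^sub>i\<close>.\<close>

lemma act_emb:
  assumes a: "a \<in> gr i" and "p \<in> carrier PK" "x \<in> carrier M"
  shows "act p (emb a \<odot>\<^bsub>M\<^esub> x) = emb a \<odot>\<^bsub>M\<^esub> act (Pk.shift (int i) p) x"
  using assms(2,3)
proof (induction p arbitrary: x rule: Pk.UP_induct)
  have ac: "emb a \<in> carrier R" using a gr_carrier by blast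
  case (const c)
  then show ?case
    using ac kap_central[of c "emb a"] by (simp add: act_const L.smult_assoc1[symmetric])
next
  case (add p q)
  then show ?case using a gr_carrier[OF a] by (simp add: act_add L.smult_r_distr)
next
  case (mult_X p)
  let ?X = "up_ring.monom PK \<one>\<^bsub>k\<^esub> 1"
  have X: "?X \<in> carrier PK" by simp
  have ac: "emb a \<in> carrier R" using a gr_carrier by blast
  have ic: "Pk.int_const (int i) \<in> carrier k" by simp
  have ki: "kap (Pk.int_const (int i)) = [i] \<cdot>\<^bsub>R\<^esub> \<one>\<^bsub>R\<^esub>" by (simp add: Pk.int_const_nat kap_nat)
  \<comment> \<open>Integers are central, so in the Leibniz term \<open>i a x\<close> the scalar can
    be moved to the right of \<open>a\<close>, where it turns \<open>D\<close> into
    \<open>D + i\<close>.\<close>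
  have "[i] \<cdot>\<^bsub>R\<^esub> emb a = emb a \<otimes>\<^bsub>R\<^esub> kap (Pk.int_const (int i))"
    unfolding ki using ac by (simp add: S.add_pow_rdistr)
  then have "D (emb a \<odot>\<^bsub>M\<^esub> x) = emb a \<odot>\<^bsub>M\<^esub> (D x \<oplus>\<^bsub>M\<^esub> kap (Pk.int_const (int i)) \<odot>\<^bsub>M\<^esub> x)"
    using mult_X ac ic by (simp add: D_smult der_emb[OF a] L.smult_r_distr L.smult_assoc1)
  also have "D x \<oplus>\<^bsub>M\<^esub> kap (Pk.int_const (int i)) \<odot>\<^bsub>M\<^esub> x = act (Pk.shift (int i) ?X) x"
    using mult_X ic by (simp add: Pk.shift_X act_add act_X act_const del: One_nat_def)
  finally have "act (p \<otimes>\<^bsub>PK\<^esub> ?X) (emb a \<odot>\<^bsub>M\<^esub> x) = act p (emb a \<odot>\<^bsub>M\<^esub> act (Pk.shift (int i) ?X) x)"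
    using mult_X ac X by (simp add: act_mult act_X del: One_nat_def)
  also have "\<dots> = emb a \<odot>\<^bsub>M\<^esub> act (Pk.shift (int i) p) (act (Pk.shift (int i) ?X) x)"
    by (rule mult_X.IH) (use mult_X X in auto)
  also have "\<dots> = emb a \<odot>\<^bsub>M\<^esub> act (Pk.shift (int i) (p \<otimes>\<^bsub>PK\<^esub> ?X)) x"
    using mult_X X by (simp add: act_mult del: One_nat_def)
  finally show ?case .
qed

end

section \<open>Decomposition into generalized eigenspaces\<close>

context connection_module
begin

lemma act_minus:
  assumes "p \<in> carrier PK" "q \<in> carrier PK" "x \<in> carrier M"
  shows "act (p \<ominus>\<^bsub>PK\<^esub> q) x = act p x \<ominus>\<^bsub>M\<^esub> act q x"
proof -
  have "act p x = act (p \<ominus>\<^bsub>PK\<^esub> q) x \<oplus>\<^bsub>M\<^esub> act q x"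
    using assms act_add[of "p \<ominus>\<^bsub>PK\<^esub> q" q x] Pk.P.minus_add_cancel[of p q] by simp
  then show ?thesis
    using assms L.M.add_minus_cancel_right[of "act (p \<ominus>\<^bsub>PK\<^esub> q) x" "act q x"] by simp
qed

lemma stable_subgroup: "stable H \<Longrightarrow> additive_subgroup H M"
  and stable_carrier: "\<lbrakk>stable H; x \<in> H\<rbrakk> \<Longrightarrow> x \<in> carrier M"
  and stable_kap: "\<lbrakk>stable H; c \<in> carrier k; x \<in> H\<rbrakk> \<Longrightarrow> kap c \<odot>\<^bsub>M\<^esub> x \<in> H"
  using additive_subgroup.a_subset by (auto simp: stable_def)

definition extend :: "'m set \<Rightarrow> 'm \<Rightarrow> 'm set"
  where "extend G z = {y \<oplus>\<^bsub>M\<^esub> kap c \<odot>\<^bsub>M\<^esub> z | y c. y \<in> G \<and> c \<in> carrier k}"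

lemma extend_stable:
  assumes G: "stable G" and z: "z \<in> carrier M"
  shows "stable (extend G z)" "G \<subseteq> extend G z" "z \<in> extend G z"
proof -
  note sub = stable_subgroup[OF G] and car = stable_carrier[OF G]
  have "additive_subgroup (extend G z) M"
  proof (rule L.M.additive_subgroup_by_minus)
    show "extend G z \<subseteq> carrier M" using car z by (auto simp: extend_def)
    have "\<zero>\<^bsub>M\<^esub> = \<zero>\<^bsub>M\<^esub> \<oplus>\<^bsub>M\<^esub> kap \<zero>\<^bsub>k\<^esub> \<odot>\<^bsub>M\<^esub> z" using z by (simp add: kap_def)
    then show "\<zero>\<^bsub>M\<^esub> \<in> extend G z"
      unfolding extend_def using additive_subgroup.zero_closed[OF sub] by blast
    fix x y assume "x \<in> extend G z" "y \<in> extend G z"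
    then obtain u c v d where *: "x = u \<oplus>\<^bsub>M\<^esub> kap c \<odot>\<^bsub>M\<^esub> z" "u \<in> G" "c \<in> carrier k"
      "y = v \<oplus>\<^bsub>M\<^esub> kap d \<odot>\<^bsub>M\<^esub> z" "v \<in> G" "d \<in> carrier k" by (auto simp: extend_def)
    have "x \<ominus>\<^bsub>M\<^esub> y = (u \<ominus>\<^bsub>M\<^esub> v) \<oplus>\<^bsub>M\<^esub> kap (c \<ominus>\<^bsub>k\<^esub> d) \<odot>\<^bsub>M\<^esub> z"
      using * car z by (simp add: L.M.add_minus_add L.smult_l_diff kap_minus)
    then show "x \<ominus>\<^bsub>M\<^esub> y \<in> extend G z"
      unfolding extend_def using * L.M.subgroup_minus_closed[OF sub] R.minus_closed by blast
  qed
  moreover have "kap c \<odot>\<^bsub>M\<^esub> x \<in> extend G z" if c: "c \<in> carrier k" "x \<in> extend G z" for c x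
  proof -
    obtain u d where *: "x = u \<oplus>\<^bsub>M\<^esub> kap d \<odot>\<^bsub>M\<^esub> z" "u \<in> G" "d \<in> carrier k" using c by (auto simp: extend_def)
    then have "kap c \<odot>\<^bsub>M\<^esub> x = kap c \<odot>\<^bsub>M\<^esub> u \<oplus>\<^bsub>M\<^esub> kap (c \<otimes>\<^bsub>k\<^esub> d) \<odot>\<^bsub>M\<^esub> z"
      using c car z by (simp add: L.smult_r_distr kap_mult L.smult_assoc1)
    moreover have "c \<otimes>\<^bsub>k\<^esub> d \<in> carrier k" using c * by simp
    ultimately show ?thesis
      unfolding extend_def using * stable_kap[OF G c(1)] by blast
  qed
  ultimately show "stable (extend G z)" by (simp add: stable_def)
  show "G \<subseteq> extend G z"
  proof
    fix x assume x: "x \<in> G"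
    then have "x = x \<oplus>\<^bsub>M\<^esub> kap \<zero>\<^bsub>k\<^esub> \<odot>\<^bsub>M\<^esub> z" using car z by (simp add: kap_def)
    then show "x \<in> extend G z" unfolding extend_def using x by blast
  qed
  have "z = \<zero>\<^bsub>M\<^esub> \<oplus>\<^bsub>M\<^esub> kap \<one>\<^bsub>k\<^esub> \<odot>\<^bsub>M\<^esub> z" using z by (simp add: kap_one)
  then show "z \<in> extend G z"
    unfolding extend_def using additive_subgroup.zero_closed[OF sub] by blast
qed

text \<open>Instead of counting dimensions: if \<open>p(D) x\<close> lies in \<open>G + k z\<close> for polynomials \<open>p\<close> of
  arbitrarily large degree, then eliminating \<open>z\<close> between two of them of different degrees shows
  the same for \<open>G\<close>.\<close>

lemma unbounded_degree_annihilator: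
  assumes "finite Z" "Z \<subseteq> carrier M" "stable G" "x \<in> carrier M"
    and "\<And>H. \<lbrakk>stable H; G \<subseteq> H; Z \<subseteq> H\<rbrakk> \<Longrightarrow> carrier M \<subseteq> H"
  shows "\<exists>p\<in>carrier PK. deg k p \<ge> n \<and> act p x \<in> G"
  using assms(1-3,5)
proof (induction Z arbitrary: G n rule: finite_induct)
  case empty
  \<comment> \<open>With no vector left to adjoin, \<open>G\<close> is all of \<open>M\<close>, and
    any polynomial of large degree serves.\<close>
  have "carrier M \<subseteq> G" using empty by blast
  moreover have "deg k (up_ring.monom PK \<one>\<^bsub>k\<^esub> n) = n" using Pk.deg_monom[of "\<one>\<^bsub>k\<^esub>" n] by simp
  ultimately show ?case
    using assms(4) by (intro bexI[of _ "up_ring.monom PK \<one>\<^bsub>k\<^esub> n"]) auto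
next
  case (insert z Z)
  note G = insert.prems(2)
  have z: "z \<in> carrier M" using insert.prems by simp
  note car = stable_carrier[OF G]
  have IH: "\<exists>p\<in>carrier PK. deg k p \<ge> n \<and> act p x \<in> extend G z" for n
  proof (rule insert.IH)
    show "Z \<subseteq> carrier M" using insert.prems by simp
    show "stable (extend G z)" by (rule extend_stable(1)[OF G z])
    show "carrier M \<subseteq> H" if "stable H" "extend G z \<subseteq> H" "Z \<subseteq> H" for H
      using insert.prems(3)[OF that(1)] that extend_stable(2,3)[OF G z] by blast
  qed
  obtain p where p: "p \<in> carrier PK" "deg k p \<ge> n" "act p x \<in> extend G z" using IH by blast
  \<comment> \<open>The strict inequality of degrees keeps the leading term of \<open>q\<close> from
    cancelling in \<open>?r\<close>.\<close>
  obtain q where q: "q \<in> carrier PK" "deg k q \<ge> Suc (deg k p)" "act q x \<in> extend G z" using IH by blast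
  obtain u c where u: "act p x = u \<oplus>\<^bsub>M\<^esub> kap c \<odot>\<^bsub>M\<^esub> z" "u \<in> G" "c \<in> carrier k"
    using p(3) by (auto simp: extend_def)
  obtain v d where v: "act q x = v \<oplus>\<^bsub>M\<^esub> kap d \<odot>\<^bsub>M\<^esub> z" "v \<in> G" "d \<in> carrier k"
    using q(3) by (auto simp: extend_def)
  show ?case
  proof (cases "c = \<zero>\<^bsub>k\<^esub>")
    case True
    then have "act p x = u" using u z car by (simp add: kap_def)
    then show ?thesis using p u by auto
  next
    case False
    let ?C = "up_ring.monom PK c 0" and ?D = "up_ring.monom PK d 0"
    let ?r = "?C \<otimes>\<^bsub>PK\<^esub> q \<ominus>\<^bsub>PK\<^esub> ?D \<otimes>\<^bsub>PK\<^esub> p"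
    have CD: "?C \<in> carrier PK" "?D \<in> carrier PK" using u v by auto
    have r: "?r \<in> carrier PK" using CD p q by simp
    let ?n = "deg k q"
    have "up_ring.coeff PK ?r ?n = c \<otimes>\<^bsub>k\<^esub> up_ring.coeff PK q ?n \<ominus>\<^bsub>k\<^esub> d \<otimes>\<^bsub>k\<^esub> up_ring.coeff PK p ?n"
      using CD p q u v Pk.coeff_mult_const[OF q(1) u(3), of ?n] Pk.coeff_mult_const[OF p(1) v(3), of ?n]
      by (simp add: Pk.coeff_minus Pk.P.m_comm[of ?C q] Pk.P.m_comm[of ?D p] del: Pk.coeff_mult)
    also have "up_ring.coeff PK p ?n = \<zero>\<^bsub>k\<^esub>" using q(2) by (intro Pk.deg_aboveD[OF _ p(1)]) auto
    finally have "up_ring.coeff PK ?r ?n = c \<otimes>\<^bsub>k\<^esub> up_ring.coeff PK q ?n"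
      using u v q by simp
    moreover have "up_ring.coeff PK q ?n \<noteq> \<zero>\<^bsub>k\<^esub>"
      using q Pk.lcoeff_nonzero_deg[of q] by simp
    ultimately have "up_ring.coeff PK ?r ?n \<noteq> \<zero>\<^bsub>k\<^esub>"
      using False u(3) q(1) Pk.R.integral_iff[of c "up_ring.coeff PK q ?n"] by simp
    then have "?n \<le> deg k ?r" by (intro Pk.deg_belowI[OF _ r])
    moreover have "act ?r x \<in> G"
    proof -
      let ?k = "kap (d \<otimes>\<^bsub>k\<^esub> c) \<odot>\<^bsub>M\<^esub> z"
      have "act ?r x = kap c \<odot>\<^bsub>M\<^esub> act q x \<ominus>\<^bsub>M\<^esub> kap d \<odot>\<^bsub>M\<^esub> act p x"
        using act_minus[of "?C \<otimes>\<^bsub>PK\<^esub> q" "?D \<otimes>\<^bsub>PK\<^esub> p"] CD p q u v assms(4) by (simp add: act_mult act_const)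
      also have "kap c \<odot>\<^bsub>M\<^esub> act q x = kap c \<odot>\<^bsub>M\<^esub> v \<oplus>\<^bsub>M\<^esub> ?k"
        unfolding v(1) using u v car z R.m_comm[of d c]
        by (simp add: L.smult_r_distr kap_mult[symmetric] L.smult_assoc1[symmetric])
      also have "kap d \<odot>\<^bsub>M\<^esub> act p x = kap d \<odot>\<^bsub>M\<^esub> u \<oplus>\<^bsub>M\<^esub> ?k"
        unfolding u(1) using u v car z
        by (simp add: L.smult_r_distr kap_mult[symmetric] L.smult_assoc1[symmetric])
      also have "(kap c \<odot>\<^bsub>M\<^esub> v \<oplus>\<^bsub>M\<^esub> ?k) \<ominus>\<^bsub>M\<^esub> (kap d \<odot>\<^bsub>M\<^esub> u \<oplus>\<^bsub>M\<^esub> ?k) = kap c \<odot>\<^bsub>M\<^esub> v \<ominus>\<^bsub>M\<^esub> kap d \<odot>\<^bsub>M\<^esub> u"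
        using u v car z by (simp add: L.M.add_minus_add L.M.minus_eq_zero_iff[THEN iffD2])
      also have "\<dots> \<in> G"
        using u v stable_kap[OF G] L.M.subgroup_minus_closed[OF stable_subgroup[OF G]] by blast
      finally show ?thesis .
    qed
    ultimately show ?thesis using r p(2) q(2) by (intro bexI[of _ ?r]) auto
  qed
qed

text \<open>Coefficients are scalars modulo \<open>fl 1\<close>, so \<open>M / Fil 1\<close> is
  spanned over \<open>k\<close> by the finite set \<open>Y\<close>. Each vector of \<open>Y\<close>
  has its own nonzero annihilating polynomial; the product kills all of \<open>Y\<close> and, by
  linearity, the whole quotient.\<close>

lemma annihilator_mod_Fil_1: "\<exists>f\<in>carrier PK. f \<noteq> \<zero>\<^bsub>PK\<^esub> \<and> (\<forall>x\<in>carrier M. act f x \<in> Fil 1)"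
proof -
  have gen: "carrier M \<subseteq> H" if H: "stable H" "Fil 1 \<subseteq> H" "Y \<subseteq> H" for H
  proof
    fix x assume "x \<in> carrier M"
    then obtain r where r: "r \<in> Y \<rightarrow> carrier R" "x = L.lincomb r id Y" using Y(3) by auto
    have "r y \<odot>\<^bsub>M\<^esub> id y \<in> H" if y: "y \<in> Y" for y
    proof -
      have y': "r y \<in> carrier R" "y \<in> carrier M" "y \<in> H" using r y Y(2) H(3) by auto
      obtain c where c: "c \<in> carrier k" "r y \<ominus>\<^bsub>R\<^esub> kap c \<in> fl 1" using kap_approx[OF y'(1)] by blast
      have "kap c \<odot>\<^bsub>M\<^esub> y \<in> H" by (rule stable_kap[OF H(1) c(1) y'(3)])
      moreover have "(r y \<ominus>\<^bsub>R\<^esub> kap c) \<odot>\<^bsub>M\<^esub> y \<in> H" using Fil_smult_right[OF c(2) y'(2)] H(2) by blast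
      moreover have "r y \<odot>\<^bsub>M\<^esub> y = kap c \<odot>\<^bsub>M\<^esub> y \<oplus>\<^bsub>M\<^esub> (r y \<ominus>\<^bsub>R\<^esub> kap c) \<odot>\<^bsub>M\<^esub> y"
        using c y' by (simp add: L.smult_l_diff L.M.add_minus_cancel_left)
      ultimately show ?thesis
        using additive_subgroup.a_closed[OF stable_subgroup[OF H(1)]] by simp
    qed
    then show "x \<in> H"
      unfolding r(2) L.lincomb_def by (intro L.M.subgroup_finsum_closed[OF stable_subgroup[OF H(1)]])
  qed
  have single: "\<exists>p\<in>carrier PK. p \<noteq> \<zero>\<^bsub>PK\<^esub> \<and> act p x \<in> Fil 1" if x: "x \<in> carrier M" for x
  proof -
    \<comment> \<open>Positive degree is asked for in order to exclude the zero polynomial.\<close>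
    obtain p where "p \<in> carrier PK" "deg k p \<ge> 1" "act p x \<in> Fil 1"
      using unbounded_degree_annihilator[OF Y(1,2) Fil_stable x gen] by blast
    then show ?thesis by (intro bexI[of _ p]) auto
  qed
  have "\<exists>f\<in>carrier PK. f \<noteq> \<zero>\<^bsub>PK\<^esub> \<and> (\<forall>y\<in>Z. act f y \<in> Fil 1)" if "finite Z" "Z \<subseteq> carrier M" for Z
    using that
  proof (induction Z rule: finite_induct)
    case empty
    then show ?case using Pk.UP_one_not_zero by (intro bexI[of _ "\<one>\<^bsub>PK\<^esub>"]) auto
  next
    case (insert z Z)
    then obtain f where f: "f \<in> carrier PK" "f \<noteq> \<zero>\<^bsub>PK\<^esub>" "\<forall>y\<in>Z. act f y \<in> Fil 1" by auto
    obtain p where p: "p \<in> carrier PK" "p \<noteq> \<zero>\<^bsub>PK\<^esub>" "act p z \<in> Fil 1"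
      using single[of z] insert.prems by blast
    have "f \<otimes>\<^bsub>PK\<^esub> p \<noteq> \<zero>\<^bsub>PK\<^esub>" using Pk.UP_integral[of f p] f p by blast
    moreover have "act (f \<otimes>\<^bsub>PK\<^esub> p) y \<in> Fil 1" if y: "y \<in> insert z Z" for y
    proof (cases "y = z")
      case True
      then show ?thesis using f p insert.prems by (simp add: act_mult act_Fil)
    next
      case False
      then have "y \<in> Z" "y \<in> carrier M" using y insert.prems by auto
      then show ?thesis using f p by (simp add: act_mult act_comm[of f p] act_Fil)
    qed
    ultimately show ?case using f p by (intro bexI[of _ "f \<otimes>\<^bsub>PK\<^esub> p"]) auto
  qed
  from this[OF Y(1,2)] obtain f where f: "f \<in> carrier PK" "f \<noteq> \<zero>\<^bsub>PK\<^esub>" "\<forall>y\<in>Y. act f y \<in> Fil 1" by auto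
  let ?H = "{x \<in> carrier M. act f x \<in> Fil 1}"
  have "carrier M \<subseteq> ?H"
  proof (rule gen)
    have "additive_subgroup ?H M"
    proof (rule L.M.additive_subgroup_by_minus)
      show "x \<ominus>\<^bsub>M\<^esub> y \<in> ?H" if "x \<in> ?H" "y \<in> ?H" for x y
        using that f L.M.subgroup_minus_closed[OF Fil_subgroup] by (simp add: act_minus_right)
    qed (use f additive_subgroup.zero_closed[OF Fil_subgroup] in auto)
    moreover have "kap c \<odot>\<^bsub>M\<^esub> x \<in> ?H" if "c \<in> carrier k" "x \<in> ?H" for c x
    proof -
      have "act f (kap c \<odot>\<^bsub>M\<^esub> x) = kap c \<odot>\<^bsub>M\<^esub> act f x"
        using that f act_comm[of f "up_ring.monom PK c 0" x] by (simp add: act_const)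
      then show ?thesis using that Fil_smult_left by simp
    qed
    ultimately show "stable ?H" by (simp add: stable_def)
    show "Fil 1 \<subseteq> ?H" using Fil_carrier act_Fil[OF f(1)] by auto
    show "Y \<subseteq> ?H" using Y(2) f by auto
  qed
  then show ?thesis using f by blast
qed

end

section \<open>Primary components of \<open>D\<close> modulo the filtration\<close>

context connection_module
begin

text \<open>Fixed by choice, so that all degrees below refer to the same \<open>h\<close>.\<close>

definition base :: "nat \<Rightarrow> 'k"
  where "base = (SOME h. h \<in> carrier PK \<and> (\<forall>i. i \<noteq> 0 \<longrightarrow> Pk.P.comaximal h (Pk.shift i h)) \<and>
    (\<exists>s\<in>Pk.shift_products h. \<forall>x\<in>carrier M. act s x \<in> Fil 1))"

lemma
  shows base_closed [simp]: "base \<in> carrier PK"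
    and base_comaximal: "i \<noteq> 0 \<Longrightarrow> Pk.P.comaximal base (Pk.shift i base)"
    and base_product: "\<exists>s\<in>Pk.shift_products base. \<forall>x\<in>carrier M. act s x \<in> Fil 1"
proof -
  obtain f where f: "f \<in> carrier PK" "f \<noteq> \<zero>\<^bsub>PK\<^esub>" "\<forall>x\<in>carrier M. act f x \<in> Fil 1"
    using annihilator_mod_Fil_1 by blast
  obtain h s where h: "h \<in> carrier PK" "\<forall>i. i \<noteq> 0 \<longrightarrow> Pk.P.comaximal h (Pk.shift i h)"
    "s \<in> Pk.shift_products h" "f divides\<^bsub>PK\<^esub> s"
    using Pk.shift_coprime_base[OF f(1,2)] by blast
  obtain u where u: "u \<in> carrier PK" "s = f \<otimes>\<^bsub>PK\<^esub> u" using h(4) by (auto simp: factor_def)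
  have "\<forall>x\<in>carrier M. act s x \<in> Fil 1" using f u by (simp add: act_mult)
  then have "\<exists>h. h \<in> carrier PK \<and> (\<forall>i. i \<noteq> 0 \<longrightarrow> Pk.P.comaximal h (Pk.shift i h)) \<and>
    (\<exists>s\<in>Pk.shift_products h. \<forall>x\<in>carrier M. act s x \<in> Fil 1)" using h by blast
  then have "base \<in> carrier PK \<and> (\<forall>i. i \<noteq> 0 \<longrightarrow> Pk.P.comaximal base (Pk.shift i base)) \<and>
    (\<exists>s\<in>Pk.shift_products base. \<forall>x\<in>carrier M. act s x \<in> Fil 1)"
    unfolding base_def by (rule someI_ex)
  then show "base \<in> carrier PK" "i \<noteq> 0 \<Longrightarrow> Pk.P.comaximal base (Pk.shift i base)"
    "\<exists>s\<in>Pk.shift_products base. \<forall>x\<in>carrier M. act s x \<in> Fil 1" by blast+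
qed

text \<open>The sign is such that \<open>H l\<close> acts as \<open>h(D - l)\<close>, and
  multiplication by an element of \<open>A_i\<close> raises the index by \<open>i\<close>.\<close>

definition H :: "int \<Rightarrow> nat \<Rightarrow> 'k" where "H l = Pk.shift (- l) base"

lemma H_closed [simp]: "H l \<in> carrier PK"
  by (simp add: H_def)

lemma H_pow_closed [simp]: "H l [^]\<^bsub>PK\<^esub> (e::nat) \<in> carrier PK"
  by (rule Pk.P.nat_pow_closed[OF H_closed])

lemma shift_H: "Pk.shift i (H l) = H (l - i)"
  by (simp add: H_def Pk.shift_shift algebra_simps)

lemma H_comaximal:
  assumes "i \<noteq> j" shows "Pk.P.comaximal (H i [^]\<^bsub>PK\<^esub> (e::nat)) (H j [^]\<^bsub>PK\<^esub> (e'::nat))"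
proof -
  have "Pk.P.comaximal (Pk.shift (- i) base) (Pk.shift (- i) (Pk.shift (i - j) base))"
    using assms by (intro Pk.shift_comaximal[OF base_closed Pk.shift_closed[OF base_closed]] base_comaximal) simp
  then have "Pk.P.comaximal (H i) (H j)" by (simp add: H_def Pk.shift_shift)
  then have "Pk.P.comaximal (H i [^]\<^bsub>PK\<^esub> e) (H j)" by (rule Pk.P.comaximal_pow_left[OF H_closed H_closed])
  then have "Pk.P.comaximal (H j) (H i [^]\<^bsub>PK\<^esub> e)" by (rule Pk.P.comaximal_sym[OF H_pow_closed H_closed])
  then have "Pk.P.comaximal (H j [^]\<^bsub>PK\<^esub> e') (H i [^]\<^bsub>PK\<^esub> e)"
    by (rule Pk.P.comaximal_pow_left[OF H_closed H_pow_closed])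
  then show ?thesis by (rule Pk.P.comaximal_sym[OF H_pow_closed H_pow_closed])
qed

text \<open>Up to \<open>Fil (n + 1)\<close>, an element of \<open>Fil n\<close> is a sum of
  products \<open>a y\<close> with \<open>a\<close> of degree \<open>n\<close>. The annihilator of
  \<open>M / Fil 1\<close>, shifted by \<open>- n\<close>, becomes unshifted when it passes through
  \<open>a\<close>, and so takes \<open>Fil n\<close> into \<open>Fil (n + 1)\<close>.\<close>

lemma nilpotent_mod_Fil: "\<exists>s\<in>Pk.shift_products base. \<forall>x\<in>carrier M. act s x \<in> Fil n"
proof (induction n)
  case 0
  show ?case by (intro bexI[of _ "\<one>\<^bsub>PK\<^esub>"] Pk.shift_products.one) (simp add: Fil_0)
next
  case (Suc n)
  then obtain s where s: "s \<in> Pk.shift_products base" "\<forall>x\<in>carrier M. act s x \<in> Fil n" by blast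
  obtain s1 where s1: "s1 \<in> Pk.shift_products base" "\<forall>x\<in>carrier M. act s1 x \<in> Fil 1"
    using base_product by blast
  define t where "t = Pk.shift (- int n) s1"
  have sc: "s \<in> carrier PK" "s1 \<in> carrier PK" "t \<in> carrier PK"
    using s s1 Pk.shift_products_closed by (auto simp: t_def)
  have "act t x \<in> Fil (Suc n)" if x: "x \<in> Fil n" for x
  proof -
    obtain r where r: "x = L.lincomb r id Y" "\<forall>y\<in>Y. r y \<in> fl n"
      using x by (auto simp: Fil_def fil_def)
    have rc: "y \<in> Y \<Longrightarrow> r y \<in> carrier R" for y using r fl_carrier by blast
    have "act t x = (\<Oplus>\<^bsub>M\<^esub>y\<in>Y. act t (r y \<odot>\<^bsub>M\<^esub> id y))"
      unfolding r(1) L.lincomb_def using sc rc Y(2) by (intro act_finsum) auto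
    also have "\<dots> \<in> Fil (Suc n)"
    proof (rule L.M.subgroup_finsum_closed[OF Fil_subgroup])
      fix y assume y: "y \<in> Y"
      then have y': "y \<in> carrier M" "r y \<in> carrier R" "r y \<in> fl n" using Y(2) rc r by auto
      \<comment> \<open>Modulo \<open>fl (Suc n)\<close> the coefficient is its leading component,
        and to homogeneous elements the commutation relation applies.\<close>
      let ?a = "co (r y) n"
      have a: "?a \<in> gr n" "emb ?a \<in> carrier R" using y' by auto
      have e: "emb ?a \<in> fl n" by (rule emb_gr_in_fl[OF a(1)])
      have d: "(r y \<ominus>\<^bsub>R\<^esub> emb ?a) \<odot>\<^bsub>M\<^esub> y \<in> Fil (Suc n)"
        by (rule Fil_smult_right[OF leading_diff[OF y'(3)] y'(1)])
      have "r y \<odot>\<^bsub>M\<^esub> y = emb ?a \<odot>\<^bsub>M\<^esub> y \<oplus>\<^bsub>M\<^esub> (r y \<ominus>\<^bsub>R\<^esub> emb ?a) \<odot>\<^bsub>M\<^esub> y"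
        using a y' by (simp add: L.smult_l_diff L.M.add_minus_cancel_left)
      then have "act t (r y \<odot>\<^bsub>M\<^esub> y) = act t (emb ?a \<odot>\<^bsub>M\<^esub> y) \<oplus>\<^bsub>M\<^esub> act t ((r y \<ominus>\<^bsub>R\<^esub> emb ?a) \<odot>\<^bsub>M\<^esub> y)"
        using a y' sc by (simp add: act_add_right)
      also have "act t (emb ?a \<odot>\<^bsub>M\<^esub> y) = emb ?a \<odot>\<^bsub>M\<^esub> act s1 y"
        using act_emb[OF a(1) sc(3) y'(1)] sc(2) by (simp add: t_def Pk.shift_shift Pk.shift_0)
      finally have eq: "act t (r y \<odot>\<^bsub>M\<^esub> y) = emb ?a \<odot>\<^bsub>M\<^esub> act s1 y \<oplus>\<^bsub>M\<^esub> act t ((r y \<ominus>\<^bsub>R\<^esub> emb ?a) \<odot>\<^bsub>M\<^esub> y)" .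
      have "emb ?a \<odot>\<^bsub>M\<^esub> act s1 y \<in> Fil (Suc n)"
        using Fil_smult[OF e, of "act s1 y" 1] s1(2) y' by simp
      then show "act t (r y \<odot>\<^bsub>M\<^esub> id y) \<in> Fil (Suc n)"
        using eq act_Fil[OF sc(3) d] additive_subgroup.a_closed[OF Fil_subgroup] by simp
    qed
    finally show ?thesis .
  qed
  then have "\<forall>x\<in>carrier M. act (t \<otimes>\<^bsub>PK\<^esub> s) x \<in> Fil (Suc n)" using s sc by (simp add: act_mult)
  moreover have "t \<otimes>\<^bsub>PK\<^esub> s \<in> Pk.shift_products base"
    unfolding t_def using s s1 by (intro Pk.shift_products_mult Pk.shift_products_shift) auto
  ultimately show ?case by blast
qed

text \<open>The exponent may depend on \<open>n\<close>: the elements of \<open>\<Inter>n. W n l\<close> are limits of generalized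
  eigenvectors, and need not be killed by a power of \<open>H l\<close>.\<close>

definition W :: "nat \<Rightarrow> int \<Rightarrow> 'm set"
  where "W n l = {x \<in> carrier M. \<exists>e::nat. act (H l [^]\<^bsub>PK\<^esub> e) x \<in> Fil n}"

lemma W_carrier: "x \<in> W n l \<Longrightarrow> x \<in> carrier M"
  by (simp add: W_def)

lemma W_I: "\<lbrakk>x \<in> carrier M; act (H l [^]\<^bsub>PK\<^esub> (e::nat)) x \<in> Fil n\<rbrakk> \<Longrightarrow> x \<in> W n l"
  unfolding W_def by blast

lemma act_H_pow_le:
  assumes "x \<in> carrier M" "act (H l [^]\<^bsub>PK\<^esub> (e::nat)) x \<in> Fil n" "e \<le> e'"
  shows "act (H l [^]\<^bsub>PK\<^esub> e') x \<in> Fil n"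
proof -
  have "H l [^]\<^bsub>PK\<^esub> e' = H l [^]\<^bsub>PK\<^esub> (e' - e) \<otimes>\<^bsub>PK\<^esub> H l [^]\<^bsub>PK\<^esub> e"
    using assms(3) Pk.P.nat_pow_mult[OF H_closed, of l "e' - e" e] by simp
  then show ?thesis using assms by (simp add: act_mult act_Fil)
qed

lemma W_subgroup: "additive_subgroup (W n l) M"
proof (rule L.M.additive_subgroup_by_minus)
  show "W n l \<subseteq> carrier M" by (auto simp: W_def)
  show "\<zero>\<^bsub>M\<^esub> \<in> W n l"
    by (rule W_I[of _ _ 0]) (simp_all add: additive_subgroup.zero_closed[OF Fil_subgroup])
  fix x y assume x: "x \<in> W n l" and y: "y \<in> W n l"
  obtain e1 e2 :: nat where e: "act (H l [^]\<^bsub>PK\<^esub> e1) x \<in> Fil n" "act (H l [^]\<^bsub>PK\<^esub> e2) y \<in> Fil n"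
    using x y by (auto simp: W_def)
  let ?e = "max e1 e2"
  have xy: "x \<in> carrier M" "y \<in> carrier M" using x y by (auto simp: W_def)
  have "act (H l [^]\<^bsub>PK\<^esub> ?e) x \<in> Fil n" "act (H l [^]\<^bsub>PK\<^esub> ?e) y \<in> Fil n"
    using act_H_pow_le[OF xy(1) e(1), of ?e] act_H_pow_le[OF xy(2) e(2), of ?e] by auto
  then have "act (H l [^]\<^bsub>PK\<^esub> ?e) (x \<ominus>\<^bsub>M\<^esub> y) \<in> Fil n"
    using xy L.M.subgroup_minus_closed[OF Fil_subgroup] by (simp add: act_minus_right)
  then show "x \<ominus>\<^bsub>M\<^esub> y \<in> W n l" by (rule W_I[OF L.M.minus_closed[OF xy]])
qed

lemma Fil_sub_W: "Fil n \<subseteq> W n l"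
proof
  fix x assume x: "x \<in> Fil n"
  have xc: "x \<in> carrier M" using x Fil_carrier by blast
  have "act (H l [^]\<^bsub>PK\<^esub> (0::nat)) x \<in> Fil n" using x xc by simp
  then show "x \<in> W n l" by (rule W_I[OF xc])
qed

lemma W_antimono: "m \<le> n \<Longrightarrow> W n l \<subseteq> W m l"
  using Fil_antimono unfolding W_def by blast

lemma act_W: "\<lbrakk>p \<in> carrier PK; x \<in> W n l\<rbrakk> \<Longrightarrow> act p x \<in> W n l"
proof -
  assume p: "p \<in> carrier PK" and x: "x \<in> W n l"
  then obtain e :: nat where e: "act (H l [^]\<^bsub>PK\<^esub> e) x \<in> Fil n" by (auto simp: W_def)
  have "act (H l [^]\<^bsub>PK\<^esub> e) (act p x) \<in> Fil n"
    using act_Fil[OF p e] p x W_carrier by (simp add: act_comm[of "H l [^]\<^bsub>PK\<^esub> e" p])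
  then show ?thesis by (rule W_I[OF act_closed[OF p W_carrier[OF x]]])
qed

lemma W_lift: "\<lbrakk>x \<in> carrier M; act (H l) x \<in> W n l\<rbrakk> \<Longrightarrow> x \<in> W n l"
proof -
  assume x: "x \<in> carrier M" "act (H l) x \<in> W n l"
  then obtain e :: nat where "act (H l [^]\<^bsub>PK\<^esub> e) (act (H l) x) \<in> Fil n" by (auto simp: W_def)
  then have "act (H l [^]\<^bsub>PK\<^esub> (Suc e)) x \<in> Fil n" using x by (simp add: act_mult)
  then show ?thesis by (rule W_I[OF x(1)])
qed

lemma emb_W:
  assumes a: "a \<in> gr i" and x: "x \<in> W n l"
  shows "emb a \<odot>\<^bsub>M\<^esub> x \<in> W n (int i + l)"
proof -
  obtain e :: nat where e: "x \<in> carrier M" "act (H l [^]\<^bsub>PK\<^esub> e) x \<in> Fil n" using x by (auto simp: W_def)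
  have ac: "emb a \<in> carrier R" using a gr_carrier by blast
  have "act (H (int i + l) [^]\<^bsub>PK\<^esub> e) (emb a \<odot>\<^bsub>M\<^esub> x) = emb a \<odot>\<^bsub>M\<^esub> act (H l [^]\<^bsub>PK\<^esub> e) x"
    using act_emb[OF a H_pow_closed e(1), of "int i + l" e] by (simp add: Pk.shift_pow shift_H)
  also have "\<dots> \<in> Fil n" using Fil_smult_left[OF ac e(2)] .
  finally show ?thesis by (rule W_I[OF L.smult_closed[OF ac e(1)]])
qed

text \<open>Evaluate a Bezout identity for the two powers at \<open>D\<close> and apply it to
  \<open>x\<close>: both terms are in \<open>Fil n\<close>.\<close>

lemma W_comaximal:
  assumes "x \<in> W n i" "i \<noteq> j" "act (H j [^]\<^bsub>PK\<^esub> (e::nat)) x \<in> Fil n"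
  shows "x \<in> Fil n"
proof -
  obtain e' :: nat where e': "act (H i [^]\<^bsub>PK\<^esub> e') x \<in> Fil n" using assms by (auto simp: W_def)
  obtain u v where uv: "u \<in> carrier PK" "v \<in> carrier PK"
    "u \<otimes>\<^bsub>PK\<^esub> H i [^]\<^bsub>PK\<^esub> e' \<oplus>\<^bsub>PK\<^esub> v \<otimes>\<^bsub>PK\<^esub> H j [^]\<^bsub>PK\<^esub> e = \<one>\<^bsub>PK\<^esub>"
    using H_comaximal[OF assms(2), of e' e] by (auto simp: Pk.P.comaximal_def)
  have x: "x \<in> carrier M" using assms W_carrier by blast
  have "x = act (u \<otimes>\<^bsub>PK\<^esub> H i [^]\<^bsub>PK\<^esub> e' \<oplus>\<^bsub>PK\<^esub> v \<otimes>\<^bsub>PK\<^esub> H j [^]\<^bsub>PK\<^esub> e) x" using uv x by simp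
  also have "\<dots> = act u (act (H i [^]\<^bsub>PK\<^esub> e') x) \<oplus>\<^bsub>M\<^esub> act v (act (H j [^]\<^bsub>PK\<^esub> e) x)"
    using uv(1,2) x by (simp add: act_add act_mult)
  also have "\<dots> \<in> Fil n"
    using act_Fil[OF uv(1) e'] act_Fil[OF uv(2) assms(3)] additive_subgroup.a_closed[OF Fil_subgroup] by blast
  finally show ?thesis .
qed

text \<open>A power of \<open>H l\<close> removes the summand of index \<open>l\<close> and, by
  induction, sends every other summand into \<open>Fil n\<close>. On components of index different
  from \<open>l\<close> this forces the summand itself into \<open>Fil n\<close>.\<close>

lemma W_direct:
  assumes "finite I" "\<And>i. i \<in> I \<Longrightarrow> x i \<in> W n i" "(\<Oplus>\<^bsub>M\<^esub>i\<in>I. x i) \<in> Fil n" "j \<in> I"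
  shows "x j \<in> Fil n"
  using assms
proof (induction I arbitrary: x j rule: finite_induct)
  case empty
  then show ?case by simp
next
  case (insert l I)
  have xc: "i \<in> insert l I \<Longrightarrow> x i \<in> carrier M" for i using insert.prems W_carrier by blast
  have s: "(\<Oplus>\<^bsub>M\<^esub>i\<in>insert l I. x i) = x l \<oplus>\<^bsub>M\<^esub> (\<Oplus>\<^bsub>M\<^esub>i\<in>I. x i)"
    using insert.hyps xc by (intro L.M.finsum_insert) auto
  obtain e :: nat where e: "act (H l [^]\<^bsub>PK\<^esub> e) (x l) \<in> Fil n" using insert.prems(1)[of l] by (auto simp: W_def)
  let ?h = "H l [^]\<^bsub>PK\<^esub> e"
  have xI: "(\<Oplus>\<^bsub>M\<^esub>i\<in>I. x i) \<in> carrier M" using xc by (intro L.M.finsum_closed) auto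
  have "act ?h (\<Oplus>\<^bsub>M\<^esub>i\<in>insert l I. x i) = act ?h (x l) \<oplus>\<^bsub>M\<^esub> act ?h (\<Oplus>\<^bsub>M\<^esub>i\<in>I. x i)"
    unfolding s using xc xI by (intro act_add_right) auto
  then have "act ?h (\<Oplus>\<^bsub>M\<^esub>i\<in>I. x i) = act ?h (\<Oplus>\<^bsub>M\<^esub>i\<in>insert l I. x i) \<ominus>\<^bsub>M\<^esub> act ?h (x l)"
    using xc xI L.M.add_minus_cancel_right[of "act ?h (\<Oplus>\<^bsub>M\<^esub>i\<in>I. x i)" "act ?h (x l)"]
    by (simp add: L.M.a_comm)
  also have "\<dots> \<in> Fil n"
    using L.M.subgroup_minus_closed[OF Fil_subgroup act_Fil[OF _ insert.prems(2)] e] by simp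
  finally have hI: "(\<Oplus>\<^bsub>M\<^esub>i\<in>I. act ?h (x i)) \<in> Fil n" using act_finsum[of ?h x I] xc by auto
  have F: "x i \<in> Fil n" if i: "i \<in> I" for i
  proof (rule W_comaximal[where j = l and e = e])
    show "x i \<in> W n i" using insert.prems(1) i by blast
    show "i \<noteq> l" using i insert.hyps by blast
    show "act ?h (x i) \<in> Fil n"
      by (rule insert.IH[OF _ hI i]) (use insert.prems(1) act_W in auto)
  qed
  show ?case
  proof (cases "j = l")
    case True
    have "x l = (\<Oplus>\<^bsub>M\<^esub>i\<in>insert l I. x i) \<ominus>\<^bsub>M\<^esub> (\<Oplus>\<^bsub>M\<^esub>i\<in>I. x i)"
      unfolding s using xc xI by (simp add: L.M.add_minus_cancel_right)
    also have "\<dots> \<in> Fil n"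
      by (rule L.M.subgroup_minus_closed[OF Fil_subgroup insert.prems(2)
            L.M.subgroup_finsum_closed[OF Fil_subgroup F]])
    finally show ?thesis using True by simp
  next
    case False
    then show ?thesis using F insert.prems by blast
  qed
qed

text \<open>Primary decomposition by peeling off one factor of the annihilator. If
  \<open>H l\<close> takes \<open>x\<close> to a sum of components, those of index different from
  \<open>l\<close> are divisible by \<open>H l\<close> modulo \<open>Fil n\<close>, as
  \<open>H l\<close> acts invertibly there. Subtracting the quotients from \<open>x\<close> leaves
  an element that \<open>H l\<close> sends into the component of index \<open>l\<close>, and such an
  element belongs to that component.\<close>

lemma W_span_product:
  assumes "s \<in> Pk.shift_products base" "x \<in> carrier M" "act s x \<in> Fil n"
  shows "\<exists>I y. finite I \<and> (\<forall>i\<in>I. y i \<in> W n i) \<and> x = (\<Oplus>\<^bsub>M\<^esub>i\<in>I. y i)"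
  using assms
proof (induction arbitrary: x rule: Pk.shift_products.induct)
  case one
  \<comment> \<open>The empty product annihilates only \<open>Fil n\<close>, which is contained in
    every component; the index \<open>0\<close> is arbitrary.\<close>
  then have "x \<in> W n 0" using Fil_sub_W by auto
  then show ?case using one by (intro exI[of _ "{0}"] exI[of _ "\<lambda>_. x"]) (simp add: L.M.finsum_singleton)
next
  case (mult s l')
  define l where "l = - l'"
  have Hl: "Pk.shift l' base = H l" by (simp add: H_def l_def)
  have sc: "s \<in> carrier PK" using mult.hyps Pk.shift_products_closed by simp
  have "act s (act (H l) x) \<in> Fil n" using mult.prems sc by (simp add: Hl act_mult)
  then obtain I y where I: "finite I" "\<forall>i\<in>I. y i \<in> W n i" "act (H l) x = (\<Oplus>\<^bsub>M\<^esub>i\<in>I. y i)"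
    using mult.IH[of "act (H l) x"] mult.prems by auto
  have "\<exists>z. z \<in> W n i \<and> act (H l) z \<ominus>\<^bsub>M\<^esub> y i \<in> Fil n" if i: "i \<in> I - {l}" for i
  proof -
    have yi: "y i \<in> W n i" "y i \<in> carrier M" using I i W_carrier by auto
    obtain e :: nat where e: "act (H i [^]\<^bsub>PK\<^esub> e) (y i) \<in> Fil n" using yi by (auto simp: W_def)
    have "Pk.P.comaximal (H i [^]\<^bsub>PK\<^esub> e) (H l [^]\<^bsub>PK\<^esub> (1::nat))" using i by (intro H_comaximal) auto
    then have "Pk.P.comaximal (H i [^]\<^bsub>PK\<^esub> e) (H l)" using Pk.P.nat_pow_eone[OF H_closed] by metis
    then obtain u v where uv: "u \<in> carrier PK" "v \<in> carrier PK"
      "u \<otimes>\<^bsub>PK\<^esub> H i [^]\<^bsub>PK\<^esub> e \<oplus>\<^bsub>PK\<^esub> v \<otimes>\<^bsub>PK\<^esub> H l = \<one>\<^bsub>PK\<^esub>" by (auto simp: Pk.P.comaximal_def)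
    have "y i = act (u \<otimes>\<^bsub>PK\<^esub> H i [^]\<^bsub>PK\<^esub> e \<oplus>\<^bsub>PK\<^esub> v \<otimes>\<^bsub>PK\<^esub> H l) (y i)" using uv yi by simp
    also have "\<dots> = act u (act (H i [^]\<^bsub>PK\<^esub> e) (y i)) \<oplus>\<^bsub>M\<^esub> act (H l) (act v (y i))"
      using uv(1,2) yi by (simp add: act_add act_mult act_comm[of v "H l"])
    finally have "act (H l) (act v (y i)) \<ominus>\<^bsub>M\<^esub> y i = \<ominus>\<^bsub>M\<^esub> act u (act (H i [^]\<^bsub>PK\<^esub> e) (y i))"
      using uv(1,2) yi
      by (metis H_closed H_pow_closed L.M.a_comm L.M.add_minus_cancel_right L.M.minus_swap act_closed)
    then have "act (H l) (act v (y i)) \<ominus>\<^bsub>M\<^esub> y i \<in> Fil n"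
      using act_Fil[OF uv(1) e] additive_subgroup.a_inv_closed[OF Fil_subgroup] by simp
    then show ?thesis using act_W[OF uv(2) yi(1)] by blast
  qed
  then obtain z where z: "\<And>i. i \<in> I - {l} \<Longrightarrow> z i \<in> W n i \<and> act (H l) (z i) \<ominus>\<^bsub>M\<^esub> y i \<in> Fil n" by metis
  let ?J = "I - {l}"
  have zc: "i \<in> ?J \<Longrightarrow> z i \<in> carrier M" for i using z W_carrier by blast
  have yc: "i \<in> I \<Longrightarrow> y i \<in> carrier M" for i using I(2) W_carrier by blast
  have zs: "(\<Oplus>\<^bsub>M\<^esub>i\<in>?J. z i) \<in> carrier M" using zc by (intro L.M.finsum_closed) auto
  define w where "w = x \<ominus>\<^bsub>M\<^esub> (\<Oplus>\<^bsub>M\<^esub>i\<in>?J. z i)"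
  have wc: "w \<in> carrier M" using mult.prems zs by (simp add: w_def)
  have "act (H l) w \<in> W n l"
  proof -
    let ?Z = "\<Oplus>\<^bsub>M\<^esub>i\<in>?J. act (H l) (z i)" and ?Y = "\<Oplus>\<^bsub>M\<^esub>i\<in>?J. y i"
    have YJ: "?Y \<in> carrier M" "?Z \<in> carrier M" using yc zc by (auto intro!: L.M.finsum_closed)
    have "act (H l) w = act (H l) x \<ominus>\<^bsub>M\<^esub> act (H l) (\<Oplus>\<^bsub>M\<^esub>i\<in>?J. z i)"
      unfolding w_def using mult.prems zs by (intro act_minus_right) auto
    also have "act (H l) (\<Oplus>\<^bsub>M\<^esub>i\<in>?J. z i) = ?Z" using zc by (intro act_finsum) auto
    finally have w: "act (H l) w = act (H l) x \<ominus>\<^bsub>M\<^esub> ?Z" .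
    have "L.M.congr (Fil n) ?Z ?Y"
      using z zc yc by (intro L.M.congr_finsum[OF Fil_subgroup]) (auto simp: L.M.congr_def)
    then have "L.M.congr (W n l) ?Z ?Y" using Fil_sub_W by (rule L.M.congr_mono)
    moreover have "L.M.congr (W n l) (act (H l) x) ?Y"
    proof (cases "l \<in> I")
      case True
      then have "I = insert l ?J" by blast
      then have "act (H l) x = (\<Oplus>\<^bsub>M\<^esub>i\<in>insert l ?J. y i)" using I(3) by simp
      also have "\<dots> = y l \<oplus>\<^bsub>M\<^esub> ?Y" using I(1) yc True by (intro L.M.finsum_insert) auto
      finally show ?thesis
        using YJ yc[OF True] I(2) True by (simp add: L.M.congr_def L.M.add_minus_cancel_right)
    next
      case False
      then have "act (H l) x = ?Y" using I(3) by simp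
      then show ?thesis using YJ by (simp add: L.M.congr_refl[OF W_subgroup])
    qed
    ultimately have "L.M.congr (W n l) (act (H l) x) ?Z"
      using L.M.congr_trans[OF W_subgroup _ L.M.congr_sym[OF W_subgroup]] by blast
    then show ?thesis by (simp add: w L.M.congr_def)
  qed
  then have w: "w \<in> W n l" by (rule W_lift[OF wc])
  let ?y = "\<lambda>i. if i = l then w else z i"
  have "(\<Oplus>\<^bsub>M\<^esub>i\<in>insert l ?J. ?y i) = w \<oplus>\<^bsub>M\<^esub> (\<Oplus>\<^bsub>M\<^esub>i\<in>?J. ?y i)"
    using I(1) wc zc by (subst L.M.finsum_insert) auto
  also have "(\<Oplus>\<^bsub>M\<^esub>i\<in>?J. ?y i) = (\<Oplus>\<^bsub>M\<^esub>i\<in>?J. z i)" using zc by (intro L.M.finsum_cong') auto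
  also have "w \<oplus>\<^bsub>M\<^esub> \<dots> = x" unfolding w_def using mult.prems zs by (simp add: L.M.minus_add_cancel)
  finally have "x = (\<Oplus>\<^bsub>M\<^esub>i\<in>insert l ?J. ?y i)" ..
  moreover have "\<forall>i\<in>insert l ?J. ?y i \<in> W n i" using w z by simp
  ultimately show ?case using I(1) by (intro exI[of _ "insert l ?J"] exI[of _ ?y]) auto
qed

lemma W_span:
  "x \<in> carrier M \<Longrightarrow> \<exists>I y. finite I \<and> (\<forall>i\<in>I. y i \<in> W n i) \<and> x = (\<Oplus>\<^bsub>M\<^esub>i\<in>I. y i)"
  using nilpotent_mod_Fil[of n] W_span_product by blast

end

section \<open>The graded submodule\<close>

context connection_module
begin

definition hom_part :: "int \<Rightarrow> 'm set" where "hom_part l = (\<Inter>n. W n l)"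

lemma hom_part_W: "x \<in> hom_part l \<Longrightarrow> x \<in> W n l"
  by (simp add: hom_part_def)

lemma hom_partI: "(\<And>n. x \<in> W n l) \<Longrightarrow> x \<in> hom_part l"
  by (simp add: hom_part_def)

lemma hom_part_carrier: "x \<in> hom_part l \<Longrightarrow> x \<in> carrier M"
  using hom_part_W W_carrier by blast

lemma hom_part_subgroup: "additive_subgroup (hom_part l) M"
proof (rule L.M.additive_subgroup_by_minus)
  show "hom_part l \<subseteq> carrier M" using hom_part_carrier by blast
  show "\<zero>\<^bsub>M\<^esub> \<in> hom_part l"
    by (rule hom_partI[OF additive_subgroup.zero_closed[OF W_subgroup]])
  show "x \<ominus>\<^bsub>M\<^esub> y \<in> hom_part l" if "x \<in> hom_part l" "y \<in> hom_part l" for x y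
    by (rule hom_partI[OF L.M.subgroup_minus_closed[OF W_subgroup hom_part_W[OF that(1)] hom_part_W[OF that(2)]]])
qed

lemma emb_hom_part: "\<lbrakk>a \<in> gr i; x \<in> hom_part l\<rbrakk> \<Longrightarrow> emb a \<odot>\<^bsub>M\<^esub> x \<in> hom_part (int i + l)"
  by (rule hom_partI[OF emb_W[OF _ hom_part_W]])

lemma hom_part_direct:
  "\<lbrakk>finite I; \<And>i. i \<in> I \<Longrightarrow> x i \<in> hom_part i; (\<Oplus>\<^bsub>M\<^esub>i\<in>I. x i) \<in> Fil n; j \<in> I\<rbrakk> \<Longrightarrow> x j \<in> Fil n"
  by (rule W_direct[OF _ hom_part_W])

text \<open>Components are unique modulo \<open>Fil n\<close>, so the decompositions of
  \<open>x\<close> modulo the various \<open>Fil n\<close> are compatible and form a Cauchy sequence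
  in each degree, with limit in \<open>hom_part\<close>. The set of degrees involved may grow with
  \<open>n\<close>, hence \<open>x\<close> is only approximated by finite sums.\<close>

lemma hom_part_dense:
  assumes x: "x \<in> carrier M"
  shows "\<exists>I y. finite I \<and> (\<forall>i. y i \<in> hom_part i) \<and> x \<ominus>\<^bsub>M\<^esub> (\<Oplus>\<^bsub>M\<^esub>i\<in>I. y i) \<in> Fil n"
proof -
  have "\<exists>I y. finite I \<and> (\<forall>i. y i \<in> W n i) \<and> (\<forall>i. i \<notin> I \<longrightarrow> y i = \<zero>\<^bsub>M\<^esub>) \<and> x = (\<Oplus>\<^bsub>M\<^esub>i\<in>I. y i)" for n
  proof -
    obtain I y where I: "finite I" "\<forall>i\<in>I. y i \<in> W n i" "x = (\<Oplus>\<^bsub>M\<^esub>i\<in>I. y i)" using W_span[OF x] by blast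
    let ?y = "\<lambda>i. if i \<in> I then y i else \<zero>\<^bsub>M\<^esub>"
    have "x = (\<Oplus>\<^bsub>M\<^esub>i\<in>I. ?y i)" unfolding I(3) using I(2) W_carrier by (intro L.M.finsum_cong') auto
    then show ?thesis
      using I additive_subgroup.zero_closed[OF W_subgroup] by (intro exI[of _ I] exI[of _ ?y]) auto
  qed
  then obtain I y where Iy: "\<And>n. finite (I n)" "\<And>n i. y n i \<in> W n i" "\<And>n i. i \<notin> I n \<Longrightarrow> y n i = \<zero>\<^bsub>M\<^esub>"
    "\<And>n. x = (\<Oplus>\<^bsub>M\<^esub>i\<in>I n. y n i)" by metis
  have yc: "y n i \<in> carrier M" for n i using Iy(2) W_carrier by blast
  have sum: "x = (\<Oplus>\<^bsub>M\<^esub>i\<in>J. y n i)" if "finite J" "I n \<subseteq> J" for n J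
  proof -
    have "(\<Oplus>\<^bsub>M\<^esub>i\<in>I n. y n i) = (\<Oplus>\<^bsub>M\<^esub>i\<in>J. y n i)"
      using that Iy(3) yc by (intro L.M.add.finprod_mono_neutral_cong_left) auto
    then show ?thesis using Iy(4)[of n] by simp
  qed
  have step: "y (Suc n) i \<ominus>\<^bsub>M\<^esub> y n i \<in> Fil n" for n i
  proof -
    \<comment> \<open>A common index set for both decompositions of \<open>x\<close>;
      \<open>i\<close> is inserted so that \<open>W_direct\<close> also applies to it when it occurs
      in neither.\<close>
    let ?J = "insert i (I n \<union> I (Suc n))"
    have J: "finite ?J" using Iy(1) by simp
    have "(\<Oplus>\<^bsub>M\<^esub>i\<in>?J. y (Suc n) i \<ominus>\<^bsub>M\<^esub> y n i) = (\<Oplus>\<^bsub>M\<^esub>i\<in>?J. y (Suc n) i) \<ominus>\<^bsub>M\<^esub> (\<Oplus>\<^bsub>M\<^esub>i\<in>?J. y n i)"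
      using yc by (intro L.M.finsum_minus) auto
    also have "(\<Oplus>\<^bsub>M\<^esub>i\<in>?J. y (Suc n) i) = x" by (rule sum[symmetric, OF J]) auto
    also have "(\<Oplus>\<^bsub>M\<^esub>i\<in>?J. y n i) = x" by (rule sum[symmetric, OF J]) auto
    also have "x \<ominus>\<^bsub>M\<^esub> x = \<zero>\<^bsub>M\<^esub>" using x L.M.minus_eq_zero_iff by blast
    finally have z: "(\<Oplus>\<^bsub>M\<^esub>i\<in>?J. y (Suc n) i \<ominus>\<^bsub>M\<^esub> y n i) \<in> Fil n"
      using additive_subgroup.zero_closed[OF Fil_subgroup] by simp
    show ?thesis
    proof (rule W_direct[OF J _ z])
      show "y (Suc n) l \<ominus>\<^bsub>M\<^esub> y n l \<in> W n l" for l
        using Iy(2)[of n l] Iy(2)[of "Suc n" l] W_antimono[of n "Suc n" l]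
        by (intro L.M.subgroup_minus_closed[OF W_subgroup]) auto
    qed simp
  qed
  have "\<exists>z\<in>carrier M. \<forall>n. z \<ominus>\<^bsub>M\<^esub> y n i \<in> Fil n" for i
    by (rule Fil_complete) (auto simp: yc step)
  then obtain z where z: "\<And>i. z i \<in> carrier M" "\<And>i n. z i \<ominus>\<^bsub>M\<^esub> y n i \<in> Fil n" by metis
  have "z i \<in> hom_part i" for i
  proof (rule hom_partI)
    fix n
    have "L.M.congr (W n i) (z i) (y n i)"
      using z(1) z(2)[of i n] yc Fil_sub_W[of n i] by (auto simp: L.M.congr_def)
    then show "z i \<in> W n i" using L.M.congr_mem_iff[OF W_subgroup] Iy(2) by blast
  qed
  moreover have "x \<ominus>\<^bsub>M\<^esub> (\<Oplus>\<^bsub>M\<^esub>i\<in>I n. z i) \<in> Fil n"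
  proof -
    have "L.M.congr (Fil n) (\<Oplus>\<^bsub>M\<^esub>i\<in>I n. z i) (\<Oplus>\<^bsub>M\<^esub>i\<in>I n. y n i)"
      using z yc by (intro L.M.congr_finsum[OF Fil_subgroup]) (simp add: L.M.congr_def)
    then have "L.M.congr (Fil n) x (\<Oplus>\<^bsub>M\<^esub>i\<in>I n. z i)"
      using Iy(4)[of n] L.M.congr_sym[OF Fil_subgroup] by simp
    then show ?thesis by (simp add: L.M.congr_def)
  qed
  ultimately show ?thesis using Iy(1) by blast
qed

definition Nc :: "'m set"
  where "Nc = {(\<Oplus>\<^bsub>M\<^esub>i\<in>I. y i) | I y. finite I \<and> (\<forall>i. y i \<in> hom_part i)}"

lemma Nc_sum: "\<lbrakk>finite I; \<And>i. y i \<in> hom_part i\<rbrakk> \<Longrightarrow> (\<Oplus>\<^bsub>M\<^esub>i\<in>I. y i) \<in> Nc"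
  unfolding Nc_def by blast

lemma zero_hom_part [simp]: "\<zero>\<^bsub>M\<^esub> \<in> hom_part l"
  by (rule additive_subgroup.zero_closed[OF hom_part_subgroup])

lemma hom_part_Nc:
  assumes "x \<in> hom_part l" shows "x \<in> Nc"
proof -
  let ?y = "\<lambda>i. if i = l then x else \<zero>\<^bsub>M\<^esub>"
  have "(\<Oplus>\<^bsub>M\<^esub>i\<in>{l}. ?y i) = x"
    using assms hom_part_carrier by (subst L.M.finsum_single[where i = l]) auto
  moreover have "(\<Oplus>\<^bsub>M\<^esub>i\<in>{l}. ?y i) \<in> Nc" using assms by (intro Nc_sum) auto
  ultimately show ?thesis by simp
qed

lemma NcE:
  assumes "x \<in> Nc"
  obtains I y where "finite I" "\<And>i. y i \<in> hom_part i" "\<And>i. i \<notin> I \<Longrightarrow> y i = \<zero>\<^bsub>M\<^esub>" "x = (\<Oplus>\<^bsub>M\<^esub>i\<in>I. y i)"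
proof -
  obtain I y where I: "finite I" "\<forall>i. y i \<in> hom_part i" "x = (\<Oplus>\<^bsub>M\<^esub>i\<in>I. y i)"
    using assms by (auto simp: Nc_def)
  let ?y = "\<lambda>i. if i \<in> I then y i else \<zero>\<^bsub>M\<^esub>"
  have yc: "y i \<in> carrier M" for i using I(2) hom_part_carrier by blast
  have "x = (\<Oplus>\<^bsub>M\<^esub>i\<in>I. ?y i)" unfolding I(3) using yc by (intro L.M.finsum_cong') auto
  then show thesis using I by (intro that[of I ?y]) auto
qed

lemma sum_extend:
  assumes "finite J" "I \<subseteq> J" "\<And>i. y i \<in> carrier M" "\<And>i. i \<notin> I \<Longrightarrow> y i = \<zero>\<^bsub>M\<^esub>"
  shows "(\<Oplus>\<^bsub>M\<^esub>i\<in>I. y i) = (\<Oplus>\<^bsub>M\<^esub>i\<in>J. y i)"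
  using assms by (intro L.M.add.finprod_mono_neutral_cong_left) auto

lemma Nc_subgroup: "additive_subgroup Nc M"
proof (rule L.M.additive_subgroup_by_minus)
  show "Nc \<subseteq> carrier M"
    using hom_part_carrier by (auto simp: Nc_def intro!: L.M.finsum_closed)
  show "\<zero>\<^bsub>M\<^esub> \<in> Nc" by (rule hom_part_Nc[OF zero_hom_part])
  fix x x' assume x: "x \<in> Nc" "x' \<in> Nc"
  obtain I y where I: "finite I" "\<And>i. y i \<in> hom_part i" "\<And>i. i \<notin> I \<Longrightarrow> y i = \<zero>\<^bsub>M\<^esub>" "x = (\<Oplus>\<^bsub>M\<^esub>i\<in>I. y i)"
    using NcE[OF x(1)] by metis
  obtain I' y' where I': "finite I'" "\<And>i. y' i \<in> hom_part i" "\<And>i. i \<notin> I' \<Longrightarrow> y' i = \<zero>\<^bsub>M\<^esub>"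
    "x' = (\<Oplus>\<^bsub>M\<^esub>i\<in>I'. y' i)" using NcE[OF x(2)] by metis
  note c = hom_part_carrier[OF I(2)] hom_part_carrier[OF I'(2)]
  let ?J = "I \<union> I'"
  have "x = (\<Oplus>\<^bsub>M\<^esub>i\<in>?J. y i)" unfolding I(4) by (rule sum_extend) (use I(1,3) I'(1) c in auto)
  moreover have "x' = (\<Oplus>\<^bsub>M\<^esub>i\<in>?J. y' i)" unfolding I'(4) by (rule sum_extend) (use I(1) I'(1,3) c in auto)
  ultimately have "x \<ominus>\<^bsub>M\<^esub> x' = (\<Oplus>\<^bsub>M\<^esub>i\<in>?J. y i \<ominus>\<^bsub>M\<^esub> y' i)"
    using c by (simp add: L.M.finsum_minus Pi_def)
  also have "\<dots> \<in> Nc"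
    using I I' L.M.subgroup_minus_closed[OF hom_part_subgroup] by (intro Nc_sum) auto
  finally show "x \<ominus>\<^bsub>M\<^esub> x' \<in> Nc" .
qed

lemma Nc_carrier: "x \<in> Nc \<Longrightarrow> x \<in> carrier M"
  using additive_subgroup.a_subset[OF Nc_subgroup] by blast

lemma Nc_emb:
  assumes a: "a \<in> carrier A" and x: "x \<in> Nc"
  shows "emb a \<odot>\<^bsub>M\<^esub> x \<in> Nc"
proof -
  obtain n where n: "a = (\<Oplus>\<^bsub>A\<^esub>i\<in>{..<n}. comp a i)" using comp_sum_ex[OF a] by blast
  obtain I y where I: "finite I" "\<And>i. y i \<in> hom_part i" "x = (\<Oplus>\<^bsub>M\<^esub>i\<in>I. y i)" using NcE[OF x] by metis
  have ac: "comp a i \<in> carrier A" for i using a by simp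
  have "emb a = (\<Oplus>\<^bsub>R\<^esub>i\<in>{..<n}. emb (comp a i))"
    using emb_finsum[of "comp a" "{..<n}"] ac n by simp
  then have "emb a \<odot>\<^bsub>M\<^esub> x = (\<Oplus>\<^bsub>M\<^esub>i\<in>{..<n}. emb (comp a i) \<odot>\<^bsub>M\<^esub> x)"
    using L.finsum_smult[of "\<lambda>i. emb (comp a i)" "{..<n}" x] ac Nc_carrier[OF x] by simp
  also have "\<dots> \<in> Nc"
  proof (rule L.M.subgroup_finsum_closed[OF Nc_subgroup])
    fix i
    have "emb (comp a i) \<odot>\<^bsub>M\<^esub> x = (\<Oplus>\<^bsub>M\<^esub>l\<in>I. emb (comp a i) \<odot>\<^bsub>M\<^esub> y l)"
      unfolding I(3) using ac hom_part_carrier[OF I(2)] by (intro L.smult_finsum) auto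
    also have "\<dots> \<in> Nc"
      using emb_hom_part[OF comp_in_gr[OF a] I(2)] hom_part_Nc
      by (intro L.M.subgroup_finsum_closed[OF Nc_subgroup]) blast
    finally show "emb (comp a i) \<odot>\<^bsub>M\<^esub> x \<in> Nc" .
  qed
  finally show ?thesis .
qed

lemma Nc_dense: "x \<in> carrier M \<Longrightarrow> \<exists>y\<in>Nc. x \<ominus>\<^bsub>M\<^esub> y \<in> Fil n"
  using hom_part_dense[of x n] Nc_sum by blast

text \<open>Group the terms by degree and subtract them from \<open>x\<close>, placed in degree
  \<open>j\<close>: directness modulo \<open>Fil n\<close> isolates that degree.\<close>

lemma hom_part_direct_degree:
  assumes K: "finite K" "\<And>\<kappa>. \<kappa> \<in> K \<Longrightarrow> f \<kappa> \<in> hom_part (dg \<kappa>)" and x: "x \<in> hom_part j"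
    and F: "x \<ominus>\<^bsub>M\<^esub> (\<Oplus>\<^bsub>M\<^esub>\<kappa>\<in>K. f \<kappa>) \<in> Fil n"
  shows "x \<ominus>\<^bsub>M\<^esub> (\<Oplus>\<^bsub>M\<^esub>\<kappa>\<in>{\<kappa> \<in> K. dg \<kappa> = j}. f \<kappa>) \<in> Fil n"
proof -
  define K' where "K' l = {\<kappa> \<in> K. dg \<kappa> = l}" for l
  define I where "I = insert j (dg ` K)"
  define z where "z l = (\<Oplus>\<^bsub>M\<^esub>\<kappa>\<in>K' l. f \<kappa>)" for l
  define x0 where "x0 l = (if l = j then x else \<zero>\<^bsub>M\<^esub>)" for l
  have I: "finite I" "j \<in> I" using K(1) by (simp_all add: I_def)
  have fc: "f \<kappa> \<in> carrier M" if "\<kappa> \<in> K" for \<kappa> by (rule hom_part_carrier[OF K(2)[OF that]])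
  have xc: "x \<in> carrier M" by (rule hom_part_carrier[OF x])
  have x0: "x0 l \<in> hom_part l" for l using x by (simp add: x0_def)
  have x0c: "x0 l \<in> carrier M" for l by (rule hom_part_carrier[OF x0])
  have z: "z l \<in> hom_part l" for l
    unfolding z_def by (rule L.M.subgroup_finsum_closed[OF hom_part_subgroup]) (use K(2) in \<open>auto simp: K'_def\<close>)
  have zc: "z l \<in> carrier M" for l by (rule hom_part_carrier[OF z])
  have "(\<Oplus>\<^bsub>M\<^esub>\<kappa>\<in>(\<Union>l\<in>I. K' l). f \<kappa>) = (\<Oplus>\<^bsub>M\<^esub>l\<in>I. z l)"
    unfolding z_def using I(1) K(1) fc
    by (intro L.M.add.finprod_UN_disjoint) (auto simp: pairwise_def disjnt_def K'_def)
  moreover have "(\<Union>l\<in>I. K' l) = K" by (auto simp: I_def K'_def)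
  ultimately have "(\<Oplus>\<^bsub>M\<^esub>\<kappa>\<in>K. f \<kappa>) = (\<Oplus>\<^bsub>M\<^esub>l\<in>I. z l)" by simp
  moreover have "(\<Oplus>\<^bsub>M\<^esub>l\<in>I. x0 l) = x"
    using L.M.finsum_single[OF I, of x0] x0c by (simp add: x0_def Pi_def)
  moreover have "(\<Oplus>\<^bsub>M\<^esub>l\<in>I. x0 l \<ominus>\<^bsub>M\<^esub> z l) = (\<Oplus>\<^bsub>M\<^esub>l\<in>I. x0 l) \<ominus>\<^bsub>M\<^esub> (\<Oplus>\<^bsub>M\<^esub>l\<in>I. z l)"
    using x0c zc by (intro L.M.finsum_minus) auto
  ultimately have "(\<Oplus>\<^bsub>M\<^esub>l\<in>I. x0 l \<ominus>\<^bsub>M\<^esub> z l) \<in> Fil n" using F by simp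
  then have "x0 j \<ominus>\<^bsub>M\<^esub> z j \<in> Fil n"
    by (rule hom_part_direct[OF I(1) L.M.subgroup_minus_closed[OF hom_part_subgroup x0 z] _ I(2)])
  then show ?thesis by (simp add: x0_def z_def K'_def)
qed

text \<open>This is \<open>A_{>=e}\<close>, the counterpart of \<open>fl e\<close> in
  \<open>A\<close>.\<close>

definition tail :: "nat \<Rightarrow> 'a set"
  where "tail e = {a \<in> carrier A. \<forall>i<e. comp a i = \<zero>\<^bsub>A\<^esub>}"

definition tail_span :: "'m set \<Rightarrow> nat \<Rightarrow> 'm set"
  where "tail_span T e = {L.lincomb (\<lambda>t. emb (b t)) id T | b. \<forall>t\<in>T. b t \<in> tail e}"

lemma tail_span_subgroup:
  assumes "T \<subseteq> carrier M" shows "additive_subgroup (tail_span T e) M"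
proof (rule L.M.additive_subgroup_by_minus)
  have T: "id \<in> T \<rightarrow> carrier M" using assms by auto
  have c: "(\<lambda>t. emb (b t)) \<in> T \<rightarrow> carrier R" if "\<forall>t\<in>T. b t \<in> tail e" for b
    using that by (auto simp: tail_def)
  show "tail_span T e \<subseteq> carrier M" using L.lincomb_closed[OF c T] by (auto simp: tail_span_def)
  have "\<zero>\<^bsub>M\<^esub> = L.lincomb (\<lambda>t. emb \<zero>\<^bsub>A\<^esub>) id T" using T by (simp add: L.lincomb_zero)
  then show "\<zero>\<^bsub>M\<^esub> \<in> tail_span T e"
    unfolding tail_span_def by (intro CollectI exI[of _ "\<lambda>_. \<zero>\<^bsub>A\<^esub>"]) (simp add: tail_def)
  fix x y assume "x \<in> tail_span T e" "y \<in> tail_span T e"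
  then obtain b c where bc: "x = L.lincomb (\<lambda>t. emb (b t)) id T" "\<forall>t\<in>T. b t \<in> tail e"
    "y = L.lincomb (\<lambda>t. emb (c t)) id T" "\<forall>t\<in>T. c t \<in> tail e" by (auto simp: tail_span_def)
  have "x \<ominus>\<^bsub>M\<^esub> y = L.lincomb (\<lambda>t. emb (b t) \<ominus>\<^bsub>R\<^esub> emb (c t)) id T"
    unfolding bc(1,3) using L.lincomb_minus[OF c[OF bc(2)] c[OF bc(4)] T] by simp
  also have "\<dots> = L.lincomb (\<lambda>t. emb (b t \<ominus>\<^bsub>A\<^esub> c t)) id T"
    using bc(2,4) T by (intro L.lincomb_cong) (auto simp: tail_def)
  also have "\<dots> \<in> tail_span T e"
    unfolding tail_span_def using bc(2,4)
    by (intro CollectI exI[of _ "\<lambda>t. b t \<ominus>\<^bsub>A\<^esub> c t"]) (simp add: tail_def M.minus_eq_zero_iff)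
  finally show "x \<ominus>\<^bsub>M\<^esub> y \<in> tail_span T e" .
qed

lemma tail_span_single:
  assumes "finite T" "T \<subseteq> carrier M" "t \<in> T" "a \<in> tail e"
  shows "emb a \<odot>\<^bsub>M\<^esub> t \<in> tail_span T e"
proof -
  let ?b = "\<lambda>s. if s = t then a else \<zero>\<^bsub>A\<^esub>"
  have a: "a \<in> carrier A" using assms by (simp add: tail_def)
  have "L.lincomb (\<lambda>s. emb (?b s)) id T = L.lincomb (\<lambda>s. if s = t then emb a else \<zero>\<^bsub>R\<^esub>) id T"
    using a assms by (intro L.lincomb_cong) auto
  also have "\<dots> = emb a \<odot>\<^bsub>M\<^esub> id t" using assms a by (intro L.lincomb_single) auto
  finally have "emb a \<odot>\<^bsub>M\<^esub> t = L.lincomb (\<lambda>s. emb (?b s)) id T" by simp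
  then show ?thesis
    unfolding tail_span_def using assms(4) by (intro CollectI exI[of _ ?b]) (simp add: tail_def)
qed

text \<open>Only the component of \<open>r t\<close> in degree \<open>j - dg t\<close> contributes
  in degree \<open>j\<close>, so each series may be replaced by a homogeneous element of
  \<open>A\<close>, which inherits the bound \<open>e\<close>. The equality holds modulo every
  \<open>Fil n\<close>, and then by separatedness.\<close>

lemma homogeneous_combination:
  assumes T: "finite T" "\<And>t. t \<in> T \<Longrightarrow> t \<in> hom_part (dg t)"
    and r: "\<And>t. t \<in> T \<Longrightarrow> r t \<in> fl e" and x: "x \<in> hom_part j" "x = L.lincomb r id T"
  shows "x \<in> tail_span T e"
proof -
  have Tc: "T \<subseteq> carrier M" using T(2) hom_part_carrier by blast
  have rc: "t \<in> T \<Longrightarrow> r t \<in> carrier R" for t using r fl_carrier by blast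
  let ?f = "\<lambda>(t, i). emb (co (r t) i) \<odot>\<^bsub>M\<^esub> t" and ?dg = "\<lambda>(t, i). int i + dg t"
  let ?K = "\<lambda>n. {\<kappa> \<in> T \<times> {..<n}. ?dg \<kappa> = j}"
  have co_tail: "co (r t) i \<in> tail e" if "t \<in> T" for t i
    using that r[OF that] rc[OF that] comp_homogeneous[OF co_in_gr[OF rc[OF that]], of i]
    by (auto simp: tail_def fl_def)
  have approx: "x \<ominus>\<^bsub>M\<^esub> (\<Oplus>\<^bsub>M\<^esub>\<kappa>\<in>T \<times> {..<n}. ?f \<kappa>) \<in> Fil n" for n
  proof -
    have "L.M.congr (Fil n) (r t \<odot>\<^bsub>M\<^esub> id t) (\<Oplus>\<^bsub>M\<^esub>i\<in>{..<n}. ?f (t, i))" if t: "t \<in> T" for t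
    proof -
      have tc: "t \<in> carrier M" using t Tc by blast
      have "emb (trunc n (r t)) = (\<Oplus>\<^bsub>R\<^esub>i\<in>{..<n}. emb (co (r t) i))"
        unfolding trunc_def using rc[OF t] by (intro emb_finsum) auto
      then have "emb (trunc n (r t)) \<odot>\<^bsub>M\<^esub> t = (\<Oplus>\<^bsub>M\<^esub>i\<in>{..<n}. ?f (t, i))"
        using L.finsum_smult[of "\<lambda>i. emb (co (r t) i)" "{..<n}" t] rc[OF t] tc by simp
      moreover have "(r t \<ominus>\<^bsub>R\<^esub> emb (trunc n (r t))) \<odot>\<^bsub>M\<^esub> t \<in> Fil n"
        by (rule Fil_smult_right[OF trunc_diff[OF rc[OF t]] tc])
      moreover have "emb (trunc n (r t)) \<in> carrier R" using rc[OF t] by auto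
      ultimately show ?thesis
        using rc[OF t] tc L.smult_closed[of "emb (trunc n (r t))" t] by (simp add: L.M.congr_def L.smult_l_diff)
    qed
    then have "L.M.congr (Fil n) x (\<Oplus>\<^bsub>M\<^esub>t\<in>T. \<Oplus>\<^bsub>M\<^esub>i\<in>{..<n}. ?f (t, i))"
      unfolding x(2) L.lincomb_def by (rule L.M.congr_finsum[OF Fil_subgroup])
    also have "(\<Oplus>\<^bsub>M\<^esub>t\<in>T. \<Oplus>\<^bsub>M\<^esub>i\<in>{..<n}. ?f (t, i)) = (\<Oplus>\<^bsub>M\<^esub>\<kappa>\<in>T \<times> {..<n}. ?f \<kappa>)"
    proof -
      have inner: "(\<Oplus>\<^bsub>M\<^esub>i\<in>{..<n}. ?f (t, i)) = (\<Oplus>\<^bsub>M\<^esub>\<kappa>\<in>{t} \<times> {..<n}. ?f \<kappa>)" if "t \<in> T" for t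
      proof -
        have "{t} \<times> {..<n} = Pair t ` {..<n}" by auto
        then show ?thesis
          using that rc Tc by (simp, subst L.M.finsum_reindex) (auto simp: inj_on_def)
      qed
      have "(\<Oplus>\<^bsub>M\<^esub>t\<in>T. \<Oplus>\<^bsub>M\<^esub>i\<in>{..<n}. ?f (t, i)) = (\<Oplus>\<^bsub>M\<^esub>t\<in>T. \<Oplus>\<^bsub>M\<^esub>\<kappa>\<in>{t} \<times> {..<n}. ?f \<kappa>)"
        using inner rc Tc by (intro L.M.finsum_cong') (auto intro!: L.M.finsum_closed)
      also have "\<dots> = (\<Oplus>\<^bsub>M\<^esub>\<kappa>\<in>(\<Union>t\<in>T. {t} \<times> {..<n}). ?f \<kappa>)"
        using T(1) rc Tc
        by (intro L.M.add.finprod_UN_disjoint[symmetric]) (auto simp: pairwise_def disjnt_def)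
      also have "(\<Union>t\<in>T. {t} \<times> {..<n}) = T \<times> {..<n}" by auto
      finally show ?thesis .
    qed
    finally show ?thesis by (simp add: L.M.congr_def)
  qed
  have part: "x \<ominus>\<^bsub>M\<^esub> (\<Oplus>\<^bsub>M\<^esub>\<kappa>\<in>?K n. ?f \<kappa>) \<in> Fil n" for n
  proof (rule hom_part_direct_degree[OF _ _ x(1) approx])
    show "finite (T \<times> {..<n})" using T(1) by simp
    fix \<kappa> assume \<kappa>: "\<kappa> \<in> T \<times> {..<n}"
    then obtain t i where ti: "\<kappa> = (t, i)" "t \<in> T" by auto
    show "?f \<kappa> \<in> hom_part (?dg \<kappa>)"
      using emb_hom_part[OF co_in_gr[OF rc[OF ti(2)]] T(2)[OF ti(2)]] by (simp add: ti(1))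
  qed
  \<comment> \<open>A bound for all \<open>i\<close> with \<open>i + dg t = j\<close>. From
    \<open>n0\<close> on the relevant index set no longer changes, so one finite sum approximates
    \<open>x\<close> to every order.\<close>
  define n0 where "n0 = Suc (nat (sum (\<lambda>t. \<bar>j - dg t\<bar>) T))"
  have bound: "i < n0" if "t \<in> T" "int i + dg t = j" for t i
  proof -
    have "\<bar>j - dg t\<bar> \<le> sum (\<lambda>t. \<bar>j - dg t\<bar>) T" using T(1) that by (intro member_le_sum) auto
    then show ?thesis using that by (simp add: n0_def)
  qed
  define z where "z = (\<Oplus>\<^bsub>M\<^esub>\<kappa>\<in>?K n0. ?f \<kappa>)"
  have K: "?K n = ?K n0" if "n \<ge> n0" for n
    using bound by (auto intro: less_le_trans[OF _ that])
  have "x \<ominus>\<^bsub>M\<^esub> z \<in> Fil n" for n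
  proof -
    have "x \<ominus>\<^bsub>M\<^esub> z \<in> Fil (max n n0)" using part[of "max n n0"] unfolding K[OF max.cobounded2] z_def .
    then show ?thesis using Fil_antimono[of n "max n n0"] by auto
  qed
  then have xz: "x \<ominus>\<^bsub>M\<^esub> z = \<zero>\<^bsub>M\<^esub>" by (rule Fil_separated)
  have S: "z \<in> tail_span T e"
    unfolding z_def
  proof (rule L.M.subgroup_finsum_closed[OF tail_span_subgroup[OF Tc]])
    fix \<kappa> assume "\<kappa> \<in> ?K n0"
    then obtain t i where ti: "\<kappa> = (t, i)" "t \<in> T" by auto
    show "?f \<kappa> \<in> tail_span T e"
      using tail_span_single[OF T(1) Tc ti(2) co_tail[OF ti(2)], of i] by (simp add: ti(1))
  qed
  then have "z \<in> carrier M"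
    using additive_subgroup.a_subset[OF tail_span_subgroup[OF Tc]] by blast
  then have "x = z" using xz L.M.minus_eq_zero_iff[OF hom_part_carrier[OF x(1)]] by simp
  then show ?thesis using S by simp
qed

text \<open>Finitely many homogeneous elements which generate \<open>M\<close> modulo \<open>R\<^sub>\<ge>\<^sub>1 M\<close> generate \<open>M\<close> over \<open>R\<close>
  and \<open>N\<close> over \<open>A\<close>, compatibly with the filtrations.\<close>

lemma homogeneous_generators:
  obtains T where "finite T" "T \<subseteq> Nc" "\<And>e. Nc \<inter> Fil e \<subseteq> tail_span T e"
proof -
  have "\<forall>y\<in>Y. \<exists>I z. finite I \<and> (\<forall>i. z i \<in> hom_part i) \<and> y \<ominus>\<^bsub>M\<^esub> (\<Oplus>\<^bsub>M\<^esub>i\<in>I. z i) \<in> Fil 1"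
    using hom_part_dense Y(2) by blast
  then obtain I z where Iz: "\<And>y. y \<in> Y \<Longrightarrow> finite (I y)" "\<And>y i. y \<in> Y \<Longrightarrow> z y i \<in> hom_part i"
    "\<And>y. y \<in> Y \<Longrightarrow> y \<ominus>\<^bsub>M\<^esub> (\<Oplus>\<^bsub>M\<^esub>i\<in>I y. z y i) \<in> Fil 1" by metis
  \<comment> \<open>The homogeneous components of approximations to \<open>Y\<close> modulo
    \<open>Fil 1\<close>, which is all the precision that the Nakayama argument asks for.\<close>
  define T where "T = (\<Union>y\<in>Y. z y ` I y)"
  have T: "finite T" "\<forall>t\<in>T. \<exists>l. t \<in> hom_part l" using Iz Y(1) by (auto simp: T_def)
  then obtain dg where dg: "\<And>t. t \<in> T \<Longrightarrow> t \<in> hom_part (dg t)" by metis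
  have TN: "T \<subseteq> Nc" using dg hom_part_Nc by blast
  have Tsub: "T \<subseteq> carrier M" using dg hom_part_carrier by blast
  then have Tc: "id \<in> T \<rightarrow> carrier M" by auto
  let ?S = "{L.lincomb r id T | r. r \<in> T \<rightarrow> carrier R}"
  have S: "submodule ?S R M" by (rule L.lincombs_submodule[OF T(1) Tc])
  note Ssub = L.submodule_imp_additive[OF S]
  have TS: "T \<subseteq> ?S"
    using L.submodule_generated_finite[OF T(1) Tc] L.submodule_generated_superset[of T] by simp
  have gen: "\<exists>r\<in>T \<rightarrow> carrier R. x \<ominus>\<^bsub>M\<^esub> L.lincomb r id T \<in> Fil 1" if x: "x \<in> carrier M" for x
  proof -
    obtain a where a: "a \<in> Y \<rightarrow> carrier R" "x = L.lincomb a id Y" using x Y(3) by auto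
    let ?u = "\<lambda>y. \<Oplus>\<^bsub>M\<^esub>i\<in>I y. z y i"
    have u: "?u y \<in> ?S" if "y \<in> Y" for y
      using that TS by (intro L.M.subgroup_finsum_closed[OF Ssub]) (auto simp: T_def)
    have uc: "y \<in> Y \<Longrightarrow> ?u y \<in> carrier M" for y using u additive_subgroup.a_subset[OF Ssub] by blast
    have "L.M.congr (Fil 1) (a y \<odot>\<^bsub>M\<^esub> id y) (a y \<odot>\<^bsub>M\<^esub> ?u y)" if y: "y \<in> Y" for y
    proof -
      have ay: "a y \<in> carrier R" "y \<in> carrier M" using a y Y(2) by auto
      have "a y \<odot>\<^bsub>M\<^esub> (y \<ominus>\<^bsub>M\<^esub> ?u y) \<in> Fil 1" by (rule Fil_smult_left[OF ay(1) Iz(3)[OF y]])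
      then show ?thesis using ay uc[OF y] by (simp add: L.M.congr_def L.smult_r_diff)
    qed
    then have "L.M.congr (Fil 1) x (\<Oplus>\<^bsub>M\<^esub>y\<in>Y. a y \<odot>\<^bsub>M\<^esub> ?u y)"
      unfolding a(2) L.lincomb_def by (rule L.M.congr_finsum[OF Fil_subgroup])
    moreover have "(\<Oplus>\<^bsub>M\<^esub>y\<in>Y. a y \<odot>\<^bsub>M\<^esub> ?u y) \<in> ?S"
    proof (rule L.M.subgroup_finsum_closed[OF Ssub])
      show "a y \<odot>\<^bsub>M\<^esub> ?u y \<in> ?S" if y: "y \<in> Y" for y
        by (rule submodule.smult_closed[OF S _ u[OF y]]) (use a y in auto)
    qed
    then obtain r where "r \<in> T \<rightarrow> carrier R" "(\<Oplus>\<^bsub>M\<^esub>y\<in>Y. a y \<odot>\<^bsub>M\<^esub> ?u y) = L.lincomb r id T" by blast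
    ultimately show ?thesis by (auto simp: L.M.congr_def)
  qed
  have "Nc \<inter> Fil e \<subseteq> tail_span T e" for e
  proof
    fix x assume x: "x \<in> Nc \<inter> Fil e"
    then obtain J y where J: "finite J" "\<And>i. y i \<in> hom_part i" "x = (\<Oplus>\<^bsub>M\<^esub>i\<in>J. y i)" using NcE by blast
    have "y i \<in> tail_span T e" if i: "i \<in> J" for i
    proof -
      \<comment> \<open>The depth of an element of \<open>Nc\<close> passes to its components, so
        each can be treated on its own.\<close>
      have "y i \<in> Fil e" by (rule hom_part_direct[OF J(1) J(2) _ i]) (use x J(3) in auto)
      then obtain r where "\<forall>t\<in>T. r t \<in> fl e" "y i = L.lincomb r id T"
        using Fil_generators[OF T(1) Tc gen] by blast
      then show ?thesis using homogeneous_combination[OF T(1) dg _ J(2)] by blast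
    qed
    then show "x \<in> tail_span T e"
      unfolding J(3) by (rule L.M.subgroup_finsum_closed[OF tail_span_subgroup[OF Tsub]])
  qed
  then show thesis using that T(1) TN by blast
qed

end

section \<open>Powers of the irrelevant ideal\<close>

context connected_graded_algebra
begin

lemma positive_part_ideal: "ideal (positive_part A gr) A"
proof (rule idealI)
  show "ring A" by (rule A.ring_axioms)
  have "additive_subgroup (positive_part A gr) A"
    by (rule M.additive_subgroup_by_minus) (auto simp: positive_part_iff M.minus_eq_zero_iff)
  then show "subgroup (positive_part A gr) (add_monoid A)" by (simp add: additive_subgroup_def)
  show "x \<otimes>\<^bsub>A\<^esub> a \<in> positive_part A gr" "a \<otimes>\<^bsub>A\<^esub> x \<in> positive_part A gr"
    if "a \<in> positive_part A gr" "x \<in> carrier A" for a x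
    using that by (simp_all add: positive_part_iff comp_mult)
qed

definition power :: "nat \<Rightarrow> 'a set" where "power n = ideal_power A (positive_part A gr) n"

lemma power_0: "power 0 = carrier A"
  by (simp add: power_def ideals_set_def)

lemma power_Suc: "power (Suc n) = ideal_prod A (power n) (positive_part A gr)"
  by (simp add: power_def ideals_set_def)

lemma power_ideal: "ideal (power n) A"
proof (induction n)
  case 0
  show ?case unfolding power_0 by (rule A.oneideal)
next
  case (Suc n)
  then show ?case unfolding power_Suc using positive_part_ideal by (rule A.ideal_prod_is_ideal)
qed

lemma power_subgroup: "additive_subgroup (power n) A"
  by (rule ideal.axioms(1)[OF power_ideal])

lemma power_carrier: "a \<in> power n \<Longrightarrow> a \<in> carrier A"
  using additive_subgroup.a_subset[OF power_subgroup] by blast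

lemma power_antimono: "m \<le> n \<Longrightarrow> power n \<subseteq> power m"
proof (rule lift_Suc_antimono_le[of power])
  show "power (Suc n) \<subseteq> power n" for n
    unfolding power_Suc using A.ideal_prod_inter[OF power_ideal positive_part_ideal] by blast
qed

text \<open>Each factor from \<open>A_{>=1}\<close> raises the order by at least one.\<close>

lemma power_comp: "\<lbrakk>a \<in> power n; i < n\<rbrakk> \<Longrightarrow> comp a i = \<zero>\<^bsub>A\<^esub>"
proof (induction n arbitrary: a i)
  case 0
  then show ?case by simp
next
  case (Suc n)
  from Suc.prems(1) show ?case unfolding power_Suc using Suc.prems(2)
  proof (induction rule: ideal_prod.induct)
    case (prod b c)
    have c: "b \<in> carrier A" "c \<in> carrier A" "comp c 0 = \<zero>\<^bsub>A\<^esub>"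
      using prod power_carrier by (auto simp: positive_part_iff)
    have "comp b j \<otimes>\<^bsub>A\<^esub> comp c (i - j) = \<zero>\<^bsub>A\<^esub>" if "j \<le> i" for j
      using Suc.IH[OF prod(1), of j] c that prod(3) by (cases "j < n") auto
    then show ?case using c by (simp add: comp_mult) (intro M.add.finprod_one_eqI, simp)
  next
    case (sum s1 s2)
    have "s1 \<in> carrier A" "s2 \<in> carrier A"
      using sum(1,2) power_carrier[of _ "Suc n"] by (auto simp: power_Suc)
    then show ?case using sum by simp
  qed
qed

text \<open>By noetherianity, the ideal is generated by elements of bounded degree.\<close>

lemma power_contains_tail:
  assumes noeth: "left_noetherian A"
  obtains d where "d \<ge> 1" "\<And>n a. \<lbrakk>a \<in> carrier A; \<And>i. i < n * d \<Longrightarrow> comp a i = \<zero>\<^bsub>A\<^esub>\<rbrakk> \<Longrightarrow> a \<in> power n"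
proof -
  let ?I = "positive_part A gr"
  interpret AM: left_module A "regular_module A" by (rule A.regular_left_module)
  have reg [simp]: "carrier (regular_module A) = carrier A" "smult (regular_module A) = monoid.mult A"
    by (auto simp: regular_module_def)
  have fs: "finsum (regular_module A) = finsum A"
    by (auto simp: regular_module_def finsum_def fun_eq_iff finprod_def)
  have "submodule ?I A (regular_module A)"
    using ideal.axioms(1)[OF positive_part_ideal] ideal.I_l_closed[OF positive_part_ideal]
    by (intro AM.submodule_by_minus) (auto simp: additive_subgroup_regular_module_iff)
  then obtain G where G: "finite G" "G \<subseteq> carrier A" "?I = submodule_generated A (regular_module A) G"
    using noeth by (auto simp: left_noetherian_def)
  have idG: "id \<in> G \<rightarrow> carrier (regular_module A)" using G by auto
  have GI: "G \<subseteq> ?I" using G(3) AM.submodule_generated_superset by blast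
  have "\<forall>s\<in>G. \<exists>n. \<forall>i\<ge>n. comp s i = \<zero>\<^bsub>A\<^esub>" using comp_bound G(2) by blast
  then obtain b where b: "\<And>s i. \<lbrakk>s \<in> G; i \<ge> b s\<rbrakk> \<Longrightarrow> comp s i = \<zero>\<^bsub>A\<^esub>" by metis
  \<comment> \<open>Beyond the degrees of all generators, and positive even if there are
    none.\<close>
  define d where "d = Suc (sum b G)"
  have d: "comp s i = \<zero>\<^bsub>A\<^esub>" if "s \<in> G" "i \<ge> d" for s i
  proof (rule b[OF that(1)])
    have "b s \<le> sum b G" using G(1) that(1) by (intro member_le_sum) auto
    then show "i \<ge> b s" using that(2) by (simp add: d_def)
  qed
  \<comment> \<open>In an expression of \<open>a\<close> through the generators, the component of a
    generator has degree at least one and less than \<open>d\<close>. If \<open>a\<close> has degree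
    at least \<open>(n + 1) d\<close>, the cofactor keeps degree at least \<open>n d\<close> and
    falls under the induction hypothesis.\<close>
  have hom: "a \<in> power n" if "a \<in> gr j" "j \<ge> n * d" for a j n
    using that
  proof (induction n arbitrary: a j)
    case 0
    then show ?case using gr_carrier by (simp add: power_0)
  next
    case (Suc n)
    have ac: "a \<in> carrier A" using Suc.prems gr_carrier by blast
    have "j > 0" using Suc.prems(2) by (auto simp: d_def)
    then have "a \<in> ?I" using comp_homogeneous[OF Suc.prems(1), of 0] ac by (simp add: positive_part_iff)
    then have "a \<in> {AM.lincomb r id G | r. r \<in> G \<rightarrow> carrier A}"
      using AM.submodule_generated_finite[OF G(1) idG] G(3) by simp
    then obtain r where r: "r \<in> G \<rightarrow> carrier A" "a = AM.lincomb r id G" by blast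
    have rG: "s \<in> G \<Longrightarrow> r s \<in> carrier A" "s \<in> G \<Longrightarrow> s \<in> carrier A" for s using r G(2) by auto
    have "a = (\<Oplus>\<^bsub>A\<^esub>s\<in>G. r s \<otimes>\<^bsub>A\<^esub> s)" unfolding r(2) by (simp add: AM.lincomb_def fs)
    moreover have "comp (\<Oplus>\<^bsub>A\<^esub>s\<in>G. r s \<otimes>\<^bsub>A\<^esub> s) j = (\<Oplus>\<^bsub>A\<^esub>s\<in>G. comp (r s \<otimes>\<^bsub>A\<^esub> s) j)"
      using rG by (intro comp_finsum) auto
    moreover have "comp a j = a" using comp_homogeneous[OF Suc.prems(1), of j] by simp
    ultimately have "a = (\<Oplus>\<^bsub>A\<^esub>s\<in>G. comp (r s \<otimes>\<^bsub>A\<^esub> s) j)" by simp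
    also have "\<dots> \<in> power (Suc n)"
    proof (rule M.subgroup_finsum_closed[OF power_subgroup])
      fix s assume s: "s \<in> G"
      have "comp (r s \<otimes>\<^bsub>A\<^esub> s) j = (\<Oplus>\<^bsub>A\<^esub>i\<in>{..j}. comp (r s) i \<otimes>\<^bsub>A\<^esub> comp s (j - i))"
        using rG[OF s] by (rule comp_mult)
      also have "\<dots> \<in> power (Suc n)"
      proof (rule M.subgroup_finsum_closed[OF power_subgroup])
        fix i
        show "comp (r s) i \<otimes>\<^bsub>A\<^esub> comp s (j - i) \<in> power (Suc n)"
        proof (cases "comp s (j - i) = \<zero>\<^bsub>A\<^esub>")
          case True
          then show ?thesis using rG[OF s] additive_subgroup.zero_closed[OF power_subgroup] by simp
        next
          case False
          have "comp s 0 = \<zero>\<^bsub>A\<^esub>" using GI s by (auto simp: positive_part_iff)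
          then have ji: "j - i \<noteq> 0" "j - i < d" using False d[OF s, of "j - i"] by (metis, metis not_le)
          then have "i \<ge> n * d" using Suc.prems(2) by simp
          then have "comp (r s) i \<in> power n" using Suc.IH[OF comp_in_gr[OF rG(1)[OF s]]] by blast
          moreover have "comp s (j - i) \<in> ?I"
            using rG[OF s] ji comp_homogeneous[OF comp_in_gr[OF rG(2)[OF s]], of "j - i" 0]
            by (simp add: positive_part_iff)
          ultimately show ?thesis unfolding power_Suc by (rule ideal_prod.prod)
        qed
      qed
      finally show "comp (r s \<otimes>\<^bsub>A\<^esub> s) j \<in> power (Suc n)" .
    qed
    finally show ?case .
  qed
  have "a \<in> power n" if a: "a \<in> carrier A" "\<And>i. i < n * d \<Longrightarrow> comp a i = \<zero>\<^bsub>A\<^esub>" for a n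
  proof -
    obtain m where m: "a = (\<Oplus>\<^bsub>A\<^esub>i\<in>{..<m}. comp a i)" using comp_sum_ex[OF a(1)] by blast
    have "(\<Oplus>\<^bsub>A\<^esub>i\<in>{..<m}. comp a i) \<in> power n"
    proof (rule M.subgroup_finsum_closed[OF power_subgroup])
      fix i
      show "comp a i \<in> power n"
      proof (cases "i < n * d")
        case True
        then show ?thesis using a(2) additive_subgroup.zero_closed[OF power_subgroup] by simp
      next
        case False
        then show ?thesis using hom[OF comp_in_gr[OF a(1)]] by simp
      qed
    qed
    then show ?thesis using m by simp
  qed
  then show thesis using that[of d] by (simp add: d_def)
qed

text \<open>Order \<open>n d\<close> suffices for membership in the \<open>n\<close>-th power, and
  by \<open>power_comp\<close> the elements of that power have order at least \<open>n\<close>: the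
  two filtrations are cofinal. The constant is chosen once because later definitions depend on
  it.\<close>

definition power_bound :: nat
  where "power_bound = (SOME d. d \<ge> 1 \<and>
    (\<forall>n a. a \<in> carrier A \<longrightarrow> (\<forall>i<n * d. comp a i = \<zero>\<^bsub>A\<^esub>) \<longrightarrow> a \<in> power n))"

lemma power_bound:
  assumes "left_noetherian A"
  shows "power_bound \<ge> 1"
    and "\<lbrakk>a \<in> carrier A; \<And>i. i < n * power_bound \<Longrightarrow> comp a i = \<zero>\<^bsub>A\<^esub>\<rbrakk> \<Longrightarrow> a \<in> power n"
proof -
  have "\<exists>d. d \<ge> 1 \<and> (\<forall>n a. a \<in> carrier A \<longrightarrow> (\<forall>i<n * d. comp a i = \<zero>\<^bsub>A\<^esub>) \<longrightarrow> a \<in> power n)"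
    using power_contains_tail[OF assms] by metis
  then have *: "power_bound \<ge> 1 \<and>
    (\<forall>n a. a \<in> carrier A \<longrightarrow> (\<forall>i<n * power_bound. comp a i = \<zero>\<^bsub>A\<^esub>) \<longrightarrow> a \<in> power n)"
    unfolding power_bound_def by (rule someI_ex)
  show "power_bound \<ge> 1" using * ..
  show "\<lbrakk>a \<in> carrier A; \<And>i. i < n * power_bound \<Longrightarrow> comp a i = \<zero>\<^bsub>A\<^esub>\<rbrakk> \<Longrightarrow> a \<in> power n" using * by blast
qed

end

section \<open>The graded module and its completion\<close>

context connection_module
begin

definition Ngr :: "('a, 'm) module"
  where "Ngr = \<lparr>carrier = Nc, monoid.mult = undefined, one = undefined, ring.zero = \<zero>\<^bsub>M\<^esub>,
    ring.add = (\<oplus>\<^bsub>M\<^esub>), smult = (\<lambda>a x. emb a \<odot>\<^bsub>M\<^esub> x)\<rparr>"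

lemma Ngr_simps [simp]:
  "carrier Ngr = Nc" "ring.zero Ngr = \<zero>\<^bsub>M\<^esub>" "ring.add Ngr = (\<oplus>\<^bsub>M\<^esub>)" "smult Ngr = (\<lambda>a x. emb a \<odot>\<^bsub>M\<^esub> x)"
  by (simp_all add: Ngr_def)

lemma Ngr_left_module: "left_module A Ngr"
proof -
  have "abelian_group Ngr"
  proof (rule abelian_groupI)
    fix x assume x: "x \<in> carrier Ngr"
    then have "\<ominus>\<^bsub>M\<^esub> x \<in> Nc" "x \<in> carrier M"
      using additive_subgroup.a_inv_closed[OF Nc_subgroup] Nc_carrier by auto
    then show "\<exists>y\<in>carrier Ngr. y \<oplus>\<^bsub>Ngr\<^esub> x = \<zero>\<^bsub>Ngr\<^esub>"
      by (intro bexI[of _ "\<ominus>\<^bsub>M\<^esub> x"]) (auto simp: L.M.l_neg)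
    show "\<zero>\<^bsub>Ngr\<^esub> \<oplus>\<^bsub>Ngr\<^esub> x = x" using x Nc_carrier by simp
  next
    fix x y assume x: "x \<in> carrier Ngr" "y \<in> carrier Ngr"
    show "x \<oplus>\<^bsub>Ngr\<^esub> y \<in> carrier Ngr" using x additive_subgroup.a_closed[OF Nc_subgroup] by simp
    show "x \<oplus>\<^bsub>Ngr\<^esub> y = y \<oplus>\<^bsub>Ngr\<^esub> x" using x Nc_carrier by (simp add: L.M.a_comm)
  next
    fix x y z assume "x \<in> carrier Ngr" "y \<in> carrier Ngr" "z \<in> carrier Ngr"
    then show "x \<oplus>\<^bsub>Ngr\<^esub> y \<oplus>\<^bsub>Ngr\<^esub> z = x \<oplus>\<^bsub>Ngr\<^esub> (y \<oplus>\<^bsub>Ngr\<^esub> z)" using Nc_carrier by (simp add: L.M.a_assoc)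
  qed (simp add: additive_subgroup.zero_closed[OF Nc_subgroup])
  then show ?thesis
    by (intro left_module.intro left_module_axioms.intro A.ring_axioms)
      (auto simp: Nc_emb L.smult_l_distr L.smult_r_distr L.smult_assoc1 dest!: Nc_carrier)
qed

end

sublocale connection_module < Nm: left_module A Ngr
  by (rule Ngr_left_module)

context connection_module
begin

text \<open>\<open>finsum\<close> refers to the carrier of its structure, so agreement of the
  additions does not identify the two sums by itself; an induction on the index set does.\<close>

lemma Ngr_finsum: "f \<in> I \<rightarrow> Nc \<Longrightarrow> finsum Ngr f I = finsum M f I"
proof (induction I rule: infinite_finite_induct)
  case (insert i I)
  have "finsum Ngr f (insert i I) = f i \<oplus>\<^bsub>Ngr\<^esub> finsum Ngr f I"
    using insert by (intro Nm.M.finsum_insert) auto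
  moreover have "finsum M f (insert i I) = f i \<oplus>\<^bsub>M\<^esub> finsum M f I"
    using insert Nc_carrier by (intro L.M.finsum_insert) auto
  ultimately show ?case using insert by auto
next
  case (infinite I)
  then show ?case using Nm.M.finsum_infinite[of I f] L.M.finsum_infinite[of I f] by simp
qed (use Nm.M.finsum_empty in simp)

lemma Ngr_minus: "\<lbrakk>x \<in> Nc; y \<in> Nc\<rbrakk> \<Longrightarrow> x \<ominus>\<^bsub>Ngr\<^esub> y = x \<ominus>\<^bsub>M\<^esub> y"
proof -
  assume xy: "x \<in> Nc" "y \<in> Nc"
  have "\<ominus>\<^bsub>M\<^esub> y \<in> Nc" using xy additive_subgroup.a_inv_closed[OF Nc_subgroup] by blast
  then have "\<ominus>\<^bsub>Ngr\<^esub> y = \<ominus>\<^bsub>M\<^esub> y"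
    using xy Nc_carrier[OF xy(2)] by (intro Nm.M.minus_equality) (auto simp: L.M.l_neg)
  then show ?thesis by (simp add: a_minus_def)
qed

lemma Ngr_subgroup: "\<lbrakk>additive_subgroup V M; V \<subseteq> Nc\<rbrakk> \<Longrightarrow> additive_subgroup V Ngr"
  by (rule Nm.M.additive_subgroup_by_minus)
    (auto simp: Ngr_minus subset_iff additive_subgroup.zero_closed L.M.subgroup_minus_closed)

lemma Ngr_lincomb:
  assumes "b \<in> I \<rightarrow> carrier A" "g \<in> I \<rightarrow> Nc"
  shows "Nm.lincomb b g I = L.lincomb (\<lambda>i. emb (b i)) g I"
  unfolding Nm.lincomb_def L.lincomb_def Ngr_simps
  using assms Nc_emb by (intro Ngr_finsum) auto

lemma Ngr_finitely_generated: "finitely_generated A Ngr"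
proof -
  obtain T where T: "finite T" "T \<subseteq> Nc" "\<And>e. Nc \<inter> Fil e \<subseteq> tail_span T e"
    using homogeneous_generators by blast
  have g: "id \<in> T \<rightarrow> Nc" using T by auto
  have sub: "submodule (submodule_generated A Ngr T) A Ngr"
    using T by (intro Nm.submodule_generated_is_submodule) simp
  have "Nc \<subseteq> submodule_generated A Ngr T"
  proof
    fix x assume x: "x \<in> Nc"
    then have "x \<in> tail_span T 0" using T(3)[of 0] Nc_carrier by (auto simp: Fil_0)
    then obtain b where b: "x = L.lincomb (\<lambda>t. emb (b t)) id T" "\<forall>t\<in>T. b t \<in> tail 0"
      by (auto simp: tail_span_def)
    then have bc: "b \<in> T \<rightarrow> carrier A" by (auto simp: tail_def)
    have "Nm.lincomb b id T \<in> submodule_generated A Ngr T"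
      using Nm.submodule_generated_superset[of T] by (intro Nm.submodule_lincomb[OF sub bc]) auto
    then show "x \<in> submodule_generated A Ngr T" unfolding b(1) Ngr_lincomb[OF bc g] .
  qed
  moreover have "submodule_generated A Ngr T \<subseteq> Nc"
    using additive_subgroup.a_subset[OF Nm.submodule_imp_additive[OF sub]] by simp
  ultimately show ?thesis
    unfolding finitely_generated_def using T by (intro exI[of _ T]) auto
qed

text \<open>Existence of components is built into \<open>Nc\<close>; uniqueness comes from
  directness modulo each \<open>Fil n\<close> together with separatedness.\<close>

lemma Ngr_graded: "graded_left_module A gr Ngr hom_part"
proof (intro graded_left_module.intro graded_left_module_axioms.intro Ngr_left_module)
  show "a \<odot>\<^bsub>Ngr\<^esub> x \<in> hom_part (int i + j)" if "a \<in> gr i" "x \<in> hom_part j" for a i x j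
    using emb_hom_part[OF that] by simp
  have fam: "family_sum Ngr c = (\<Oplus>\<^bsub>M\<^esub>i\<in>J. c i)"
    if "homogeneous_family Ngr hom_part c" "finite J" "{i. c i \<noteq> \<zero>\<^bsub>M\<^esub>} \<subseteq> J" for c J
  proof -
    have c: "c i \<in> hom_part i" for i using that(1) by (simp add: homogeneous_family_def)
    have "family_sum Ngr c = (\<Oplus>\<^bsub>M\<^esub>i\<in>{i. c i \<noteq> \<zero>\<^bsub>M\<^esub>}. c i)"
      unfolding family_sum_def Ngr_simps using hom_part_Nc[OF c] by (intro Ngr_finsum) auto
    also have "\<dots> = (\<Oplus>\<^bsub>M\<^esub>i\<in>J. c i)"
      by (rule sum_extend[OF that(2,3) hom_part_carrier[OF c]]) simp
    finally show ?thesis .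
  qed
  show "internal_direct_sum Ngr hom_part"
    unfolding internal_direct_sum_def
  proof (intro conjI allI ballI)
    show "subgroup (hom_part i) (add_monoid Ngr)" for i
      using Ngr_subgroup[OF hom_part_subgroup] hom_part_Nc by (auto simp: additive_subgroup_def)
    fix x assume "x \<in> carrier Ngr"
    then have "x \<in> Nc" by simp
    then obtain I y where I: "finite I" "\<And>i. y i \<in> hom_part i" "\<And>i. i \<notin> I \<Longrightarrow> y i = \<zero>\<^bsub>M\<^esub>"
      "x = (\<Oplus>\<^bsub>M\<^esub>i\<in>I. y i)" using NcE by metis
    have supp: "{i. y i \<noteq> \<zero>\<^bsub>M\<^esub>} \<subseteq> I" using I(3) by blast
    have hy: "homogeneous_family Ngr hom_part y"
      using I finite_subset[OF supp] by (auto simp: homogeneous_family_def)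
    show "\<exists>!c. homogeneous_family Ngr hom_part c \<and> x = family_sum Ngr c"
    proof (rule ex1I[of _ y])
      show "homogeneous_family Ngr hom_part y \<and> x = family_sum Ngr y"
        using hy fam[OF hy I(1) supp] I(4) by simp
      fix c assume c: "homogeneous_family Ngr hom_part c \<and> x = family_sum Ngr c"
      let ?J = "I \<union> {i. c i \<noteq> \<zero>\<^bsub>M\<^esub>}"
      have J: "finite ?J" using c I(1) by (simp add: homogeneous_family_def)
      have ch: "c i \<in> hom_part i" for i using c by (simp add: homogeneous_family_def)
      have "(\<Oplus>\<^bsub>M\<^esub>i\<in>?J. c i) = x" using fam[of c ?J] c J by simp
      moreover have "{i. y i \<noteq> \<zero>\<^bsub>M\<^esub>} \<subseteq> ?J" using supp by blast
      then have "(\<Oplus>\<^bsub>M\<^esub>i\<in>?J. y i) = x" using fam[OF hy J] fam[OF hy I(1) supp] I(4) by simp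
      ultimately have "(\<Oplus>\<^bsub>M\<^esub>i\<in>?J. c i \<ominus>\<^bsub>M\<^esub> y i) = x \<ominus>\<^bsub>M\<^esub> x"
        using hom_part_carrier[OF ch] hom_part_carrier[OF I(2)] by (simp add: L.M.finsum_minus Pi_def)
      also have "\<dots> = \<zero>\<^bsub>M\<^esub>" using Nc_carrier[OF \<open>x \<in> Nc\<close>] L.M.minus_eq_zero_iff by blast
      finally have z: "(\<Oplus>\<^bsub>M\<^esub>i\<in>?J. c i \<ominus>\<^bsub>M\<^esub> y i) \<in> Fil n" for n
        using additive_subgroup.zero_closed[OF Fil_subgroup] by simp
      have "c i = y i" for i
      proof (cases "i \<in> ?J")
        case True
        have "c i \<ominus>\<^bsub>M\<^esub> y i \<in> Fil n" for n
          by (rule hom_part_direct[OF J L.M.subgroup_minus_closed[OF hom_part_subgroup ch I(2)] z True])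
        then have "c i \<ominus>\<^bsub>M\<^esub> y i = \<zero>\<^bsub>M\<^esub>" by (rule Fil_separated)
        then show ?thesis
          using L.M.minus_eq_zero_iff[OF hom_part_carrier[OF ch] hom_part_carrier[OF I(2)]] by simp
      next
        case False
        then show ?thesis using I(3) by auto
      qed
      then show "c = y" by auto
    qed
  qed
qed

section \<open>Powers of the ideal acting on \<open>N\<close> and their closures in
  \<open>M\<close>\<close>

definition powN :: "nat \<Rightarrow> 'm set" where "powN n = ideal_smult A (power n) Ngr"

definition ord :: "nat \<Rightarrow> nat" where "ord n = n * power_bound"

lemma powN_submodule: "submodule (powN n) A Ngr"
  unfolding powN_def ideal_smult_def using power_carrier
  by (intro Nm.submodule_generated_is_submodule) (auto simp: Nc_emb)

lemma powN_subgroup_N: "additive_subgroup (powN n) Ngr"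
  by (rule Nm.submodule_imp_additive[OF powN_submodule])

lemma powN_sub: "powN n \<subseteq> Nc"
  using additive_subgroup.a_subset[OF powN_subgroup_N] by simp

lemma powN_subgroup: "additive_subgroup (powN n) M"
proof (rule L.M.additive_subgroup_by_minus)
  show "powN n \<subseteq> carrier M" using powN_sub Nc_carrier by blast
  show "\<zero>\<^bsub>M\<^esub> \<in> powN n" using additive_subgroup.zero_closed[OF powN_subgroup_N] by simp
  show "x \<ominus>\<^bsub>M\<^esub> y \<in> powN n" if "x \<in> powN n" "y \<in> powN n" for x y
    using Nm.M.subgroup_minus_closed[OF powN_subgroup_N that] that powN_sub Ngr_minus by (metis subsetD)
qed

lemma powN_smult: "\<lbrakk>a \<in> power n; x \<in> Nc\<rbrakk> \<Longrightarrow> emb a \<odot>\<^bsub>M\<^esub> x \<in> powN n"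
  unfolding powN_def ideal_smult_def Ngr_simps
  by (rule subsetD[OF Nm.submodule_generated_superset[unfolded Ngr_simps]]) blast

lemma powN_emb: "\<lbrakk>a \<in> carrier A; x \<in> powN n\<rbrakk> \<Longrightarrow> emb a \<odot>\<^bsub>M\<^esub> x \<in> powN n"
  using submodule.smult_closed[OF powN_submodule, of a x n] by simp

lemma powN_antimono: "m \<le> n \<Longrightarrow> powN n \<subseteq> powN m"
  unfolding powN_def[of n] ideal_smult_def
  using power_antimono[of m n] powN_smult
  by (intro Nm.submodule_generated_least[OF powN_submodule]) auto

lemma powN_Fil: "powN n \<subseteq> Fil n"
proof -
  have "submodule (Nc \<inter> Fil n) A Ngr"
  proof (rule Nm.submodule_by_minus)
    have "additive_subgroup (Nc \<inter> Fil n) M"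
      using L.M.subgroup_minus_closed[OF Nc_subgroup] L.M.subgroup_minus_closed[OF Fil_subgroup]
        additive_subgroup.zero_closed[OF Nc_subgroup] additive_subgroup.zero_closed[OF Fil_subgroup] Nc_carrier
      by (intro L.M.additive_subgroup_by_minus) auto
    then show "additive_subgroup (Nc \<inter> Fil n) Ngr" by (rule Ngr_subgroup) simp
    show "a \<odot>\<^bsub>Ngr\<^esub> x \<in> Nc \<inter> Fil n" if "a \<in> carrier A" "x \<in> Nc \<inter> Fil n" for a x
      using that Nc_emb Fil_smult_left by simp
  qed
  moreover have "{a \<odot>\<^bsub>Ngr\<^esub> x | a x. a \<in> power n \<and> x \<in> carrier Ngr} \<subseteq> Nc \<inter> Fil n"
  proof
    fix y assume "y \<in> {a \<odot>\<^bsub>Ngr\<^esub> x | a x. a \<in> power n \<and> x \<in> carrier Ngr}"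
    then obtain a x where ax: "y = emb a \<odot>\<^bsub>M\<^esub> x" "a \<in> power n" "x \<in> Nc" by auto
    have "emb a \<in> fl n" using power_carrier[OF ax(2)] power_comp[OF ax(2)] by (intro emb_in_fl)
    then show "y \<in> Nc \<inter> Fil n"
      unfolding ax(1) using Nc_emb[OF power_carrier[OF ax(2)] ax(3)] Fil_smult_right[OF _ Nc_carrier[OF ax(3)]]
      by blast
  qed
  ultimately show ?thesis
    unfolding powN_def ideal_smult_def using Nm.submodule_generated_least by blast
qed

text \<open>A deep element of \<open>N\<close> has deep coefficients over the homogeneous
  generators, and coefficients of order \<open>n power_bound\<close> lie in the \<open>n\<close>-th
  power of the ideal. This is where the compatibility of the generators with the filtration is
  used.\<close>

lemma Fil_powN: "Nc \<inter> Fil (ord n) \<subseteq> powN n"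
proof
  fix x assume x: "x \<in> Nc \<inter> Fil (ord n)"
  obtain T where T: "finite T" "T \<subseteq> Nc" "\<And>e. Nc \<inter> Fil e \<subseteq> tail_span T e"
    using homogeneous_generators by blast
  have "x \<in> tail_span T (ord n)" using x T(3) by blast
  then obtain b where b: "x = L.lincomb (\<lambda>t. emb (b t)) id T" "\<forall>t\<in>T. b t \<in> tail (ord n)"
    by (auto simp: tail_span_def)
  show "x \<in> powN n"
    unfolding b(1) L.lincomb_def
  proof (rule L.M.subgroup_finsum_closed[OF powN_subgroup])
    fix t assume t: "t \<in> T"
    then have "b t \<in> power n"
      using b(2) by (intro power_bound(2)[OF noeth]) (auto simp: tail_def ord_def)
    then show "emb (b t) \<odot>\<^bsub>M\<^esub> id t \<in> powN n" using powN_smult[of "b t" n t] T(2) t by auto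
  qed
qed

lemma ord_ge: "n \<le> ord n"
  using power_bound(1)[OF noeth] by (simp add: ord_def)

lemma ord_mono: "m \<le> n \<Longrightarrow> ord m \<le> ord n"
  by (simp add: ord_def)

text \<open>The closure of \<open>powN n\<close> in \<open>M\<close>. It lies between
  \<open>Fil (ord n)\<close> and \<open>Fil n\<close> and meets \<open>N\<close> in
  \<open>powN n\<close>, so \<open>N / powN n\<close> and \<open>M / Mn n\<close> agree: the terms
  of the completion of \<open>N\<close> become quotients of \<open>M\<close>.\<close>

definition Mn :: "nat \<Rightarrow> 'm set"
  where "Mn n = {x \<in> carrier M. \<exists>z\<in>powN n. x \<ominus>\<^bsub>M\<^esub> z \<in> Fil (ord n)}"

lemma powN_carrier: "x \<in> powN n \<Longrightarrow> x \<in> carrier M"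
  using powN_sub Nc_carrier by blast

lemma MnI: "\<lbrakk>x \<in> carrier M; z \<in> powN n; x \<ominus>\<^bsub>M\<^esub> z \<in> Fil (ord n)\<rbrakk> \<Longrightarrow> x \<in> Mn n"
  unfolding Mn_def by blast

lemma Mn_subgroup: "additive_subgroup (Mn n) M"
proof (rule L.M.additive_subgroup_by_minus)
  show "Mn n \<subseteq> carrier M" by (auto simp: Mn_def)
  have "\<zero>\<^bsub>M\<^esub> \<ominus>\<^bsub>M\<^esub> \<zero>\<^bsub>M\<^esub> \<in> Fil (ord n)" using additive_subgroup.zero_closed[OF Fil_subgroup] by simp
  then show "\<zero>\<^bsub>M\<^esub> \<in> Mn n" by (rule MnI[OF L.M.zero_closed additive_subgroup.zero_closed[OF powN_subgroup]])
  fix x y assume "x \<in> Mn n" "y \<in> Mn n"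
  then obtain u v where uv: "u \<in> powN n" "v \<in> powN n" "x \<ominus>\<^bsub>M\<^esub> u \<in> Fil (ord n)" "y \<ominus>\<^bsub>M\<^esub> v \<in> Fil (ord n)"
    "x \<in> carrier M" "y \<in> carrier M" by (auto simp: Mn_def)
  have "L.M.congr (Fil (ord n)) (x \<ominus>\<^bsub>M\<^esub> y) (u \<ominus>\<^bsub>M\<^esub> v)"
    using uv powN_carrier by (intro L.M.congr_minus[OF Fil_subgroup]) (auto simp: L.M.congr_def)
  moreover have "u \<ominus>\<^bsub>M\<^esub> v \<in> powN n" using uv L.M.subgroup_minus_closed[OF powN_subgroup] by blast
  ultimately show "x \<ominus>\<^bsub>M\<^esub> y \<in> Mn n" unfolding Mn_def L.M.congr_def by blast
qed

lemma powN_Mn: "powN n \<subseteq> Mn n"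
proof
  fix x assume x: "x \<in> powN n"
  have "x \<ominus>\<^bsub>M\<^esub> x = \<zero>\<^bsub>M\<^esub>" using powN_carrier[OF x] L.M.minus_eq_zero_iff by blast
  then have "x \<ominus>\<^bsub>M\<^esub> x \<in> Fil (ord n)" using additive_subgroup.zero_closed[OF Fil_subgroup] by simp
  then show "x \<in> Mn n" by (rule MnI[OF powN_carrier[OF x] x])
qed

lemma Fil_Mn: "Fil (ord n) \<subseteq> Mn n"
proof
  fix x assume x: "x \<in> Fil (ord n)"
  then have "x \<ominus>\<^bsub>M\<^esub> \<zero>\<^bsub>M\<^esub> \<in> Fil (ord n)" using Fil_carrier by simp
  then show "x \<in> Mn n"
    unfolding Mn_def using x Fil_carrier additive_subgroup.zero_closed[OF powN_subgroup] by blast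
qed

lemma Mn_Fil: "Mn n \<subseteq> Fil n"
proof
  fix x assume "x \<in> Mn n"
  then obtain z where z: "z \<in> powN n" "x \<ominus>\<^bsub>M\<^esub> z \<in> Fil (ord n)" "x \<in> carrier M" by (auto simp: Mn_def)
  have "L.M.congr (Fil n) x z"
    using z powN_carrier Fil_antimono[OF ord_ge] by (auto simp: L.M.congr_def)
  then show "x \<in> Fil n" using L.M.congr_mem_iff[OF Fil_subgroup] powN_Fil z(1) by blast
qed

lemma Mn_antimono: "m \<le> n \<Longrightarrow> Mn n \<subseteq> Mn m"
  using powN_antimono[of m n] Fil_antimono[OF ord_mono, of m n] unfolding Mn_def by blast

lemma Mn_Nc: "\<lbrakk>x \<in> Nc; x \<in> Mn n\<rbrakk> \<Longrightarrow> x \<in> powN n"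
proof -
  assume x: "x \<in> Nc" "x \<in> Mn n"
  then obtain z where z: "z \<in> powN n" "x \<ominus>\<^bsub>M\<^esub> z \<in> Fil (ord n)" by (auto simp: Mn_def)
  have "x \<ominus>\<^bsub>M\<^esub> z \<in> Nc" using x z powN_sub L.M.subgroup_minus_closed[OF Nc_subgroup] by blast
  then have "L.M.congr (powN n) x z"
    using z Fil_powN x Nc_carrier powN_carrier by (auto simp: L.M.congr_def)
  then show ?thesis using L.M.congr_mem_iff[OF powN_subgroup] z(1) by blast
qed

lemma Mn_emb: "\<lbrakk>a \<in> carrier A; x \<in> Mn n\<rbrakk> \<Longrightarrow> emb a \<odot>\<^bsub>M\<^esub> x \<in> Mn n"
proof -
  assume a: "a \<in> carrier A" and "x \<in> Mn n"
  then obtain z where z: "z \<in> powN n" "x \<ominus>\<^bsub>M\<^esub> z \<in> Fil (ord n)" "x \<in> carrier M" by (auto simp: Mn_def)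
  have "emb a \<odot>\<^bsub>M\<^esub> x \<ominus>\<^bsub>M\<^esub> emb a \<odot>\<^bsub>M\<^esub> z \<in> Fil (ord n)"
    using Fil_smult_left[OF emb_closed[OF a] z(2)] a z powN_carrier by (simp add: L.smult_r_diff)
  then show ?thesis unfolding Mn_def using powN_emb[OF a z(1)] a z(3) by blast
qed

text \<open>Approximate \<open>x\<close> by an element of \<open>N\<close> to order
  \<open>ord n\<close>: the error is absorbed by \<open>Fil (ord n)\<close>, and the product with
  the approximation is in \<open>powN n\<close>.\<close>

lemma power_smult_Mn: "\<lbrakk>a \<in> power n; x \<in> carrier M\<rbrakk> \<Longrightarrow> emb a \<odot>\<^bsub>M\<^esub> x \<in> Mn n"
proof -
  assume a: "a \<in> power n" and x: "x \<in> carrier M"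
  have ac: "a \<in> carrier A" using a power_carrier by blast
  obtain y where y: "y \<in> Nc" "x \<ominus>\<^bsub>M\<^esub> y \<in> Fil (ord n)" using Nc_dense[OF x] by blast
  have "emb a \<odot>\<^bsub>M\<^esub> x \<ominus>\<^bsub>M\<^esub> emb a \<odot>\<^bsub>M\<^esub> y \<in> Fil (ord n)"
    using Fil_smult_left[OF emb_closed[OF ac] y(2)] ac x y Nc_carrier by (simp add: L.smult_r_diff)
  then show ?thesis unfolding Mn_def using powN_smult[OF a y(1)] ac x by blast
qed

end

section \<open>The comparison map from \<open>M\<close> to the completion of
  \<open>N\<close>\<close>

context connection_module
begin

text \<open>The \<open>n\<close>-th coordinate of the image of \<open>m\<close> in the completion.
  No representative is chosen, so compatibility for varying \<open>n\<close> is just monotonicity of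
  \<open>Mn\<close>.\<close>

definition approx :: "'m \<Rightarrow> nat \<Rightarrow> 'm set"
  where "approx m n = {x \<in> Nc. x \<ominus>\<^bsub>M\<^esub> m \<in> Mn n}"

text \<open>Between elements of \<open>N\<close>, congruence modulo \<open>Mn n\<close> is
  congruence modulo \<open>powN n\<close>; the elements near \<open>m\<close> thus form a single
  coset as soon as there is one.\<close>

lemma approx_coset:
  assumes "x \<in> Nc" "m \<in> carrier M" "x \<ominus>\<^bsub>M\<^esub> m \<in> Mn n"
  shows "approx m n = powN n +>\<^bsub>Ngr\<^esub> x"
proof -
  have xm: "L.M.congr (Mn n) x m" using assms Nc_carrier by (simp add: L.M.congr_def)
  have "w \<in> approx m n \<longleftrightarrow> w \<in> powN n +>\<^bsub>Ngr\<^esub> x" for w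
  proof -
    have "w \<in> powN n +>\<^bsub>Ngr\<^esub> x \<longleftrightarrow> w \<in> Nc \<and> w \<ominus>\<^bsub>M\<^esub> x \<in> powN n"
      using Nm.M.mem_coset_iff[OF powN_subgroup_N, of x w n] assms(1) Ngr_minus by auto
    also have "\<dots> \<longleftrightarrow> w \<in> Nc \<and> w \<ominus>\<^bsub>M\<^esub> x \<in> Mn n"
      using Mn_Nc powN_Mn L.M.subgroup_minus_closed[OF Nc_subgroup _ assms(1)] by blast
    also have "\<dots> \<longleftrightarrow> w \<in> Nc \<and> L.M.congr (Mn n) w x"
      using Nc_carrier assms(1) by (auto simp: L.M.congr_def)
    also have "\<dots> \<longleftrightarrow> w \<in> Nc \<and> L.M.congr (Mn n) w m"
      using L.M.congr_trans[OF Mn_subgroup _ xm] L.M.congr_trans[OF Mn_subgroup _ L.M.congr_sym[OF Mn_subgroup xm]]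
      by blast
    also have "\<dots> \<longleftrightarrow> w \<in> approx m n"
      using Nc_carrier assms(2) by (auto simp: approx_def L.M.congr_def)
    finally show ?thesis ..
  qed
  then show ?thesis by blast
qed

lemma approx_ex:
  assumes "m \<in> carrier M"
  obtains x where "x \<in> Nc" "x \<ominus>\<^bsub>M\<^esub> m \<in> Mn n"
proof -
  obtain x where x: "x \<in> Nc" "m \<ominus>\<^bsub>M\<^esub> x \<in> Fil (ord n)" using Nc_dense[OF assms] by blast
  have "x \<ominus>\<^bsub>M\<^esub> m = \<ominus>\<^bsub>M\<^esub> (m \<ominus>\<^bsub>M\<^esub> x)" using x assms Nc_carrier by (simp add: L.M.minus_swap)
  then have "x \<ominus>\<^bsub>M\<^esub> m \<in> Fil (ord n)" using additive_subgroup.a_inv_closed[OF Fil_subgroup x(2)] by simp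
  then show thesis using that x(1) Fil_Mn by blast
qed

lemma approx_add:
  assumes "x \<in> carrier M" "y \<in> carrier M"
  shows "approx (x \<oplus>\<^bsub>M\<^esub> y) n = approx x n <+>\<^bsub>Ngr\<^esub> approx y n"
proof -
  interpret P: abelian_subgroup "powN n" Ngr
    by (rule abelian_subgroupI3[OF powN_subgroup_N Nm.M.abelian_group_axioms])
  obtain u where u: "u \<in> Nc" "u \<ominus>\<^bsub>M\<^esub> x \<in> Mn n" by (rule approx_ex[OF assms(1)])
  obtain v where v: "v \<in> Nc" "v \<ominus>\<^bsub>M\<^esub> y \<in> Mn n" by (rule approx_ex[OF assms(2)])
  have "(u \<oplus>\<^bsub>M\<^esub> v) \<ominus>\<^bsub>M\<^esub> (x \<oplus>\<^bsub>M\<^esub> y) = (u \<ominus>\<^bsub>M\<^esub> x) \<oplus>\<^bsub>M\<^esub> (v \<ominus>\<^bsub>M\<^esub> y)"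
    using u v assms Nc_carrier by (simp add: L.M.add_minus_add)
  then have "(u \<oplus>\<^bsub>M\<^esub> v) \<ominus>\<^bsub>M\<^esub> (x \<oplus>\<^bsub>M\<^esub> y) \<in> Mn n"
    using additive_subgroup.a_closed[OF Mn_subgroup u(2) v(2)] by simp
  then have "approx (x \<oplus>\<^bsub>M\<^esub> y) n = powN n +>\<^bsub>Ngr\<^esub> (u \<oplus>\<^bsub>M\<^esub> v)"
    using u v assms additive_subgroup.a_closed[OF Nc_subgroup] by (intro approx_coset) auto
  also have "\<dots> = (powN n +>\<^bsub>Ngr\<^esub> u) <+>\<^bsub>Ngr\<^esub> (powN n +>\<^bsub>Ngr\<^esub> v)"
    using P.a_rcos_sum[of u v] u v by simp
  also have "powN n +>\<^bsub>Ngr\<^esub> u = approx x n" by (rule approx_coset[OF u(1) assms(1) u(2), symmetric])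
  also have "powN n +>\<^bsub>Ngr\<^esub> v = approx y n" by (rule approx_coset[OF v(1) assms(2) v(2), symmetric])
  finally show ?thesis .
qed

text \<open>\<open>C\<close> stands for the coset \<open>r n\<close>. A member \<open>a\<close> of
  it represents \<open>r\<close> only up to the \<open>n\<close>-th power of the ideal, and this
  difference need not have order \<open>ord n\<close>; a correction \<open>b\<close> in that power
  achieves agreement to this order. Modulo \<open>Mn n\<close> the correction is invisible, so all
  choices of representatives lead to one coset.\<close>

lemma approx_smult:
  assumes r: "r \<in> carrier R" and x: "x \<in> carrier M" and ne: "C \<noteq> {}"
    and C: "\<And>a. a \<in> C \<Longrightarrow> a \<in> carrier A \<and> (\<exists>b\<in>power n. r \<ominus>\<^bsub>R\<^esub> emb (a \<oplus>\<^bsub>A\<^esub> b) \<in> fl (ord n))"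
  shows "approx (r \<odot>\<^bsub>M\<^esub> x) n = (\<Union>a\<in>C. \<Union>w\<in>approx x n. powN n +>\<^bsub>Ngr\<^esub> (a \<odot>\<^bsub>Ngr\<^esub> w))"
proof -
  have "powN n +>\<^bsub>Ngr\<^esub> (a \<odot>\<^bsub>Ngr\<^esub> w) = approx (r \<odot>\<^bsub>M\<^esub> x) n" if a: "a \<in> C" and w: "w \<in> approx x n" for a w
  proof -
    obtain b where b: "a \<in> carrier A" "b \<in> power n" "r \<ominus>\<^bsub>R\<^esub> emb (a \<oplus>\<^bsub>A\<^esub> b) \<in> fl (ord n)"
      using C[OF a] by blast
    have bc: "b \<in> carrier A" using b power_carrier by blast
    have w': "w \<in> Nc" "w \<in> carrier M" "w \<ominus>\<^bsub>M\<^esub> x \<in> Mn n" using w Nc_carrier by (auto simp: approx_def)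
    let ?ax = "emb a \<odot>\<^bsub>M\<^esub> x" and ?bx = "emb b \<odot>\<^bsub>M\<^esub> x" and ?aw = "emb a \<odot>\<^bsub>M\<^esub> w"
    have c: "?ax \<in> carrier M" "?bx \<in> carrier M" "?aw \<in> carrier M" "r \<odot>\<^bsub>M\<^esub> x \<in> carrier M"
      using b bc x w' r by auto
    have "emb a \<odot>\<^bsub>M\<^esub> (w \<ominus>\<^bsub>M\<^esub> x) \<in> Mn n" by (rule Mn_emb[OF b(1) w'(3)])
    then have 1: "L.M.congr (Mn n) ?aw ?ax"
      using b(1) w'(2) x c by (simp add: L.M.congr_def L.smult_r_diff)
    have "(r \<ominus>\<^bsub>R\<^esub> emb (a \<oplus>\<^bsub>A\<^esub> b)) \<odot>\<^bsub>M\<^esub> x \<in> Mn n" using Fil_smult_right[OF b(3) x] Fil_Mn by blast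
    then have 2: "L.M.congr (Mn n) (r \<odot>\<^bsub>M\<^esub> x) (?ax \<oplus>\<^bsub>M\<^esub> ?bx)"
      using b(1) bc r x c by (simp add: L.M.congr_def L.smult_l_diff L.smult_l_distr)
    have "L.M.congr (Mn n) ?bx \<zero>\<^bsub>M\<^esub>"
      using power_smult_Mn[OF b(2) x] c by (simp add: L.M.congr_zero_iff)
    then have "L.M.congr (Mn n) (?ax \<oplus>\<^bsub>M\<^esub> ?bx) (?ax \<oplus>\<^bsub>M\<^esub> \<zero>\<^bsub>M\<^esub>)"
      using c by (intro L.M.congr_add[OF Mn_subgroup] L.M.congr_refl[OF Mn_subgroup])
    then have 3: "L.M.congr (Mn n) (?ax \<oplus>\<^bsub>M\<^esub> ?bx) ?ax" using c by simp
    have "L.M.congr (Mn n) (r \<odot>\<^bsub>M\<^esub> x) ?ax" by (rule L.M.congr_trans[OF Mn_subgroup 2 3])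
    then have "L.M.congr (Mn n) ?aw (r \<odot>\<^bsub>M\<^esub> x)"
      by (rule L.M.congr_trans[OF Mn_subgroup 1 L.M.congr_sym[OF Mn_subgroup]])
    then show ?thesis
      using approx_coset[OF Nc_emb[OF b(1) w'(1)] c(4)] by (simp add: L.M.congr_def)
  qed
  moreover obtain w where "w \<in> Nc" "w \<ominus>\<^bsub>M\<^esub> x \<in> Mn n" by (rule approx_ex[OF x])
  then have "w \<in> approx x n" by (simp add: approx_def)
  ultimately show ?thesis using ne by blast
qed

lemma approx_inj:
  assumes "x \<in> carrier M" "y \<in> carrier M" "\<And>n. approx x n = approx y n"
  shows "x = y"
proof -
  have "x \<ominus>\<^bsub>M\<^esub> y \<in> Fil n" for n
  proof -
    obtain u where u: "u \<in> Nc" "u \<ominus>\<^bsub>M\<^esub> x \<in> Mn n" by (rule approx_ex[OF assms(1)])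
    then have "u \<in> approx y n" using assms(3)[of n] by (auto simp: approx_def)
    then have "L.M.congr (Mn n) u x" "L.M.congr (Mn n) u y"
      using u assms Nc_carrier by (auto simp: L.M.congr_def approx_def)
    then have "L.M.congr (Mn n) x y" by (rule L.M.congr_trans[OF Mn_subgroup L.M.congr_sym[OF Mn_subgroup]])
    then show ?thesis using Mn_Fil by (auto simp: L.M.congr_def)
  qed
  then have "x \<ominus>\<^bsub>M\<^esub> y = \<zero>\<^bsub>M\<^esub>" by (rule Fil_separated)
  then show ?thesis using L.M.minus_eq_zero_iff[OF assms(1,2)] by simp
qed

text \<open>Representatives of compatible cosets form a Cauchy sequence because
  \<open>powN n\<close> lies in \<open>Fil n\<close>. Its limit is compared with \<open>u n\<close>
  through the later term \<open>u (ord n)\<close>, from which it differs by an element of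
  \<open>Fil (ord n)\<close>, hence of \<open>Mn n\<close>.\<close>

lemma approx_surj:
  assumes \<xi>: "\<And>n. \<xi> n \<in> a_rcosets\<^bsub>Ngr\<^esub> (powN n)" "\<And>m n. m \<le> n \<Longrightarrow> \<xi> n \<subseteq> \<xi> m"
  shows "\<exists>x\<in>carrier M. \<xi> = approx x"
proof -
  have "\<exists>u\<in>Nc. \<xi> n = powN n +>\<^bsub>Ngr\<^esub> u" for n using \<xi>(1)[of n] by (auto simp: A_RCOSETS_def')
  then obtain u where u: "\<And>n. u n \<in> Nc" "\<And>n. \<xi> n = powN n +>\<^bsub>Ngr\<^esub> u n" by metis
  have uc: "u n \<in> carrier M" for n using u(1) Nc_carrier by blast
  have diff: "u n \<ominus>\<^bsub>M\<^esub> u m \<in> powN m" if "m \<le> n" for m n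
  proof -
    have "u n \<in> \<xi> n" using Nm.M.coset_self[OF powN_subgroup_N] u by simp
    then have "u n \<in> powN m +>\<^bsub>Ngr\<^esub> u m" using \<xi>(2)[OF that] u(2) by blast
    then show ?thesis
      using Nm.M.mem_coset_iff[OF powN_subgroup_N, of "u m" "u n" m] u(1) Ngr_minus by simp
  qed
  have "u (Suc n) \<ominus>\<^bsub>M\<^esub> u n \<in> Fil n" for n using diff[of n "Suc n"] powN_Fil by auto
  then obtain x where x: "x \<in> carrier M" "\<And>n. x \<ominus>\<^bsub>M\<^esub> u n \<in> Fil n" using Fil_complete[of u] uc by blast
  have "u n \<ominus>\<^bsub>M\<^esub> x \<in> Mn n" for n
  proof -
    have "L.M.congr (Mn n) x (u (ord n))"
      using x uc Fil_Mn by (auto simp: L.M.congr_def)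
    moreover have "L.M.congr (Mn n) (u (ord n)) (u n)"
      using diff[OF ord_ge] powN_Mn uc by (auto simp: L.M.congr_def)
    ultimately have "L.M.congr (Mn n) x (u n)" by (rule L.M.congr_trans[OF Mn_subgroup])
    then show ?thesis using L.M.congr_sym[OF Mn_subgroup] by (auto simp: L.M.congr_def)
  qed
  then have "approx x n = powN n +>\<^bsub>Ngr\<^esub> u n" for n by (rule approx_coset[OF u(1) x(1)])
  then have "\<xi> n = approx x n" for n using u(2) by simp
  then show ?thesis using x(1) by auto
qed

end

text \<open>The locale knows \<open>R\<close> only through components. The coset hypotheses recover
  what the action on the completion depends on: each \<open>r n\<close> is inhabited, and its
  members represent \<open>r\<close> up to the \<open>n\<close>-th power of the ideal.\<close>

lemma module_completion_iso:
  fixes R :: "(nat \<Rightarrow> 'a set, 'w) ring_scheme"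
  assumes "connection_module k A gr R co M Y D"
    and cosets: "\<And>r n. r \<in> carrier R \<Longrightarrow> r n \<noteq> {}"
      "\<And>r n a. \<lbrakk>r \<in> carrier R; a \<in> r n\<rbrakk> \<Longrightarrow> a \<in> carrier A \<and>
        (\<exists>b\<in>connected_graded_algebra.power A gr n.
          r \<ominus>\<^bsub>R\<^esub> graded_completion.emb A gr R co (a \<oplus>\<^bsub>A\<^esub> b) \<in>
            graded_completion.fl A R co (n * connected_graded_algebra.power_bound A gr))"
  shows "left_module_iso R M
    (module_completion A (positive_part A gr) (connection_module.Ngr k A gr R co M Y D))"
proof -
  interpret connection_module k A gr R co M Y D by fact
  let ?C = "module_completion A (positive_part A gr) Ngr"
  have Q: "ideal_smult A (ideal_power A (positive_part A gr) n) Ngr = powN n" for n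
    by (simp add: powN_def power_def)
  have C: "carrier ?C = {x. (\<forall>n. x n \<in> a_rcosets\<^bsub>Ngr\<^esub> (powN n)) \<and> (\<forall>m n. m \<le> n \<longrightarrow> x n \<subseteq> x m)}"
    "x \<oplus>\<^bsub>?C\<^esub> y = (\<lambda>n. x n <+>\<^bsub>Ngr\<^esub> y n)"
    "r \<odot>\<^bsub>?C\<^esub> x = (\<lambda>n. \<Union>a\<in>r n. \<Union>w\<in>x n. powN n +>\<^bsub>Ngr\<^esub> (a \<odot>\<^bsub>Ngr\<^esub> w))" for x y r
    unfolding module_completion_def Let_def Q by (simp_all add: FactModule_def)
  have mem: "approx x \<in> carrier ?C" if x: "x \<in> carrier M" for x
  proof -
    have "approx x n \<in> a_rcosets\<^bsub>Ngr\<^esub> (powN n)" for n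
    proof -
      obtain u where u: "u \<in> Nc" "u \<ominus>\<^bsub>M\<^esub> x \<in> Mn n" by (rule approx_ex[OF x])
      then show ?thesis using approx_coset[OF u(1) x u(2)] by (auto simp: A_RCOSETS_def')
    qed
    moreover have "approx x n \<subseteq> approx x m" if "m \<le> n" for m n
      using Mn_antimono[OF that] by (auto simp: approx_def)
    ultimately show ?thesis unfolding C by blast
  qed
  have "approx \<in> left_hom R M ?C"
    unfolding left_hom_def
  proof (intro CollectI conjI ballI)
    show "approx \<in> carrier M \<rightarrow> carrier ?C" using mem by blast
    show "approx (x \<oplus>\<^bsub>M\<^esub> y) = approx x \<oplus>\<^bsub>?C\<^esub> approx y" if "x \<in> carrier M" "y \<in> carrier M" for x y
      unfolding C(2) using approx_add[OF that] by (rule ext)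
    show "approx (r \<odot>\<^bsub>M\<^esub> x) = r \<odot>\<^bsub>?C\<^esub> approx x" if "r \<in> carrier R" "x \<in> carrier M" for r x
      unfolding C(3)
      using approx_smult[OF that cosets(1)[OF that(1)] cosets(2)[OF that(1), folded ord_def]] by (rule ext)
  qed
  moreover have "bij_betw approx (carrier M) (carrier ?C)"
  proof (rule bij_betw_imageI)
    show "inj_on approx (carrier M)" by (rule inj_onI) (metis approx_inj)
    show "approx ` carrier M = carrier ?C"
    proof
      show "approx ` carrier M \<subseteq> carrier ?C" using mem by blast
      show "carrier ?C \<subseteq> approx ` carrier M"
      proof
        fix \<xi> assume "\<xi> \<in> carrier ?C"
        then show "\<xi> \<in> approx ` carrier M" using approx_surj[of \<xi>] unfolding C by blast
      qed
    qed
  qed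
  ultimately show ?thesis unfolding left_module_iso_def by blast
qed

section \<open>Components of the adic completion\<close>

context connected_graded_algebra
begin

abbreviation (input) completion where "completion \<equiv> ring_completion A (positive_part A gr)"

text \<open>Degree \<open>i\<close> is read off in the coordinate \<open>Suc i\<close>: elements of
  \<open>power (Suc i)\<close> have no component in degree \<open>i\<close>, so every representative
  gives the same value.\<close>

definition completion_co :: "(nat \<Rightarrow> 'a set) \<Rightarrow> nat \<Rightarrow> 'a"
  where "completion_co x i = comp (SOME a. a \<in> x (Suc i)) i"

lemma completion_carrier:
  "carrier completion = {x. (\<forall>n. x n \<in> a_rcosets\<^bsub>A\<^esub> (power n)) \<and> (\<forall>m n. m \<le> n \<longrightarrow> x n \<subseteq> x m)}"
  by (simp add: ring_completion_def FactRing_def power_def)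

lemma completion_rep:
  assumes "x \<in> carrier completion"
  obtains a where "a \<in> carrier A" "x n = power n +>\<^bsub>A\<^esub> a" "a \<in> x n"
proof -
  have "x n \<in> a_rcosets\<^bsub>A\<^esub> (power n)" using assms unfolding completion_carrier by blast
  then obtain a where "a \<in> carrier A" "x n = power n +>\<^bsub>A\<^esub> a" by (auto simp: A_RCOSETS_def')
  then show thesis using that M.coset_self[OF power_subgroup] by simp
qed

lemma completion_mem:
  assumes "x \<in> carrier completion" "a \<in> x n"
  shows "a \<in> carrier A" "x n = power n +>\<^bsub>A\<^esub> a" "\<And>b. b \<in> x n \<longleftrightarrow> M.congr (power n) b a"
proof -
  obtain b where b: "b \<in> carrier A" "x n = power n +>\<^bsub>A\<^esub> b" by (rule completion_rep[OF assms(1)])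
  then have ab: "M.congr (power n) a b" using assms(2) M.mem_coset_iff_congr[OF power_subgroup] by simp
  then show a: "a \<in> carrier A" by (simp add: M.congr_def)
  show x: "x n = power n +>\<^bsub>A\<^esub> a" using M.coset_eqI[OF power_subgroup ab] b(2) by simp
  show "b \<in> x n \<longleftrightarrow> M.congr (power n) b a" for b
    unfolding x by (rule M.mem_coset_iff_congr[OF power_subgroup a])
qed

lemma comp_completion:
  assumes x: "x \<in> carrier completion" and a: "a \<in> x n" "i < n"
  shows "comp a i = completion_co x i"
proof -
  let ?b = "SOME a. a \<in> x (Suc i)"
  have "x n \<subseteq> x (Suc i)" using x a(2) unfolding completion_carrier by auto
  then have a': "a \<in> x (Suc i)" using a by blast
  then have b: "?b \<in> x (Suc i)" by (rule someI)
  have "M.congr (power (Suc i)) ?b a" using completion_mem(3)[OF x a'] b by blast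
  then have "?b \<ominus>\<^bsub>A\<^esub> a \<in> power (Suc i)" "?b \<in> carrier A" "a \<in> carrier A" by (auto simp: M.congr_def)
  then show ?thesis
    using power_comp[of "?b \<ominus>\<^bsub>A\<^esub> a" "Suc i" i] by (simp add: completion_co_def M.minus_eq_zero_iff)
qed

lemma completion_co_in_gr: "x \<in> carrier completion \<Longrightarrow> completion_co x i \<in> gr i"
proof -
  assume x: "x \<in> carrier completion"
  obtain a where a: "a \<in> carrier A" "x (Suc i) = power (Suc i) +>\<^bsub>A\<^esub> a" "a \<in> x (Suc i)"
    by (rule completion_rep[OF x])
  show ?thesis using comp_completion[OF x a(3), of i] a(1) comp_in_gr by (metis lessI)
qed

lemma completion_series:
  assumes noeth: "left_noetherian A" and f: "\<And>i. f i \<in> gr i"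
  shows "\<exists>x\<in>carrier completion. completion_co x = f"
proof -
  \<comment> \<open>Truncation at degree \<open>n\<close> need not give compatible cosets: the
    omitted terms have to lie in the \<open>n\<close>-th power of the ideal, which is guaranteed
    from degree \<open>n power_bound\<close> on.\<close>
  define s where "s n = (\<Oplus>\<^bsub>A\<^esub>i\<in>{..<n * power_bound}. f i)" for n
  have fc: "f i \<in> carrier A" for i using f gr_carrier by blast
  have sc: "s n \<in> carrier A" for n unfolding s_def using fc by (intro M.finsum_closed) auto
  have s_comp: "comp (s n) i = (if i < n * power_bound then f i else \<zero>\<^bsub>A\<^esub>)" for n i
  proof -
    have "s n = (\<Oplus>\<^bsub>A\<^esub>i\<in>{..<n * power_bound}. if i < n * power_bound then f i else \<zero>\<^bsub>A\<^esub>)"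
      unfolding s_def using fc by (intro M.finsum_cong') auto
    then show ?thesis
      using comp_unique[of "{..<n * power_bound}" "\<lambda>i. if i < n * power_bound then f i else \<zero>\<^bsub>A\<^esub>"] f
      by simp
  qed
  define x where "x n = power n +>\<^bsub>A\<^esub> s n" for n
  have "x n \<subseteq> x m" if mn: "m \<le> n" for m n
  proof
    fix w assume "w \<in> x n"
    then have "M.congr (power n) w (s n)"
      using M.mem_coset_iff_congr[OF power_subgroup sc] by (simp add: x_def)
    then have 1: "M.congr (power m) w (s n)" using power_antimono[OF mn] by (rule M.congr_mono)
    have "comp (s n \<ominus>\<^bsub>A\<^esub> s m) i = \<zero>\<^bsub>A\<^esub>" if i: "i < m * power_bound" for i
    proof -
      have "i < n * power_bound" by (rule less_le_trans[OF i mult_le_mono1[OF mn]])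
      then show ?thesis using i sc fc M.minus_eq_zero_iff[OF fc[of i] fc[of i]] by (simp add: s_comp)
    qed
    then have "s n \<ominus>\<^bsub>A\<^esub> s m \<in> power m" using sc by (intro power_bound(2)[OF noeth]) auto
    then have "M.congr (power m) (s n) (s m)" using sc by (simp add: M.congr_def)
    then have "M.congr (power m) w (s m)" by (rule M.congr_trans[OF power_subgroup 1])
    then show "w \<in> x m" using M.mem_coset_iff_congr[OF power_subgroup sc] by (simp add: x_def)
  qed
  then have x: "x \<in> carrier completion"
    unfolding completion_carrier using sc by (auto simp: x_def A_RCOSETS_def')
  have "completion_co x i = f i" for i
  proof -
    have "s (Suc i) \<in> x (Suc i)" using M.coset_self[OF power_subgroup sc] by (simp add: x_def)
    then have "completion_co x i = comp (s (Suc i)) i" using comp_completion[OF x] by simp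
    moreover have "i < Suc i * power_bound" using power_bound(1)[OF noeth] by (cases power_bound) auto
    ultimately show ?thesis using s_comp by simp
  qed
  then show ?thesis using x by auto
qed

lemma completion_co_inj:
  assumes noeth: "left_noetherian A" and x: "x \<in> carrier completion" and y: "y \<in> carrier completion"
    and eq: "completion_co x = completion_co y"
  shows "x = y"
proof
  fix n
  \<comment> \<open>Far enough out to determine the components below \<open>n power_bound\<close>,
    and at least \<open>n\<close>, so that the representatives also lie in the coordinates at
    \<open>n\<close>.\<close>
  let ?N = "max n (n * power_bound)"
  obtain a where a: "a \<in> carrier A" "a \<in> x ?N" by (rule completion_rep[OF x])
  obtain b where b: "b \<in> carrier A" "b \<in> y ?N" by (rule completion_rep[OF y])
  have "comp a i = comp b i" if "i < n * power_bound" for i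
    using comp_completion[OF x a(2), of i] comp_completion[OF y b(2), of i] eq that by simp
  then have "a \<ominus>\<^bsub>A\<^esub> b \<in> power n"
    using a b by (intro power_bound(2)[OF noeth]) (auto simp: M.minus_eq_zero_iff)
  then have ab: "M.congr (power n) a b" using a b by (simp add: M.congr_def)
  have "x ?N \<subseteq> x n" "y ?N \<subseteq> y n" using x y unfolding completion_carrier by auto
  then have "x n = power n +>\<^bsub>A\<^esub> a" "y n = power n +>\<^bsub>A\<^esub> b"
    using a b completion_mem(2)[OF x] completion_mem(2)[OF y] by blast+
  then show "x n = y n" using M.coset_eqI[OF power_subgroup ab] by simp
qed

lemma completion_add_mem:
  "\<lbrakk>a \<in> x n; b \<in> y n\<rbrakk> \<Longrightarrow> a \<oplus>\<^bsub>A\<^esub> b \<in> (x \<oplus>\<^bsub>completion\<^esub> y) n"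
  by (auto simp: ring_completion_def FactRing_def set_add_def')

lemma completion_mult_mem:
  assumes "a \<in> x n" "b \<in> y n" "a \<in> carrier A" "b \<in> carrier A"
  shows "a \<otimes>\<^bsub>A\<^esub> b \<in> (x \<otimes>\<^bsub>completion\<^esub> y) n"
proof -
  have "(x \<otimes>\<^bsub>completion\<^esub> y) n = (\<Union>a\<in>x n. \<Union>b\<in>y n. power n +>\<^bsub>A\<^esub> (a \<otimes>\<^bsub>A\<^esub> b))"
    by (simp add: ring_completion_def FactRing_def rcoset_mult_def power_def)
  then show ?thesis using M.coset_self[OF power_subgroup, of "a \<otimes>\<^bsub>A\<^esub> b" n] assms by auto
qed

text \<open>Sums and products of representatives are representatives of sums and products, so the
  laws for components of series reduce to those for components in \<open>A\<close>.\<close>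

lemma graded_completion_ring_completion:
  assumes noeth: "left_noetherian A" and ring: "ring completion"
  shows "graded_completion k A gr completion completion_co"
proof -
  interpret S: ring completion by (rule ring)
  have rep: "\<exists>a\<in>carrier A. a \<in> x n" if "x \<in> carrier completion" for x n
    using completion_rep[OF that] by metis
  show ?thesis
  proof (intro graded_completion.intro graded_completion_axioms.intro connected_graded_algebra_axioms ring)
    show "bij_betw completion_co (carrier completion) {f. \<forall>i. f i \<in> gr i}"
    proof (rule bij_betw_imageI)
      show "inj_on completion_co (carrier completion)"
        using completion_co_inj[OF noeth] by (rule inj_onI)
      show "completion_co ` carrier completion = {f. \<forall>i. f i \<in> gr i}"
      proof
        show "completion_co ` carrier completion \<subseteq> {f. \<forall>i. f i \<in> gr i}"
          using completion_co_in_gr by blast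
        show "{f. \<forall>i. f i \<in> gr i} \<subseteq> completion_co ` carrier completion"
          using completion_series[OF noeth] by blast
      qed
    qed
  next
    fix x y i assume xy: "x \<in> carrier completion" "y \<in> carrier completion"
    obtain a b where ab: "a \<in> carrier A" "a \<in> x (Suc i)" "b \<in> carrier A" "b \<in> y (Suc i)"
      using rep xy by metis
    have "completion_co (x \<oplus>\<^bsub>completion\<^esub> y) i = comp (a \<oplus>\<^bsub>A\<^esub> b) i"
      by (rule comp_completion[symmetric, of _ _ "Suc i"])
        (use xy completion_add_mem[of a x "Suc i" b y] ab in auto)
    then show "completion_co (x \<oplus>\<^bsub>completion\<^esub> y) i = completion_co x i \<oplus>\<^bsub>A\<^esub> completion_co y i"
      using comp_completion[OF xy(1) ab(2), of i] comp_completion[OF xy(2) ab(4), of i] ab by simp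
    have "completion_co (x \<otimes>\<^bsub>completion\<^esub> y) i = comp (a \<otimes>\<^bsub>A\<^esub> b) i"
      by (rule comp_completion[symmetric, of _ _ "Suc i"])
        (use xy completion_mult_mem[of a x "Suc i" b y] ab in auto)
    also have "\<dots> = (\<Oplus>\<^bsub>A\<^esub>j\<in>{..i}. comp a j \<otimes>\<^bsub>A\<^esub> comp b (i - j))" using ab by (intro comp_mult)
    also have "\<dots> = (\<Oplus>\<^bsub>A\<^esub>j\<in>{..i}. completion_co x j \<otimes>\<^bsub>A\<^esub> completion_co y (i - j))"
    proof (rule M.finsum_cong')
      show "(\<lambda>j. completion_co x j \<otimes>\<^bsub>A\<^esub> completion_co y (i - j)) \<in> {..i} \<rightarrow> carrier A"
        using completion_co_in_gr[OF xy(1)] completion_co_in_gr[OF xy(2)] gr_carrier by blast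
      show "comp a j \<otimes>\<^bsub>A\<^esub> comp b (i - j) = completion_co x j \<otimes>\<^bsub>A\<^esub> completion_co y (i - j)" if "j \<in> {..i}" for j
        using comp_completion[OF xy(1) ab(2), of j] comp_completion[OF xy(2) ab(4), of "i - j"] that by simp
    qed simp
    finally show "completion_co (x \<otimes>\<^bsub>completion\<^esub> y) i =
        (\<Oplus>\<^bsub>A\<^esub>j\<in>{..i}. completion_co x j \<otimes>\<^bsub>A\<^esub> completion_co y (i - j))" .
  next
    fix i
    have "\<one>\<^bsub>A\<^esub> \<in> \<one>\<^bsub>completion\<^esub> (Suc i)"
      using M.coset_self[OF power_subgroup, of "\<one>\<^bsub>A\<^esub>" "Suc i"]
      by (simp add: ring_completion_def FactRing_def power_def)
    then show "completion_co \<one>\<^bsub>completion\<^esub> i = (if i = 0 then \<one>\<^bsub>A\<^esub> else \<zero>\<^bsub>A\<^esub>)"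
      using comp_completion[of "\<one>\<^bsub>completion\<^esub>" "\<one>\<^bsub>A\<^esub>" "Suc i" i] by (simp add: comp_one)
  qed
qed

end

theorem proposition7p1:
  fixes k :: "('k, 'x) ring_scheme"
    and A :: "('k, 'a, 'y) module_scheme"
    and gr :: "nat \<Rightarrow> 'a set"
    and R :: "(nat \<Rightarrow> 'a set) ring"
    and M :: "(nat \<Rightarrow> 'a set, 'm, 'z) module_scheme"
  assumes "field k" and "char_zero k"
    and "connected_graded_algebra k A gr"
    and "left_noetherian A"
    and "R = ring_completion A (positive_part A gr)"
    and "left_module R M" and "finitely_generated R M"
    and "trivial_group (Ext1 R M M)"
  shows "\<exists>(N :: ('a, 'm) module) (grN :: int \<Rightarrow> 'm set).
    graded_left_module A gr N grN \<and> finitely_generated A N \<and>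
    left_module_iso R M (module_completion A (positive_part A gr) N)"
proof -
  interpret A: connected_graded_algebra k A gr by fact
  interpret M: left_module R M by fact
  \<comment> \<open>That the completion is a ring is contained in the assumption that
    \<open>M\<close> is a left module over it.\<close>
  have "graded_completion k A gr R A.completion_co"
    using A.graded_completion_ring_completion[OF assms(4)] M.R.ring_axioms assms(5) by simp
  then interpret C: graded_completion k A gr R A.completion_co .
  obtain Y where Y: "finite Y" "Y \<subseteq> carrier M" "submodule_generated R M Y = carrier M"
    using assms(7) by (auto simp: finitely_generated_def)
  have "id \<in> Y \<rightarrow> carrier M" using Y(2) by auto
  from M.submodule_generated_finite[OF Y(1) this]
  have gen: "carrier M = {M.lincomb r id Y | r. r \<in> Y \<rightarrow> carrier R}" using Y(3) by simp
  obtain D where D: "\<And>x. x \<in> carrier M \<Longrightarrow> D x \<in> carrier M"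
    "\<And>x y. \<lbrakk>x \<in> carrier M; y \<in> carrier M\<rbrakk> \<Longrightarrow> D (x \<oplus>\<^bsub>M\<^esub> y) = D x \<oplus>\<^bsub>M\<^esub> D y"
    "\<And>a x. \<lbrakk>a \<in> carrier R; x \<in> carrier M\<rbrakk> \<Longrightarrow> D (a \<odot>\<^bsub>M\<^esub> x) = a \<odot>\<^bsub>M\<^esub> D x \<oplus>\<^bsub>M\<^esub> C.der a \<odot>\<^bsub>M\<^esub> x"
    using connection_exists[OF assms(6,8) C.der_closed C.der_add C.der_mult] by metis
  have conn: "connection_module k A gr R A.completion_co M Y D"
    by (intro connection_module.intro connection_module_axioms.intro fg_completion_module.intro
        fg_completion_module_axioms.intro completion_module.intro C.graded_completion_axioms
        M.left_module_axioms assms(1,2,4) Y(1,2) gen D)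
  then interpret X: connection_module k A gr R A.completion_co M Y D .
  have rc: "r \<in> carrier A.completion" if "r \<in> carrier R" for r using that assms(5) by simp
  have "left_module_iso R M (module_completion A (positive_part A gr) X.Ngr)"
  proof (rule module_completion_iso[OF conn])
    fix r n assume r: "r \<in> carrier R"
    show "r n \<noteq> {}" using A.completion_rep[OF rc[OF r], of n] by blast
    fix a assume a: "a \<in> r n"
    let ?d = "n * A.power_bound"
    \<comment> \<open>A representative so far out that its components below \<open>?d\<close> are
      those of \<open>r\<close>. It still belongs to \<open>r n\<close>, so \<open>c - a\<close> is
      the required correction in the \<open>n\<close>-th power.\<close>
    obtain c where c: "c \<in> carrier A" "c \<in> r (max n ?d)" by (rule A.completion_rep[OF rc[OF r]])
    have "r (max n ?d) \<subseteq> r n" using rc[OF r] unfolding A.completion_carrier by auto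
    then have "c \<in> r n" using c(2) by blast
    then have ca: "c \<ominus>\<^bsub>A\<^esub> a \<in> A.power n" "a \<in> carrier A"
      using A.completion_mem[OF rc[OF r] a] by (auto simp: A.M.congr_def)
    have "A.comp c i = A.completion_co r i" if "i < ?d" for i
      using A.comp_completion[OF rc[OF r] c(2), of i] that by simp
    then have "r \<ominus>\<^bsub>R\<^esub> C.emb c \<in> C.fl ?d"
      using r c(1) by (auto simp: C.fl_def A.M.minus_eq_zero_iff)
    moreover have "a \<oplus>\<^bsub>A\<^esub> (c \<ominus>\<^bsub>A\<^esub> a) = c" using c(1) ca(2) by (rule A.M.add_minus_cancel_left[rotated])
    ultimately show "a \<in> carrier A \<and> (\<exists>b\<in>A.power n. r \<ominus>\<^bsub>R\<^esub> C.emb (a \<oplus>\<^bsub>A\<^esub> b) \<in> C.fl ?d)"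
      using ca by (intro conjI bexI[of _ "c \<ominus>\<^bsub>A\<^esub> a"]) auto
  qed
  then show ?thesis using X.Ngr_graded X.Ngr_finitely_generated by blast
qed

end
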